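(* Fix $\sigma>5/2$. There exist constants $L^{(\mathrm e)}>0$ and $L^{(\mathrm o)}>0$ such that for all $t\in\mathbb{R}$ and all $f\in L^2(\mathbb{R})$ with $\langle\cdot\rangle^{\sigma}f\in L^2(\mathbb{R})$, $$\left\|\langle\cdot\rangle^{-\sigma}\left(e^{-it\mathcal{B}}\mathcal{P}_{\mathrm c}^{(\mathrm e)}f\right)(\cdot)\right\|_2\le L^{(\mathrm e)}\langle t\rangle^{-1/2}\,\|\langle\cdot\rangle^{\sigma}f(\cdot)\|_2$$ and $$\left\|\langle\cdot\rangle^{-\sigma}\left(e^{-it\mathcal{B}}\mathcal{P}_{\mathrm c}^{(\mathrm o)}f\right)(\cdot)\right\|_2\le L^{(\mathrm o)}\langle t\rangle^{-3/2}\,\|\langle\cdot\rangle^{\sigma}f(\cdot)\|_2 .$$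
   Context: Notation: $\langle x\rangle=(1+x^2)^{1/2}$, $\langle f,g\rangle=\int_{\mathbb{R}}\overline{f(x)}g(x)\,dx$, and $\|\cdot\|_2$ is the $L^2(\mathbb{R})$ norm. Fix real parameters $0<\rho_1<\rho_2$ and $\theta_1,\theta_2\in\mathbb{R}$, and put $\lambda_k=i\rho_k$, $g_k=e^{i\theta_k}$ for $k=1,2$. For each $x\in\mathbb{R}$ let $a_0(x),a_1(x),b_0(x),b_1(x)\in\mathbb{C}$ be the unique solution of the linear system (for $k=1,2$) $$(\lambda_k^2+a_1\lambda_k+a_0)e^{-2i\lambda_kx}=\overline{g_k}\,(b_1\lambda_k+b_0),\qquad b_1\overline{\lambda_k}+b_0=-g_k(\overline{\lambda_k}^2+a_1\overline{\lambda_k}+a_0)e^{-2i\overline{\lambda_k}x}.$$ Set $a(x,\lambda)=(\lambda^2+a_1(x)\lambda+a_0(x))e^{-2i\lambda x}$ for $\lambda\in\mathbb{C}$, and for $\lambda\ge 0$ $$\Psi_{\mathrm d}^{(\mathrm e)}(x,\lambda)=\frac{a(x,\lambda)+a(x,-\lambda)}{\sqrt{2\pi(\lambda^2+\rho_1^2)(\lambda^2+\rho_2^2)}},\qquad \Psi_{\mathrm d}^{(\mathrm o)}(x,\lambda)=\frac{a(x,\lambda)-a(x,-\lambda)}{\sqrt{2\pi(\lambda^2+\rho_1^2)(\lambda^2+\rho_2^2)}} .$$ These are respectively even and odd in $x$. They are generalized eigenfunctions, at time $0$, of the periodic separable two-soliton potential with period $L=\pi/(\rho_2^2-\rho_1^2)$.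 Let $\Pi$ be the orthogonal projection of $L^2(\mathbb{R})$ onto $\mathrm{span}\{a(\cdot,-i\rho_1),a(\cdot,-i\rho_2)\}$ (the bound states). Define $$(\mathcal{P}_{\mathrm c}^{(\mathrm e)}f)(x)=\int_0^\infty\langle\Psi_{\mathrm d}^{(\mathrm e)}(\cdot,\lambda),f\rangle\Psi_{\mathrm d}^{(\mathrm e)}(x,\lambda)\,d\lambda,\qquad (\mathcal{P}_{\mathrm c}^{(\mathrm o)}f)(x)=\int_0^\infty\langle\Psi_{\mathrm d}^{(\mathrm o)}(\cdot,\lambda),f\rangle\Psi_{\mathrm d}^{(\mathrm o)}(x,\lambda)\,d\lambda$$ (integrals in the usual $L^2$ sense of generalized eigenfunction expansions; $\Pi$, $\mathcal{P}_{\mathrm c}^{(\mathrm e)}$, $\mathcal{P}_{\mathrm c}^{(\mathrm o)}$ are mutually orthogonal projections summing to the identity). The self-adjoint operator $\mathcal{B}$ on $L^2(\mathbb{R})$ is $$\mathcal{B}f=-2\beta_{\mathrm b}\,\Pi f+\sum_{\alpha\in\{\mathrm e,\mathrm o\}}\int_0^\infty 2\lambda^2\langle\Psi_{\mathrm d}^{(\alpha)}(\cdot,\lambda),f\rangle\Psi_{\mathrm d}^{(\alpha)}(x,\lambda)\,d\lambda,$$ where $\beta_{\mathrm b}>0$ is a fixed number with $e^{2i\beta_{\mathrm b}L}=e^{2i\rho_1^2L}=e^{2i\rho_2^2L}$. Thus $e^{-it\mathcal{B}}\mathcal{P}_{\mathrm c}^{(\alpha)}f=\int_0^\infty e^{-2i\lambda^2t}\langle\Psi_{\mathrm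 d}^{(\alpha)}(\cdot,\lambda),f\rangle\Psi_{\mathrm d}^{(\alpha)}(\cdot,\lambda)\,d\lambda$. *)

theory Defs
  imports "HOL-Analysis.Analysis"
begin

section \<open>Square-integrable functions\<close>

text \<open>
  Elements of $L^2$ are represented by (Borel measurable) functions, and equality in $L^2$ is
  equality almost everywhere.
\<close>

definition L2 :: "'a measure \<Rightarrow> ('a \<Rightarrow> complex) set" where
  "L2 M = {f \<in> borel_measurable M. integrable M (\<lambda>x. (cmod (f x))\<^sup>2)}"

text \<open>Only meaningful on \<^term>\<open>L2 M\<close>, since the Bochner integral is \<open>0\<close> on non-integrable functions.\<close>

definition L2_norm :: "'a measure \<Rightarrow> ('a \<Rightarrow> complex) \<Rightarrow> real" where
  "L2_norm M f = sqrt (LINT x|M. (cmod (f x))\<^sup>2)"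

definition L2_inner :: "(real \<Rightarrow> complex) \<Rightarrow> (real \<Rightarrow> complex) \<Rightarrow> complex" where
  "L2_inner f g = (LINT x|lborel. cnj (f x) * g x)"

text \<open>Limit in the mean of a family \<open>F R\<close> as \<open>R\<close> tends to infinity.\<close>

definition is_L2_limit :: "'a measure \<Rightarrow> (real \<Rightarrow> 'a \<Rightarrow> complex) \<Rightarrow> ('a \<Rightarrow> complex) \<Rightarrow> bool" where
  "is_L2_limit M F g \<longleftrightarrow>
     g \<in> L2 M \<and> (\<forall>\<^sub>F R in at_top. F R \<in> L2 M) \<and>
     ((\<lambda>R. L2_norm M (\<lambda>x. F R x - g x)) \<longlongrightarrow> 0) at_top"

text \<open>A representative of the limit, which is unique up to null sets.\<close>

definition L2_limit :: "'a measure \<Rightarrow> (real \<Rightarrow> 'a \<Rightarrow> complex) \<Rightarrow> 'a \<Rightarrow> complex" where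
  "L2_limit M F = (SOME g. is_L2_limit M F g)"

definition japanese :: "real \<Rightarrow> real" where
  "japanese x = sqrt (1 + x\<^sup>2)"


section \<open>Generalized eigenfunctions of the two-soliton potential\<close>

text \<open>
  The parameters $\rho_k$, $\theta_k$ for $k = 1, 2$ are the values \<open>\<rho> k\<close>, \<open>\<theta> k\<close> of functions
  on \<^typ>\<open>nat\<close>; the values at other arguments are never used.
\<close>

definition soliton_system ::
  "(nat \<Rightarrow> real) \<Rightarrow> (nat \<Rightarrow> real) \<Rightarrow> real \<Rightarrow> complex \<times> complex \<times> complex \<times> complex \<Rightarrow> bool" where
  "soliton_system \<rho> \<theta> x = (\<lambda>(a0, a1, b0, b1).
     \<forall>k\<in>{1, 2}. let l = \<i> * complex_of_real (\<rho> k); g = exp (\<i> * complex_of_real (\<theta> k)) in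
       (l\<^sup>2 + a1 * l + a0) * exp (- 2 * \<i> * l * complex_of_real x) = cnj g * (b1 * l + b0) \<and>
       b1 * cnj l + b0 =
         - g * ((cnj l)\<^sup>2 + a1 * cnj l + a0) * exp (- 2 * \<i> * cnj l * complex_of_real x))"

definition soliton_coeffs ::
  "(nat \<Rightarrow> real) \<Rightarrow> (nat \<Rightarrow> real) \<Rightarrow> real \<Rightarrow> complex \<times> complex \<times> complex \<times> complex" where
  "soliton_coeffs \<rho> \<theta> x = (THE c. soliton_system \<rho> \<theta> x c)"

definition soliton_a ::
  "(nat \<Rightarrow> real) \<Rightarrow> (nat \<Rightarrow> real) \<Rightarrow> real \<Rightarrow> complex \<Rightarrow> complex" where
  "soliton_a \<rho> \<theta> x l = (case soliton_coeffs \<rho> \<theta> x of (a0, a1, b0, b1) \<Rightarrow>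
     (l\<^sup>2 + a1 * l + a0) * exp (- 2 * \<i> * l * complex_of_real x))"

datatype parity = Even | Odd

fun parity_sign :: "parity \<Rightarrow> complex" where
  "parity_sign Even = 1"
| "parity_sign Odd = - 1"

definition Psi ::
  "(nat \<Rightarrow> real) \<Rightarrow> (nat \<Rightarrow> real) \<Rightarrow> parity \<Rightarrow> real \<Rightarrow> real \<Rightarrow> complex" where
  "Psi \<rho> \<theta> \<alpha> x l =
     (soliton_a \<rho> \<theta> x (complex_of_real l)
        + parity_sign \<alpha> * soliton_a \<rho> \<theta> x (- complex_of_real l))
     / complex_of_real (sqrt (2 * pi * (l\<^sup>2 + (\<rho> 1)\<^sup>2) * (l\<^sup>2 + (\<rho> 2)\<^sup>2)))"


section \<open>Bound states and eigenfunction expansions\<close>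

definition bound_state :: "(nat \<Rightarrow> real) \<Rightarrow> (nat \<Rightarrow> real) \<Rightarrow> nat \<Rightarrow> real \<Rightarrow> complex" where
  "bound_state \<rho> \<theta> k x = soliton_a \<rho> \<theta> x (- \<i> * complex_of_real (\<rho> k))"

definition bound_space :: "(nat \<Rightarrow> real) \<Rightarrow> (nat \<Rightarrow> real) \<Rightarrow> (real \<Rightarrow> complex) set" where
  "bound_space \<rho> \<theta> =
     {h. \<exists>c1 c2. h = (\<lambda>x. c1 * bound_state \<rho> \<theta> 1 x + c2 * bound_state \<rho> \<theta> 2 x)}"

text \<open>The orthogonal projection of $L^2(\mathbb{R})$ onto the span of the bound states.\<close>

definition bound_proj ::
  "(nat \<Rightarrow> real) \<Rightarrow> (nat \<Rightarrow> real) \<Rightarrow> (real \<Rightarrow> complex) \<Rightarrow> real \<Rightarrow> complex" where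
  "bound_proj \<rho> \<theta> f =
     (THE h. h \<in> bound_space \<rho> \<theta> \<and>
        (\<forall>v\<in>bound_space \<rho> \<theta>. L2_inner v (\<lambda>x. f x - h x) = 0))"

text \<open>
  The coefficient function $\lambda \mapsto \langle \Psi^{(\alpha)}(\cdot,\lambda), f\rangle$ in
  $L^2(0,\infty)$. As \<open>\<Psi>\<close> is bounded but not square-integrable in \<open>x\<close>, the pairing with a
  general \<open>f\<close> in $L^2(\mathbb{R})$ is the limit in the mean of the truncated integrals; it agrees
  for almost every \<open>\<lambda>\<close> with the Lebesgue integral when \<open>f\<close> is also integrable.
\<close>

definition eigen_coeff ::
  "(nat \<Rightarrow> real) \<Rightarrow> (nat \<Rightarrow> real) \<Rightarrow> parity \<Rightarrow> (real \<Rightarrow> complex) \<Rightarrow> real \<Rightarrow> complex" where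
  "eigen_coeff \<rho> \<theta> \<alpha> f =
     L2_limit (restrict_space lborel {0..})
       (\<lambda>R l. LINT x:{-R..R}|lborel. cnj (Psi \<rho> \<theta> \<alpha> x l) * f x)"

text \<open>$\int_0^\infty m(\lambda)\,\langle \Psi^{(\alpha)}(\cdot,\lambda), f\rangle\,
  \Psi^{(\alpha)}(\cdot,\lambda)\,d\lambda$, converging in $L^2(\mathbb{R})$.\<close>

definition eigen_expansion ::
  "(nat \<Rightarrow> real) \<Rightarrow> (nat \<Rightarrow> real) \<Rightarrow> parity \<Rightarrow> (real \<Rightarrow> complex) \<Rightarrow>
     (real \<Rightarrow> complex) \<Rightarrow> real \<Rightarrow> complex" where
  "eigen_expansion \<rho> \<theta> \<alpha> m f =
     L2_limit lborel
       (\<lambda>R x. LINT l:{0..R}|lborel. m l * eigen_coeff \<rho> \<theta> \<alpha> f l * Psi \<rho> \<theta> \<alpha> x l)"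

definition cont_proj ::
  "(nat \<Rightarrow> real) \<Rightarrow> (nat \<Rightarrow> real) \<Rightarrow> parity \<Rightarrow> (real \<Rightarrow> complex) \<Rightarrow> real \<Rightarrow> complex" where
  "cont_proj \<rho> \<theta> \<alpha> f = eigen_expansion \<rho> \<theta> \<alpha> (\<lambda>_. 1) f"


section \<open>The operator B and its unitary group\<close>

text \<open>
  B is given by its spectral resolution: eigenvalue $-2\beta_b$ on the bound states and
  multiplication by $2\lambda^2$ on the continuous part. \<open>B_calculus \<dots> \<phi>\<close> is the operator
  $\phi(B)$ of the corresponding functional calculus, acting on all of $L^2(\mathbb{R})$ for bounded
  \<open>\<phi>\<close>, and in general on those \<open>f\<close> for which $\phi(2\lambda^2)\langle \Psi, f\rangle$ is
  square-integrable.
\<close>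

definition B_calculus ::
  "(nat \<Rightarrow> real) \<Rightarrow> (nat \<Rightarrow> real) \<Rightarrow> real \<Rightarrow> (real \<Rightarrow> complex) \<Rightarrow>
     (real \<Rightarrow> complex) \<Rightarrow> real \<Rightarrow> complex" where
  "B_calculus \<rho> \<theta> \<beta> \<phi> f = (\<lambda>x.
     \<phi> (- 2 * \<beta>) * bound_proj \<rho> \<theta> f x
     + (\<Sum>\<alpha>\<in>{Even, Odd}. eigen_expansion \<rho> \<theta> \<alpha> (\<lambda>l. \<phi> (2 * l\<^sup>2)) f x))"

definition B_op ::
  "(nat \<Rightarrow> real) \<Rightarrow> (nat \<Rightarrow> real) \<Rightarrow> real \<Rightarrow> (real \<Rightarrow> complex) \<Rightarrow> real \<Rightarrow> complex" where
  "B_op \<rho> \<theta> \<beta> = B_calculus \<rho> \<theta> \<beta> complex_of_real"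

definition exp_itB ::
  "(nat \<Rightarrow> real) \<Rightarrow> (nat \<Rightarrow> real) \<Rightarrow> real \<Rightarrow> real \<Rightarrow> (real \<Rightarrow> complex) \<Rightarrow> real \<Rightarrow> complex" where
  "exp_itB \<rho> \<theta> \<beta> t = B_calculus \<rho> \<theta> \<beta> (\<lambda>s. exp (- \<i> * complex_of_real t * complex_of_real s))"

end

theory Submission
  imports Defs
begin

text \<open>
  The product of two eigenfunctions has an explicit antiderivative in \<open>x\<close>: with \<open>a\<close> and \<open>b\<close> as in the
  linear system there is \<open>G\<close> with $G' = 2i(m-l)\,\overline{a(x,\bar m)}\,a(x,l)$. Against the weight
  $e^{-2\varepsilon|x|}$ the integral of $\overline{a(x,m)}\,a(x,l)$ is therefore a Poisson kernel in
  $m-l$ up to a small error, and $\varepsilon \to 0$ shows that $h \mapsto \int_0^\infty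
  h(\lambda)\Psi^{(\alpha)}(\cdot,\lambda)\,d\lambda$ is isometric, with orthogonal ranges for the two
  parities. The same identity at $m = i\rho_k$ makes these ranges orthogonal to the bound states.
  Completeness is not needed: on the range of the projection, $e^{-itB}$ just multiplies the
  coefficients by $e^{-2i\lambda^2 t}$.

  The evolution is thus the limit of integral operators with kernels $\int_0^R e^{-2i\lambda^2t}
  \Psi(x,\lambda)\overline{\Psi(y,\lambda)}\,d\lambda$. As \<open>\<Psi>\<close> is a sum of two plane waves with
  symbol-like amplitudes, van der Corput's lemma bounds them by $|t|^{-1/2}$. The odd \<open>\<Psi>\<close>
  vanishes at $\lambda = 0$, so one integration by parts gains a further $1/|t|$, at the price of a
  factor $\langle x\rangle^2\langle y\rangle^2$, which the weights compensate since $\sigma - 2 > 1/2$.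
\<close>

section \<open>Convergence in the mean\<close>

text \<open>All that is known of the coefficients comes from the relations at the four points
  +-i\<rho>_k, since a polynomial of degree at most three vanishing there is zero. This gives
  uniqueness, the identity |A|^2 + |B|^2 = (l^2 + \<rho>_1^2)(l^2 + \<rho>_2^2) for real l, where A
  = l^2 + a1 l + a0 and B = b1 l + b0, and, once the relations are differentiated in x, the
  differential equations that produce \<open>G\<close>. The identity also bounds the coefficients
  uniformly in x and accounts for the normalisation of \<Psi>.

  The projections are chosen representatives of limits in the mean, so existence of the limits
  precedes every computation. Isometry on bounded amplitudes of bounded support provides it; the
  Poisson argument works with continuous amplitudes and is extended by almost everywhere
  approximation.

  The kernel bounds degenerate as t tends to 0, so |t| \<le> 1 is settled by isometry alone. For the
  odd part, cutting the spectrum at R leaves a boundary term of size 1/(|t| R); this is why the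
  bounds carry R and the limit in R is taken last.\<close>

lemma borel_measurable_cnj [measurable]:
  "f \<in> borel_measurable M \<Longrightarrow> (\<lambda>x. cnj (f x)) \<in> borel_measurable M"
  by (rule borel_measurable_continuous_on) (intro continuous_intros, simp)

lemma L2_measurable: "f \<in> L2 M \<Longrightarrow> f \<in> borel_measurable M"
  by (simp add: L2_def)

lemma L2_integrable_sq: "f \<in> L2 M \<Longrightarrow> integrable M (\<lambda>x. (cmod (f x))\<^sup>2)"
  by (simp add: L2_def)

lemma L2_dominated:
  assumes "f \<in> borel_measurable M" "integrable M g" "\<And>x. x \<in> space M \<Longrightarrow> (cmod (f x))\<^sup>2 \<le> g x"
  shows "f \<in> L2 M"
  unfolding L2_def
proof safe
  have [measurable]: "f \<in> borel_measurable M" by fact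
  show "integrable M (\<lambda>x. (cmod (f x))\<^sup>2)"
    by (rule Bochner_Integration.integrable_bound[OF assms(2)])
       (use assms(3) in \<open>auto intro!: AE_I2 order_trans[OF _ abs_ge_self]\<close>)
qed (rule assms)

lemma cmod_add_sq_le: "(cmod (a + b))\<^sup>2 \<le> 2 * (cmod a)\<^sup>2 + 2 * (cmod b)\<^sup>2"
proof -
  have "(cmod (a + b))\<^sup>2 \<le> (cmod a + cmod b)\<^sup>2"
    by (intro power_mono norm_triangle_ineq norm_ge_zero)
  also have "\<dots> \<le> 2 * (cmod a)\<^sup>2 + 2 * (cmod b)\<^sup>2"
    using sum_squares_bound[of "cmod a" "cmod b"] by (simp add: power2_sum)
  finally show ?thesis .
qed

lemma L2_add: "f \<in> L2 M \<Longrightarrow> g \<in> L2 M \<Longrightarrow> (\<lambda>x. f x + g x) \<in> L2 M"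
  by (rule L2_dominated[where g="\<lambda>x. 2 * (cmod (f x))\<^sup>2 + 2 * (cmod (g x))\<^sup>2"])
     (auto simp: L2_def cmod_add_sq_le)

lemma L2_cmult: "f \<in> L2 M \<Longrightarrow> (\<lambda>x. c * f x) \<in> L2 M"
  by (auto simp: L2_def norm_mult power_mult_distrib)

lemma L2_diff: "f \<in> L2 M \<Longrightarrow> g \<in> L2 M \<Longrightarrow> (\<lambda>x. f x - g x) \<in> L2 M"
  using L2_add[of f M "\<lambda>x. (-1) * g x"] L2_cmult[of g M "-1"] by simp

lemma L2_mult_bounded:
  assumes "f \<in> L2 M" "m \<in> borel_measurable M" "\<And>x. x \<in> space M \<Longrightarrow> cmod (m x) \<le> 1"
  shows "(\<lambda>x. m x * f x) \<in> L2 M"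
  using assms
  by (intro L2_dominated[where g="\<lambda>x. (cmod (f x))\<^sup>2"])
     (auto simp: L2_def norm_mult intro!: power_mono mult_left_le_one_le)

lemma L2_norm_nonneg [simp]: "0 \<le> L2_norm M f"
  by (simp add: L2_norm_def)

lemma L2_norm_sq: "(L2_norm M f)\<^sup>2 = (LINT x|M. (cmod (f x))\<^sup>2)"
  by (simp add: L2_norm_def)

lemma L2_norm_zero [simp]: "L2_norm M (\<lambda>_. 0) = 0"
  by (simp add: L2_norm_def)

lemma L2_norm_cmult: "L2_norm M (\<lambda>x. c * f x) = cmod c * L2_norm M f"
  by (simp add: L2_norm_def norm_mult power_mult_distrib real_sqrt_mult)

lemma L2_norm_minus_commute: "L2_norm M (\<lambda>x. f x - g x) = L2_norm M (\<lambda>x. g x - f x)"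
  by (simp add: L2_norm_def norm_minus_commute)

lemma L2_norm_cong_AE:
  assumes "AE x in M. f x = g x" "f \<in> borel_measurable M" "g \<in> borel_measurable M"
  shows "L2_norm M f = L2_norm M g"
  unfolding L2_norm_def using assms by (intro arg_cong[where f=sqrt] integral_cong_AE) auto

lemma L2_norm_mono:
  assumes "f \<in> borel_measurable M" "g \<in> L2 M" "\<And>x. x \<in> space M \<Longrightarrow> cmod (f x) \<le> cmod (g x)"
  shows "L2_norm M f \<le> L2_norm M g"
proof -
  have "f \<in> L2 M"
    using assms L2_integrable_sq[OF assms(2)] by (intro L2_dominated) (auto intro!: power_mono)
  thus ?thesis
    unfolding L2_norm_def using assms(2,3) L2_integrable_sq
    by (intro real_sqrt_le_mono integral_mono) (auto intro!: power_mono)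
qed

lemma L2_norm_mult_bounded:
  assumes "f \<in> L2 M" "m \<in> borel_measurable M" "\<And>x. x \<in> space M \<Longrightarrow> cmod (m x) \<le> 1"
  shows "L2_norm M (\<lambda>x. m x * f x) \<le> L2_norm M f"
  using L2_measurable[OF assms(1)] assms
  by (intro L2_norm_mono) (auto simp: norm_mult intro!: mult_left_le_one_le)

lemma L2_norm_zero_AE:
  assumes "f \<in> L2 M" "L2_norm M f = 0"
  shows "AE x in M. f x = 0"
proof -
  have "(LINT x|M. (cmod (f x))\<^sup>2) = 0" using assms(2) L2_norm_sq[of M f] by simp
  hence "AE x in M. (cmod (f x))\<^sup>2 = 0"
    using integral_nonneg_eq_0_iff_AE[OF L2_integrable_sq[OF assms(1)]] by simp
  thus ?thesis by simp
qed

lemma L2_norm_mult_integrable: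
  assumes "f \<in> L2 M" "g \<in> L2 M"
  shows "integrable M (\<lambda>x. cmod (f x) * cmod (g x))"
proof (rule Bochner_Integration.integrable_bound)
  show "integrable M (\<lambda>x. (cmod (f x))\<^sup>2 + (cmod (g x))\<^sup>2)"
    using assms by (simp add: L2_def)
  show "(\<lambda>x. cmod (f x) * cmod (g x)) \<in> borel_measurable M"
    using assms[THEN L2_measurable] by measurable
  have "cmod (f x) * cmod (g x) \<le> (cmod (f x))\<^sup>2 + (cmod (g x))\<^sup>2" for x
    using sum_squares_bound[of "cmod (f x)" "cmod (g x)"]
      mult_nonneg_nonneg[OF norm_ge_zero norm_ge_zero, of "f x" "g x"]
    by linarith
  thus "AE x in M. norm (cmod (f x) * cmod (g x)) \<le> norm ((cmod (f x))\<^sup>2 + (cmod (g x))\<^sup>2)"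
    by simp
qed

text \<open>The integral of \<open>(s * cmod f - u * cmod g)^2\<close> is a nonnegative quadratic
  form in \<open>(s, u)\<close>; each case evaluates it at a point where it would be negative if the
  inequality failed.\<close>

lemma L2_Cauchy_Schwarz_norm:
  assumes "f \<in> L2 M" "g \<in> L2 M"
  shows "(LINT x|M. cmod (f x) * cmod (g x)) \<le> L2_norm M f * L2_norm M g"
proof -
  define a b c where "a = L2_norm M f" and "b = L2_norm M g"
    and "c = (LINT x|M. cmod (f x) * cmod (g x))"
  have q: "0 \<le> s\<^sup>2 * a\<^sup>2 - 2 * s * u * c + u\<^sup>2 * b\<^sup>2" for s u
  proof -
    have "0 \<le> (LINT x|M. (s * cmod (f x) - u * cmod (g x))\<^sup>2)" by simp
    also have "\<dots> = (LINT x|M. s\<^sup>2 * (cmod (f x))\<^sup>2 - 2 * s * u * (cmod (f x) * cmod (g x))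
                       + u\<^sup>2 * (cmod (g x))\<^sup>2)"
      by (intro Bochner_Integration.integral_cong) (auto simp: power2_eq_square algebra_simps)
    also have "\<dots> = s\<^sup>2 * a\<^sup>2 - 2 * s * u * c + u\<^sup>2 * b\<^sup>2"
      using L2_norm_mult_integrable[OF assms] L2_integrable_sq[OF assms(1)] L2_integrable_sq[OF assms(2)]
      by (simp add: a_def b_def c_def L2_norm_sq)
    finally show ?thesis .
  qed
  have c0: "0 \<le> c" by (simp add: c_def)
  have a0: "0 \<le> a" and b0: "0 \<le> b" by (simp_all add: a_def b_def)
  have "c \<le> a * b"
  proof (rule ccontr)
    assume "\<not> c \<le> a * b"
    hence lt: "a * b < c" by simp
    have cp: "c > 0" using lt mult_nonneg_nonneg[OF a0 b0] by linarith
    show False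
    proof (cases "b = 0")
      case True
      \<comment> \<open>With b = 0 the form is linear in u, and u = \<open>(a^2 + 1) / c\<close> is
        large enough to make it negative.\<close>
      have "0 \<le> 1 * a\<^sup>2 - 2 * ((a\<^sup>2 + 1) / c) * c" using q[of 1 "(a\<^sup>2 + 1) / c"] True by simp
      moreover have "(a\<^sup>2 + 1) / c * c = a\<^sup>2 + 1" using cp by simp
      ultimately have "0 \<le> a\<^sup>2 - 2 * (a\<^sup>2 + 1)" by (metis (no_types) mult.assoc mult_1)
      hence "a\<^sup>2 + 2 \<le> 0" by (simp add: algebra_simps)
      thus False using zero_le_power2[of a] by linarith
    next
      case False
      hence bp: "b > 0" using b0 by simp
      \<comment> \<open>The point s = b^2, u = c minimises the form along the ratio u / s.\<close>
      have "0 \<le> b\<^sup>2 * (a\<^sup>2 * b\<^sup>2 - c\<^sup>2)"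
        using q[of "b\<^sup>2" c] by (simp add: power2_eq_square algebra_simps)
      hence "c\<^sup>2 \<le> (a * b)\<^sup>2" using bp by (simp add: zero_le_mult_iff power_mult_distrib)
      hence "c \<le> a * b" using a0 b0 by (simp add: power2_le_iff_abs_le abs_mult)
      thus False using lt by simp
    qed
  qed
  thus ?thesis by (simp add: a_def b_def c_def)
qed

lemma L2_cnj_mult_integrable:
  assumes "f \<in> L2 M" "g \<in> L2 M"
  shows "integrable M (\<lambda>x. cnj (f x) * g x)"
  by (rule Bochner_Integration.integrable_bound[OF L2_norm_mult_integrable[OF assms]])
     (use assms[THEN L2_measurable] in \<open>auto simp: norm_mult\<close>)

lemma L2_Cauchy_Schwarz:
  assumes "f \<in> L2 M" "g \<in> L2 M"
  shows "cmod (LINT x|M. cnj (f x) * g x) \<le> L2_norm M f * L2_norm M g"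
proof -
  have "cmod (LINT x|M. cnj (f x) * g x) \<le> (LINT x|M. cmod (cnj (f x) * g x))"
    by (rule integral_norm_bound)
  also have "\<dots> = (LINT x|M. cmod (f x) * cmod (g x))" by (simp add: norm_mult)
  also have "\<dots> \<le> L2_norm M f * L2_norm M g" by (rule L2_Cauchy_Schwarz_norm[OF assms])
  finally show ?thesis .
qed

lemma L2_norm_triangle:
  assumes "f \<in> L2 M" "g \<in> L2 M"
  shows "L2_norm M (\<lambda>x. f x + g x) \<le> L2_norm M f + L2_norm M g"
proof (rule power2_le_imp_le)
  have "(L2_norm M (\<lambda>x. f x + g x))\<^sup>2 = (LINT x|M. (cmod (f x + g x))\<^sup>2)" by (rule L2_norm_sq)
  also have "\<dots> \<le> (LINT x|M. (cmod (f x))\<^sup>2 + 2 * (cmod (f x) * cmod (g x)) + (cmod (g x))\<^sup>2)"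
  proof (intro integral_mono)
    show "(cmod (f x + g x))\<^sup>2 \<le> (cmod (f x))\<^sup>2 + 2 * (cmod (f x) * cmod (g x)) + (cmod (g x))\<^sup>2" for x
      using power_mono[OF norm_triangle_ineq[of "f x" "g x"] norm_ge_zero, of 2]
      by (simp add: power2_sum)
  qed (intro L2_integrable_sq L2_add assms Bochner_Integration.integrable_add integrable_mult_right
      L2_norm_mult_integrable)+
  also have "\<dots> = (L2_norm M f)\<^sup>2 + 2 * (LINT x|M. cmod (f x) * cmod (g x)) + (L2_norm M g)\<^sup>2"
    using L2_norm_mult_integrable[OF assms] L2_integrable_sq[OF assms(1)] L2_integrable_sq[OF assms(2)]
    by (simp add: L2_norm_sq)
  also have "\<dots> \<le> (L2_norm M f + L2_norm M g)\<^sup>2"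
    using L2_Cauchy_Schwarz_norm[OF assms] by (simp add: power2_sum)
  finally show "(L2_norm M (\<lambda>x. f x + g x))\<^sup>2 \<le> (L2_norm M f + L2_norm M g)\<^sup>2" .
qed simp

lemma L2_norm_triangle_diff:
  assumes "f \<in> L2 M" "g \<in> L2 M"
  shows "L2_norm M f \<le> L2_norm M g + L2_norm M (\<lambda>x. f x - g x)"
  using L2_norm_triangle[OF assms(2) L2_diff[OF assms]] by simp

lemma L2_norm_triangle3:
  assumes "f \<in> L2 M" "g \<in> L2 M" "h \<in> L2 M"
  shows "L2_norm M (\<lambda>x. f x - h x) \<le> L2_norm M (\<lambda>x. f x - g x) + L2_norm M (\<lambda>x. g x - h x)"
  using L2_norm_triangle[OF L2_diff[OF assms(1,2)] L2_diff[OF assms(2,3)]] by simp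

lemma L2_norm_abs_diff:
  assumes "f \<in> L2 M" "g \<in> L2 M"
  shows "\<bar>L2_norm M f - L2_norm M g\<bar> \<le> L2_norm M (\<lambda>x. f x - g x)"
  using L2_norm_triangle_diff[OF assms] L2_norm_triangle_diff[OF assms(2,1)]
    L2_norm_minus_commute[of M f g] by linarith

lemma nn_integral_cmod_sq:
  assumes "f \<in> L2 M"
  shows "(\<integral>\<^sup>+x. ennreal ((cmod (f x))\<^sup>2) \<partial>M) = ennreal ((L2_norm M f)\<^sup>2)"
  by (simp add: nn_integral_eq_integral L2_integrable_sq[OF assms] L2_norm_sq)

text \<open>Fatou's lemma for the nonnegative integral makes \<open>g \<in> L2 M\<close> part of the
  conclusion. This is how norm bounds pass to pointwise limits below; lower bounds are lost on the
  way and have to be recovered separately.\<close>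

lemma L2_Fatou:
  assumes f: "\<And>n. f n \<in> L2 M" and g: "g \<in> borel_measurable M"
    and lim: "AE x in M. (\<lambda>n. f n x) \<longlonglongrightarrow> g x"
    and bd: "\<forall>\<^sub>F n in sequentially. L2_norm M (f n) \<le> C"
  shows "g \<in> L2 M" and "L2_norm M g \<le> C"
proof -
  note [measurable] = g
  have [measurable]: "f n \<in> borel_measurable M" for n using f L2_measurable by blast
  obtain k where "L2_norm M (f k) \<le> C" using eventually_happens[OF bd] by auto
  hence C: "0 \<le> C" using L2_norm_nonneg[of M "f k"] by linarith
  have "(\<integral>\<^sup>+x. ennreal ((cmod (g x))\<^sup>2) \<partial>M) = (\<integral>\<^sup>+x. liminf (\<lambda>n. ennreal ((cmod (f n x))\<^sup>2)) \<partial>M)"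
  proof (rule nn_integral_cong_AE, use lim in eventually_elim)
    case (elim x)
    have "(\<lambda>n. ennreal ((cmod (f n x))\<^sup>2)) \<longlonglongrightarrow> ennreal ((cmod (g x))\<^sup>2)"
      by (intro tendsto_intros elim)
    from lim_imp_Liminf[OF _ this] show ?case by simp
  qed
  also have "\<dots> \<le> liminf (\<lambda>n. \<integral>\<^sup>+x. ennreal ((cmod (f n x))\<^sup>2) \<partial>M)"
    by (rule nn_integral_liminf) simp
  also have "\<dots> \<le> limsup (\<lambda>n. \<integral>\<^sup>+x. ennreal ((cmod (f n x))\<^sup>2) \<partial>M)"
    by (rule Liminf_le_Limsup) simp
  also have "\<dots> \<le> ennreal (C\<^sup>2)"
    by (rule Limsup_bounded, use bd in eventually_elim)
       (auto simp: nn_integral_cmod_sq[OF f] intro!: ennreal_leI power_mono)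
  finally have le: "(\<integral>\<^sup>+x. ennreal ((cmod (g x))\<^sup>2) \<partial>M) \<le> ennreal (C\<^sup>2)" .
  have int: "integrable M (\<lambda>x. (cmod (g x))\<^sup>2)"
    using le by (intro integrableI_bounded) (auto simp: top_unique le_less_trans)
  show gL: "g \<in> L2 M" using int g by (simp add: L2_def)
  have "ennreal ((L2_norm M g)\<^sup>2) \<le> ennreal (C\<^sup>2)" using le nn_integral_cmod_sq[OF gL] by simp
  hence "(L2_norm M g)\<^sup>2 \<le> C\<^sup>2" by (simp add: ennreal_le_iff)
  thus "L2_norm M g \<le> C" using C by (rule power2_le_imp_le)
qed

lemma L2_fast_Cauchy_AE_convergent:
  assumes f: "\<And>n. f n \<in> L2 M"
    and fast: "\<And>n. L2_norm M (\<lambda>x. f (Suc n) x - f n x) \<le> (1/2) ^ n"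
  shows "AE x in M. convergent (\<lambda>n. f n x)"
proof -
  have [measurable]: "f n \<in> borel_measurable M" for n using f L2_measurable by blast
  \<comment> \<open>Squared increments have integral at most 4^(-n), which leaves room for the
    weight 2^n. Finiteness of the weighted sum at x then forces the increments at x to decay like
    2^(-n/2).\<close>
  define u where "u n x = 2 ^ n * (cmod (f (Suc n) x - f n x))\<^sup>2" for n x
  have um[measurable]: "u n \<in> borel_measurable M" for n unfolding u_def by measurable
  have "(\<integral>\<^sup>+x. (\<Sum>n. ennreal (u n x)) \<partial>M) = (\<Sum>n. \<integral>\<^sup>+x. ennreal (u n x) \<partial>M)"
    by (intro nn_integral_suminf) simp
  also have "\<dots> \<le> (\<Sum>n. ennreal ((1/2) ^ n))"
  proof (intro suminf_le summableI)
    fix n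
    have "(\<integral>\<^sup>+x. ennreal (u n x) \<partial>M)
        = (\<integral>\<^sup>+x. ennreal (2 ^ n) * ennreal ((cmod (f (Suc n) x - f n x))\<^sup>2) \<partial>M)"
      by (simp add: u_def ennreal_mult)
    also have "\<dots> = ennreal (2 ^ n) * ennreal ((L2_norm M (\<lambda>x. f (Suc n) x - f n x))\<^sup>2)"
      by (simp add: nn_integral_cmult nn_integral_cmod_sq[OF L2_diff[OF f f]])
    also have "\<dots> = ennreal (2 ^ n * (L2_norm M (\<lambda>x. f (Suc n) x - f n x))\<^sup>2)"
      by (simp add: ennreal_mult)
    also have "\<dots> \<le> ennreal (2 ^ n * ((1/2) ^ n)\<^sup>2)"
      by (intro ennreal_leI mult_left_mono power_mono fast) auto
    also have "2 ^ n * ((1/2) ^ n)\<^sup>2 = ((1/2) ^ n :: real)"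
      by (simp add: power2_eq_square power_divide)
    finally show "(\<integral>\<^sup>+x. ennreal (u n x) \<partial>M) \<le> ennreal ((1/2) ^ n)" .
  qed
  also have "\<dots> = ennreal (\<Sum>n. (1/2) ^ n)"
    by (rule suminf_ennreal_eq) (auto intro: summable_sums)
  also have "\<dots> < \<infinity>" by simp
  finally have "(\<integral>\<^sup>+x. (\<Sum>n. ennreal (u n x)) \<partial>M) \<noteq> \<infinity>" by simp
  hence "AE x in M. (\<Sum>n. ennreal (u n x)) \<noteq> \<infinity>"
    by (intro nn_integral_PInf_AE) auto
  thus ?thesis
  proof eventually_elim
    case (elim x)
    then obtain S where S: "(\<Sum>n. ennreal (u n x)) = ennreal S" "0 \<le> S"
      by (cases "(\<Sum>n. ennreal (u n x))") auto
    have u0: "0 \<le> u n x" for n by (simp add: u_def)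
    have uS: "u n x \<le> S" for n
    proof -
      have "ennreal (u n x) \<le> (\<Sum>n. ennreal (u n x))"
        using sum_le_suminf[of "\<lambda>n. ennreal (u n x)" "{n}"] by simp
      thus ?thesis using S by simp
    qed
    have "cmod (f (Suc n) x - f n x) \<le> sqrt S * (sqrt (1/2)) ^ n" for n
    proof -
      have "(cmod (f (Suc n) x - f n x))\<^sup>2 \<le> S * (1/2) ^ n"
        using mult_right_mono[OF uS[of n], of "(1/2) ^ n"] by (simp add: u_def power_one_over)
      hence "cmod (f (Suc n) x - f n x) \<le> sqrt (S * (1/2) ^ n)" by (rule real_le_rsqrt)
      thus ?thesis by (simp add: real_sqrt_mult real_sqrt_power)
    qed
    hence le: "norm (f (Suc n) x - f n x) \<le> sqrt S * (sqrt (1/2)) ^ n" for n by simp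
    have "norm (sqrt (1/2 :: real)) < 1" unfolding real_norm_def by (simp add: real_sqrt_divide)
    hence "summable (\<lambda>n. sqrt S * (sqrt (1/2)) ^ n)" by (intro summable_mult summable_geometric)
    hence "summable (\<lambda>n. f (Suc n) x - f n x)" by (rule summable_comparison_test') (rule le)
    hence "convergent (\<lambda>n. \<Sum>i<n. f (Suc i) x - f i x)" by (simp add: summable_iff_convergent)
    hence "convergent (\<lambda>n. f n x - f 0 x)"
      unfolding sum_lessThan_telescope[of "\<lambda>i. f i x"] .
    from convergent_add[OF this convergent_const[of "f 0 x"]] show ?case by simp
  qed
qed

text \<open>Riesz-Fischer for a real parameter: a rapidly convergent subsequence along
  \<open>r\<close> has an almost everywhere limit \<open>g\<close>, and Fatou's lemma, applied in
  one index of the Cauchy estimate, gives convergence of the whole family.\<close>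

lemma L2_complete:
  assumes F: "\<And>R. F R \<in> L2 M"
    and Cauchy: "\<And>e. e > 0 \<Longrightarrow> \<exists>N. \<forall>R\<ge>N. \<forall>S\<ge>N. L2_norm M (\<lambda>x. F R x - F S x) < e"
  shows "\<exists>g. is_L2_limit M F g"
proof -
  have "\<exists>N. \<forall>R\<ge>N. \<forall>S\<ge>N. L2_norm M (\<lambda>x. F R x - F S x) < (1/2) ^ n" for n
    by (rule Cauchy) simp
  then obtain N where N: "\<And>n R S. R \<ge> N n \<Longrightarrow> S \<ge> N n \<Longrightarrow> L2_norm M (\<lambda>x. F R x - F S x) < (1/2) ^ n"
    by metis
  \<comment> \<open>The maximum over all earlier thresholds makes \<open>r n\<close> admissible for
    every \<open>N m\<close> with m \<le> n, although \<open>N\<close> need not be monotone.\<close>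
  define r where "r n = (MAX i\<in>{..n}. N i) + real n" for n
  have rN: "r n \<ge> N m" if "m \<le> n" for m n
  proof -
    have "N m \<le> (MAX i\<in>{..n}. N i)" using that by (intro Max_ge) auto
    thus ?thesis by (simp add: r_def)
  qed
  define f where "f n = F (r n)" for n
  have fL: "f n \<in> L2 M" for n by (simp add: f_def F)
  have [measurable]: "f n \<in> borel_measurable M" for n using fL L2_measurable by blast
  have "AE x in M. convergent (\<lambda>n. f n x)"
    by (rule L2_fast_Cauchy_AE_convergent[OF fL])
       (auto simp: f_def intro!: less_imp_le N rN)
  hence conv: "AE x in M. (\<lambda>n. f n x) \<longlonglongrightarrow> lim (\<lambda>n. f n x)"
    by eventually_elim (simp add: convergent_LIMSEQ_iff)
  define g where "g x = lim (\<lambda>n. f n x)" for x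
  have gm[measurable]: "g \<in> borel_measurable M" unfolding g_def by measurable
  have est: "(\<lambda>x. g x - F R x) \<in> L2 M \<and> L2_norm M (\<lambda>x. g x - F R x) \<le> (1/2) ^ n" if "R \<ge> N n" for n R
  proof -
    have [measurable]: "F R \<in> borel_measurable M" using F L2_measurable by blast
    have A: "AE x in M. (\<lambda>k. f k x - F R x) \<longlonglongrightarrow> g x - F R x"
      using conv by eventually_elim (auto simp: g_def intro!: tendsto_intros)
    have B: "\<forall>\<^sub>F k in sequentially. L2_norm M (\<lambda>x. f k x - F R x) \<le> (1/2) ^ n"
      using eventually_ge_at_top[of n]
      by eventually_elim (auto simp: f_def intro!: less_imp_le N rN that)
    show ?thesis using L2_Fatou[OF L2_diff[OF fL F] _ A B] by simp
  qed
  have gL: "g \<in> L2 M" using L2_add[OF conjunct1[OF est[of 0 "N 0"]] F[of "N 0"]] by simp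
  have "((\<lambda>R. L2_norm M (\<lambda>x. F R x - g x)) \<longlongrightarrow> 0) at_top"
  proof (rule tendstoI)
    fix e :: real assume "e > 0"
    then obtain n where n: "(1/2) ^ n < e" using real_arch_pow_inv[of e "1/2"] by auto
    show "\<forall>\<^sub>F R in at_top. dist (L2_norm M (\<lambda>x. F R x - g x)) 0 < e"
      using eventually_ge_at_top[of "N n"]
    proof eventually_elim
      case (elim R)
      thus ?case using est[of n R] n L2_norm_minus_commute[of M "F R" g] by (simp add: dist_real_def)
    qed
  qed
  thus ?thesis using gL F by (auto simp: is_L2_limit_def)
qed

lemma is_L2_limit_L2_limit: "is_L2_limit M F g \<Longrightarrow> is_L2_limit M F (L2_limit M F)"
  unfolding L2_limit_def by (rule someI[of "is_L2_limit M F"])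

text \<open>\<open>F n - g\<close> tends to 0 in norm and to \<open>h - g\<close> pointwise, so
  Fatou's lemma forces \<open>h - g\<close> to have norm 0. This identifies a chosen representative
  with a concrete integral.\<close>

lemma is_L2_limit_pointwise_AE:
  assumes "is_L2_limit M F g" and h: "h \<in> borel_measurable M"
    and pw: "AE x in M. (\<lambda>n. F (real n) x) \<longlonglongrightarrow> h x"
  shows "AE x in M. g x = h x"
proof -
  have gL: "g \<in> L2 M" and FL: "\<forall>\<^sub>F R in at_top. F R \<in> L2 M"
    and lim: "((\<lambda>R. L2_norm M (\<lambda>x. F R x - g x)) \<longlongrightarrow> 0) at_top"
    using assms by (auto simp: is_L2_limit_def)
  note [measurable] = h L2_measurable[OF gL]
  obtain N :: nat where N: "\<And>n. n \<ge> N \<Longrightarrow> F (real n) \<in> L2 M"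
    using eventually_compose_filterlim[OF FL filterlim_real_sequentially]
    by (auto simp: eventually_sequentially)
  \<comment> \<open>The shift by \<open>N\<close> discards the indices at which \<open>F\<close> may
    fail to be in L2.\<close>
  define f where "f n x = F (real (n + N)) x - g x" for n x
  have fL: "f n \<in> L2 M" for n unfolding f_def by (intro L2_diff N gL) simp
  have flim: "(\<lambda>n. L2_norm M (f n)) \<longlonglongrightarrow> 0"
    using LIMSEQ_ignore_initial_segment[OF filterlim_compose[OF lim filterlim_real_sequentially], of N]
    by (simp add: f_def[abs_def])
  have pw': "AE x in M. (\<lambda>n. f n x) \<longlonglongrightarrow> h x - g x"
    using pw
  proof eventually_elim
    case (elim x)
    from LIMSEQ_ignore_initial_segment[OF elim, of N] show ?case
      unfolding f_def by (intro tendsto_intros)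
  qed
  have hg: "(\<lambda>x. h x - g x) \<in> borel_measurable M" by simp
  have "L2_norm M (\<lambda>x. h x - g x) \<le> e" if "e > 0" for e
    using order_tendstoD(2)[OF flim that]
    by (intro L2_Fatou(2)[OF fL hg pw']) (auto elim!: eventually_mono)
  hence "L2_norm M (\<lambda>x. h x - g x) \<le> 0" by (rule field_le_epsilon[of _ 0, simplified])
  hence z: "L2_norm M (\<lambda>x. h x - g x) = 0" by (simp add: order_antisym)
  have "(\<lambda>x. h x - g x) \<in> L2 M"
    using order_tendstoD(2)[OF flim, of 1]
    by (intro L2_Fatou(1)[OF fL hg pw', of 1]) (auto elim!: eventually_mono)
  from L2_norm_zero_AE[OF this z] show ?thesis by eventually_elim simp
qed

lemma is_L2_limit_norm:
  assumes "is_L2_limit M F g"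
  shows "((\<lambda>R. L2_norm M (F R)) \<longlongrightarrow> L2_norm M g) at_top"
proof (rule LIM_zero_cancel)
  have g: "g \<in> L2 M" and F: "\<forall>\<^sub>F R in at_top. F R \<in> L2 M"
    and lim: "((\<lambda>R. L2_norm M (\<lambda>x. F R x - g x)) \<longlongrightarrow> 0) at_top"
    using assms by (auto simp: is_L2_limit_def)
  show "((\<lambda>R. L2_norm M (F R) - L2_norm M g) \<longlongrightarrow> 0) at_top"
  proof (rule Lim_null_comparison[OF _ lim])
    show "\<forall>\<^sub>F R in at_top. norm (L2_norm M (F R) - L2_norm M g) \<le> L2_norm M (\<lambda>x. F R x - g x)"
      using F
    proof eventually_elim
      case (elim R)
      thus ?case using L2_norm_abs_diff[OF elim g] by simp
    qed
  qed
qed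

lemma is_L2_limit_inner:
  assumes "is_L2_limit M F g" "\<phi> \<in> L2 M"
  shows "((\<lambda>R. LINT x|M. cnj (\<phi> x) * F R x) \<longlongrightarrow> (LINT x|M. cnj (\<phi> x) * g x)) at_top"
proof (rule LIM_zero_cancel)
  have g: "g \<in> L2 M" and F: "\<forall>\<^sub>F R in at_top. F R \<in> L2 M"
    and lim: "((\<lambda>R. L2_norm M (\<lambda>x. F R x - g x)) \<longlongrightarrow> 0) at_top"
    using assms by (auto simp: is_L2_limit_def)
  have lim': "((\<lambda>R. L2_norm M \<phi> * L2_norm M (\<lambda>x. F R x - g x)) \<longlongrightarrow> 0) at_top"
    using tendsto_mult_right_zero[OF lim] by simp
  show "((\<lambda>R. (LINT x|M. cnj (\<phi> x) * F R x) - (LINT x|M. cnj (\<phi> x) * g x)) \<longlongrightarrow> 0) at_top"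
  proof (rule Lim_null_comparison[OF _ lim'])
    show "\<forall>\<^sub>F R in at_top. norm ((LINT x|M. cnj (\<phi> x) * F R x) - (LINT x|M. cnj (\<phi> x) * g x))
        \<le> L2_norm M \<phi> * L2_norm M (\<lambda>x. F R x - g x)"
      using F
    proof eventually_elim
      case (elim R)
      have "(LINT x|M. cnj (\<phi> x) * F R x) - (LINT x|M. cnj (\<phi> x) * g x)
          = (LINT x|M. cnj (\<phi> x) * (F R x - g x))"
        using L2_cnj_mult_integrable[OF assms(2) g] L2_cnj_mult_integrable[OF assms(2) elim]
        by (simp add: algebra_simps)
      thus ?case using L2_Cauchy_Schwarz[OF assms(2) L2_diff[OF elim g]]
        by simp
    qed
  qed
qed

section \<open>Isometric integral operators with bounded kernels\<close>

text \<open>\<open>C * cmod (f x) * cmod (g y)\<close> dominates the integrand on the product space.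
  The adjoint relation, the weighted norm identity and the kernel form of the evolution all rest on
  this exchange.\<close>

lemma Fubini_bounded_kernel:
  fixes f g :: "_ \<Rightarrow> complex"
  assumes sf: "sigma_finite_measure M1" "sigma_finite_measure M2"
    and f: "integrable M1 f" and g: "integrable M2 g"
    and k: "(\<lambda>(x, y). k x y) \<in> borel_measurable (M1 \<Otimes>\<^sub>M M2)"
    and bd: "\<And>x y. x \<in> space M1 \<Longrightarrow> y \<in> space M2 \<Longrightarrow> cmod (k x y) \<le> C"
  shows "(LINT x|M1. f x * (LINT y|M2. g y * k x y)) = (LINT y|M2. g y * (LINT x|M1. f x * k x y))"
proof -
  interpret M1: sigma_finite_measure M1 by fact
  interpret M2: sigma_finite_measure M2 by fact
  interpret pair_sigma_finite M1 M2 ..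
  have [measurable]: "f \<in> borel_measurable M1" "g \<in> borel_measurable M2" using f g by auto
  note [measurable] = k
  have gk: "integrable M2 (\<lambda>y. g y * k x y)" if "x \<in> space M1" for x
  proof (rule Bochner_Integration.integrable_bound)
    show "integrable M2 (\<lambda>y. C * cmod (g y))" using g by simp
    show "(\<lambda>y. g y * k x y) \<in> borel_measurable M2"
      using measurable_Pair2[OF k that] by simp
    show "AE y in M2. norm (g y * k x y) \<le> norm (C * cmod (g y))"
    proof (rule AE_I2)
      fix y assume "y \<in> space M2"
      from bd[OF that this] have "cmod (g y) * cmod (k x y) \<le> \<bar>C\<bar> * cmod (g y)"
        by (subst mult.commute) (intro mult_right_mono, auto)
      thus "norm (g y * k x y) \<le> norm (C * cmod (g y))" by (simp add: norm_mult abs_mult)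
    qed
  qed
  have "integrable (M1 \<Otimes>\<^sub>M M2) (\<lambda>(x, y). f x * (g y * k x y))"
  proof (rule Fubini_integrable)
    show "(\<lambda>(x, y). f x * (g y * k x y)) \<in> borel_measurable (M1 \<Otimes>\<^sub>M M2)" by measurable
    show "AE x in M1. integrable M2 (\<lambda>y. case (x, y) of (x, y) \<Rightarrow> f x * (g y * k x y))"
      by (rule AE_I2) (simp add: gk)
    show "integrable M1 (\<lambda>x. LINT y|M2. norm (case (x, y) of (x, y) \<Rightarrow> f x * (g y * k x y)))"
    proof (rule Bochner_Integration.integrable_bound)
      show "integrable M1 (\<lambda>x. (\<bar>C\<bar> * (LINT y|M2. cmod (g y))) * cmod (f x))" using f by simp
      show "(\<lambda>x. LINT y|M2. norm (case (x, y) of (x, y) \<Rightarrow> f x * (g y * k x y))) \<in> borel_measurable M1"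
        by measurable
      show "AE x in M1. norm (LINT y|M2. norm (case (x, y) of (x, y) \<Rightarrow> f x * (g y * k x y)))
          \<le> norm ((\<bar>C\<bar> * (LINT y|M2. cmod (g y))) * cmod (f x))"
      proof (rule AE_I2)
        fix x assume x: "x \<in> space M1"
        have "(LINT y|M2. cmod (g y * k x y)) \<le> (LINT y|M2. \<bar>C\<bar> * cmod (g y))"
        proof (intro integral_mono)
          show "integrable M2 (\<lambda>y. cmod (g y * k x y))" using gk[OF x] by simp
          show "integrable M2 (\<lambda>y. \<bar>C\<bar> * cmod (g y))" using g by simp
          fix y assume "y \<in> space M2"
          from bd[OF x this] have "cmod (g y) * cmod (k x y) \<le> \<bar>C\<bar> * cmod (g y)"
            by (subst mult.commute) (intro mult_right_mono, auto)
          thus "cmod (g y * k x y) \<le> \<bar>C\<bar> * cmod (g y)" by (simp add: norm_mult)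
        qed
        hence "cmod (f x) * (LINT y|M2. cmod (g y * k x y)) \<le> cmod (f x) * (\<bar>C\<bar> * (LINT y|M2. cmod (g y)))"
          by (intro mult_left_mono) auto
        thus "norm (LINT y|M2. norm (case (x, y) of (x, y) \<Rightarrow> f x * (g y * k x y)))
          \<le> norm ((\<bar>C\<bar> * (LINT y|M2. cmod (g y))) * cmod (f x))"
          by (simp add: norm_mult[of "f x"] abs_mult mult_ac)
      qed
    qed
  qed
  from Fubini_integral[OF this]
  have "(LINT y|M2. LINT x|M1. f x * (g y * k x y)) = (LINT x|M1. LINT y|M2. f x * (g y * k x y))" by simp
  also have "(LINT x|M1. LINT y|M2. f x * (g y * k x y)) = (LINT x|M1. f x * (LINT y|M2. g y * k x y))" by simp
  also have "(\<lambda>y. LINT x|M1. f x * (g y * k x y)) = (\<lambda>y. g y * (LINT x|M1. f x * k x y))"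
  proof
    fix y
    have "(LINT x|M1. f x * (g y * k x y)) = (LINT x|M1. g y * (f x * k x y))"
      by (intro Bochner_Integration.integral_cong) (simp_all add: mult_ac)
    thus "(LINT x|M1. f x * (g y * k x y)) = g y * (LINT x|M1. f x * k x y)" by simp
  qed
  finally show ?thesis by simp
qed

text \<open>Dominated convergence, stated for general sets because it serves two kinds of
  truncation: in the variable (\<open>cut\<close>, \<open>trunc\<close>) and in the size of the
  function (\<open>T_norm\<close>).\<close>

lemma L2_cut_tendsto:
  assumes f: "f \<in> L2 M" and A: "\<And>R::real. A R \<in> sets M"
    and ev: "\<And>x. x \<in> space M \<Longrightarrow> \<forall>\<^sub>F R in at_top. x \<in> A R"
  shows "((\<lambda>R. L2_norm M (\<lambda>x. f x * indicator (A R) x - f x)) \<longlongrightarrow> 0) at_top"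
proof -
  have [measurable]: "f \<in> borel_measurable M" "\<And>R. A R \<in> sets M" using f A L2_measurable by auto
  have "((\<lambda>R. LINT x|M. (cmod (f x * indicator (A R) x - f x))\<^sup>2) \<longlongrightarrow> (LINT x|M. 0)) at_top"
  proof (rule integral_dominated_convergence_at_top)
    show "integrable M (\<lambda>x. (cmod (f x))\<^sup>2)" by (rule L2_integrable_sq[OF f])
    show "\<forall>\<^sub>F R in at_top. AE x in M. norm ((cmod (f x * indicator (A R) x - f x))\<^sup>2) \<le> (cmod (f x))\<^sup>2"
      by (intro always_eventually allI AE_I2) (simp split: split_indicator)
    show "AE x in M. ((\<lambda>R. (cmod (f x * indicator (A R) x - f x))\<^sup>2) \<longlongrightarrow> 0) at_top"
    proof (rule AE_I2)
      fix x assume "x \<in> space M"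
      from ev[OF this] have "\<forall>\<^sub>F R in at_top. (cmod (f x * indicator (A R) x - f x))\<^sup>2 = 0"
        by eventually_elim simp
      thus "((\<lambda>R. (cmod (f x * indicator (A R) x - f x))\<^sup>2) \<longlongrightarrow> 0) at_top"
        by (rule tendsto_eventually)
    qed
  qed measurable
  hence "((\<lambda>R. sqrt (LINT x|M. (cmod (f x * indicator (A R) x - f x))\<^sup>2)) \<longlongrightarrow> sqrt 0) at_top"
    by (intro tendsto_real_sqrt) simp
  thus ?thesis by (simp add: L2_norm_def)
qed

lemma L2_mult_indicator: "f \<in> L2 M \<Longrightarrow> A \<in> sets M \<Longrightarrow> (\<lambda>x. f x * indicator A x) \<in> L2 M"
  using L2_mult_bounded[of f M "indicator A"] by (simp add: mult.commute split: split_indicator)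

text \<open>Polarisation with the second argument scaled by a fourth root of unity, the shape that
  \<open>T_add_cmult\<close> can handle; it turns preservation of norms into preservation of inner
  products.\<close>

lemma L2_inner_polarization:
  assumes f: "f \<in> L2 M" and g: "g \<in> L2 M"
  shows "4 * (LINT x|M. cnj (f x) * g x) =
    complex_of_real ((L2_norm M (\<lambda>x. f x + g x))\<^sup>2) - complex_of_real ((L2_norm M (\<lambda>x. f x + (-1) * g x))\<^sup>2)
    - \<i> * complex_of_real ((L2_norm M (\<lambda>x. f x + \<i> * g x))\<^sup>2)
    + \<i> * complex_of_real ((L2_norm M (\<lambda>x. f x + (-\<i>) * g x))\<^sup>2)"
proof -
  have I: "integrable M (\<lambda>x. complex_of_real ((cmod (f x + c * g x))\<^sup>2))" for c
    using L2_integrable_sq[OF L2_add[OF f L2_cmult[OF g]], of c] by (rule integrable_of_real)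
  have N: "complex_of_real ((L2_norm M (\<lambda>x. f x + c * g x))\<^sup>2)
      = (LINT x|M. complex_of_real ((cmod (f x + c * g x))\<^sup>2))" for c
    unfolding L2_norm_sq
    by (rule integral_of_real[OF L2_integrable_sq[OF L2_add[OF f L2_cmult[OF g]]], symmetric])
  have pt: "4 * (cnj a * b) = complex_of_real ((cmod (a + 1 * b))\<^sup>2) - complex_of_real ((cmod (a + (-1) * b))\<^sup>2)
    - \<i> * complex_of_real ((cmod (a + \<i> * b))\<^sup>2) + \<i> * complex_of_real ((cmod (a + (-\<i>) * b))\<^sup>2)" for a b
    unfolding complex_norm_square by (simp add: algebra_simps)
  have "4 * (LINT x|M. cnj (f x) * g x) = (LINT x|M. 4 * (cnj (f x) * g x))" by simp
  also have "\<dots> = (LINT x|M. complex_of_real ((cmod (f x + 1 * g x))\<^sup>2))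
    - (LINT x|M. complex_of_real ((cmod (f x + (-1) * g x))\<^sup>2))
    - \<i> * (LINT x|M. complex_of_real ((cmod (f x + \<i> * g x))\<^sup>2))
    + \<i> * (LINT x|M. complex_of_real ((cmod (f x + (-\<i>) * g x))\<^sup>2))"
    unfolding pt using I[of 1] I[of "-1"] I[of \<i>] I[of "-\<i>"]
    by (simp del: of_real_power)
  finally show ?thesis unfolding N[symmetric] by simp
qed

text \<open>The measure is a parameter because the same theory is used for Lebesgue measure on the
  line (kernel \<open>kf\<close>) and on the half-line (kernel \<Psi>).\<close>

locale bounded_kernel =
  fixes M :: "real measure" and K :: "real \<Rightarrow> real \<Rightarrow> complex" and C :: real
  assumes sigma_finite: "sigma_finite_measure M"
    and id_measurable: "(\<lambda>l. l) \<in> borel_measurable M"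
    and finite_bounded: "emeasure M ({-R..R} \<inter> space M) < \<infinity>"
    and kernel_measurable: "(\<lambda>(x, l). K x l) \<in> borel_measurable (lborel \<Otimes>\<^sub>M M)"
    and kernel_bound: "l \<in> space M \<Longrightarrow> cmod (K x l) \<le> C"
begin

definition T :: "(real \<Rightarrow> complex) \<Rightarrow> real \<Rightarrow> complex" where
  "T h x = (LINT l|M. h l * K x l)"

definition TS :: "(real \<Rightarrow> complex) \<Rightarrow> real \<Rightarrow> complex" where
  "TS f l = (LINT x|lborel. f x * cnj (K x l))"

definition cut :: "real \<Rightarrow> (real \<Rightarrow> complex) \<Rightarrow> real \<Rightarrow> complex" where
  "cut R h l = h l * indicator {-R..R} l"

definition supp_in :: "real \<Rightarrow> (real \<Rightarrow> complex) \<Rightarrow> bool" where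
  "supp_in N h \<longleftrightarrow> (\<forall>l\<in>space M. \<bar>l\<bar> > N \<longrightarrow> h l = 0)"

lemma interval_sets: "{a..b::real} \<inter> space M \<in> sets M"
  using measurable_sets[OF id_measurable, of "{a..b}"] by (simp add: vimage_def)

lemma cut_alt: "l \<in> space M \<Longrightarrow> cut R h l = h l * indicator ({-R..R} \<inter> space M) l"
  by (simp add: cut_def indicator_def)

lemma indicator_interval_measurable [measurable]:
  "(indicator {a..b} :: real \<Rightarrow> complex) \<in> borel_measurable M"
  by (rule measurable_compose[OF id_measurable borel_measurable_indicator]) simp

lemma cut_measurable: "h \<in> borel_measurable M \<Longrightarrow> cut R h \<in> borel_measurable M"
  unfolding cut_def[abs_def] by (intro borel_measurable_times indicator_interval_measurable)

lemma cut_L2: "h \<in> L2 M \<Longrightarrow> cut R h \<in> L2 M"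
  using L2_mult_bounded[of h M "indicator {-R..R}"]
  by (simp add: cut_def[abs_def] mult.commute split: split_indicator)

lemma cut_supp: "supp_in R (cut R h)"
  by (auto simp: supp_in_def cut_def indicator_def)

lemma cut_tendsto:
  assumes "h \<in> L2 M"
  shows "((\<lambda>R. L2_norm M (\<lambda>l. cut R h l - h l)) \<longlongrightarrow> 0) at_top"
proof -
  have "((\<lambda>R. L2_norm M (\<lambda>x. h x * indicator ({-R..R} \<inter> space M) x - h x)) \<longlongrightarrow> 0) at_top"
  proof (rule L2_cut_tendsto[OF assms interval_sets])
    fix l assume "l \<in> space M"
    show "\<forall>\<^sub>F R in at_top. l \<in> {-R..R} \<inter> space M"
      using eventually_ge_at_top[of "\<bar>l\<bar>"] by eventually_elim (use \<open>l \<in> space M\<close> in auto)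
  qed
  moreover have "L2_norm M (\<lambda>l. cut R h l - h l)
      = L2_norm M (\<lambda>x. h x * indicator ({-R..R} \<inter> space M) x - h x)" for R
    unfolding L2_norm_def by (intro arg_cong[where f=sqrt] Bochner_Integration.integral_cong) (simp_all add: cut_alt)
  ultimately show ?thesis by simp
qed

lemma integrable_supp:
  assumes h: "h \<in> L2 M" and N: "supp_in N h"
  shows "integrable M h"
proof (rule Bochner_Integration.integrable_bound)
  have "integrable M (indicator ({-N..N} \<inter> space M) :: real \<Rightarrow> real)"
    using finite_bounded[of N] interval_sets by (intro integrable_real_indicator) auto
  thus "integrable M (\<lambda>l. (cmod (h l))\<^sup>2 + indicator ({-N..N} \<inter> space M) l)"
    using L2_integrable_sq[OF h] by simp
  show "h \<in> borel_measurable M" by (rule L2_measurable[OF h])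
  show "AE l in M. norm (h l) \<le> norm ((cmod (h l))\<^sup>2 + indicator ({-N..N} \<inter> space M) l)"
  proof (rule AE_I2)
    fix l assume l: "l \<in> space M"
    show "norm (h l) \<le> norm ((cmod (h l))\<^sup>2 + indicator ({-N..N} \<inter> space M) l)"
    proof (cases "\<bar>l\<bar> \<le> N")
      case True
      hence "l \<in> {-N..N} \<inter> space M" using l by auto
      moreover have "cmod (h l) \<le> (cmod (h l))\<^sup>2 + 1"
        using zero_le_power2[of "cmod (h l) - 1"] by (simp add: power2_diff)
           (use norm_ge_zero[of "h l"] in linarith)
      ultimately show ?thesis by simp
    next
      case False
      thus ?thesis using N l by (auto simp: supp_in_def)
    qed
  qed
qed

lemma kernel_section: "(\<lambda>l. K x l) \<in> borel_measurable M"
  using measurable_Pair2[OF kernel_measurable, of x] by simp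

lemma T_integrand_integrable:
  assumes "integrable M h" shows "integrable M (\<lambda>l. h l * K x l)"
proof (rule Bochner_Integration.integrable_bound)
  show "integrable M (\<lambda>l. C * cmod (h l))" using assms by simp
  show "(\<lambda>l. h l * K x l) \<in> borel_measurable M" using assms kernel_section by simp
  show "AE l in M. norm (h l * K x l) \<le> norm (C * cmod (h l))"
  proof (rule AE_I2)
    fix l assume "l \<in> space M"
    from kernel_bound[OF this, of x] have "cmod (h l) * cmod (K x l) \<le> \<bar>C\<bar> * cmod (h l)"
      by (subst mult.commute) (intro mult_right_mono, auto)
    thus "norm (h l * K x l) \<le> norm (C * cmod (h l))" by (simp add: norm_mult abs_mult)
  qed
qed

lemma T_measurable:
  assumes [measurable]: "h \<in> borel_measurable M"
  shows "T h \<in> borel_measurable lborel"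
proof -
  interpret sigma_finite_measure M by (rule sigma_finite)
  note [measurable] = kernel_measurable
  show ?thesis unfolding T_def[abs_def] by measurable
qed

lemma T_diff:
  assumes "integrable M h" "integrable M g"
  shows "T (\<lambda>l. h l - g l) x = T h x - T g x"
  using T_integrand_integrable[OF assms(1), of x] T_integrand_integrable[OF assms(2), of x]
  by (simp add: T_def algebra_simps)

lemma T_add_cmult:
  assumes "integrable M h" "integrable M g"
  shows "T (\<lambda>l. h l + c * g l) x = T h x + c * T g x"
proof -
  have "T (\<lambda>l. h l + c * g l) x = (LINT l|M. h l * K x l + c * (g l * K x l))"
    by (simp add: T_def algebra_simps)
  thus ?thesis
    using T_integrand_integrable[OF assms(1), of x] T_integrand_integrable[OF assms(2), of x]
    by (simp add: T_def)
qed

lemma T_tendsto: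
  assumes "\<And>n. h n \<in> borel_measurable M" "g \<in> borel_measurable M" "integrable M w"
    "\<And>n l. l \<in> space M \<Longrightarrow> cmod (h n l) \<le> w l" "AE l in M. (\<lambda>n. h n l) \<longlonglongrightarrow> g l"
  shows "(\<lambda>n. T (h n) x) \<longlonglongrightarrow> T g x"
  unfolding T_def
proof (rule integral_dominated_convergence)
  show "integrable M (\<lambda>l. w l * \<bar>C\<bar>)" using assms(3) by simp
  show "(\<lambda>l. g l * K x l) \<in> borel_measurable M" "\<And>n. (\<lambda>l. h n l * K x l) \<in> borel_measurable M"
    using assms kernel_section by auto
  show "AE l in M. (\<lambda>n. h n l * K x l) \<longlonglongrightarrow> g l * K x l"
    using assms(5) by eventually_elim (intro tendsto_intros)
  show "AE l in M. norm (h n l * K x l) \<le> w l * \<bar>C\<bar>" for n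
  proof (rule AE_I2)
    fix l assume l: "l \<in> space M"
    have "0 \<le> w l" using assms(4)[OF l, of 0] norm_ge_zero order_trans by blast
    thus "norm (h n l * K x l) \<le> w l * \<bar>C\<bar>" 
      unfolding norm_mult using assms(4)[OF l, of n] kernel_bound[OF l, of x] 
      by (intro mult_mono) auto
  qed
qed

lemma TS_measurable:
  assumes [measurable]: "f \<in> borel_measurable lborel"
  shows "TS f \<in> borel_measurable M"
proof -
  interpret sigma_finite_measure M by (rule sigma_finite)
  have [measurable]: "(\<lambda>(l, x). K x l) \<in> borel_measurable (M \<Otimes>\<^sub>M lborel)"
    using measurable_compose[OF measurable_pair_swap' kernel_measurable] by (simp add: case_prod_beta)
  show ?thesis unfolding TS_def[abs_def] by measurable
qed

lemma TS_integrand_integrable: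
  assumes "integrable lborel f" "l \<in> space M"
  shows "integrable lborel (\<lambda>x. f x * cnj (K x l))"
proof (rule Bochner_Integration.integrable_bound)
  show "integrable lborel (\<lambda>x. C * cmod (f x))" using assms by simp
  have "(\<lambda>x. K x l) \<in> borel_measurable lborel" 
    using measurable_Pair1[OF kernel_measurable assms(2)] by simp
  thus "(\<lambda>x. f x * cnj (K x l)) \<in> borel_measurable lborel" using assms
    by (intro borel_measurable_times borel_measurable_cnj) auto
  show "AE x in lborel. norm (f x * cnj (K x l)) \<le> norm (C * cmod (f x))"
  proof (rule AE_I2)
    fix x
    from kernel_bound[OF assms(2), of x] have "cmod (f x) * cmod (K x l) \<le> \<bar>C\<bar> * cmod (f x)"
      by (subst mult.commute) (intro mult_right_mono, auto)
    thus "norm (f x * cnj (K x l)) \<le> norm (C * cmod (f x))" by (simp add: norm_mult abs_mult)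
  qed
qed

lemma TS_bound:
  assumes "integrable lborel f" "l \<in> space M"
  shows "cmod (TS f l) \<le> C * (LINT x|lborel. cmod (f x))"
proof -
  have "cmod (TS f l) \<le> (LINT x|lborel. cmod (f x * cnj (K x l)))"
    unfolding TS_def by (rule integral_norm_bound)
  also have "\<dots> \<le> (LINT x|lborel. C * cmod (f x))"
  proof (intro integral_mono)
    show "cmod (f x * cnj (K x l)) \<le> C * cmod (f x)" for x
      using mult_right_mono[OF kernel_bound[OF assms(2), of x] norm_ge_zero[of "f x"]]
      by (simp add: norm_mult mult.commute)
  qed (use TS_integrand_integrable[OF assms] assms in auto)
  finally show ?thesis by simp
qed

lemma adjoint:
  assumes g: "integrable M g" and f: "integrable lborel f"
  shows "(LINT l|M. cnj (g l) * TS f l) = (LINT x|lborel. cnj (T g x) * f x)"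
proof -
  have k: "(\<lambda>(x, l). cnj (K x l)) \<in> borel_measurable (lborel \<Otimes>\<^sub>M M)"
    using borel_measurable_cnj[OF kernel_measurable] by (simp add: case_prod_beta)
  have "(LINT x|lborel. f x * (LINT l|M. cnj (g l) * cnj (K x l)))
      = (LINT l|M. cnj (g l) * (LINT x|lborel. f x * cnj (K x l)))"
    by (rule Fubini_bounded_kernel[OF lborel.sigma_finite_measure_axioms sigma_finite f _ k, where C=C])
       (use g kernel_bound in auto)
  moreover have "cnj (T g x) = (LINT l|M. cnj (g l) * cnj (K x l))" for x
    unfolding T_def by (subst Bochner_Integration.integral_cnj[symmetric]) simp
  ultimately show ?thesis by (simp add: TS_def mult.commute)
qed

end

lemma LIM_unique_at_top:
  fixes f :: "real \<Rightarrow> 'a::t2_space"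
  shows "(f \<longlongrightarrow> a) at_top \<Longrightarrow> (f \<longlongrightarrow> b) at_top \<Longrightarrow> a = b"
  by (rule tendsto_unique) auto

text \<open>Isometry is demanded on bounded functions of bounded support, where all integrals
  converge absolutely; the extension to the whole of L2 is derived from it.\<close>

locale isometric_kernel = bounded_kernel +
  assumes isometry: "h \<in> borel_measurable M \<Longrightarrow> (\<And>l. l \<in> space M \<Longrightarrow> cmod (h l) \<le> B) \<Longrightarrow>
    supp_in N h \<Longrightarrow> T h \<in> L2 lborel \<and> L2_norm lborel (T h) = L2_norm M h"
begin

text \<open>Cutting \<open>h\<close> at height n reaches the bounded case. Only the upper bound
  survives the pointwise limit; \<open>T_norm\<close> applies it to the remainder to get
  equality.\<close>

lemma T_contraction:
  assumes h: "h \<in> L2 M" and N: "supp_in N h"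
  shows "T h \<in> L2 lborel" and "L2_norm lborel (T h) \<le> L2_norm M h"
proof -
  note [measurable] = L2_measurable[OF h]
  define hn where "hn n l = h l * indicator {l\<in>space M. cmod (h l) \<le> real n} l" for n l
  have hn_m: "hn n \<in> borel_measurable M" for n unfolding hn_def by measurable
  have hn_le: "cmod (hn n l) \<le> cmod (h l)" for n l by (simp add: hn_def split: split_indicator)
  have hn_b: "cmod (hn n l) \<le> real n" for n l by (simp add: hn_def split: split_indicator)
  have hn_N: "supp_in N (hn n)" for n using N by (auto simp: supp_in_def hn_def)
  have hn_lim: "(\<lambda>n. hn n l) \<longlonglongrightarrow> h l" if "l \<in> space M" for l
  proof (rule tendsto_eventually)
    obtain k :: nat where "cmod (h l) \<le> real k" using real_arch_simple by blast
    thus "\<forall>\<^sub>F n in sequentially. hn n l = h l"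
      using that by (auto simp: hn_def eventually_sequentially split: split_indicator intro!: exI[of _ k])
  qed
  have iso: "T (hn n) \<in> L2 lborel \<and> L2_norm lborel (T (hn n)) = L2_norm M (hn n)" for n
    by (rule isometry[OF hn_m hn_b hn_N])
  have le: "L2_norm M (hn n) \<le> L2_norm M h" for n
    by (rule L2_norm_mono[OF hn_m h hn_le])
  have lim: "AE x in lborel. (\<lambda>n. T (hn n) x) \<longlonglongrightarrow> T h x"
    by (intro AE_I2 T_tendsto[where w="\<lambda>l. cmod (h l)"] hn_m hn_le AE_I2 hn_lim)
       (use integrable_supp[OF h N] in auto)
  have bd: "\<forall>\<^sub>F n in sequentially. L2_norm lborel (T (hn n)) \<le> L2_norm M h"
    by (intro always_eventually allI) (use iso le in simp)
  show "T h \<in> L2 lborel" and "L2_norm lborel (T h) \<le> L2_norm M h"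
    using L2_Fatou[OF conjunct1[OF iso] T_measurable[OF L2_measurable[OF h]] lim bd] by blast+
qed

lemma T_L2: "h \<in> L2 M \<Longrightarrow> supp_in N h \<Longrightarrow> T h \<in> L2 lborel"
  by (rule T_contraction)

lemma supp_in_lincomb: "supp_in N h \<Longrightarrow> supp_in N g \<Longrightarrow> supp_in N (\<lambda>l. h l + c * g l)"
  by (auto simp: supp_in_def)

text \<open>The part \<open>hR R - h\<close> discarded by the cut in height is small in norm, and by
  \<open>T_contraction\<close> so is its image; hence nothing is lost in the limit.\<close>

lemma T_norm:
  assumes h: "h \<in> L2 M" and N: "supp_in N h"
  shows "L2_norm lborel (T h) = L2_norm M h"
proof -
  note [measurable] = L2_measurable[OF h]
  define A where "A R = {l\<in>space M. cmod (h l) \<le> R}" for R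
  define hR where "hR R l = h l * indicator (A R) l" for R l
  have A[measurable]: "A R \<in> sets M" for R unfolding A_def by measurable
  have hR_L2: "hR R \<in> L2 M" for R unfolding hR_def[abs_def] by (rule L2_mult_indicator[OF h A])
  have hR_N: "supp_in N (hR R)" for R using N by (auto simp: supp_in_def hR_def)
  have hR_b: "cmod (hR R l) \<le> \<bar>R\<bar>" for R l by (auto simp: hR_def A_def split: split_indicator)
  have lim: "((\<lambda>R. L2_norm M (\<lambda>l. hR R l - h l)) \<longlongrightarrow> 0) at_top"
    unfolding hR_def
    by (rule L2_cut_tendsto[OF h A]) (auto simp: A_def intro: eventually_ge_at_top)
  have iso: "L2_norm lborel (T (hR R)) = L2_norm M (hR R)" for R
    using isometry[OF L2_measurable[OF hR_L2] hR_b hR_N] by simp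
  have "L2_norm M h - 2 * L2_norm M (\<lambda>l. hR R l - h l) \<le> L2_norm lborel (T h)" for R
  proof -
    have "L2_norm M h \<le> L2_norm M (hR R) + L2_norm M (\<lambda>l. hR R l - h l)"
      using L2_norm_triangle_diff[OF h hR_L2, of R] by (simp add: L2_norm_minus_commute)
    also have "L2_norm M (hR R) \<le> L2_norm lborel (T h) + L2_norm lborel (\<lambda>x. T (hR R) x - T h x)"
      unfolding iso[symmetric]
      by (rule L2_norm_triangle_diff[OF T_L2[OF hR_L2 hR_N] T_L2[OF h N]])
    also have "(\<lambda>x. T (hR R) x - T h x) = T (\<lambda>l. hR R l - h l)"
      using T_diff[OF integrable_supp[OF hR_L2 hR_N] integrable_supp[OF h N]] by auto
    also have "L2_norm lborel (T (\<lambda>l. hR R l - h l)) \<le> L2_norm M (\<lambda>l. hR R l - h l)"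
      using N hR_N by (intro T_contraction(2)[OF L2_diff[OF hR_L2 h], of N]) (auto simp: supp_in_def)
    finally show ?thesis by simp
  qed
  moreover have "((\<lambda>R. L2_norm M h - 2 * L2_norm M (\<lambda>l. hR R l - h l)) \<longlongrightarrow> L2_norm M h - 2 * 0) at_top"
    by (intro tendsto_intros lim)
  ultimately have "L2_norm M h - 2 * 0 \<le> L2_norm lborel (T h)"
    by (intro tendsto_upperbound[OF _ always_eventually]) auto
  thus ?thesis using T_contraction(2)[OF h N] by simp
qed

lemma T_inner:
  assumes h: "h \<in> L2 M" "supp_in N h" and g: "g \<in> L2 M" "supp_in N g"
  shows "(LINT x|lborel. cnj (T h x) * T g x) = (LINT l|M. cnj (h l) * g l)"
proof -
  have "L2_norm lborel (\<lambda>x. T h x + c * T g x) = L2_norm M (\<lambda>l. h l + c * g l)" for c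
    unfolding T_add_cmult[OF integrable_supp[OF h] integrable_supp[OF g], symmetric]
    by (intro T_norm[where N=N] L2_add L2_cmult h g supp_in_lincomb)
  from this[of 1] this[of "-1"] this[of \<i>] this[of "-\<i>"]
  have "4 * (LINT x|lborel. cnj (T h x) * T g x) = 4 * (LINT l|M. cnj (h l) * g l)"
    using L2_inner_polarization[OF T_L2[OF h] T_L2[OF g]] L2_inner_polarization[OF h(1) g(1)] by simp
  thus ?thesis by simp
qed

lemma supp_in_mono: "supp_in N h \<Longrightarrow> N \<le> N' \<Longrightarrow> supp_in N' h"
  by (auto simp: supp_in_def)

section \<open>Extension to L2 by limits in the mean\<close>

definition V :: "(real \<Rightarrow> complex) \<Rightarrow> real \<Rightarrow> complex" where
  "V h = L2_limit lborel (\<lambda>R. T (cut R h))"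

text \<open>\<open>T\<close> maps differences of cut-offs isometrically, so the images form a Cauchy
  family because the cut-offs do.\<close>

lemma V_limit:
  assumes h: "h \<in> L2 M"
  shows "is_L2_limit lborel (\<lambda>R. T (cut R h)) (V h)"
proof -
  have "\<exists>g. is_L2_limit lborel (\<lambda>R. T (cut R h)) g"
  proof (rule L2_complete)
    show "T (cut R h) \<in> L2 lborel" for R by (rule T_L2[OF cut_L2[OF h] cut_supp])
    fix e :: real assume e: "e > 0"
    have "\<forall>\<^sub>F R in at_top. L2_norm M (\<lambda>l. cut R h l - h l) < e / 2"
      using order_tendstoD(2)[OF cut_tendsto[OF h], of "e/2"] e by simp
    then obtain N where N: "\<And>R. R \<ge> N \<Longrightarrow> L2_norm M (\<lambda>l. cut R h l - h l) < e / 2"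
      by (auto simp: eventually_at_top_linorder)
    have "L2_norm lborel (\<lambda>x. T (cut R h) x - T (cut S h) x) < e" if "R \<ge> N" "S \<ge> N" for R S
    proof -
      have s: "supp_in (max R S) (\<lambda>l. cut R h l - cut S h l)"
        using cut_supp[of R h] cut_supp[of S h] by (auto simp: supp_in_def)
      have "(\<lambda>x. T (cut R h) x - T (cut S h) x) = T (\<lambda>l. cut R h l - cut S h l)"
        using T_diff[OF integrable_supp[OF cut_L2[OF h] cut_supp] integrable_supp[OF cut_L2[OF h] cut_supp]]
        by auto
      hence "L2_norm lborel (\<lambda>x. T (cut R h) x - T (cut S h) x) = L2_norm M (\<lambda>l. cut R h l - cut S h l)"
        using T_norm[OF L2_diff[OF cut_L2[OF h] cut_L2[OF h]] s] by simp
      also have "\<dots> \<le> L2_norm M (\<lambda>l. cut R h l - h l) + L2_norm M (\<lambda>l. cut S h l - h l)"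
        using L2_norm_triangle3[OF cut_L2[OF h] h cut_L2[OF h], of R S]
        by (simp add: L2_norm_minus_commute[of M h])
      finally show ?thesis using N[OF that(1)] N[OF that(2)] by linarith
    qed
    thus "\<exists>N. \<forall>R\<ge>N. \<forall>S\<ge>N. L2_norm lborel (\<lambda>x. T (cut R h) x - T (cut S h) x) < e" by blast
  qed
  thus ?thesis unfolding V_def using is_L2_limit_L2_limit by blast
qed

lemma V_L2: "h \<in> L2 M \<Longrightarrow> V h \<in> L2 lborel"
  using V_limit by (auto simp: is_L2_limit_def)

lemma V_norm:
  assumes h: "h \<in> L2 M"
  shows "L2_norm lborel (V h) = L2_norm M h"
proof (rule LIM_unique_at_top)
  show "((\<lambda>R. L2_norm lborel (T (cut R h))) \<longlongrightarrow> L2_norm lborel (V h)) at_top"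
    by (rule is_L2_limit_norm[OF V_limit[OF h]])
  have "is_L2_limit M (\<lambda>R. cut R h) h"
    using cut_tendsto[OF h] cut_L2[OF h] h by (simp add: is_L2_limit_def)
  from is_L2_limit_norm[OF this]
  show "((\<lambda>R. L2_norm lborel (T (cut R h))) \<longlongrightarrow> L2_norm M h) at_top"
    by (simp add: T_norm[OF cut_L2[OF h] cut_supp])
qed

lemma V_null:
  assumes "h \<in> L2 M" "AE l in M. h l = 0"
  shows "AE x in lborel. V h x = 0"
proof -
  have "L2_norm M h = L2_norm M (\<lambda>_. 0)"
    using assms L2_measurable by (intro L2_norm_cong_AE) auto
  thus ?thesis using V_norm[OF assms(1)] L2_norm_zero_AE[OF V_L2[OF assms(1)]] by simp
qed

text \<open>Duality: with u = \<open>TS f\<close> cut to [-n, n], the adjoint relation gives ||u||^2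
  = <u, TS f> = <T u, f> \<le> ||u|| ||f||. Fatou's lemma removes the cut.\<close>

lemma TS_contraction:
  assumes f: "f \<in> L2 lborel" "integrable lborel f"
  shows "TS f \<in> L2 M" and "L2_norm M (TS f) \<le> L2_norm lborel f"
proof -
  define u where "u n = cut (real n) (TS f)" for n :: nat
  have TSm: "TS f \<in> borel_measurable M" using TS_measurable f by auto
  have um: "u n \<in> borel_measurable M" for n unfolding u_def by (rule cut_measurable[OF TSm])
  define B where "B = \<bar>C * (LINT x|lborel. cmod (f x))\<bar>"
  have B: "cmod (TS f l) \<le> B" if "l \<in> space M" for l
    using TS_bound[OF f(2) that] by (simp add: B_def)
  have ub: "cmod (u n l) \<le> B" if "l \<in> space M" for n l
    using B[OF that] by (simp add: u_def cut_def B_def split: split_indicator)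
  \<comment> \<open>Square integrability of \<open>u n\<close> cannot be inherited from
    \<open>TS f\<close>, where it is the claim; it comes from the pointwise bound \<open>B\<close>
    on a set of finite measure.\<close>
  have uL: "u n \<in> L2 M" for n
  proof (rule L2_dominated[OF um])
    have "integrable M (indicator ({-real n..real n} \<inter> space M) :: real \<Rightarrow> real)"
      using finite_bounded[of "real n"] interval_sets by (intro integrable_real_indicator) auto
    thus "integrable M (\<lambda>l. B\<^sup>2 * indicator ({-real n..real n} \<inter> space M) l)" by simp
    show "(cmod (u n l))\<^sup>2 \<le> B\<^sup>2 * indicator ({-real n..real n} \<inter> space M) l" if "l \<in> space M" for l
      using B[OF that] that by (auto simp: u_def cut_def split: split_indicator intro!: power_mono)
  qed
  have us: "supp_in (real n) (u n)" for n unfolding u_def by (rule cut_supp)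
  have le: "L2_norm M (u n) \<le> L2_norm lborel f" for n
  proof -
    have "complex_of_real ((L2_norm M (u n))\<^sup>2) = (LINT l|M. complex_of_real ((cmod (u n l))\<^sup>2))"
      unfolding L2_norm_sq by (rule integral_of_real[OF L2_integrable_sq[OF uL], symmetric])
    also have "\<dots> = (LINT l|M. cnj (u n l) * TS f l)"
      unfolding complex_norm_square
      by (intro Bochner_Integration.integral_cong) (auto simp: u_def cut_def split: split_indicator)
    also have "\<dots> = (LINT x|lborel. cnj (T (u n) x) * f x)"
      by (rule adjoint[OF integrable_supp[OF uL us] f(2)])
    finally have "(L2_norm M (u n))\<^sup>2 = cmod (LINT x|lborel. cnj (T (u n) x) * f x)"
      by (metis abs_power2 norm_of_real)
    also have "\<dots> \<le> L2_norm lborel (T (u n)) * L2_norm lborel f"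
      by (rule L2_Cauchy_Schwarz[OF T_L2[OF uL us] f(1)])
    finally have "L2_norm M (u n) * L2_norm M (u n) \<le> L2_norm M (u n) * L2_norm lborel f"
      by (simp add: T_norm[OF uL us] power2_eq_square)
    thus ?thesis
      using L2_norm_nonneg[of M "u n"] L2_norm_nonneg[of lborel f]
      by (cases "L2_norm M (u n) = 0") (auto simp: mult_le_cancel_left)
  qed
  have lim: "AE l in M. (\<lambda>n. u n l) \<longlonglongrightarrow> TS f l"
  proof (rule AE_I2)
    fix l
    obtain k :: nat where "\<bar>l\<bar> \<le> real k" using real_arch_simple by blast
    hence "u n l = TS f l" if "n \<ge> k" for n
      using that by (auto simp: u_def cut_def split: split_indicator)
    hence "\<forall>\<^sub>F n in sequentially. u n l = TS f l" by (auto simp: eventually_sequentially)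
    thus "(\<lambda>n. u n l) \<longlonglongrightarrow> TS f l" by (rule tendsto_eventually)
  qed
  have bd: "\<forall>\<^sub>F n in sequentially. L2_norm M (u n) \<le> L2_norm lborel f"
    by (intro always_eventually allI le)
  show "TS f \<in> L2 M" and "L2_norm M (TS f) \<le> L2_norm lborel f"
    using L2_Fatou[OF uL TSm lim bd] by blast+
qed

definition trunc :: "real \<Rightarrow> (real \<Rightarrow> complex) \<Rightarrow> real \<Rightarrow> complex" where
  "trunc R f x = f x * indicator {-R..R} x"

lemma trunc_L2: "f \<in> L2 lborel \<Longrightarrow> trunc R f \<in> L2 lborel"
  unfolding trunc_def[abs_def] by (rule L2_mult_indicator) auto

lemma trunc_limit: "f \<in> L2 lborel \<Longrightarrow> is_L2_limit lborel (\<lambda>R. trunc R f) f"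
  unfolding is_L2_limit_def
proof (intro conjI always_eventually allI trunc_L2)
  assume f: "f \<in> L2 lborel"
  show "((\<lambda>R. L2_norm lborel (\<lambda>x. trunc R f x - f x)) \<longlongrightarrow> 0) at_top"
    unfolding trunc_def
  proof (rule L2_cut_tendsto[OF f])
    fix x :: real show "\<forall>\<^sub>F R in at_top. x \<in> {-R..R}"
      using eventually_ge_at_top[of "\<bar>x\<bar>"] by eventually_elim auto
  qed auto
qed

lemma trunc_integrable:
  assumes f: "f \<in> L2 lborel"
  shows "integrable lborel (trunc R f)"
proof (rule Bochner_Integration.integrable_bound)
  show "integrable lborel (\<lambda>x. (cmod (f x))\<^sup>2 + indicator {-R..R} x)"
    using emeasure_compact_finite[of "{-R..R}"]
    by (intro Bochner_Integration.integrable_add L2_integrable_sq[OF f] integrable_real_indicator) auto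
  show "trunc R f \<in> borel_measurable lborel" by (rule L2_measurable[OF trunc_L2[OF f]])
  have "cmod a \<le> (cmod a)\<^sup>2 + 1" for a
  proof -
    have "2 * cmod a \<le> (cmod a)\<^sup>2 + 1" using sum_squares_bound[of "cmod a" 1] by simp
    thus ?thesis using norm_ge_zero[of a] by linarith
  qed
  thus "AE x in lborel. norm (trunc R f x) \<le> norm ((cmod (f x))\<^sup>2 + indicator {-R..R} x)"
    by (intro AE_I2) (auto simp: trunc_def split: split_indicator)
qed

definition W :: "(real \<Rightarrow> complex) \<Rightarrow> real \<Rightarrow> complex" where
  "W f = L2_limit M (\<lambda>R. TS (trunc R f))"

lemma TS_diff:
  assumes "integrable lborel f" "integrable lborel g" "l \<in> space M"
  shows "TS (\<lambda>x. f x - g x) l = TS f l - TS g l"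
  using TS_integrand_integrable[OF assms(1,3)] TS_integrand_integrable[OF assms(2,3)]
  by (simp add: TS_def left_diff_distrib)

lemma W_limit:
  assumes f: "f \<in> L2 lborel"
  shows "is_L2_limit M (\<lambda>R. TS (trunc R f)) (W f)"
proof -
  have "\<exists>g. is_L2_limit M (\<lambda>R. TS (trunc R f)) g"
  proof (rule L2_complete)
    show "TS (trunc R f) \<in> L2 M" for R
      by (rule TS_contraction[OF trunc_L2[OF f] trunc_integrable[OF f]])
    fix e :: real assume e: "e > 0"
    have "\<forall>\<^sub>F R in at_top. L2_norm lborel (\<lambda>x. trunc R f x - f x) < e / 2"
      using trunc_limit[OF f] e unfolding is_L2_limit_def by (auto dest: order_tendstoD(2)[of _ _ _ "e/2"])
    then obtain N where N: "\<And>R. R \<ge> N \<Longrightarrow> L2_norm lborel (\<lambda>x. trunc R f x - f x) < e / 2"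
      by (auto simp: eventually_at_top_linorder)
    have "L2_norm M (\<lambda>l. TS (trunc R f) l - TS (trunc S f) l) < e" if "R \<ge> N" "S \<ge> N" for R S
    proof -
      have "L2_norm M (\<lambda>l. TS (trunc R f) l - TS (trunc S f) l)
          = L2_norm M (TS (\<lambda>x. trunc R f x - trunc S f x))"
        unfolding L2_norm_def
        by (intro arg_cong[where f=sqrt] Bochner_Integration.integral_cong)
           (simp_all add: TS_diff[OF trunc_integrable[OF f] trunc_integrable[OF f]])
      also have "\<dots> \<le> L2_norm lborel (\<lambda>x. trunc R f x - trunc S f x)"
        by (intro TS_contraction L2_diff trunc_L2 f Bochner_Integration.integrable_diff trunc_integrable)
      also have "\<dots> \<le> L2_norm lborel (\<lambda>x. trunc R f x - f x) + L2_norm lborel (\<lambda>x. trunc S f x - f x)"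
        using L2_norm_triangle3[OF trunc_L2[OF f] f trunc_L2[OF f], of R S]
        by (simp add: L2_norm_minus_commute[of lborel f])
      finally show ?thesis using N[OF that(1)] N[OF that(2)] by linarith
    qed
    thus "\<exists>N. \<forall>R\<ge>N. \<forall>S\<ge>N. L2_norm M (\<lambda>l. TS (trunc R f) l - TS (trunc S f) l) < e" by blast
  qed
  thus ?thesis unfolding W_def using is_L2_limit_L2_limit by blast
qed

lemma W_L2: "f \<in> L2 lborel \<Longrightarrow> W f \<in> L2 M"
  using W_limit by (auto simp: is_L2_limit_def)

text \<open>Ties the limit in the mean to the absolutely convergent integral, the form in which
  kernel estimates can be used.\<close>

lemma W_integrable:
  assumes f: "f \<in> L2 lborel" "integrable lborel f"
  shows "AE l in M. W f l = TS f l"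
proof (rule is_L2_limit_pointwise_AE[OF W_limit[OF f(1)]])
  show "TS f \<in> borel_measurable M" using TS_measurable f by auto
  show "AE l in M. (\<lambda>n. TS (trunc (real n) f) l) \<longlonglongrightarrow> TS f l"
  proof (rule AE_I2)
    fix l assume l: "l \<in> space M"
    note I = TS_integrand_integrable[OF f(2) l]
    show "(\<lambda>n. TS (trunc (real n) f) l) \<longlonglongrightarrow> TS f l"
      unfolding TS_def
    proof (rule integral_dominated_convergence[where w="\<lambda>x. cmod (f x * cnj (K x l))"])
      show "AE x in lborel. (\<lambda>n. trunc (real n) f x * cnj (K x l)) \<longlonglongrightarrow> f x * cnj (K x l)"
      proof (rule AE_I2)
        fix x :: real
        obtain k :: nat where "\<bar>x\<bar> \<le> real k" using real_arch_simple by blast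
        hence "\<forall>\<^sub>F n in sequentially. trunc (real n) f x * cnj (K x l) = f x * cnj (K x l)"
          by (auto simp: trunc_def eventually_sequentially split: split_indicator intro!: exI[of _ k])
        thus "(\<lambda>n. trunc (real n) f x * cnj (K x l)) \<longlonglongrightarrow> f x * cnj (K x l)"
          by (rule tendsto_eventually)
      qed
      show "(\<lambda>x. trunc (real n) f x * cnj (K x l)) \<in> borel_measurable lborel" for n
        using TS_integrand_integrable[OF trunc_integrable[OF f(1)] l] by auto
      show "AE x in lborel. norm (trunc (real n) f x * cnj (K x l)) \<le> cmod (f x * cnj (K x l))" for n
        by (intro AE_I2) (simp add: trunc_def split: split_indicator)
    qed (use I in auto)
  qed
qed

lemma W_adjoint:
  assumes f: "f \<in> L2 lborel" and h: "h \<in> L2 M" "supp_in N h"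
  shows "(LINT l|M. cnj (h l) * W f l) = (LINT x|lborel. cnj (T h x) * f x)"
proof (rule LIM_unique_at_top)
  show "((\<lambda>R. LINT l|M. cnj (h l) * TS (trunc R f) l) \<longlongrightarrow> (LINT l|M. cnj (h l) * W f l)) at_top"
    by (rule is_L2_limit_inner[OF W_limit[OF f] h(1)])
  show "((\<lambda>R. LINT l|M. cnj (h l) * TS (trunc R f) l) \<longlongrightarrow> (LINT x|lborel. cnj (T h x) * f x)) at_top"
    unfolding adjoint[OF integrable_supp[OF h] trunc_integrable[OF f]]
    by (rule is_L2_limit_inner[OF trunc_limit[OF f] T_L2[OF h]])
qed

text \<open>Testing against \<open>d\<close> cut to [-N, N] gives the squared norm of that
  cut.\<close>

lemma L2_eqI_test:
  assumes d: "d \<in> L2 M" and test: "\<And>N h. h \<in> L2 M \<Longrightarrow> supp_in N h \<Longrightarrow> (LINT l|M. cnj (h l) * d l) = 0"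
  shows "AE l in M. d l = 0"
proof -
  have "L2_norm M (cut N d) = 0" for N
  proof -
    have "complex_of_real ((L2_norm M (cut N d))\<^sup>2) = (LINT l|M. complex_of_real ((cmod (cut N d l))\<^sup>2))"
      unfolding L2_norm_sq by (rule integral_of_real[OF L2_integrable_sq[OF cut_L2[OF d]], symmetric])
    also have "\<dots> = (LINT l|M. cnj (cut N d l) * d l)"
      unfolding complex_norm_square
      by (intro Bochner_Integration.integral_cong) (auto simp: cut_def split: split_indicator)
    also have "\<dots> = 0" by (rule test[OF cut_L2[OF d] cut_supp])
    finally show ?thesis by simp
  qed
  moreover have "is_L2_limit M (\<lambda>R. cut R d) d"
    using cut_tendsto[OF d] cut_L2[OF d] d by (simp add: is_L2_limit_def)
  ultimately have "((\<lambda>R::real. 0) \<longlongrightarrow> L2_norm M d) at_top" using is_L2_limit_norm[of M "\<lambda>R. cut R d" d] by simp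
  hence "L2_norm M d = 0" using tendsto_const LIM_unique_at_top by blast
  thus ?thesis by (rule L2_norm_zero_AE[OF d])
qed

text \<open>\<open>V\<close> is isometric, so its adjoint \<open>W\<close> inverts it on the left.
  The adjoint relation is available for test functions of bounded support, and
  \<open>T_inner\<close> is applied after enlarging both supports to \<open>max N R\<close>.\<close>

lemma W_V:
  assumes h: "h \<in> L2 M"
  shows "AE l in M. W (V h) l = h l"
proof -
  have "AE l in M. W (V h) l - h l = 0"
  proof (rule L2_eqI_test[OF L2_diff[OF W_L2[OF V_L2[OF h]] h]])
    fix N \<phi> assume \<phi>: "\<phi> \<in> L2 M" "supp_in N \<phi>"
    have "(LINT l|M. cnj (\<phi> l) * W (V h) l) = (LINT x|lborel. cnj (T \<phi> x) * V h x)"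
      by (rule W_adjoint[OF V_L2[OF h] \<phi>])
    also have "\<dots> = (LINT l|M. cnj (\<phi> l) * h l)"
    proof (rule LIM_unique_at_top)
      show "((\<lambda>R. LINT x|lborel. cnj (T \<phi> x) * T (cut R h) x) \<longlongrightarrow> (LINT x|lborel. cnj (T \<phi> x) * V h x)) at_top"
        by (rule is_L2_limit_inner[OF V_limit[OF h] T_L2[OF \<phi>]])
      have "is_L2_limit M (\<lambda>R. cut R h) h"
        using cut_tendsto[OF h] cut_L2[OF h] h by (simp add: is_L2_limit_def)
      from is_L2_limit_inner[OF this \<phi>(1)]
      have "((\<lambda>R. LINT l|M. cnj (\<phi> l) * cut R h l) \<longlongrightarrow> (LINT l|M. cnj (\<phi> l) * h l)) at_top" .
      moreover have "(LINT x|lborel. cnj (T \<phi> x) * T (cut R h) x) = (LINT l|M. cnj (\<phi> l) * cut R h l)" for R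
        by (rule T_inner[OF \<phi>(1) supp_in_mono[OF \<phi>(2)] cut_L2[OF h] supp_in_mono[OF cut_supp], of "max N R"]) auto
      ultimately show "((\<lambda>R. LINT x|lborel. cnj (T \<phi> x) * T (cut R h) x) \<longlongrightarrow> (LINT l|M. cnj (\<phi> l) * h l)) at_top"
        by simp
    qed
    finally show "(LINT l|M. cnj (\<phi> l) * (W (V h) l - h l)) = 0"
      using L2_cnj_mult_integrable[OF \<phi>(1) W_L2[OF V_L2[OF h]]] L2_cnj_mult_integrable[OF \<phi>(1) h]
      by (simp add: right_diff_distrib)
  qed
  thus ?thesis by eventually_elim simp
qed

text \<open>Formulated with the approximants \<open>F R\<close>, because orthogonality of two ranges
  becomes known at the level of \<open>T\<close> on bounded supports.\<close>

lemma W_orthogonal: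
  assumes g: "g \<in> L2 lborel" and R: "is_L2_limit lborel F g"
    and orth: "\<And>N \<phi> R. \<phi> \<in> L2 M \<Longrightarrow> supp_in N \<phi> \<Longrightarrow> (LINT x|lborel. cnj (T \<phi> x) * F R x) = 0"
  shows "AE l in M. W g l = 0"
proof (rule L2_eqI_test[OF W_L2[OF g]])
  fix N \<phi> assume \<phi>: "\<phi> \<in> L2 M" "supp_in N \<phi>"
  from is_L2_limit_inner[OF R T_L2[OF \<phi>]]
  have "((\<lambda>R::real. 0) \<longlongrightarrow> (LINT x|lborel. cnj (T \<phi> x) * g x)) at_top" by (simp add: orth[OF \<phi>])
  hence "(LINT x|lborel. cnj (T \<phi> x) * g x) = 0" using tendsto_const LIM_unique_at_top by blast
  thus "(LINT l|M. cnj (\<phi> l) * W g l) = 0" using W_adjoint[OF g \<phi>] by simp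
qed

end

section \<open>The coefficients of the two-soliton eigenfunctions\<close>

text \<open>The values at i\<rho> and -i\<rho> separate even and odd parts:
  \<open>p0 = p2 * \<rho>^2\<close> and \<open>p1 = p3 * \<rho>^2\<close>. Two different values of
  \<rho>^2 leave only zero.\<close>

lemma cubic_two_root_pairs:
  fixes p0 p1 p2 p3 :: complex and r s :: real
  assumes rs: "0 < r" "r < s"
    and z: "\<And>\<rho>. \<rho> \<in> {r, s, -r, -s} \<Longrightarrow>
       p3 * (\<i> * of_real \<rho>) ^ 3 + p2 * (\<i> * of_real \<rho>)\<^sup>2 + p1 * (\<i> * of_real \<rho>) + p0 = 0"
  shows "p3 = 0" "p2 = 0" "p1 = 0" "p0 = 0"
proof -
  have i3: "\<i> ^ 3 = - \<i>" by (simp add: power3_eq_cube)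
  have e: "p0 = p2 * of_real (\<rho>\<^sup>2) \<and> p1 = p3 * of_real (\<rho>\<^sup>2)" if "\<rho> \<in> {r, s}" for \<rho>
  proof -
    have \<rho>: "\<rho> > 0" using that rs by auto
    have m: "- \<rho> \<in> {r, s, -r, -s}" "\<rho> \<in> {r, s, -r, -s}" using that by auto
    from z[OF m(2)] z[OF m(1)]
    have 1: "- \<i> * p3 * of_real \<rho> ^ 3 - p2 * of_real \<rho> ^ 2 + p1 * \<i> * of_real \<rho> + p0 = 0"
     and 2: "\<i> * p3 * of_real \<rho> ^ 3 - p2 * of_real \<rho> ^ 2 - p1 * \<i> * of_real \<rho> + p0 = 0"
      by (simp_all add: power_mult_distrib i3 algebra_simps)
    have a: "2 * (p0 - p2 * of_real \<rho> ^ 2) = 0" using 1 2 by algebra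
    have b: "(2 * \<i> * of_real \<rho>) * (p1 - p3 * of_real \<rho> ^ 2) = 0" using 1 2 by algebra
    show ?thesis using a b \<rho> by simp
  qed
  have ne: "complex_of_real (s\<^sup>2) \<noteq> of_real (r\<^sup>2)"
    unfolding of_real_eq_iff using rs power_strict_mono[of r s 2] by simp
  have "p2 * (of_real (s\<^sup>2) - of_real (r\<^sup>2)) = 0" "p3 * (of_real (s\<^sup>2) - of_real (r\<^sup>2)) = 0"
    using e[of r] e[of s] by (simp_all add: right_diff_distrib)
  thus p: "p2 = 0" "p3 = 0" using ne by (simp_all only: mult_eq_0_iff right_minus_eq, simp_all)
  show "p1 = 0" "p0 = 0" using e[of r] p by simp_all
qed

text \<open>\<open>E\<close> and \<open>g\<close> drop out. Applied to a polynomial and its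
  conjugate, this cancellation is the common source of uniqueness and of
  \<open>unitarity\<close>.\<close>

lemma paired_relation_null:
  fixes U Us V Vs g E :: complex
  assumes "U * E = g * V" "Vs = - g * Us / E" "E \<noteq> 0"
  shows "U * Us + V * Vs = 0"
proof -
  have U: "U = g * V / E" using assms by (simp add: field_simps)
  show ?thesis unfolding U assms(2) by simp
qed

text \<open>Write u^c, v^c for the polynomials with conjugated coefficients. Then u u^c + v v^c has
  degree at most two and vanishes at all four points, hence is zero; its leading and constant
  coefficients are |u1|^2 + |v1|^2 and |u0|^2 + |v0|^2. The lemma serves for uniqueness of the
  solution and again for the derivatives of the coefficients.\<close>

lemma paired_relation_homogeneous:
  fixes u0 u1 v0 v1 :: complex and E :: "nat \<Rightarrow> real" and g :: "nat \<Rightarrow> complex" and r :: "nat \<Rightarrow> real"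
  assumes r: "0 < r 1" "r 1 < r 2" and E: "\<And>k. E k > 0"
    and 1: "\<And>k. k \<in> {1, 2} \<Longrightarrow> (u1 * (\<i> * r k) + u0) * E k = cnj (g k) * (v1 * (\<i> * r k) + v0)"
    and 2: "\<And>k. k \<in> {1, 2} \<Longrightarrow> v1 * (- \<i> * r k) + v0 = - g k * (u1 * (- \<i> * r k) + u0) / E k"
  shows "u0 = 0 \<and> u1 = 0 \<and> v0 = 0 \<and> v1 = 0"
proof -
  define p2 where "p2 = u1 * cnj u1 + v1 * cnj v1"
  define p1 where "p1 = u1 * cnj u0 + u0 * cnj u1 + v1 * cnj v0 + v0 * cnj v1"
  define p0 where "p0 = u0 * cnj u0 + v0 * cnj v0"
  have poly: "p2 * z\<^sup>2 + p1 * z + p0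
     = (u1 * z + u0) * (cnj u1 * z + cnj u0) + (v1 * z + v0) * (cnj v1 * z + cnj v0)" for z
    by (simp add: p0_def p1_def p2_def power2_eq_square algebra_simps)
  have a: "p2 * (\<i> * r k)\<^sup>2 + p1 * (\<i> * r k) + p0 = 0" if k: "k \<in> {1, 2}" for k
    unfolding poly
  proof (rule paired_relation_null[OF 1[OF k]])
    show "cnj v1 * (\<i> * r k) + cnj v0 = - cnj (g k) * (cnj u1 * (\<i> * r k) + cnj u0) / E k"
      using arg_cong[OF 2[OF k], of cnj] by (simp add: add.commute)
  qed (use E[of k] in simp)
  have b: "p2 * (- \<i> * r k)\<^sup>2 + p1 * (- \<i> * r k) + p0 = 0" if k: "k \<in> {1, 2}" for k
  proof -
    have "(cnj u1 * (- \<i> * r k) + cnj u0) * (u1 * (- \<i> * r k) + u0)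
        + (cnj v1 * (- \<i> * r k) + cnj v0) * (v1 * (- \<i> * r k) + v0) = 0"
    proof (rule paired_relation_null[OF _ 2[OF k]])
      show "(cnj u1 * (- \<i> * r k) + cnj u0) * E k = g k * (cnj v1 * (- \<i> * r k) + cnj v0)"
        using arg_cong[OF 1[OF k], of cnj] by simp
    qed (use E[of k] in simp)
    thus ?thesis unfolding poly by (simp add: mult.commute)
  qed
  have "0 * (\<i> * of_real s) ^ 3 + p2 * (\<i> * of_real s)\<^sup>2 + p1 * (\<i> * of_real s) + p0 = 0"
    if "s \<in> {r 1, r 2, - r 1, - r 2}" for s
    using that a[of 1] a[of 2] b[of 1] b[of 2] by auto
  from cubic_two_root_pairs[OF r this] have "p2 = 0" "p0 = 0" by auto
  moreover have "p2 = of_real ((cmod u1)\<^sup>2 + (cmod v1)\<^sup>2)" "p0 = of_real ((cmod u0)\<^sup>2 + (cmod v0)\<^sup>2)"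
    unfolding p2_def p0_def of_real_add complex_norm_square by simp_all
  ultimately have "(cmod u1)\<^sup>2 + (cmod v1)\<^sup>2 = 0" "(cmod u0)\<^sup>2 + (cmod v0)\<^sup>2 = 0"
    by (simp_all only: of_real_eq_0_iff)
  thus ?thesis by (simp add: sum_power2_eq_zero_iff)
qed

locale soliton =
  fixes \<rho> \<theta> :: "nat \<Rightarrow> real"
  assumes \<rho>_pos: "0 < \<rho> 1" and \<rho>_less: "\<rho> 1 < \<rho> 2"
begin

definition g :: "nat \<Rightarrow> complex" where "g k = exp (\<i> * complex_of_real (\<theta> k))"

lemma g_unit: "cnj (g k) * g k = 1" "g k * cnj (g k) = 1" "cmod (g k) = 1"
  by (simp_all add: g_def exp_cnj flip: exp_add)

definition E :: "nat \<Rightarrow> real \<Rightarrow> real" where "E k x = exp (2 * \<rho> k * x)"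

lemma E_pos: "E k x > 0" by (simp add: E_def)

lemma soliton_system_iff:
  "soliton_system \<rho> \<theta> x (a0, a1, b0, b1) \<longleftrightarrow> (\<forall>k\<in>{1, 2}.
     ((\<i> * \<rho> k)\<^sup>2 + a1 * (\<i> * \<rho> k) + a0) * E k x = cnj (g k) * (b1 * (\<i> * \<rho> k) + b0) \<and>
     b1 * (- \<i> * \<rho> k) + b0 = - g k * ((- \<i> * \<rho> k)\<^sup>2 + a1 * (- \<i> * \<rho> k) + a0) / E k x)"
proof -
  have e: "- 2 * \<i> * (\<i> * complex_of_real (\<rho> k)) * complex_of_real x = of_real (2 * \<rho> k * x)"
    "- 2 * \<i> * cnj (\<i> * complex_of_real (\<rho> k)) * complex_of_real x = of_real (- (2 * \<rho> k * x))" for k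
    by (simp_all add: complex_eq_iff)
  have "exp (- 2 * \<i> * (\<i> * complex_of_real (\<rho> k)) * complex_of_real x) = of_real (E k x)" for k
    unfolding e exp_of_real by (simp add: E_def)
  moreover have "exp (- 2 * \<i> * cnj (\<i> * complex_of_real (\<rho> k)) * complex_of_real x) = inverse (of_real (E k x))" for k
    unfolding e exp_of_real by (simp add: E_def exp_minus)
  ultimately show ?thesis
    unfolding soliton_system_def Let_def g_def[symmetric] split
    by (simp only: divide_inverse) simp
qed

lemma soliton_system_unique:
  assumes "soliton_system \<rho> \<theta> x c" "soliton_system \<rho> \<theta> x d"
  shows "c = d"
proof -
  obtain a0 a1 b0 b1 where c: "c = (a0, a1, b0, b1)" by (cases c)
  obtain c0 c1 d0 d1 where d: "d = (c0, c1, d0, d1)" by (cases d)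
  have "a0 - c0 = 0 \<and> a1 - c1 = 0 \<and> b0 - d0 = 0 \<and> b1 - d1 = 0"
  proof (rule paired_relation_homogeneous[OF \<rho>_pos \<rho>_less, where E="\<lambda>k. E k x" and g=g])
    show "E k x > 0" for k by (rule E_pos)
    fix k :: nat assume k: "k \<in> {1, 2}"
    note 1 = assms(1)[unfolded c soliton_system_iff, rule_format, OF k]
    note 2 = assms(2)[unfolded d soliton_system_iff, rule_format, OF k]
    show "((a1 - c1) * (\<i> * \<rho> k) + (a0 - c0)) * E k x = cnj (g k) * ((b1 - d1) * (\<i> * \<rho> k) + (b0 - d0))"
      using arg_cong2[OF conjunct1[OF 1] conjunct1[OF 2], of minus] by (simp add: algebra_simps)
    show "(b1 - d1) * (- \<i> * \<rho> k) + (b0 - d0) = - g k * ((a1 - c1) * (- \<i> * \<rho> k) + (a0 - c0)) / E k x"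
      using arg_cong2[OF conjunct2[OF 1] conjunct2[OF 2], of minus]
      by (simp add: algebra_simps diff_divide_distrib add_divide_distrib)
  qed
  thus ?thesis by (simp add: c d)
qed

text \<open>Writing $A(i\rho_k) = (\rho_1 - \rho_2) q_k$ and eliminating $b_0$, $b_1$ through
  $B(i\rho_k) = g_k e^{2\rho_k x} A(i\rho_k)$ leaves a $2\times2$ system for $q_1$, $q_2$. It is
  solved here with the complex variable \<open>z\<close> in place of \<open>x\<close>, so that complex differentiation
  rules apply.\<close>

definition Ez :: "nat \<Rightarrow> complex \<Rightarrow> complex" where "Ez k z = g k * exp (complex_of_real (2 * \<rho> k) * z)"
definition Fz :: "nat \<Rightarrow> complex \<Rightarrow> complex" where "Fz k z = g k * exp (- (complex_of_real (2 * \<rho> k) * z))"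
definition S :: real where "S = \<rho> 1 + \<rho> 2"

text \<open>Determinant of the linear system in \<open>q_equations\<close>; \<open>q1\<close> and
  \<open>q2\<close> are its solution by Cramer's rule.\<close>

definition Det :: "complex \<Rightarrow> complex" where
  "Det z = 4 * \<rho> 1 * \<rho> 2 * (Ez 2 z + Fz 1 z) * (Ez 1 z + Fz 2 z) - S\<^sup>2 * (Ez 1 z + Fz 1 z) * (Ez 2 z + Fz 2 z)"

definition q1 :: "complex \<Rightarrow> complex" where
  "q1 z = (2 * \<rho> 1 * S\<^sup>2 * Fz 1 z * (Ez 2 z + Fz 2 z) - 4 * \<rho> 1 * \<rho> 2 * S * Fz 2 z * (Ez 2 z + Fz 1 z)) / Det z"

definition q2 :: "complex \<Rightarrow> complex" where
  "q2 z = (4 * \<rho> 1 * \<rho> 2 * S * Fz 1 z * (Ez 1 z + Fz 2 z) - 2 * \<rho> 2 * S\<^sup>2 * Fz 2 z * (Ez 1 z + Fz 1 z)) / Det z"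

text \<open>Lagrange interpolation: to (z - i\<rho>_1)(z - i\<rho>_2) is added the linear polynomial
  with values (\<rho>_1 - \<rho>_2) q_k at i\<rho>_k. In the same way \<open>b0z\<close> and
  \<open>b1z\<close> interpolate the values (\<rho>_1 - \<rho>_2) \<open>Ez k\<close> q_k.\<close>

definition a0z :: "complex \<Rightarrow> complex" where "a0z z = - \<rho> 1 * \<rho> 2 - \<rho> 2 * q1 z + \<rho> 1 * q2 z"
definition a1z :: "complex \<Rightarrow> complex" where "a1z z = - \<i> * S - \<i> * (q1 z - q2 z)"
definition b0z :: "complex \<Rightarrow> complex" where "b0z z = - \<rho> 2 * Ez 1 z * q1 z + \<rho> 1 * Ez 2 z * q2 z"
definition b1z :: "complex \<Rightarrow> complex" where "b1z z = - \<i> * (Ez 1 z * q1 z - Ez 2 z * q2 z)"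

lemma exp_plus_exp_minus_ge: "exp y + exp (- y) \<ge> (2::real)"
  using exp_ge_add_one_self[of y] exp_ge_add_one_self[of "-y"] by linarith

lemma determinant_identity:
  fixes e1 e2 f1 f2 :: complex
  assumes "e1 * e2 = c * ep" "e1 * f2 = c * dp" "f1 * e2 = c * dm" "f1 * f2 = c * em"
    "e1 * f1 = h1" "e2 * f2 = h2" "d = s - r"
  shows "r * (e2 + f1) * (e1 + f2) - s * (e1 + f1) * (e2 + f2)
    = - (c * (d * (ep + em) + s * (dp + dm))) + r * (h1 + h2)"
  using assms by algebra

text \<open>Up to a unimodular factor the main term \<open>X\<close> is a combination of hyperbolic
  cosines, at least 2 D^2 + 2 S^2, while the rest is at most 8 \<rho>_1 \<rho>_2 in modulus. The gap
  is 4 (\<rho>_2 - \<rho>_1)^2 > 0.\<close>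

lemma Det_nonzero: "Det (of_real x) \<noteq> 0"
proof -
  define D where "D = \<rho> 1 - \<rho> 2"
  define X where "X = D\<^sup>2 * (exp (2 * S * x) + exp (- (2 * S * x))) + S\<^sup>2 * (exp (2 * D * x) + exp (- (2 * D * x)))"
  have EE: "Ez 1 (of_real x) * Ez 2 (of_real x) = g 1 * g 2 * of_real (exp (2 * S * x))"
    "Ez 1 (of_real x) * Fz 2 (of_real x) = g 1 * g 2 * of_real (exp (2 * D * x))"
    "Fz 1 (of_real x) * Ez 2 (of_real x) = g 1 * g 2 * of_real (exp (- (2 * D * x)))"
    "Fz 1 (of_real x) * Fz 2 (of_real x) = g 1 * g 2 * of_real (exp (- (2 * S * x)))"
    unfolding Ez_def Fz_def exp_of_real[symmetric] mult_exp_exp D_def S_def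
    by (simp_all add: exp_add[symmetric] algebra_simps flip: mult_exp_exp)
       (simp_all add: exp_add exp_diff exp_minus field_simps)
  have EF: "Ez k (of_real x) * Fz k (of_real x) = g k * g k" for k
    by (simp add: Ez_def Fz_def exp_minus)
  have DS: "complex_of_real (D\<^sup>2) = of_real (S\<^sup>2) - of_real (4 * \<rho> 1 * \<rho> 2)"
    by (simp add: D_def S_def power2_eq_square algebra_simps)
  have "Det (of_real x) = - (g 1 * g 2 * of_real X) + 4 * \<rho> 1 * \<rho> 2 * (g 1 * g 1 + g 2 * g 2)"
    unfolding X_def of_real_add of_real_mult[of "D\<^sup>2"] of_real_mult[of "S\<^sup>2"] Det_def of_real_power[of S]
    by (rule determinant_identity[OF EE EF EF DS[unfolded of_real_power[of S]]])
  moreover have "cmod (4 * \<rho> 1 * \<rho> 2 * (g 1 * g 1 + g 2 * g 2)) < cmod (g 1 * g 2 * of_real X)"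
  proof -
    have "cmod (g 1 * g 1 + g 2 * g 2) \<le> 2"
      using norm_triangle_ineq[of "g 1 * g 1" "g 2 * g 2"] by (simp add: norm_mult g_unit)
    hence "cmod (4 * \<rho> 1 * \<rho> 2 * (g 1 * g 1 + g 2 * g 2)) \<le> 4 * \<rho> 1 * \<rho> 2 * 2"
      unfolding norm_mult[of "complex_of_real (4 * \<rho> 1 * \<rho> 2)"] norm_of_real
      using \<rho>_pos \<rho>_less by (simp only: abs_of_pos mult_pos_pos) (intro mult_left_mono, auto)
    also have "\<dots> < D\<^sup>2 * 2 + S\<^sup>2 * 2"
    proof -
      have "0 < 4 * (\<rho> 2 - \<rho> 1)\<^sup>2" using \<rho>_less by simp
      also have "\<dots> = D\<^sup>2 * 2 + S\<^sup>2 * 2 - 4 * \<rho> 1 * \<rho> 2 * 2"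
        by (simp add: D_def S_def power2_eq_square algebra_simps)
      finally show ?thesis by simp
    qed
    also have "\<dots> \<le> X"
      unfolding X_def by (intro add_mono mult_left_mono exp_plus_exp_minus_ge) auto
    also have "X \<le> cmod (g 1 * g 2 * of_real X)" by (simp add: norm_mult g_unit)
    finally show ?thesis .
  qed
  ultimately show ?thesis by auto
qed

lemma q_equations:
  shows "- S * (Ez 1 (of_real x) + Fz 1 (of_real x)) * q1 (of_real x)
      + 2 * \<rho> 1 * (Ez 2 (of_real x) + Fz 1 (of_real x)) * q2 (of_real x) = 2 * \<rho> 1 * S * Fz 1 (of_real x)"
   and "- 2 * \<rho> 2 * (Ez 1 (of_real x) + Fz 2 (of_real x)) * q1 (of_real x)
      + S * (Ez 2 (of_real x) + Fz 2 (of_real x)) * q2 (of_real x) = 2 * \<rho> 2 * S * Fz 2 (of_real x)"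
proof -
  define n1 where "n1 = q1 (of_real x) * Det (of_real x)"
  define n2 where "n2 = q2 (of_real x) * Det (of_real x)"
  have n1: "n1 = 2 * \<rho> 1 * S\<^sup>2 * Fz 1 x * (Ez 2 x + Fz 2 x) - 4 * \<rho> 1 * \<rho> 2 * S * Fz 2 x * (Ez 2 x + Fz 1 x)"
   and n2: "n2 = 4 * \<rho> 1 * \<rho> 2 * S * Fz 1 x * (Ez 1 x + Fz 2 x) - 2 * \<rho> 2 * S\<^sup>2 * Fz 2 x * (Ez 1 x + Fz 1 x)"
    using Det_nonzero[of x] by (simp_all add: n1_def n2_def q1_def q2_def)
  have q: "q1 x = n1 / Det x" "q2 x = n2 / Det x" using Det_nonzero[of x] by (simp_all add: n1_def n2_def)
  have "- S * (Ez 1 x + Fz 1 x) * n1 + 2 * \<rho> 1 * (Ez 2 x + Fz 1 x) * n2 = 2 * \<rho> 1 * S * Fz 1 x * Det x"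
    unfolding n1 n2 Det_def by (simp add: power2_eq_square) algebra
  thus "- S * (Ez 1 (of_real x) + Fz 1 (of_real x)) * q1 (of_real x)
      + 2 * \<rho> 1 * (Ez 2 (of_real x) + Fz 1 (of_real x)) * q2 (of_real x) = 2 * \<rho> 1 * S * Fz 1 (of_real x)"
    unfolding q using Det_nonzero[of x] by (simp add: field_simps)
  have "- 2 * \<rho> 2 * (Ez 1 x + Fz 2 x) * n1 + S * (Ez 2 x + Fz 2 x) * n2 = 2 * \<rho> 2 * S * Fz 2 x * Det x"
    unfolding n1 n2 Det_def by (simp add: power2_eq_square) algebra
  thus "- 2 * \<rho> 2 * (Ez 1 (of_real x) + Fz 2 (of_real x)) * q1 (of_real x)
      + S * (Ez 2 (of_real x) + Fz 2 (of_real x)) * q2 (of_real x) = 2 * \<rho> 2 * S * Fz 2 (of_real x)"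
    unfolding q using Det_nonzero[of x] by (simp add: field_simps)
qed

lemma soliton_system_explicit: "soliton_system \<rho> \<theta> x (a0z x, a1z x, b0z x, b1z x)"
proof -
  define d where "d = complex_of_real (\<rho> 1 - \<rho> 2)"
  have EE: "Ez k (of_real x) = g k * E k x" "Fz k (of_real x) = g k / E k x" for k
    by (simp_all add: Ez_def Fz_def E_def exp_of_real[symmetric] exp_minus divide_inverse)
  have i2: "\<i> * (\<i> * c) = - c" for c by (simp flip: mult.assoc)
  have A1: "(\<i> * \<rho> 1)\<^sup>2 + a1z x * (\<i> * \<rho> 1) + a0z x = d * q1 x" "(\<i> * \<rho> 2)\<^sup>2 + a1z x * (\<i> * \<rho> 2) + a0z x = d * q2 x"
    and B1: "b1z x * (\<i> * \<rho> 1) + b0z x = d * Ez 1 x * q1 x" "b1z x * (\<i> * \<rho> 2) + b0z x = d * Ez 2 x * q2 x"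
    by (simp_all add: a1z_def a0z_def b1z_def b0z_def d_def S_def power_mult_distrib power2_eq_square algebra_simps i2)
  have B2: "b1z x * (- \<i> * \<rho> 1) + b0z x = - S * Ez 1 x * q1 x + 2 * \<rho> 1 * Ez 2 x * q2 x"
     "b1z x * (- \<i> * \<rho> 2) + b0z x = - 2 * \<rho> 2 * Ez 1 x * q1 x + S * Ez 2 x * q2 x"
   and A2: "(- \<i> * \<rho> 1)\<^sup>2 + a1z x * (- \<i> * \<rho> 1) + a0z x = - 2 * \<rho> 1 * S - S * q1 x + 2 * \<rho> 1 * q2 x"
     "(- \<i> * \<rho> 2)\<^sup>2 + a1z x * (- \<i> * \<rho> 2) + a0z x = - 2 * \<rho> 2 * S - 2 * \<rho> 2 * q1 x + S * q2 x"
    by (simp_all add: a1z_def a0z_def b1z_def b0z_def d_def S_def power_mult_distrib power2_eq_square algebra_simps i2)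
  \<comment> \<open>The relations at -i\<rho>_k become \<open>q_equations\<close> once
    \<open>A2\<close> and \<open>B2\<close> are inserted.\<close>
  have R1: "b1z x * (- \<i> * \<rho> 1) + b0z x = - Fz 1 x * ((- \<i> * \<rho> 1)\<^sup>2 + a1z x * (- \<i> * \<rho> 1) + a0z x)"
    unfolding A2 B2 using q_equations(1)[of x] unfolding of_real_mult of_real_minus of_real_numeral by algebra
  have R2: "b1z x * (- \<i> * \<rho> 2) + b0z x = - Fz 2 x * ((- \<i> * \<rho> 2)\<^sup>2 + a1z x * (- \<i> * \<rho> 2) + a0z x)"
    unfolding A2 B2 using q_equations(2)[of x] unfolding of_real_mult of_real_minus of_real_numeral by algebra
  have g: "cnj (g k) * (d * (g k * E k x) * q) = d * q * E k x" for k q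
  proof -
    have "cnj (g k) * (d * (g k * E k x) * q) = (cnj (g k) * g k) * (d * q * E k x)" by (simp only: mult_ac)
    thus ?thesis by (simp add: g_unit)
  qed
  show ?thesis
    unfolding soliton_system_iff
  proof
    fix k :: nat assume "k \<in> {1, 2}"
    then consider "k = 1" | "k = 2" by auto
    thus "((\<i> * \<rho> k)\<^sup>2 + a1z x * (\<i> * \<rho> k) + a0z x) * E k x = cnj (g k) * (b1z x * (\<i> * \<rho> k) + b0z x) \<and>
      b1z x * (- \<i> * \<rho> k) + b0z x = - g k * ((- \<i> * \<rho> k)\<^sup>2 + a1z x * (- \<i> * \<rho> k) + a0z x) / E k x"
    proof cases
      case 1
      show ?thesis unfolding 1 R1 A1 B1 unfolding EE g by simp
    next
      case 2
      show ?thesis unfolding 2 R2 A1 B1 unfolding EE g by simp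
    qed
  qed
qed

lemma soliton_coeffs_eq: "soliton_coeffs \<rho> \<theta> x = (a0z x, a1z x, b0z x, b1z x)"
  unfolding soliton_coeffs_def
  using soliton_system_explicit soliton_system_unique by blast

definition a0 where "a0 (x::real) = a0z (of_real x)"
definition a1 where "a1 (x::real) = a1z (of_real x)"
definition b0 where "b0 (x::real) = b0z (of_real x)"
definition b1 where "b1 (x::real) = b1z (of_real x)"

lemma soliton_a_eq: "soliton_a \<rho> \<theta> x l = (l\<^sup>2 + a1 x * l + a0 x) * exp (- 2 * \<i> * l * x)"
  by (simp add: soliton_a_def soliton_coeffs_eq a0_def a1_def)

lemma relation1: "k \<in> {1, 2} \<Longrightarrow>
    ((\<i> * \<rho> k)\<^sup>2 + a1 x * (\<i> * \<rho> k) + a0 x) * E k x = cnj (g k) * (b1 x * (\<i> * \<rho> k) + b0 x)"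
  and relation2: "k \<in> {1, 2} \<Longrightarrow>
    b1 x * (- \<i> * \<rho> k) + b0 x = - g k * ((- \<i> * \<rho> k)\<^sup>2 + a1 x * (- \<i> * \<rho> k) + a0 x) / E k x"
  using soliton_system_explicit[of x] unfolding soliton_system_iff a0_def a1_def b0_def b1_def by blast+

lemma relation1_cnj: "k \<in> {1, 2} \<Longrightarrow>
    ((- \<i> * \<rho> k)\<^sup>2 + cnj (a1 x) * (- \<i> * \<rho> k) + cnj (a0 x)) * E k x = g k * (cnj (b1 x) * (- \<i> * \<rho> k) + cnj (b0 x))"
  and relation2_cnj: "k \<in> {1, 2} \<Longrightarrow>
    cnj (b1 x) * (\<i> * \<rho> k) + cnj (b0 x) = - cnj (g k) * ((\<i> * \<rho> k)\<^sup>2 + cnj (a1 x) * (\<i> * \<rho> k) + cnj (a0 x)) / E k x"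
  using arg_cong[OF relation1[of k x], of cnj] arg_cong[OF relation2[of k x], of cnj] by (simp_all add: add.commute)

text \<open>The z^4 terms of the two sides cancel, which leaves a difference of degree at most
  three. Both sides vanish at +-i\<rho>_k, the left one by the paired relations.\<close>

lemma unitarity:
  "(z\<^sup>2 + a1 x * z + a0 x) * (z\<^sup>2 + cnj (a1 x) * z + cnj (a0 x)) + (b1 x * z + b0 x) * (cnj (b1 x) * z + cnj (b0 x))
   = (z\<^sup>2 + (\<rho> 1)\<^sup>2) * (z\<^sup>2 + (\<rho> 2)\<^sup>2)"
proof -
  define p3 where "p3 = a1 x + cnj (a1 x)"
  define p2 where "p2 = a1 x * cnj (a1 x) + a0 x + cnj (a0 x) + b1 x * cnj (b1 x) - (\<rho> 1)\<^sup>2 - (\<rho> 2)\<^sup>2"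
  define p1 where "p1 = a1 x * cnj (a0 x) + a0 x * cnj (a1 x) + b1 x * cnj (b0 x) + b0 x * cnj (b1 x)"
  define p0 where "p0 = a0 x * cnj (a0 x) + b0 x * cnj (b0 x) - (\<rho> 1)\<^sup>2 * (\<rho> 2)\<^sup>2"
  let ?L = "\<lambda>z. (z\<^sup>2 + a1 x * z + a0 x) * (z\<^sup>2 + cnj (a1 x) * z + cnj (a0 x)) + (b1 x * z + b0 x) * (cnj (b1 x) * z + cnj (b0 x))"
  have poly: "p3 * z ^ 3 + p2 * z\<^sup>2 + p1 * z + p0 = ?L z - (z\<^sup>2 + (\<rho> 1)\<^sup>2) * (z\<^sup>2 + (\<rho> 2)\<^sup>2)" for z
    by (simp add: p0_def p1_def p2_def p3_def power2_eq_square power3_eq_cube algebra_simps)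
  have a: "?L (\<i> * \<rho> k) = 0" if "k \<in> {1, 2}" for k
    by (rule paired_relation_null[OF relation1[OF that] relation2_cnj[OF that]]) (use E_pos[of k x] in simp)
  have b: "?L (- \<i> * \<rho> k) = 0" if "k \<in> {1, 2}" for k
    using paired_relation_null[OF relation1_cnj[OF that] relation2[OF that]] E_pos[of k x] by (simp add: mult.commute)
  have root: "p3 * (\<i> * of_real r) ^ 3 + p2 * (\<i> * of_real r)\<^sup>2 + p1 * (\<i> * of_real r) + p0 = 0"
    if "r \<in> {\<rho> 1, \<rho> 2, - \<rho> 1, - \<rho> 2}" for r
  proof -
    have "?L (\<i> * of_real r) = 0" using that a[of 1] a[of 2] b[of 1] b[of 2] by auto
    moreover have "((\<i> * of_real r)\<^sup>2 + (\<rho> 1)\<^sup>2) * ((\<i> * of_real r)\<^sup>2 + (\<rho> 2)\<^sup>2) = 0"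
      using that by (auto simp: power_mult_distrib)
    ultimately show ?thesis unfolding poly by simp
  qed
  have "p3 = 0" "p2 = 0" "p1 = 0" "p0 = 0" using cubic_two_root_pairs[OF \<rho>_pos \<rho>_less root] by auto
  with poly[of z] show ?thesis by simp
qed

lemma unitarity_real:
  fixes l x :: real
  shows "(cmod (l\<^sup>2 + a1 x * l + a0 x))\<^sup>2 + (cmod (b1 x * l + b0 x))\<^sup>2 = (l\<^sup>2 + (\<rho> 1)\<^sup>2) * (l\<^sup>2 + (\<rho> 2)\<^sup>2)"
proof -
  have "complex_of_real ((cmod (l\<^sup>2 + a1 x * l + a0 x))\<^sup>2 + (cmod (b1 x * l + b0 x))\<^sup>2)
      = complex_of_real ((l\<^sup>2 + (\<rho> 1)\<^sup>2) * (l\<^sup>2 + (\<rho> 2)\<^sup>2))"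
    unfolding of_real_add complex_norm_square using unitarity[of "of_real l" x] by simp
  thus ?thesis by (simp only: of_real_eq_iff)
qed

section \<open>Uniform bounds and spatial asymptotics of the coefficients\<close>

definition P :: "real \<Rightarrow> real" where "P l = (l\<^sup>2 + (\<rho> 1)\<^sup>2) * (l\<^sup>2 + (\<rho> 2)\<^sup>2)"

lemma P_pos: "P l > 0"
  using \<rho>_pos \<rho>_less by (auto simp: P_def intro!: mult_pos_pos add_nonneg_pos)

lemma soliton_a_norm:
  fixes l x :: real
  shows "cmod (l\<^sup>2 + a1 x * l + a0 x) \<le> sqrt (P l)" "cmod (b1 x * l + b0 x) \<le> sqrt (P l)"
proof -
  have "(cmod (l\<^sup>2 + a1 x * l + a0 x))\<^sup>2 \<le> P l" "(cmod (b1 x * l + b0 x))\<^sup>2 \<le> P l"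
    using unitarity_real[of l x] zero_le_power2[of "cmod (b1 x * l + b0 x)"]
      zero_le_power2[of "cmod (l\<^sup>2 + a1 x * l + a0 x)"] unfolding P_def by linarith+
  thus "cmod (l\<^sup>2 + a1 x * l + a0 x) \<le> sqrt (P l)" "cmod (b1 x * l + b0 x) \<le> sqrt (P l)"
    by (auto intro: real_le_rsqrt)
qed

text \<open>By \<open>unitarity_real\<close> the moduli of A and B at l are at most sqrt (P l). The
  value at l = 0 bounds \<open>a0\<close> and \<open>b0\<close>, and the value at l = 1 then bounds
  \<open>a1\<close> and \<open>b1\<close>.\<close>

definition CB :: real where "CB = 1 + sqrt (P 0) + sqrt (P 1)"

lemma CB_ge: "CB \<ge> 1" using P_pos[of 0] P_pos[of 1] by (simp add: CB_def)

lemma coeff_bounds: "cmod (a0 x) \<le> CB" "cmod (a1 x) \<le> CB" "cmod (b0 x) \<le> CB" "cmod (b1 x) \<le> CB"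
proof -
  have 0: "cmod (a0 x) \<le> sqrt (P 0)" "cmod (b0 x) \<le> sqrt (P 0)"
    using soliton_a_norm[where l=0 and x=x] by simp_all
  have 1: "cmod (1 + a1 x + a0 x) \<le> sqrt (P 1)" "cmod (b1 x + b0 x) \<le> sqrt (P 1)"
    using soliton_a_norm[where l=1 and x=x] by simp_all
  have "cmod (a1 x) \<le> cmod (1 + a1 x + a0 x) + cmod (1 + a0 x)"
    using norm_triangle_ineq4[of "1 + a1 x + a0 x" "1 + a0 x"] by simp
  moreover have "cmod (1 + a0 x) \<le> 1 + cmod (a0 x)" using norm_triangle_ineq[of 1 "a0 x"] by simp
  ultimately show "cmod (a1 x) \<le> CB" using 0 1 by (simp add: CB_def)
  have "cmod (b1 x) \<le> cmod (b1 x + b0 x) + cmod (b0 x)"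
    using norm_triangle_ineq4[of "b1 x + b0 x" "b0 x"] by simp
  thus "cmod (b1 x) \<le> CB" using 0 1 by (simp add: CB_def)
  show "cmod (a0 x) \<le> CB" "cmod (b0 x) \<le> CB" using 0 P_pos[of 1] by (auto simp: CB_def intro: order_trans)
qed

text \<open>The slower of the two exponential rates, so that it dominates the factors of both
  relations.\<close>

definition e :: "real \<Rightarrow> real" where "e x = exp (- 2 * \<rho> 1 * \<bar>x\<bar>)"

text \<open>\<open>KA\<close> bounds A and B at the points +-i\<rho>_k; \<open>K\<close> adds the
  loss in passing from two values of a linear polynomial to its coefficients.\<close>

definition KA :: real where "KA = (\<rho> 2)\<^sup>2 + CB * \<rho> 2 + CB"

definition K :: real where "K = KA + (\<rho> 2 + 1) * (2 * KA / (\<rho> 2 - \<rho> 1))"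

lemma \<rho>_cases: "k \<in> {1, 2} \<Longrightarrow> 0 < \<rho> k \<and> \<rho> 1 \<le> \<rho> k \<and> \<rho> k \<le> \<rho> 2"
  using \<rho>_pos \<rho>_less by auto

text \<open>Subtracting the two values isolates \<open>u1\<close>. The unimodular \<open>s\<close>
  lets one lemma treat interpolation at i\<rho>_k and at -i\<rho>_k.\<close>

lemma linear_interpolation:
  fixes u0 u1 :: complex
  assumes "cmod (u1 * (s * \<i> * \<rho> 1) + u0) \<le> KA * t" "cmod (u1 * (s * \<i> * \<rho> 2) + u0) \<le> KA * t" "cmod s = 1"
  shows "cmod u0 \<le> K * t" "cmod u1 \<le> K * t"
proof -
  have KA0: "0 \<le> KA" using CB_ge \<rho>_pos \<rho>_less by (simp add: KA_def)
  have D: "\<rho> 2 - \<rho> 1 > 0" using \<rho>_less by simp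
  have "0 \<le> KA * t" using assms(1) norm_ge_zero order_trans by blast
  have eq: "u1 * (s * \<i> * (\<rho> 2 - \<rho> 1)) = (u1 * (s * \<i> * \<rho> 2) + u0) - (u1 * (s * \<i> * \<rho> 1) + u0)"
    by (simp add: algebra_simps)
  have "cmod (u1 * (s * \<i> * (\<rho> 2 - \<rho> 1))) \<le> KA * t + KA * t" unfolding eq
    using norm_triangle_ineq4[of "u1 * (s * \<i> * \<rho> 2) + u0" "u1 * (s * \<i> * \<rho> 1) + u0"] assms(1,2) by linarith
  moreover have "cmod (u1 * (s * \<i> * (\<rho> 2 - \<rho> 1))) = cmod u1 * (\<rho> 2 - \<rho> 1)"
    using D by (simp add: norm_mult assms flip: of_real_diff)
  ultimately have u1: "cmod u1 \<le> 2 * KA / (\<rho> 2 - \<rho> 1) * t"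
    using D by (simp add: field_simps)
  have nn: "0 \<le> 2 * KA / (\<rho> 2 - \<rho> 1) * t"
    using u1 norm_ge_zero order_trans by blast
  have "cmod u0 \<le> cmod (u1 * (s * \<i> * \<rho> 1) + u0) + cmod (u1 * (s * \<i> * \<rho> 1))"
    using norm_triangle_ineq4[of "u1 * (s * \<i> * \<rho> 1) + u0" "u1 * (s * \<i> * \<rho> 1)"] by simp
  also have "cmod (u1 * (s * \<i> * \<rho> 1)) = \<rho> 1 * cmod u1"
    using \<rho>_pos by (simp add: norm_mult assms)
  finally have "cmod u0 \<le> KA * t + \<rho> 1 * (2 * KA / (\<rho> 2 - \<rho> 1) * t)"
    using assms(1) mult_left_mono[OF u1, of "\<rho> 1"] \<rho>_pos by linarith
  also have "\<dots> \<le> KA * t + (\<rho> 2 + 1) * (2 * KA / (\<rho> 2 - \<rho> 1) * t)"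
    using nn \<rho>_less by (intro add_left_mono mult_right_mono) auto
  finally show "cmod u0 \<le> K * t" by (simp add: K_def algebra_simps)
  have "1 * (2 * KA / (\<rho> 2 - \<rho> 1) * t) \<le> (\<rho> 2 + 1) * (2 * KA / (\<rho> 2 - \<rho> 1) * t)"
    using nn \<rho>_pos \<rho>_less by (intro mult_right_mono) auto
  with u1 \<open>0 \<le> KA * t\<close> show "cmod u1 \<le> K * t" by (simp add: K_def algebra_simps)
qed

lemma A_bound_bound_points:
  assumes "k \<in> {1, 2}" "s = 1 \<or> s = -1"
  shows "cmod ((s * \<i> * \<rho> k)\<^sup>2 + a1 x * (s * \<i> * \<rho> k) + a0 x) \<le> KA"
    and "cmod (b1 x * (s * \<i> * \<rho> k) + b0 x) \<le> KA"
proof -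
  note r = \<rho>_cases[OF assms(1)]
  have s: "cmod s = 1" using assms(2) by auto
  have n1: "cmod (c * (s * \<i> * \<rho> k)) \<le> CB * \<rho> 2" if "cmod c \<le> CB" for c
    using that r CB_ge by (simp add: norm_mult s mult_mono)
  have n2: "cmod ((s * \<i> * \<rho> k)\<^sup>2) \<le> (\<rho> 2)\<^sup>2"
    using r by (simp add: norm_mult norm_power s power_mono)
  have "cmod ((s * \<i> * \<rho> k)\<^sup>2 + a1 x * (s * \<i> * \<rho> k) + a0 x)
      \<le> cmod ((s * \<i> * \<rho> k)\<^sup>2) + cmod (a1 x * (s * \<i> * \<rho> k)) + cmod (a0 x)"
    by (intro norm_triangle_le add_right_mono norm_triangle_ineq)
  thus "cmod ((s * \<i> * \<rho> k)\<^sup>2 + a1 x * (s * \<i> * \<rho> k) + a0 x) \<le> KA"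
    using n1[OF coeff_bounds(2), of x] n2 coeff_bounds(1)[of x] by (simp add: KA_def)
  have "cmod (b1 x * (s * \<i> * \<rho> k) + b0 x) \<le> cmod (b1 x * (s * \<i> * \<rho> k)) + cmod (b0 x)"
    by (rule norm_triangle_ineq)
  thus "cmod (b1 x * (s * \<i> * \<rho> k) + b0 x) \<le> KA"
    using n1[OF coeff_bounds(4), of x] coeff_bounds(3)[of x] zero_le_power2[of "\<rho> 2"] unfolding KA_def by linarith
qed

lemma E_e:
  assumes "k \<in> {1, 2}"
  shows "x \<ge> 0 \<Longrightarrow> 1 / E k x \<le> e x" "x \<le> 0 \<Longrightarrow> E k x \<le> e x"
  using \<rho>_cases[OF assms] by (auto simp: E_def e_def exp_minus[symmetric] divide_inverse abs_if
    mult_right_mono mult_right_mono_neg)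

text \<open>For x \<ge> 0 the factor 1 / \<open>E k x\<close> in the relations is at most
  \<open>e x\<close>, so A is small at i\<rho>_k and B at -i\<rho>_k; for x \<le> 0 the two points
  change places. The factors 1 and -1 are written out to match
  \<open>linear_interpolation\<close>.\<close>

lemma relation_bounds_plus:
  assumes k: "k \<in> {1, 2}" and x: "x \<ge> 0"
  shows "cmod ((1 * \<i> * \<rho> k)\<^sup>2 + a1 x * (1 * \<i> * \<rho> k) + a0 x) \<le> KA * e x"
    and "cmod (b1 x * (-1 * \<i> * \<rho> k) + b0 x) \<le> KA * e x"
proof -
  have "(1 * \<i> * \<rho> k)\<^sup>2 + a1 x * (1 * \<i> * \<rho> k) + a0 x = cnj (g k) * (b1 x * (1 * \<i> * \<rho> k) + b0 x) * (1 / E k x)"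
    using relation1[OF k, of x] E_pos[of k x] by (simp add: field_simps)
  hence "cmod ((1 * \<i> * \<rho> k)\<^sup>2 + a1 x * (1 * \<i> * \<rho> k) + a0 x) = cmod (b1 x * (1 * \<i> * \<rho> k) + b0 x) * (1 / E k x)"
    using E_pos[of k x] by (simp add: norm_mult norm_divide g_unit)
  also have "\<dots> \<le> KA * e x"
    using E_pos[of k x] by (intro mult_mono A_bound_bound_points[OF k] E_e[OF k] x)
      (auto intro: order_trans[OF norm_ge_zero A_bound_bound_points(1)[OF k, of 1]])
  finally show "cmod ((1 * \<i> * \<rho> k)\<^sup>2 + a1 x * (1 * \<i> * \<rho> k) + a0 x) \<le> KA * e x" .
  have "b1 x * (-1 * \<i> * \<rho> k) + b0 x = - g k * ((-1 * \<i> * \<rho> k)\<^sup>2 + a1 x * (-1 * \<i> * \<rho> k) + a0 x) * (1 / E k x)"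
    using relation2[OF k, of x] by simp
  hence "cmod (b1 x * (-1 * \<i> * \<rho> k) + b0 x) = cmod ((-1 * \<i> * \<rho> k)\<^sup>2 + a1 x * (-1 * \<i> * \<rho> k) + a0 x) * (1 / E k x)"
    using E_pos[of k x] by (simp only: norm_mult norm_divide norm_minus_cancel g_unit) (simp add: g_unit norm_divide)
  also have "\<dots> \<le> KA * e x"
    using E_pos[of k x] by (intro mult_mono A_bound_bound_points[OF k] E_e[OF k] x)
      (auto intro: order_trans[OF norm_ge_zero A_bound_bound_points(1)[OF k, of 1]])
  finally show "cmod (b1 x * (-1 * \<i> * \<rho> k) + b0 x) \<le> KA * e x" .
qed

lemma relation_bounds_minus:
  assumes k: "k \<in> {1, 2}" and x: "x \<le> 0"
  shows "cmod ((-1 * \<i> * \<rho> k)\<^sup>2 + a1 x * (-1 * \<i> * \<rho> k) + a0 x) \<le> KA * e x"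
    and "cmod (b1 x * (1 * \<i> * \<rho> k) + b0 x) \<le> KA * e x"
proof -
  have "g k * (((1 * \<i> * \<rho> k)\<^sup>2 + a1 x * (1 * \<i> * \<rho> k) + a0 x) * E k x) = (g k * cnj (g k)) * (b1 x * (1 * \<i> * \<rho> k) + b0 x)"
    using relation1[OF k, of x] by simp
  hence "b1 x * (1 * \<i> * \<rho> k) + b0 x = g k * (((1 * \<i> * \<rho> k)\<^sup>2 + a1 x * (1 * \<i> * \<rho> k) + a0 x) * E k x)"
    unfolding g_unit(2) mult_1_left by (rule sym)
  hence "cmod (b1 x * (1 * \<i> * \<rho> k) + b0 x) = cmod ((1 * \<i> * \<rho> k)\<^sup>2 + a1 x * (1 * \<i> * \<rho> k) + a0 x) * E k x"
    using E_pos[of k x] by (simp only: norm_mult g_unit) simp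
  also have "\<dots> \<le> KA * e x"
    using E_pos[of k x] by (intro mult_mono A_bound_bound_points[OF k] E_e[OF k] x)
      (auto intro: order_trans[OF norm_ge_zero A_bound_bound_points(1)[OF k, of 1]])
  finally show "cmod (b1 x * (1 * \<i> * \<rho> k) + b0 x) \<le> KA * e x" .
  have "cmod (b1 x * (-1 * \<i> * \<rho> k) + b0 x) = cmod ((-1 * \<i> * \<rho> k)\<^sup>2 + a1 x * (-1 * \<i> * \<rho> k) + a0 x) * (1 / E k x)"
    using relation2[OF k, of x] E_pos[of k x] by (simp add: norm_mult norm_divide g_unit)
  hence "cmod ((-1 * \<i> * \<rho> k)\<^sup>2 + a1 x * (-1 * \<i> * \<rho> k) + a0 x) = cmod (b1 x * (-1 * \<i> * \<rho> k) + b0 x) * E k x"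
    using E_pos[of k x] by (simp add: field_simps)
  also have "\<dots> \<le> KA * e x"
    using E_pos[of k x] by (intro mult_mono A_bound_bound_points[OF k] E_e[OF k] x)
      (auto intro: order_trans[OF norm_ge_zero A_bound_bound_points(1)[OF k, of 1]])
  finally show "cmod ((-1 * \<i> * \<rho> k)\<^sup>2 + a1 x * (-1 * \<i> * \<rho> k) + a0 x) \<le> KA * e x" .
qed

text \<open>The coefficients of $A$ at $\pm\infty$ are those of $(\lambda \mp i\rho_1)(\lambda \mp i\rho_2)$,
  and $B$ vanishes there.\<close>

lemma asymptotics:
  assumes "x \<ge> 0 \<and> s = 1 \<or> x \<le> 0 \<and> s = -1"
  shows "cmod (a0 x + \<rho> 1 * \<rho> 2) \<le> K * e x" "cmod (a1 x + s * \<i> * S) \<le> K * e x"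
    "cmod (b0 x) \<le> K * e x" "cmod (b1 x) \<le> K * e x"
proof -
  have s: "cmod s = 1" "cmod (- s) = 1" and ss: "s * s = 1" using assms by auto
  have i2: "\<i> * (\<i> * c) = - c" for c by (simp flip: mult.assoc)
  \<comment> \<open>A minus (z - s i\<rho>_1)(z - s i\<rho>_2) is linear in z and agrees with A at
    the zeros s i\<rho>_k of the product.\<close>
  have lin: "(a1 x + s * \<i> * S) * (s * \<i> * \<rho> k) + (a0 x + \<rho> 1 * \<rho> 2) = (s * \<i> * \<rho> k)\<^sup>2 + a1 x * (s * \<i> * \<rho> k) + a0 x"
    if "k \<in> {1, 2}" for k
    using assms that by (auto simp: S_def power2_eq_square algebra_simps i2)
  have A: "cmod ((a1 x + s * \<i> * S) * (s * \<i> * \<rho> k) + (a0 x + \<rho> 1 * \<rho> 2)) \<le> KA * e x" if "k \<in> {1, 2}" for k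
    unfolding lin[OF that] using assms relation_bounds_plus(1)[OF that] relation_bounds_minus(1)[OF that] by auto
  have B: "cmod (b1 x * (- s * \<i> * \<rho> k) + b0 x) \<le> KA * e x" if "k \<in> {1, 2}" for k
    using assms relation_bounds_plus(2)[OF that] relation_bounds_minus(2)[OF that] by (auto simp: add.commute)
  show "cmod (a0 x + \<rho> 1 * \<rho> 2) \<le> K * e x" "cmod (a1 x + s * \<i> * S) \<le> K * e x"
    using linear_interpolation[OF A[of 1] A[of 2] s(1)] by auto
  show "cmod (b0 x) \<le> K * e x" "cmod (b1 x) \<le> K * e x"
    using linear_interpolation[OF B[of 1] B[of 2] s(2)] by auto
qed

section \<open>Differential equations in x\<close>

lemma Ez_differentiable: "Ez k field_differentiable at z" "Fz k field_differentiable at z"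
proof -
  have "((\<lambda>z. g k * exp (c * z)) has_field_derivative g k * (exp (c * z) * c)) (at z)" for c
    by (auto intro!: derivative_eq_intros)
  from this[of "complex_of_real (2 * \<rho> k)"] this[of "- complex_of_real (2 * \<rho> k)"]
  show "Ez k field_differentiable at z" "Fz k field_differentiable at z"
    unfolding Ez_def[abs_def] Fz_def[abs_def] field_differentiable_def by auto
qed

lemma coeffz_differentiable:
  "a0z field_differentiable at (of_real x)" "a1z field_differentiable at (of_real x)"
  "b0z field_differentiable at (of_real x)" "b1z field_differentiable at (of_real x)"
proof -
  have D: "Det field_differentiable at z" for z
    unfolding Det_def[abs_def]
    by (intro field_differentiable_diff field_differentiable_mult field_differentiable_add
      field_differentiable_const Ez_differentiable)
  have q: "q1 field_differentiable at (of_real x)" "q2 field_differentiable at (of_real x)"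
    unfolding q1_def[abs_def] q2_def[abs_def]
    by (intro field_differentiable_divide field_differentiable_diff field_differentiable_mult
      field_differentiable_add field_differentiable_const Ez_differentiable D Det_nonzero)+
  show "a0z field_differentiable at (of_real x)" "a1z field_differentiable at (of_real x)"
    "b0z field_differentiable at (of_real x)" "b1z field_differentiable at (of_real x)"
    unfolding a0z_def[abs_def] a1z_def[abs_def] b0z_def[abs_def] b1z_def[abs_def]
    by (intro field_differentiable_diff field_differentiable_mult
      field_differentiable_add field_differentiable_const Ez_differentiable q)+
qed

text \<open>Only existence is taken from the explicit formulas; the derivatives themselves are found
  from the relations, which avoids differentiating the quotients.\<close>

lemma coeff_derivatives_exist:
  "\<exists>a0' a1' b0' b1'. (a0 has_vector_derivative a0') (at x) \<and> (a1 has_vector_derivative a1') (at x) \<and>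
     (b0 has_vector_derivative b0') (at x) \<and> (b1 has_vector_derivative b1') (at x)"
  using coeffz_differentiable[of x] unfolding field_differentiable_def a0_def[abs_def] a1_def[abs_def] b0_def[abs_def] b1_def[abs_def]
  by (blast intro: has_vector_derivative_real_field)

lemma E_derivative: "((\<lambda>x. complex_of_real (E k x)) has_vector_derivative 2 * \<rho> k * E k x) (at x)"
  unfolding E_def by (rule has_vector_derivative_of_real)
    (auto intro!: derivative_eq_intros simp: has_real_derivative_iff_has_vector_derivative[symmetric])

text \<open>Differentiating the relations produces an extra term with 2\<rho>_k = -2iw at w =
  i\<rho>_k, which the relations themselves rewrite through the conjugated coefficients. The
  derivatives minus the claimed values thus solve the homogeneous system. With A^c, B^c for
  conjugated coefficients, the result reads A' = -2i b1 B^c and B' = 2i b1 A^c - 2iz B, a system of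
  Zakharov-Shabat type.\<close>

lemma coeff_derivatives:
  "(a1 has_vector_derivative - 2 * \<i> * b1 x * cnj (b1 x)) (at x)"
  "(a0 has_vector_derivative - 2 * \<i> * b1 x * cnj (b0 x)) (at x)"
  "(b1 has_vector_derivative - 2 * \<i> * b0 x + 2 * \<i> * b1 x * cnj (a1 x)) (at x)"
  "(b0 has_vector_derivative 2 * \<i> * b1 x * cnj (a0 x)) (at x)"
proof -
  obtain a0' a1' b0' b1' where d[derivative_intros]: "(a0 has_vector_derivative a0') (at x)"
    "(a1 has_vector_derivative a1') (at x)" "(b0 has_vector_derivative b0') (at x)" "(b1 has_vector_derivative b1') (at x)"
    using coeff_derivatives_exist by blast
  have "a0' + 2 * \<i> * b1 x * cnj (b0 x) = 0 \<and> a1' + 2 * \<i> * b1 x * cnj (b1 x) = 0 \<and>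
     b0' - 2 * \<i> * b1 x * cnj (a0 x) = 0 \<and> b1' + 2 * \<i> * b0 x - 2 * \<i> * b1 x * cnj (a1 x) = 0"
  proof (rule paired_relation_homogeneous[OF \<rho>_pos \<rho>_less, where E="\<lambda>k. E k x" and g=g])
    show "E k x > 0" for k by (rule E_pos)
    fix k :: nat assume k: "k \<in> {1, 2}"
    define w where "w = \<i> * complex_of_real (\<rho> k)"
    have w': "- \<i> * complex_of_real (\<rho> k) = - w" by (simp add: w_def)
    have rw: "complex_of_real (\<rho> k) = - \<i> * w" by (simp add: w_def flip: mult.assoc)
    have E0: "complex_of_real (E k x) \<noteq> 0" using E_pos[of k x] by simp
    note d1 = has_vector_derivative_mult_right has_vector_derivative_mult_left
    have L1: "((\<lambda>x. (w\<^sup>2 + a1 x * w + a0 x) * E k x) has_vector_derivative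
        (w\<^sup>2 + a1 x * w + a0 x) * (2 * \<rho> k * E k x) + (a1' * w + a0') * E k x) (at x)"
      by (rule derivative_eq_intros E_derivative d refl | simp)+
    have R1: "((\<lambda>x. cnj (g k) * (b1 x * w + b0 x)) has_vector_derivative cnj (g k) * (b1' * w + b0')) (at x)"
      by (rule derivative_eq_intros d refl | simp)+
    have Q1: "(\<lambda>x. (w\<^sup>2 + a1 x * w + a0 x) * E k x) = (\<lambda>x. cnj (g k) * (b1 x * w + b0 x))"
      using relation1[OF k] by (simp add: w_def)
    have D1: "(w\<^sup>2 + a1 x * w + a0 x) * (2 * \<rho> k * E k x) + (a1' * w + a0') * E k x = cnj (g k) * (b1' * w + b0')"
      by (rule vector_derivative_unique_at[OF L1[unfolded Q1] R1])
    have L2: "((\<lambda>x. (b1 x * (- w) + b0 x) * E k x) has_vector_derivative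
        (b1 x * (- w) + b0 x) * (2 * \<rho> k * E k x) + (b1' * (- w) + b0') * E k x) (at x)"
      by (rule derivative_eq_intros E_derivative d refl | simp)+
    have R2: "((\<lambda>x. - g k * ((- w)\<^sup>2 + a1 x * (- w) + a0 x)) has_vector_derivative - g k * (a1' * (- w) + a0')) (at x)"
      by (rule derivative_eq_intros d refl | simp)+
    have Q2: "(\<lambda>x. (b1 x * (- w) + b0 x) * E k x) = (\<lambda>x. - g k * ((- w)\<^sup>2 + a1 x * (- w) + a0 x))"
    proof
      fix x show "(b1 x * (- w) + b0 x) * E k x = - g k * ((- w)\<^sup>2 + a1 x * (- w) + a0 x)"
        using relation2[OF k, of x] E_pos[of k x] unfolding w' by simp
    qed
    have D2: "(b1 x * (- w) + b0 x) * (2 * \<rho> k * E k x) + (b1' * (- w) + b0') * E k x = - g k * (a1' * (- w) + a0')"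
      by (rule vector_derivative_unique_at[OF L2[unfolded Q2] R2])
    have r1: "(w\<^sup>2 + a1 x * w + a0 x) * E k x = cnj (g k) * (b1 x * w + b0 x)"
      using relation1[OF k, of x] by (simp add: w_def)
    have r1c: "(w\<^sup>2 - cnj (a1 x) * w + cnj (a0 x)) * E k x = g k * (- cnj (b1 x) * w + cnj (b0 x))"
      using relation1_cnj[OF k, of x] unfolding w' by simp
    have r2c: "(cnj (b1 x) * w + cnj (b0 x)) * E k x = - cnj (g k) * (w\<^sup>2 + cnj (a1 x) * w + cnj (a0 x))"
      using relation2_cnj[OF k, of x] E0 unfolding w_def[symmetric] by simp
    have i2: "\<i> * \<i> = -1" by simp
    show "((a1' + 2 * \<i> * b1 x * cnj (b1 x)) * (\<i> * \<rho> k) + (a0' + 2 * \<i> * b1 x * cnj (b0 x))) * E k x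
        = cnj (g k) * ((b1' + 2 * \<i> * b0 x - 2 * \<i> * b1 x * cnj (a1 x)) * (\<i> * \<rho> k) + (b0' - 2 * \<i> * b1 x * cnj (a0 x)))"
      using D1 r1 r2c i2 unfolding rw w_def[symmetric] of_real_mult of_real_numeral by algebra
    have "((b1' + 2 * \<i> * b0 x - 2 * \<i> * b1 x * cnj (a1 x)) * (- w) + (b0' - 2 * \<i> * b1 x * cnj (a0 x))) * E k x
        = - g k * ((a1' + 2 * \<i> * b1 x * cnj (b1 x)) * (- w) + (a0' + 2 * \<i> * b1 x * cnj (b0 x)))"
      using D2 r1c i2 unfolding rw of_real_mult of_real_numeral by algebra
    thus "(b1' + 2 * \<i> * b0 x - 2 * \<i> * b1 x * cnj (a1 x)) * (- \<i> * \<rho> k) + (b0' - 2 * \<i> * b1 x * cnj (a0 x))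
        = - g k * ((a1' + 2 * \<i> * b1 x * cnj (b1 x)) * (- \<i> * \<rho> k) + (a0' + 2 * \<i> * b1 x * cnj (b0 x))) / E k x"
      unfolding w' using E0 by (simp add: field_simps)
  qed
  hence "a0' = - 2 * \<i> * b1 x * cnj (b0 x)" "a1' = - 2 * \<i> * b1 x * cnj (b1 x)"
     "b0' = 2 * \<i> * b1 x * cnj (a0 x)" "b1' = - 2 * \<i> * b0 x + 2 * \<i> * b1 x * cnj (a1 x)"
    by (simp_all add: algebra_simps eq_neg_iff_add_eq_0)
  thus "(a1 has_vector_derivative - 2 * \<i> * b1 x * cnj (b1 x)) (at x)"
    "(a0 has_vector_derivative - 2 * \<i> * b1 x * cnj (b0 x)) (at x)"
    "(b1 has_vector_derivative - 2 * \<i> * b0 x + 2 * \<i> * b1 x * cnj (a1 x)) (at x)"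
    "(b0 has_vector_derivative 2 * \<i> * b1 x * cnj (a0 x)) (at x)"
    using d by simp_all
qed

definition G :: "complex \<Rightarrow> complex \<Rightarrow> real \<Rightarrow> complex" where
  "G m l x = exp (2 * \<i> * (m - l) * x) *
    ((m\<^sup>2 + cnj (a1 x) * m + cnj (a0 x)) * (l\<^sup>2 + a1 x * l + a0 x)
      + (b1 x * m + b0 x) * (cnj (b1 x) * l + cnj (b0 x)))"

text \<open>By \<open>coeff_derivatives\<close> the terms with \<open>b1\<close> cancel in pairs,
  and the bracket in \<open>G\<close> has derivative -2i(m - l) B(m) B^c(l), where B^c has
  conjugated coefficients; this removes the B-part of the term coming from the exponential.
  Evaluating at \<open>cnj m\<close> inside the conjugation keeps both sides holomorphic in m, so
  that m = i\<rho>_k is allowed.\<close>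

lemma G_derivative:
  "(G m l has_vector_derivative 2 * \<i> * (m - l) * (cnj (soliton_a \<rho> \<theta> x (cnj m)) * soliton_a \<rho> \<theta> x l)) (at x)"
proof -
  define As where "As = m\<^sup>2 + cnj (a1 x) * m + cnj (a0 x)"
  define A where "A = l\<^sup>2 + a1 x * l + a0 x"
  define B where "B = b1 x * m + b0 x"
  define Bs where "Bs = cnj (b1 x) * l + cnj (b0 x)"
  define ex where "ex = exp (2 * \<i> * (m - l) * complex_of_real x)"
  have dexp: "((\<lambda>x. exp (2 * \<i> * (m - l) * complex_of_real x)) has_vector_derivative 2 * \<i> * (m - l) * ex) (at x)"
    unfolding ex_def
    by (rule has_vector_derivative_real_field[of "\<lambda>z. exp (2 * \<i> * (m - l) * z)"])
       (auto intro!: derivative_eq_intros)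
  note d = coeff_derivatives[of x]
  note dc = d[THEN has_vector_derivative_cnj]
  have 1: "((\<lambda>x. m\<^sup>2 + cnj (a1 x) * m + cnj (a0 x)) has_vector_derivative
      2 * \<i> * cnj (b1 x) * b1 x * m + 2 * \<i> * cnj (b1 x) * b0 x) (at x)"
    by (rule derivative_eq_intros dc refl | simp)+
  have 2: "((\<lambda>x. l\<^sup>2 + a1 x * l + a0 x) has_vector_derivative - 2 * \<i> * b1 x * cnj (b1 x) * l - 2 * \<i> * b1 x * cnj (b0 x)) (at x)"
    by (rule derivative_eq_intros d refl | simp)+
  have 3: "((\<lambda>x. b1 x * m + b0 x) has_vector_derivative (- 2 * \<i> * b0 x + 2 * \<i> * b1 x * cnj (a1 x)) * m + 2 * \<i> * b1 x * cnj (a0 x)) (at x)"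
    by (rule derivative_eq_intros d refl | simp)+
  have 4: "((\<lambda>x. cnj (b1 x) * l + cnj (b0 x)) has_vector_derivative
      (2 * \<i> * cnj (b0 x) - 2 * \<i> * cnj (b1 x) * a1 x) * l - 2 * \<i> * cnj (b1 x) * a0 x) (at x)"
    by (rule derivative_eq_intros dc refl | simp)+
  have "(G m l has_vector_derivative ex *
      ((As * (- 2 * \<i> * b1 x * cnj (b1 x) * l - 2 * \<i> * b1 x * cnj (b0 x))
         + (2 * \<i> * cnj (b1 x) * b1 x * m + 2 * \<i> * cnj (b1 x) * b0 x) * A)
      + (B * ((2 * \<i> * cnj (b0 x) - 2 * \<i> * cnj (b1 x) * a1 x) * l - 2 * \<i> * cnj (b1 x) * a0 x)
         + ((- 2 * \<i> * b0 x + 2 * \<i> * b1 x * cnj (a1 x)) * m + 2 * \<i> * b1 x * cnj (a0 x)) * Bs))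
      + 2 * \<i> * (m - l) * ex * (As * A + B * Bs)) (at x)"
    unfolding G_def[abs_def] As_def A_def B_def Bs_def ex_def[symmetric]
    by (intro has_vector_derivative_mult[OF dexp, folded ex_def] has_vector_derivative_mult
      has_vector_derivative_add has_vector_derivative_mult[OF 1 2] has_vector_derivative_mult[OF 3 4])
  also have "ex *
      ((As * (- 2 * \<i> * b1 x * cnj (b1 x) * l - 2 * \<i> * b1 x * cnj (b0 x))
         + (2 * \<i> * cnj (b1 x) * b1 x * m + 2 * \<i> * cnj (b1 x) * b0 x) * A)
      + (B * ((2 * \<i> * cnj (b0 x) - 2 * \<i> * cnj (b1 x) * a1 x) * l - 2 * \<i> * cnj (b1 x) * a0 x)
         + ((- 2 * \<i> * b0 x + 2 * \<i> * b1 x * cnj (a1 x)) * m + 2 * \<i> * b1 x * cnj (a0 x)) * Bs))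
      + 2 * \<i> * (m - l) * ex * (As * A + B * Bs) = 2 * \<i> * (m - l) * (ex * As * A)"
    unfolding As_def A_def B_def Bs_def by algebra
  also have "ex * As * A = cnj (soliton_a \<rho> \<theta> x (cnj m)) * soliton_a \<rho> \<theta> x l"
    unfolding soliton_a_eq As_def A_def ex_def
    by (simp add: exp_cnj algebra_simps exp_diff exp_minus field_simps)
  finally show ?thesis .
qed

end

section \<open>Poisson kernels and the isometry property\<close>

definition ew :: "real \<Rightarrow> real \<Rightarrow> real" where
  "ew \<epsilon> x = indicator {0..} x * exp (- (2 * \<epsilon> * x))"

lemma ew_measurable [measurable]: "ew \<epsilon> \<in> borel_measurable borel"
  unfolding ew_def[abs_def] by measurable

lemma ew_nonneg: "0 \<le> ew \<epsilon> x"
  by (simp add: ew_def)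

lemma ew_integral:
  assumes "\<epsilon> > 0"
  shows "has_bochner_integral lborel (ew \<epsilon>) (1 / (2 * \<epsilon>))"
proof (rule has_bochner_integral_nn_integral)
  have "filterlim (\<lambda>x. 2 * \<epsilon> * x) at_top at_top"
    using assms by (intro filterlim_tendsto_pos_mult_at_top[OF tendsto_const _ filterlim_ident]) auto
  hence lim0: "((\<lambda>x. exp (- (2 * \<epsilon> * x))) \<longlongrightarrow> 0) at_top"
    by (intro filterlim_compose[OF exp_at_bot]) (simp add: filterlim_uminus_at_top)
  have lim: "((\<lambda>x. - exp (- (2 * \<epsilon> * x)) / (2 * \<epsilon>)) \<longlongrightarrow> - 0 / (2 * \<epsilon>)) at_top"
    using assms by (intro tendsto_intros lim0) auto
  have "(\<integral>\<^sup>+x. ennreal (exp (- (2 * \<epsilon> * x))) * indicator {0..} x \<partial>lborel)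
      = ennreal (- 0 / (2 * \<epsilon>) - (- exp (- (2 * \<epsilon> * 0)) / (2 * \<epsilon>)))"
    by (rule nn_integral_FTC_atLeast[OF _ _ _ lim]) (use assms in \<open>auto intro!: derivative_eq_intros\<close>)
  thus "(\<integral>\<^sup>+x. ennreal (ew \<epsilon> x) \<partial>lborel) = ennreal (1 / (2 * \<epsilon>))"
    by (simp add: ew_def ennreal_mult ennreal_indicator mult.commute)
qed (use assms in \<open>auto simp: ew_nonneg\<close>)

text \<open>A Laplace transform at 2\<epsilon>. The two half-lines are treated separately because
  \<open>G\<close> has different limiting forms at the two ends.\<close>

definition HL :: "real \<Rightarrow> (real \<Rightarrow> complex) \<Rightarrow> complex" where
  "HL \<epsilon> F = (LINT x|lborel. complex_of_real (ew \<epsilon> x) * F x)"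

lemma HL_integrable:
  assumes "\<epsilon> > 0" "F \<in> borel_measurable borel" "\<And>x. x \<ge> 0 \<Longrightarrow> cmod (F x) \<le> B"
  shows "integrable lborel (\<lambda>x. complex_of_real (ew \<epsilon> x) * F x)"
proof (rule Bochner_Integration.integrable_bound)
  show "integrable lborel (\<lambda>x. ew \<epsilon> x * B)"
    using ew_integral[OF assms(1)] by (simp add: has_bochner_integral_iff)
  show "(\<lambda>x. complex_of_real (ew \<epsilon> x) * F x) \<in> borel_measurable lborel"
    using assms(2) by simp
  show "AE x in lborel. norm (complex_of_real (ew \<epsilon> x) * F x) \<le> norm (ew \<epsilon> x * B)"
    using assms(3) by (intro AE_I2)
      (auto simp: norm_mult abs_mult ew_def split: split_indicator intro: order_trans[OF _ abs_ge_self])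
qed

text \<open>The bound is independent of \<epsilon>, as the decay of \<open>F\<close> alone is
  integrated. Multiplied by \<epsilon>, such terms disappear in the limit.\<close>

lemma HL_bound:
  assumes "\<epsilon> > 0" "c > 0" "F \<in> borel_measurable borel" "\<And>x. x \<ge> 0 \<Longrightarrow> cmod (F x) \<le> B * exp (- (2 * c * x))" "0 \<le> B"
  shows "cmod (HL \<epsilon> F) \<le> B / (2 * c)"
proof -
  have "cmod (HL \<epsilon> F) \<le> (LINT x|lborel. cmod (complex_of_real (ew \<epsilon> x) * F x))"
    unfolding HL_def by (rule integral_norm_bound)
  also have "\<dots> \<le> (LINT x|lborel. B * ew c x)"
  proof (intro integral_mono_AE AE_I2)
    have "exp (- (2 * c * x)) \<le> 1" if "x \<ge> 0" for x using assms(2) that by simp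
    hence "cmod (F x) \<le> B" if "x \<ge> 0" for x
      using assms(4)[OF that] mult_left_mono[of "exp (- (2 * c * x))" 1 B] assms(5) that by fastforce
    thus "integrable lborel (\<lambda>x. cmod (complex_of_real (ew \<epsilon> x) * F x))"
      by (intro integrable_norm HL_integrable assms)
    show "integrable lborel (\<lambda>x. B * ew c x)"
      using ew_integral[OF assms(2)] by (simp add: has_bochner_integral_iff)
    fix x :: real
    show "cmod (complex_of_real (ew \<epsilon> x) * F x) \<le> B * ew c x"
    proof (cases "x \<ge> 0")
      case True
      have "exp (- (2 * \<epsilon> * x)) * cmod (F x) \<le> 1 * (B * exp (- (2 * c * x)))"
        using True assms by (intro mult_mono) auto
      thus ?thesis using True by (simp add: ew_def norm_mult)
    qed (simp add: ew_def)
  qed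
  also have "\<dots> = B / (2 * c)"
    using ew_integral[OF assms(2)] by (simp add: has_bochner_integral_iff)
  finally show ?thesis .
qed

lemma HL_derivative:
  assumes "\<epsilon> > 0" and F: "\<And>x. (F has_vector_derivative F' x) (at x)" and c: "continuous_on UNIV F'"
    and B: "\<And>x. cmod (F x) \<le> B" "\<And>x. cmod (F' x) \<le> B"
  shows "HL \<epsilon> F' = - F 0 + 2 * complex_of_real \<epsilon> * HL \<epsilon> F"
proof -
  have cF: "continuous_on UNIV F"
    using F has_vector_derivative_continuous by (intro continuous_at_imp_continuous_on ballI) blast
  have Fm: "F \<in> borel_measurable borel" "F' \<in> borel_measurable borel"
    using cF c by (auto intro: borel_measurable_continuous_onI)
  note I1 = HL_integrable[OF assms(1) Fm(1) B(1)] and I2 = HL_integrable[OF assms(1) Fm(2) B(2)]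
  define h where "h x = complex_of_real (ew \<epsilon> x) * F' x - 2 * \<epsilon> * (complex_of_real (ew \<epsilon> x) * F x)" for x
  have hi: "integrable lborel h"
    unfolding h_def using I1 I2 by (intro Bochner_Integration.integrable_diff integrable_mult_right) auto
  have "(\<lambda>n. LINT x|lborel. indicator {..real n} x *\<^sub>R h x) \<longlonglongrightarrow> (LINT x|lborel. h x)"
    by (rule filterlim_compose[OF tendsto_integral_at_top[OF _ hi] filterlim_real_sequentially]) simp
  moreover have "(LINT x|lborel. indicator {..real n} x *\<^sub>R h x) = exp (- (2 * \<epsilon> * n)) * F n - F 0" for n :: nat
  proof -
    define E where "E x = complex_of_real (exp (- (2 * \<epsilon> * x)))" for x
    have dE: "(E has_vector_derivative (- (2 * \<epsilon>)) * E x) (at x)" for x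
    proof -
      have "((\<lambda>x. exp (- (2 * \<epsilon> * x))) has_real_derivative - (2 * \<epsilon>) * exp (- (2 * \<epsilon> * x))) (at x)"
        by (auto intro!: derivative_eq_intros)
      from has_vector_derivative_of_real[OF this]
      show ?thesis unfolding E_def[abs_def] by simp
    qed
    have cE: "continuous_on UNIV E" unfolding E_def[abs_def] by (intro continuous_intros)
    have "(LINT x|lborel. indicator {..real n} x *\<^sub>R h x)
        = (LINT x|lborel. indicator {0..real n} x *\<^sub>R (E x * F' x + - (2 * \<epsilon>) * E x * F x))"
      by (intro Bochner_Integration.integral_cong) (auto simp: h_def ew_def E_def split: split_indicator)
    also have "\<dots> = E n * F n - E 0 * F 0"
    proof (rule integral_FTC_atLeastAtMost)
      show "((\<lambda>x. E x * F x) has_vector_derivative E x * F' x + - (2 * \<epsilon>) * E x * F x) (at x within {0..real n})" for x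
        by (rule has_vector_derivative_at_within) (rule has_vector_derivative_mult[OF dE F])
      show "continuous_on {0..real n} (\<lambda>x. E x * F' x + - (2 * \<epsilon>) * E x * F x)"
        by (intro continuous_intros continuous_on_subset[OF cE] continuous_on_subset[OF cF] continuous_on_subset[OF c]) auto
    qed simp
    finally show ?thesis by (simp add: E_def)
  qed
  moreover have "(\<lambda>n. exp (- (2 * \<epsilon> * real n)) * F n - F 0) \<longlonglongrightarrow> 0 - F 0"
  proof (intro tendsto_diff tendsto_const)
    have "filterlim (\<lambda>x. 2 * \<epsilon> * x) at_top at_top"
      using assms by (intro filterlim_tendsto_pos_mult_at_top[OF tendsto_const _ filterlim_ident]) auto
    hence lim0: "((\<lambda>x. exp (- (2 * \<epsilon> * x))) \<longlongrightarrow> 0) at_top"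
      by (intro filterlim_compose[OF exp_at_bot]) (simp add: filterlim_uminus_at_top)
    have l: "(\<lambda>n. exp (- (2 * \<epsilon> * real n)) * B) \<longlonglongrightarrow> 0"
      using tendsto_mult_left_zero[OF filterlim_compose[OF lim0 filterlim_real_sequentially], of B] by simp
    show "(\<lambda>n. exp (- (2 * \<epsilon> * real n)) * F n) \<longlonglongrightarrow> 0"
      by (rule Lim_null_comparison[OF _ l]) (use B in \<open>auto simp: norm_mult\<close>)
  qed
  ultimately have "(LINT x|lborel. h x) = 0 - F 0" using LIMSEQ_unique by simp
  moreover have "(LINT x|lborel. h x) = HL \<epsilon> F' - 2 * \<epsilon> * HL \<epsilon> F"
    unfolding h_def HL_def using I1 I2 by simp
  ultimately show ?thesis by (simp add: algebra_simps)
qed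

lemma HL_exp:
  fixes d :: real
  assumes "\<epsilon> > 0"
  shows "HL \<epsilon> (\<lambda>x. exp (2 * \<i> * d * x)) = 1 / (2 * (\<epsilon> - \<i> * d))"
proof -
  have n: "cmod (exp (2 * \<i> * complex_of_real d * complex_of_real x)) = 1" for x by simp
  have d: "((\<lambda>x. exp (2 * \<i> * d * complex_of_real x)) has_vector_derivative 2 * \<i> * d * exp (2 * \<i> * d * complex_of_real x)) (at x)" for x
    by (rule has_vector_derivative_real_field[of "\<lambda>z. exp (2 * \<i> * d * z)"]) (auto intro!: derivative_eq_intros)
  have "HL \<epsilon> (\<lambda>x. 2 * \<i> * d * exp (2 * \<i> * d * complex_of_real x))
    = - exp (2 * \<i> * d * complex_of_real 0) + 2 * complex_of_real \<epsilon> * HL \<epsilon> (\<lambda>x. exp (2 * \<i> * d * complex_of_real x))"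
    by (rule HL_derivative[where F="\<lambda>x. exp (2 * \<i> * d * complex_of_real x)"
      and F'="\<lambda>x. 2 * \<i> * d * exp (2 * \<i> * d * complex_of_real x)" and B="1 + 2 * \<bar>d\<bar>", OF assms d]) (auto simp: norm_mult n intro!: continuous_intros)
  moreover have "HL \<epsilon> (\<lambda>x. 2 * \<i> * d * exp (2 * \<i> * d * complex_of_real x)) = 2 * \<i> * d * HL \<epsilon> (\<lambda>x. exp (2 * \<i> * d * complex_of_real x))"
    unfolding HL_def
    by (subst integral_mult_right_zero[symmetric]) (intro Bochner_Integration.integral_cong, auto)
  ultimately have "HL \<epsilon> (\<lambda>x. exp (2 * \<i> * d * complex_of_real x)) * (2 * (\<epsilon> - \<i> * d)) = 1"
    by (simp add: algebra_simps)
  moreover have "2 * (\<epsilon> - \<i> * d) \<noteq> 0" using assms by (simp add: complex_eq_iff)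
  ultimately show ?thesis by (simp add: eq_divide_eq)
qed

lemma LINT_reflect_split:
  fixes f :: "real \<Rightarrow> complex"
  assumes "f \<in> borel_measurable borel" "\<And>x. cmod (f x) \<le> B" "\<epsilon> > 0"
  shows "(LINT x|lborel. complex_of_real (exp (- (2 * \<epsilon> * \<bar>x\<bar>))) * f x) = HL \<epsilon> f + HL \<epsilon> (\<lambda>x. f (- x))"
    and "integrable lborel (\<lambda>x. complex_of_real (exp (- (2 * \<epsilon> * \<bar>x\<bar>))) * f x)"
proof -
  note [measurable] = assms(1)
  define p where "p x = complex_of_real (ew \<epsilon> x) * f x" for x
  define q where "q x = complex_of_real (ew \<epsilon> x) * f (- x)" for x
  have p: "integrable lborel p" unfolding p_def by (rule HL_integrable[OF assms(3,1,2)])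
  have q: "integrable lborel q" unfolding q_def by (rule HL_integrable[OF assms(3) _ assms(2)]) measurable
  have q': "integrable lborel (\<lambda>x. q (- x))" using lborel_integrable_real_affine[OF q, of "-1" 0] by simp
  \<comment> \<open>At 0 both halves contribute, so the splitting holds only almost
    everywhere.\<close>
  have ae: "AE x in lborel. complex_of_real (exp (- (2 * \<epsilon> * \<bar>x\<bar>))) * f x = p x + q (- x)"
    using AE_lborel_singleton[of 0]
    by eventually_elim (auto simp: p_def q_def ew_def split: split_indicator)
  have [measurable]: "p \<in> borel_measurable borel" "q \<in> borel_measurable borel" unfolding p_def q_def by measurable
  have I: "integrable lborel (\<lambda>x. p x + q (- x))" using p q' by simp
  show "integrable lborel (\<lambda>x. complex_of_real (exp (- (2 * \<epsilon> * \<bar>x\<bar>))) * f x)"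
    by (subst integrable_cong_AE[OF _ _ ae]) (use I in auto)
  have "(LINT x|lborel. complex_of_real (exp (- (2 * \<epsilon> * \<bar>x\<bar>))) * f x) = (LINT x|lborel. p x + q (- x))"
    by (rule integral_cong_AE[OF _ _ ae]) auto
  also have "\<dots> = (LINT x|lborel. p x) + (LINT x|lborel. q (- x))" using p q' by simp
  also have "(LINT x|lborel. q (- x)) = (LINT x|lborel. q x)"
    using lborel_integral_real_affine[of "-1" q 0] by simp
  finally show "(LINT x|lborel. complex_of_real (exp (- (2 * \<epsilon> * \<bar>x\<bar>))) * f x) = HL \<epsilon> f + HL \<epsilon> (\<lambda>x. f (- x))"
    by (simp add: HL_def p_def q_def)
qed

lemma Cauchy_kernel_integral: "has_bochner_integral lborel (\<lambda>s::real. 1 / (1 + s\<^sup>2)) pi"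
proof -
  have ct: "isCont (\<lambda>s::real. 1 / (1 + s\<^sup>2)) x" for x
    by (intro continuous_intros) (simp add: add_nonneg_eq_0_iff)
  have l: "((arctan \<circ> real_of_ereal) \<longlongrightarrow> - (pi / 2)) (at_right (- \<infinity>))"
    unfolding ereal_tendsto_simps by (rule tendsto_arctan_at_bot)
  have r: "((arctan \<circ> real_of_ereal) \<longlongrightarrow> pi / 2) (at_left \<infinity>)"
    unfolding ereal_tendsto_simps by (rule tendsto_arctan_at_top)
  have d: "DERIV arctan x :> 1 / (1 + x\<^sup>2)" for x
    using DERIV_arctan[of x] by (simp add: divide_inverse)
  have I: "set_integrable lborel (einterval (- \<infinity>) \<infinity>) (\<lambda>s::real. 1 / (1 + s\<^sup>2))"
    and L: "(LBINT s=-\<infinity>..\<infinity>. 1 / (1 + s\<^sup>2)) = pi / 2 - - (pi / 2)"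
    by (rule interval_integral_FTC_nonneg[OF _ d ct _ l r]; simp)+
  thus ?thesis
    by (simp add: has_bochner_integral_iff interval_lebesgue_integral_def einterval_eq_UNIV set_integrable_def set_lebesgue_integral_def)
qed

lemma Poisson_kernel_integral:
  assumes "\<epsilon> > 0"
  shows "has_bochner_integral lborel (\<lambda>m::real. \<epsilon> / (\<epsilon>\<^sup>2 + (l - m)\<^sup>2)) pi"
proof -
  define f where "f s = (1 / (1 + s\<^sup>2) :: real)" for s :: real
  have e: "\<epsilon> / (\<epsilon>\<^sup>2 + (l - m)\<^sup>2) = (1/\<epsilon>) * f (- l / \<epsilon> + (1/\<epsilon>) * m)" for m
  proof -
    have "- l / \<epsilon> + (1/\<epsilon>) * m = (m - l) / \<epsilon>" by (simp add: diff_divide_distrib)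
    hence "f (- l / \<epsilon> + (1/\<epsilon>) * m) = \<epsilon>\<^sup>2 / (\<epsilon>\<^sup>2 + (m - l)\<^sup>2)"
      using assms by (simp add: f_def power_divide field_simps)
    thus ?thesis using assms unfolding power2_commute[of l m] by (simp add: power2_eq_square)
  qed
  have f: "integrable lborel f" "(LINT s|lborel. f s) = pi"
    using Cauchy_kernel_integral unfolding has_bochner_integral_iff f_def by auto
  have "integrable lborel (\<lambda>m. f (- l / \<epsilon> + (1/\<epsilon>) * m))"
    using lborel_integrable_real_affine[OF f(1), of "1/\<epsilon>" "- l / \<epsilon>"] assms by simp
  moreover have "(LINT m|lborel. (1/\<epsilon>) * f (- l / \<epsilon> + (1/\<epsilon>) * m)) = pi"
    using lborel_integral_real_affine[of "1/\<epsilon>" f "- l / \<epsilon>"] f(2) assms by simp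
  ultimately show ?thesis unfolding has_bochner_integral_iff e by simp
qed

lemma integrable_compact_support:
  fixes f :: "real \<Rightarrow> complex"
  assumes [measurable]: "f \<in> borel_measurable borel" and "\<And>x. cmod (f x) \<le> B" "\<And>x. \<bar>x\<bar> > N \<Longrightarrow> f x = 0"
  shows "integrable lborel f"
proof (rule Bochner_Integration.integrable_bound)
  have "integrable lborel (indicator {-N..N} :: real \<Rightarrow> real)"
    using emeasure_compact_finite[of "{-N..N}"] by (intro integrable_real_indicator) auto
  thus "integrable lborel (\<lambda>x. B * indicator {-N..N} x :: real)" by simp
  show "AE x in lborel. norm (f x) \<le> norm (B * indicator {-N..N} x :: real)"
  proof (rule AE_I2)
    fix x show "norm (f x) \<le> norm (B * indicator {-N..N} x :: real)"
      using assms(2)[of x] assms(3)[of x] by (cases "\<bar>x\<bar> \<le> N") (auto simp: indicator_def)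
  qed
qed simp

lemma Poisson_approximate_identity:
  fixes u :: "real \<Rightarrow> complex"
  assumes u: "continuous_on UNIV u" and B: "\<And>x. cmod (u x) \<le> B" and N: "\<And>x. \<bar>x\<bar> > N \<Longrightarrow> u x = 0"
    and e: "\<And>n. e n > 0" "e \<longlonglongrightarrow> 0"
  shows "(\<lambda>n. LINT m|lborel. cnj (u m) * (LINT l|lborel. u l * complex_of_real (e n / ((e n)\<^sup>2 + (m - l)\<^sup>2))))
     \<longlonglongrightarrow> pi * (LINT m|lborel. (cmod (u m))\<^sup>2)"
proof -
  have [measurable]: "u \<in> borel_measurable borel" by (rule borel_measurable_continuous_onI[OF u])
  note C = Cauchy_kernel_integral[unfolded has_bochner_integral_iff]
  have CI: "integrable lborel (\<lambda>s::real. B * (1 / (1 + s\<^sup>2)))" for B :: real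
    using C by (intro integrable_mult_right) auto
  have CL: "(LINT s::real|lborel. B * (1 / (1 + s\<^sup>2))) = B * pi" for B :: real
    unfolding integral_mult_right_zero using C by simp
  have uI: "integrable lborel u" by (rule integrable_compact_support[OF _ B N]) auto
  \<comment> \<open>The inner integral after the substitution l = m + e_n s, which moves the
    dependence on n from the kernel into the continuous function \<open>u\<close>.\<close>
  define v where "v n m = (LINT s|lborel. u (m + e n * s) * complex_of_real (1 / (1 + s\<^sup>2)))" for n m
  have v: "(LINT l|lborel. u l * complex_of_real (e n / ((e n)\<^sup>2 + (m - l)\<^sup>2))) = v n m" for n m
  proof -
    have en: "e n \<noteq> 0" using e(1)[of n] by simp
    have eq: "e n * (e n / ((e n)\<^sup>2 + (m - (m + e n * s))\<^sup>2)) = 1 / (1 + s\<^sup>2)" for s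
    proof -
      have "(e n)\<^sup>2 + (m - (m + e n * s))\<^sup>2 = (e n)\<^sup>2 * (1 + s\<^sup>2)" by (simp add: power2_eq_square algebra_simps)
      thus ?thesis using en by (simp add: power2_eq_square)
    qed
    have "(LINT l|lborel. u l * complex_of_real (e n / ((e n)\<^sup>2 + (m - l)\<^sup>2)))
       = e n *\<^sub>R (LINT s|lborel. u (m + e n * s) * complex_of_real (e n / ((e n)\<^sup>2 + (m - (m + e n * s))\<^sup>2)))"
      using lborel_integral_real_affine[OF en, of "\<lambda>l. u l * complex_of_real (e n / ((e n)\<^sup>2 + (m - l)\<^sup>2))" m] e(1)[of n] by simp
    also have "\<dots> = (LINT s|lborel. u (m + e n * s) * complex_of_real (e n * (e n / ((e n)\<^sup>2 + (m - (m + e n * s))\<^sup>2))))"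
      unfolding scaleR_conv_of_real
      by (subst integral_mult_right_zero[symmetric]) (intro Bochner_Integration.integral_cong, auto)
    finally show ?thesis unfolding eq v_def .
  qed
  have vb: "cmod (v n m) \<le> B * pi" for n m
  proof -
    have "cmod (v n m) \<le> (LINT s|lborel. cmod (u (m + e n * s) * complex_of_real (1 / (1 + s\<^sup>2))))"
      unfolding v_def by (rule integral_norm_bound)
    also have "\<dots> \<le> (LINT s|lborel. B * (1 / (1 + s\<^sup>2)))"
    proof (rule integral_mono_AE)
      have bd: "norm (u (m + e n * s) * complex_of_real (1 / (1 + s\<^sup>2))) \<le> B * (1 / (1 + s\<^sup>2))" for s
        unfolding norm_mult norm_of_real
        using mult_right_mono[OF B[of "m + e n * s"], of "1 / (1 + s\<^sup>2)"] by (simp add: abs_of_nonneg)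
      thus "AE s in lborel. cmod (u (m + e n * s) * complex_of_real (1 / (1 + s\<^sup>2))) \<le> B * (1 / (1 + s\<^sup>2))" by simp
      show "integrable lborel (\<lambda>s. B * (1 / (1 + s\<^sup>2)))" by (rule CI)
      thus "integrable lborel (\<lambda>s. cmod (u (m + e n * s) * complex_of_real (1 / (1 + s\<^sup>2))))"
      proof (rule Bochner_Integration.integrable_bound)
        show "AE s in lborel. norm (cmod (u (m + e n * s) * complex_of_real (1 / (1 + s\<^sup>2)))) \<le> norm (B * (1 / (1 + s\<^sup>2)))"
          by (rule AE_I2) (use order_trans[OF bd abs_ge_self] in \<open>simp only: real_norm_def abs_norm_cancel\<close>)
      qed measurable
    qed
    also have "\<dots> = B * pi" by (rule CL)
    finally show ?thesis .
  qed
  have [measurable]: "v n \<in> borel_measurable borel" for n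
    unfolding v_def[abs_def] by measurable
  have vl: "(\<lambda>n. v n m) \<longlonglongrightarrow> u m * pi" for m
  proof -
    have "(\<lambda>n. v n m) \<longlonglongrightarrow> (LINT s|lborel. u m * complex_of_real (1 / (1 + s\<^sup>2)))"
      unfolding v_def
    proof (rule integral_dominated_convergence[where w="\<lambda>s. B * (1 / (1 + s\<^sup>2))"])
      show "integrable lborel (\<lambda>s. B * (1 / (1 + s\<^sup>2)))" by (rule CI)
      show "AE s in lborel. (\<lambda>n. u (m + e n * s) * complex_of_real (1 / (1 + s\<^sup>2))) \<longlonglongrightarrow> u m * complex_of_real (1 / (1 + s\<^sup>2))"
      proof (rule AE_I2, intro tendsto_mult tendsto_const)
        fix s :: real
        have "(\<lambda>n. m + e n * s) \<longlonglongrightarrow> m + 0 * s" by (intro tendsto_intros e)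
        hence "(\<lambda>n. m + e n * s) \<longlonglongrightarrow> m" by simp
        thus "(\<lambda>n. u (m + e n * s)) \<longlonglongrightarrow> u m"
          using u by (intro isCont_tendsto_compose[of _ u]) (auto simp: continuous_on_eq_continuous_at)
      qed
      show "AE s in lborel. norm (u (m + e n * s) * complex_of_real (1 / (1 + s\<^sup>2))) \<le> B * (1 / (1 + s\<^sup>2))" for n
      proof (rule AE_I2)
        fix s :: real
        show "norm (u (m + e n * s) * complex_of_real (1 / (1 + s\<^sup>2))) \<le> B * (1 / (1 + s\<^sup>2))"
          unfolding norm_mult norm_of_real
          using mult_right_mono[OF B[of "m + e n * s"], of "1 / (1 + s\<^sup>2)"] by (simp add: abs_of_nonneg)
      qed
    qed auto
    also have "(LINT s|lborel. u m * complex_of_real (1 / (1 + s\<^sup>2))) = u m * of_real (LINT s|lborel. 1 / (1 + s\<^sup>2))"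
      by (simp only: integral_mult_right_zero integral_complex_of_real)
    finally show ?thesis using C by simp
  qed
  have B0: "0 \<le> B" using B[of 0] norm_ge_zero order_trans by blast
  have "(\<lambda>n. LINT m|lborel. cnj (u m) * v n m) \<longlonglongrightarrow> (LINT m|lborel. cnj (u m) * (u m * pi))"
  proof (rule integral_dominated_convergence[where w="\<lambda>m. cmod (u m) * (B * pi)"])
    show "integrable lborel (\<lambda>m. cmod (u m) * (B * pi))" using uI by simp
    show "AE m in lborel. (\<lambda>n. cnj (u m) * v n m) \<longlonglongrightarrow> cnj (u m) * (u m * pi)"
      by (intro AE_I2 tendsto_intros vl)
    show "AE m in lborel. norm (cnj (u m) * v n m) \<le> cmod (u m) * (B * pi)" for n
      by (intro AE_I2) (simp add: norm_mult mult_left_mono vb)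
  qed auto
  also have "(LINT m|lborel. cnj (u m) * (u m * pi)) = (LINT m|lborel. complex_of_real (pi * (cmod (u m))\<^sup>2))"
    unfolding of_real_mult complex_norm_square by (simp only: mult_ac)
  also have "\<dots> = of_real (LINT m|lborel. pi * (cmod (u m))\<^sup>2)" by (rule integral_complex_of_real)
  finally show ?thesis unfolding v by simp
qed

section \<open>Limiting forms of the antiderivative\<close>

context soliton
begin

text \<open>For real l, the limit of A as x tends to +infinity, by \<open>asymptotics\<close>; at
  -infinity the limit is the conjugate.\<close>

definition Ap :: "real \<Rightarrow> complex" where "Ap l = (l - \<i> * \<rho> 1) * (l - \<i> * \<rho> 2)"

lemma Ap_norm: "(cmod (Ap l))\<^sup>2 = P l"
proof -
  have "(cmod (complex_of_real l - \<i> * r))\<^sup>2 = l\<^sup>2 + r\<^sup>2" for r :: real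
    by (simp add: cmod_power2)
  thus ?thesis by (simp add: Ap_def norm_mult power_mult_distrib P_def)
qed

lemma coeff_continuous:
  "continuous_on UNIV a0" "continuous_on UNIV a1" "continuous_on UNIV b0" "continuous_on UNIV b1"
  using has_vector_derivative_continuous[OF coeff_derivatives(1)] has_vector_derivative_continuous[OF coeff_derivatives(2)]
    has_vector_derivative_continuous[OF coeff_derivatives(3)] has_vector_derivative_continuous[OF coeff_derivatives(4)]
  by (auto intro: continuous_at_imp_continuous_on)

lemma soliton_a_continuous: "continuous_on UNIV (\<lambda>x. soliton_a \<rho> \<theta> x l)"
  unfolding soliton_a_eq by (intro continuous_intros coeff_continuous)

lemma coeff_measurable [measurable]:
  "a0 \<in> borel_measurable borel" "a1 \<in> borel_measurable borel"
  "b0 \<in> borel_measurable borel" "b1 \<in> borel_measurable borel"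
  using coeff_continuous by (auto intro: borel_measurable_continuous_onI)

lemma soliton_a_measurable [measurable]:
  "(\<lambda>(x, l). soliton_a \<rho> \<theta> x (complex_of_real l)) \<in> borel_measurable (borel \<Otimes>\<^sub>M borel)"
  unfolding soliton_a_eq by measurable

lemma soliton_a_real_bound: "cmod (soliton_a \<rho> \<theta> x (complex_of_real l)) \<le> sqrt (P l)"
  using soliton_a_norm(1)[of l x] by (simp add: soliton_a_eq norm_mult)

lemma P_mono: "\<bar>l\<bar> \<le> N \<Longrightarrow> P l \<le> P N"
  unfolding P_def by (intro mult_mono add_right_mono) (auto simp: power2_le_iff_abs_le abs_le_square_iff)

text \<open>$G$ and its limiting form at $\pm\infty$ agree on the diagonal by unitarity, hence their
  difference is $O(|m - l|)$, with the exponential decay of the coefficients.\<close>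

lemma G_real:
  "G (complex_of_real m) (complex_of_real l) x = exp (2 * \<i> * complex_of_real (m - l) * x) *
    (cnj (m\<^sup>2 + a1 x * m + a0 x) * (l\<^sup>2 + a1 x * l + a0 x) + (b1 x * m + b0 x) * cnj (b1 x * l + b0 x))"
  by (simp add: G_def)

lemma G_bound:
  assumes "\<bar>m\<bar> \<le> N" "\<bar>l\<bar> \<le> N"
  shows "cmod (G (complex_of_real m) (complex_of_real l) x) \<le> 2 * P N"
proof -
  have s: "sqrt (P m) * sqrt (P l) \<le> P N"
    using mult_mono[OF real_sqrt_le_mono[OF P_mono[OF assms(1)]] real_sqrt_le_mono[OF P_mono[OF assms(2)]]]
      P_pos[of N] P_pos[of l] by simp
  have "cmod (G (complex_of_real m) (complex_of_real l) x) \<le>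
     cmod (m\<^sup>2 + a1 x * m + a0 x) * cmod (l\<^sup>2 + a1 x * l + a0 x) + cmod (b1 x * m + b0 x) * cmod (b1 x * l + b0 x)"
    unfolding G_real norm_mult[of "exp _"]
    by (rule order_trans[OF mult_left_le_one_le norm_triangle_le]) (auto simp: norm_mult simp del: complex_cnj_add complex_cnj_mult)
  also have "\<dots> \<le> sqrt (P m) * sqrt (P l) + sqrt (P m) * sqrt (P l)"
    by (intro add_mono mult_mono soliton_a_norm) (auto simp: P_pos less_imp_le)
  finally show ?thesis using s by linarith
qed

definition Lq :: "complex \<Rightarrow> real \<Rightarrow> complex" where
  "Lq s l = (complex_of_real l)\<^sup>2 - s * \<i> * complex_of_real S * complex_of_real l - complex_of_real (\<rho> 1 * \<rho> 2)"

text \<open>What remains of the bracket in \<open>G\<close> as x tends to s times infinity, where B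
  vanishes.\<close>

definition Nlim :: "complex \<Rightarrow> real \<Rightarrow> real \<Rightarrow> complex" where
  "Nlim s m l = cnj (Lq s m) * Lq s l"

lemma Ap_eq: "Ap l = Lq 1 l" "cnj (Ap l) = Lq (-1) l"
proof -
  have i2: "\<i> * (\<i> * c) = - c" for c by (simp flip: mult.assoc)
  show "Ap l = Lq 1 l" by (simp add: Ap_def Lq_def S_def power2_eq_square algebra_simps i2)
  thus "cnj (Ap l) = Lq (-1) l" by (simp add: Lq_def)
qed

lemma Nlim_Ap: "Nlim 1 m l = cnj (Ap m) * Ap l" "Nlim (-1) m l = Ap m * cnj (Ap l)"
  unfolding Nlim_def Ap_eq(2)[symmetric] Ap_eq(1)[symmetric] by simp_all

lemma Nlim_diagonal: "s = 1 \<or> s = -1 \<Longrightarrow> Nlim s l l = P l"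
  using complex_norm_square[of "Ap l"] by (auto simp: Nlim_Ap Ap_norm mult.commute)

lemma S_pos: "S > 0" using \<rho>_pos \<rho>_less by (simp add: S_def)

text \<open>The first product is the Lipschitz constant of \<open>Nlim\<close>; the other three
  collect the four terms of \<open>split\<close> in \<open>G_limit_difference\<close>.\<close>

definition CD :: "real \<Rightarrow> real" where
  "CD N = (2 * N + S) * (N\<^sup>2 + S * N + \<rho> 1 * \<rho> 2) + K * (N\<^sup>2 + S * N + \<rho> 1 * \<rho> 2) + K * (N + 1) * (2 * N + S) + 2 * K * (K * (N + 1))"

lemma KA_nonneg: "0 \<le> KA" using CB_ge \<rho>_pos \<rho>_less by (simp add: KA_def)

lemma K_nonneg: "0 \<le> K" using KA_nonneg \<rho>_pos \<rho>_less by (simp add: K_def)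

lemma e_bounds: "0 < e x" "e x \<le> 1"
  using \<rho>_pos by (auto simp: e_def)

lemma limit_poly_bounds:
  assumes "\<bar>m\<bar> \<le> N" "\<bar>l\<bar> \<le> N" "s = 1 \<or> s = -1"
  shows "cmod (Lq s l) \<le> N\<^sup>2 + S * N + \<rho> 1 * \<rho> 2"
    and "cmod (Lq s l - Lq s m) \<le> \<bar>m - l\<bar> * (2 * N + S)"
proof -
  have cs: "cmod s = 1" using assms(3) by auto
  have "cmod (Lq s l) \<le> cmod (complex_of_real (l\<^sup>2)) + cmod (s * \<i> * S * l) + cmod (complex_of_real (\<rho> 1 * \<rho> 2))"
    using norm_triangle_ineq4[of "complex_of_real (l\<^sup>2) - s * \<i> * S * l" "complex_of_real (\<rho> 1 * \<rho> 2)"]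
      norm_triangle_ineq4[of "complex_of_real (l\<^sup>2)" "s * \<i> * S * l"] by (simp add: Lq_def)
  also have "\<dots> = l\<^sup>2 + S * \<bar>l\<bar> + \<rho> 1 * \<rho> 2"
    unfolding norm_of_real using S_pos \<rho>_pos \<rho>_less by (simp add: norm_mult cs)
  also have "\<dots> \<le> N\<^sup>2 + S * N + \<rho> 1 * \<rho> 2"
    using assms(2) S_pos \<rho>_pos \<rho>_less by (intro add_mono mult_left_mono) (auto simp: abs_le_square_iff[symmetric])
  finally show "cmod (Lq s l) \<le> N\<^sup>2 + S * N + \<rho> 1 * \<rho> 2" .
  have eq: "Lq s l - Lq s m = complex_of_real (l - m) * (complex_of_real (l + m) - s * \<i> * S)"
    by (simp add: Lq_def power2_eq_square algebra_simps)
  have "cmod (complex_of_real (l + m) - s * \<i> * S) \<le> \<bar>l + m\<bar> + S"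
    using norm_triangle_ineq4[of "complex_of_real (l + m)" "s * \<i> * S"] S_pos unfolding norm_of_real by (simp add: norm_mult cs)
  also have "\<dots> \<le> 2 * N + S" using assms by linarith
  finally have "\<bar>l - m\<bar> * cmod (complex_of_real (l + m) - s * \<i> * S) \<le> \<bar>l - m\<bar> * (2 * N + S)" by (intro mult_left_mono) auto
  thus "cmod (Lq s l - Lq s m) \<le> \<bar>m - l\<bar> * (2 * N + S)"
    unfolding eq norm_mult norm_of_real by (simp add: abs_minus_commute)
qed

lemma Nlim_Lipschitz:
  assumes "\<bar>m\<bar> \<le> N" "\<bar>l\<bar> \<le> N" "s = 1 \<or> s = -1"
  shows "cmod (Nlim s m l - P l) \<le> \<bar>m - l\<bar> * CD N"
proof -
  have N0: "N \<ge> 0" using assms(1) by simp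
  note S0 = S_pos
  have "Nlim s m l - P l = cnj (Lq s m - Lq s l) * Lq s l"
    unfolding Nlim_diagonal[OF assms(3), symmetric] Nlim_def complex_cnj_diff by (simp only: left_diff_distrib)
  also have "cmod \<dots> \<le> (\<bar>m - l\<bar> * (2 * N + S)) * (N\<^sup>2 + S * N + \<rho> 1 * \<rho> 2)"
    unfolding norm_mult complex_mod_cnj
    using limit_poly_bounds(2)[OF assms(2,1,3)] limit_poly_bounds(1)[OF assms]
    using N0 S0 by (intro mult_mono) (auto simp: abs_minus_commute)
  also have "\<dots> = \<bar>m - l\<bar> * ((2 * N + S) * (N\<^sup>2 + S * N + \<rho> 1 * \<rho> 2))" by (simp only: mult.assoc)
  also have "\<dots> \<le> \<bar>m - l\<bar> * CD N"
    unfolding CD_def using N0 S0 K_nonneg \<rho>_pos \<rho>_less by (intro mult_left_mono) auto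
  finally show ?thesis .
qed

lemma G_limit_difference:
  assumes m: "\<bar>m\<bar> \<le> N" and l: "\<bar>l\<bar> \<le> N" and s: "x \<ge> 0 \<and> s = 1 \<or> x \<le> 0 \<and> s = -1"
  shows "cmod (G (complex_of_real m) (complex_of_real l) x - exp (2 * \<i> * complex_of_real (m - l) * x) * Nlim s m l)
     \<le> \<bar>m - l\<bar> * CD N * e x"
proof -
  have N0: "N \<ge> 0" using m by simp
  have s': "s = 1 \<or> s = -1" using s by auto
  define d1 d0 where "d1 = a1 x + s * \<i> * S" and "d0 = a0 x + \<rho> 1 * \<rho> 2"
  define L where "L l = Lq s l" for l :: real
  define D where "D l = d1 * l + d0" for l :: real
  define B where "B l = b1 x * l + b0 x" for l :: real
  have A: "(complex_of_real l)\<^sup>2 + a1 x * complex_of_real l + a0 x = L l + D l" for l :: real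
    by (simp add: L_def Lq_def D_def d1_def d0_def algebra_simps)
  hence A2: "complex_of_real (l\<^sup>2) + a1 x * complex_of_real l + a0 x = L l + D l" for l :: real
    unfolding of_real_power .
  note as = asymptotics[OF s, folded d1_def d0_def]
  have K: "K * e x \<ge> 0" using K_nonneg e_bounds[of x] by simp
  have DL: "cmod (D l) \<le> K * e x * (N + 1)" if "\<bar>l\<bar> \<le> N" for l
  proof -
    have "cmod (D l) \<le> cmod d1 * \<bar>l\<bar> + cmod d0" unfolding D_def by (rule order_trans[OF norm_triangle_ineq]) (simp add: norm_mult)
    also have "\<dots> \<le> (K * e x) * N + K * e x" using as that K by (intro add_mono mult_mono) auto
    finally show ?thesis by (simp add: algebra_simps)
  qed
  have BL: "cmod (B l) \<le> K * e x * (N + 1)" if "\<bar>l\<bar> \<le> N" for l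
  proof -
    have "cmod (B l) \<le> cmod (b1 x) * \<bar>l\<bar> + cmod (b0 x)" unfolding B_def by (rule order_trans[OF norm_triangle_ineq]) (simp add: norm_mult)
    also have "\<dots> \<le> (K * e x) * N + K * e x" using as that K by (intro add_mono mult_mono) auto
    finally show ?thesis by (simp add: algebra_simps)
  qed
  have Dd: "cmod (D l - D m) \<le> K * e x * \<bar>m - l\<bar>"
  proof -
    have "D l - D m = d1 * complex_of_real (l - m)" by (simp add: D_def algebra_simps)
    thus ?thesis using mult_right_mono[OF as(2), of "\<bar>m - l\<bar>"] by (simp add: norm_mult abs_minus_commute flip: of_real_diff)
  qed
  have Bd: "cmod (B l - B m) \<le> K * e x * \<bar>m - l\<bar>"
  proof -
    have "B l - B m = b1 x * complex_of_real (l - m)" by (simp add: B_def algebra_simps)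
    thus ?thesis using mult_right_mono[OF as(4), of "\<bar>m - l\<bar>"] by (simp add: norm_mult abs_minus_commute flip: of_real_diff)
  qed
  have "complex_of_real (P m) = Nlim s m m" by (rule Nlim_diagonal[OF s', symmetric])
  hence PL: "complex_of_real (P m) = cnj (L m) * L m" by (simp only: Nlim_def L_def)
  have "complex_of_real (P m) = complex_of_real ((cmod (L m + D m))\<^sup>2 + (cmod (B m))\<^sup>2)"
    using unitarity_real[of m x] unfolding A2 B_def by (simp only: P_def)
  hence PT: "complex_of_real (P m) = cnj (L m + D m) * (L m + D m) + B m * cnj (B m)"
    unfolding of_real_add complex_norm_square by (simp only: mult.commute)
  \<comment> \<open>On the diagonal both expressions equal \<open>P m\<close>; subtracting this
    identity leaves only terms that contain a difference of values at l and m.\<close>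
  have split: "cnj (L m + D m) * (L l + D l) + B m * cnj (B l) - cnj (L m) * L l
     = cnj (L m) * (D l - D m) + cnj (D m) * (L l - L m) + cnj (D m) * (D l - D m) + B m * cnj (B l - B m)"
  proof -
    have "cnj (L m) * D m + cnj (D m) * L m + cnj (D m) * D m + B m * cnj (B m) = 0"
      using PL PT by (simp add: algebra_simps)
    thus ?thesis unfolding complex_cnj_diff complex_cnj_add by algebra
  qed
  \<comment> \<open>One factor \<open>e x\<close> per term is kept. The last two terms are quadratic
    in decaying quantities, and there the second factor is replaced by 1.\<close>
  have b: "cmod (cnj (L m) * (D l - D m)) \<le> (N\<^sup>2 + S * N + \<rho> 1 * \<rho> 2) * (K * e x * \<bar>m - l\<bar>)"
      "cmod (cnj (D m) * (L l - L m)) \<le> (K * e x * (N + 1)) * (\<bar>m - l\<bar> * (2 * N + S))"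
      "cmod (cnj (D m) * (D l - D m)) \<le> (K * 1 * (N + 1)) * (K * e x * \<bar>m - l\<bar>)"
      "cmod (B m * cnj (B l - B m)) \<le> (K * 1 * (N + 1)) * (K * e x * \<bar>m - l\<bar>)"
  proof -
    have Ke: "K * e x * (N + 1) \<le> K * 1 * (N + 1)" using K_nonneg e_bounds[of x] N0 by (intro mult_right_mono mult_left_mono) auto
    have S0: "S * N \<ge> 0" "\<rho> 1 * \<rho> 2 \<ge> 0" using S_pos N0 \<rho>_pos \<rho>_less by auto
    show "cmod (cnj (L m) * (D l - D m)) \<le> (N\<^sup>2 + S * N + \<rho> 1 * \<rho> 2) * (K * e x * \<bar>m - l\<bar>)"
      unfolding norm_mult complex_mod_cnj using limit_poly_bounds(1)[OF m m s'] Dd S0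
      by (intro mult_mono) (auto simp: L_def)
    show "cmod (cnj (D m) * (L l - L m)) \<le> (K * e x * (N + 1)) * (\<bar>m - l\<bar> * (2 * N + S))"
      unfolding norm_mult complex_mod_cnj using limit_poly_bounds(2)[OF m l s'] DL[OF m] K N0
      by (intro mult_mono) (auto simp: L_def)
    show "cmod (cnj (D m) * (D l - D m)) \<le> (K * 1 * (N + 1)) * (K * e x * \<bar>m - l\<bar>)"
      unfolding norm_mult complex_mod_cnj using order_trans[OF DL[OF m] Ke] Dd K_nonneg N0
      by (intro mult_mono) auto
    show "cmod (B m * cnj (B l - B m)) \<le> (K * 1 * (N + 1)) * (K * e x * \<bar>m - l\<bar>)"
      unfolding norm_mult complex_mod_cnj using order_trans[OF BL[OF m] Ke] Bd K_nonneg N0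
      by (intro mult_mono) auto
  qed
  have "G (complex_of_real m) (complex_of_real l) x - exp (2 * \<i> * complex_of_real (m - l) * x) * Nlim s m l
     = exp (2 * \<i> * complex_of_real (m - l) * x) * (cnj (L m + D m) * (L l + D l) + B m * cnj (B l) - cnj (L m) * L l)"
    unfolding G_real A B_def[symmetric] Nlim_def L_def[symmetric] by (simp only: right_diff_distrib)
  also have "cmod \<dots> = cmod (cnj (L m + D m) * (L l + D l) + B m * cnj (B l) - cnj (L m) * L l)"
    by (simp add: norm_mult)
  also have "\<dots> \<le> cmod (cnj (L m) * (D l - D m)) + cmod (cnj (D m) * (L l - L m)) + cmod (cnj (D m) * (D l - D m)) + cmod (B m * cnj (B l - B m))"
    unfolding split by (intro norm_triangle_le add_right_mono norm_triangle_ineq)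
  also have "\<dots> \<le> \<bar>m - l\<bar> * (CD N - (2 * N + S) * (N\<^sup>2 + S * N + \<rho> 1 * \<rho> 2)) * e x"
    using b by (simp add: CD_def algebra_simps)
  also have "\<dots> \<le> \<bar>m - l\<bar> * CD N * e x"
    using N0 S_pos \<rho>_pos \<rho>_less e_bounds[of x] by (intro mult_right_mono mult_left_mono) auto
  finally show ?thesis .
qed

definition Wk :: "real \<Rightarrow> real \<Rightarrow> real \<Rightarrow> complex" where
  "Wk \<epsilon> m l = (LINT x|lborel. complex_of_real (exp (- (2 * \<epsilon> * \<bar>x\<bar>))) *
     (cnj (soliton_a \<rho> \<theta> x (complex_of_real m)) * soliton_a \<rho> \<theta> x (complex_of_real l)))"

text \<open>The Poisson kernel without its normalising factor 1/\<pi>; this \<pi> reappears in the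
  normalisation of \<open>kf\<close>.\<close>

definition PK :: "real \<Rightarrow> real \<Rightarrow> real \<Rightarrow> real" where
  "PK \<epsilon> m l = \<epsilon> / (\<epsilon>\<^sup>2 + (m - l)\<^sup>2)"

lemma HL_add:
  assumes "integrable lborel (\<lambda>x. complex_of_real (ew \<epsilon> x) * F x)" "integrable lborel (\<lambda>x. complex_of_real (ew \<epsilon> x) * H x)"
  shows "HL \<epsilon> (\<lambda>x. F x + H x) = HL \<epsilon> F + HL \<epsilon> H"
  using assms by (simp add: HL_def distrib_left)

lemma HL_cmult: "HL \<epsilon> (\<lambda>x. c * F x) = c * HL \<epsilon> F"
  unfolding HL_def by (subst integral_mult_right_zero[symmetric]) (intro Bochner_Integration.integral_cong, auto)

text \<open>Integrating by parts on each half-line turns the antiderivative \<open>G\<close> of the integrand into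
  $1/(\varepsilon \mp i(m-l))$ times its limit at $\pm\infty$; the two half-lines add up to a
  Poisson kernel.\<close>

lemma Wk_estimate:
  assumes m: "\<bar>m\<bar> \<le> N" and l: "\<bar>l\<bar> \<le> N" and ne: "m \<noteq> l" and \<epsilon>: "\<epsilon> > 0"
  shows "cmod (Wk \<epsilon> m l - complex_of_real (PK \<epsilon> m l) * (Nlim 1 m l + Nlim (-1) m l) / 2)
    \<le> (1 + 1 / \<rho> 1) * CD N * (\<epsilon> * (1 + PK \<epsilon> m l))"
proof -
  define \<delta> where "\<delta> = m - l"
  have \<delta>0: "\<delta> \<noteq> 0" using ne by (simp add: \<delta>_def)
  define F where "F = G (complex_of_real m) (complex_of_real l)"
  define a where "a x = cnj (soliton_a \<rho> \<theta> x (complex_of_real m)) * soliton_a \<rho> \<theta> x (complex_of_real l)" for x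
  have ca: "continuous_on UNIV a" unfolding a_def[abs_def] by (intro continuous_intros soliton_a_continuous)
  have dF: "(F has_vector_derivative 2 * \<i> * complex_of_real \<delta> * a x) (at x)" for x
    using G_derivative[of "complex_of_real m" "complex_of_real l" x] by (simp add: F_def a_def \<delta>_def)
  have dFm: "((\<lambda>x. F (- x)) has_vector_derivative (- (2 * \<i> * complex_of_real \<delta>)) * a (- x)) (at x)" for x
  proof -
    have "(uminus has_vector_derivative (-1::real)) (at x)"
      by (auto intro!: derivative_eq_intros simp: has_real_derivative_iff_has_vector_derivative[symmetric])
    from vector_diff_chain_at[OF this dF] show ?thesis by (simp add: o_def)
  qed
  have cF: "continuous_on UNIV F"
    using dF has_vector_derivative_continuous by (intro continuous_at_imp_continuous_on ballI) blast
  have Fb: "cmod (F x) \<le> 2 * P N" for x unfolding F_def by (rule G_bound[OF m l])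
  have ab: "cmod (a x) \<le> P N" for x
  proof -
    have "cmod (a x) \<le> sqrt (P m) * sqrt (P l)"
      unfolding a_def norm_mult complex_mod_cnj by (intro mult_mono soliton_a_real_bound) (auto simp: P_pos less_imp_le)
    also have "\<dots> \<le> sqrt (P N) * sqrt (P N)" by (intro mult_mono real_sqrt_le_mono P_mono m l) (auto simp: P_pos less_imp_le)
    finally show ?thesis using P_pos[of N] by simp
  qed
  define B where "B = 2 * P N + 2 * \<bar>\<delta>\<bar> * P N"
  have B: "cmod (F x) \<le> B" "cmod (2 * \<i> * complex_of_real \<delta> * a x) \<le> B" "cmod (- (2 * \<i> * complex_of_real \<delta>) * a x) \<le> B" for x
    using Fb[of x] mult_left_mono[OF ab[of x], of "2 * \<bar>\<delta>\<bar>"] P_pos[of N]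
    by (auto simp: B_def norm_mult intro: order_trans[OF _ add_increasing] add_increasing2 add_increasing)
  have am[measurable]: "a \<in> borel_measurable borel" using ca by (rule borel_measurable_continuous_onI)
  have Fm[measurable]: "F \<in> borel_measurable borel" using cF by (rule borel_measurable_continuous_onI)
  have cm: "continuous_on UNIV (\<lambda>x. a (- x))" using ca by (intro continuous_on_compose2[OF ca] continuous_intros) auto
  have 1: "HL \<epsilon> (\<lambda>x. 2 * \<i> * complex_of_real \<delta> * a x) = - F 0 + 2 * complex_of_real \<epsilon> * HL \<epsilon> F"
    by (rule HL_derivative[OF \<epsilon> dF _ B(1,2)]) (intro continuous_intros ca)
  have 2: "HL \<epsilon> (\<lambda>x. - (2 * \<i> * complex_of_real \<delta>) * a (- x)) = - F (- 0) + 2 * complex_of_real \<epsilon> * HL \<epsilon> (\<lambda>x. F (- x))"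
    by (rule HL_derivative[where F="\<lambda>x. F (- x)", OF \<epsilon> dFm _ B(1,3)]) (intro continuous_intros cm)
  have W: "Wk \<epsilon> m l = HL \<epsilon> a + HL \<epsilon> (\<lambda>x. a (- x))"
    unfolding Wk_def a_def[symmetric] by (rule LINT_reflect_split[OF am ab \<epsilon>])
  \<comment> \<open>The boundary values \<open>F 0\<close> of the two half-lines cancel.\<close>
  have W2: "2 * \<i> * complex_of_real \<delta> * Wk \<epsilon> m l = 2 * \<epsilon> * (HL \<epsilon> F - HL \<epsilon> (\<lambda>x. F (- x)))"
    using 1 2 unfolding W HL_cmult by (simp add: algebra_simps)
  define rp where "rp x = F x - exp (2 * \<i> * complex_of_real \<delta> * x) * Nlim 1 m l" for x :: real
  define rm where "rm x = F (- x) - exp (2 * \<i> * complex_of_real (- \<delta>) * x) * Nlim (-1) m l" for x :: real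
  have CD0: "0 \<le> CD N" using m S_pos \<rho>_pos \<rho>_less K_nonneg by (simp add: CD_def)
  have [measurable]: "rp \<in> borel_measurable borel" "rm \<in> borel_measurable borel" unfolding rp_def rm_def by measurable
  have rpb: "cmod (rp x) \<le> \<bar>\<delta>\<bar> * CD N * exp (- (2 * \<rho> 1 * x))" if "x \<ge> 0" for x
    using G_limit_difference[OF m l, of x 1] that by (simp add: rp_def F_def \<delta>_def e_def)
  have rmb: "cmod (rm x) \<le> \<bar>\<delta>\<bar> * CD N * exp (- (2 * \<rho> 1 * x))" if "x \<ge> 0" for x
  proof -
    have ex: "2 * \<i> * complex_of_real (- \<delta>) * complex_of_real x = 2 * \<i> * complex_of_real \<delta> * complex_of_real (- x)"
      by simp
    have e: "e (- x) = exp (- (2 * \<rho> 1 * x))" using that by (simp add: e_def)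
    show ?thesis using G_limit_difference[OF m l, of "- x" "-1"] that
      unfolding rm_def ex F_def \<delta>_def[symmetric] e by simp
  qed
  have \<delta>CD: "0 \<le> \<bar>\<delta>\<bar> * CD N" using CD0 by simp
  have Hr: "cmod (HL \<epsilon> rp) \<le> \<bar>\<delta>\<bar> * CD N / (2 * \<rho> 1)" "cmod (HL \<epsilon> rm) \<le> \<bar>\<delta>\<bar> * CD N / (2 * \<rho> 1)"
    using HL_bound[OF \<epsilon> \<rho>_pos _ rpb \<delta>CD] HL_bound[OF \<epsilon> \<rho>_pos _ rmb \<delta>CD] by simp_all
  have le1: "\<bar>\<delta>\<bar> * CD N * exp (- (2 * \<rho> 1 * x)) \<le> \<bar>\<delta>\<bar> * CD N" if "x \<ge> 0" for x
    using mult_left_mono[of "exp (- (2 * \<rho> 1 * x))" 1 "\<bar>\<delta>\<bar> * CD N"] \<delta>CD \<rho>_pos that by simp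
  have Ir: "integrable lborel (\<lambda>x. complex_of_real (ew \<epsilon> x) * rp x)" "integrable lborel (\<lambda>x. complex_of_real (ew \<epsilon> x) * rm x)"
    using HL_integrable[OF \<epsilon> _ order_trans[OF rpb le1]] HL_integrable[OF \<epsilon> _ order_trans[OF rmb le1]] by simp_all
  have Ie: "integrable lborel (\<lambda>x. complex_of_real (ew \<epsilon> x) * (c * exp (2 * \<i> * complex_of_real d * x)))" for c d
    by (rule HL_integrable[OF \<epsilon>, where B="cmod c"]) (auto simp: norm_mult)
  have "HL \<epsilon> F = HL \<epsilon> (\<lambda>x. rp x + Nlim 1 m l * exp (2 * \<i> * complex_of_real \<delta> * x))"
    by (simp add: rp_def mult.commute)
  also have "\<dots> = HL \<epsilon> rp + Nlim 1 m l * (1 / (2 * (\<epsilon> - \<i> * \<delta>)))"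
    unfolding HL_add[OF Ir(1) Ie] HL_cmult HL_exp[OF \<epsilon>] ..
  finally have H1: "HL \<epsilon> F = HL \<epsilon> rp + Nlim 1 m l * (1 / (2 * (\<epsilon> - \<i> * \<delta>)))" .
  have "HL \<epsilon> (\<lambda>x. F (- x)) = HL \<epsilon> (\<lambda>x. rm x + Nlim (-1) m l * exp (2 * \<i> * complex_of_real (- \<delta>) * x))"
    by (simp add: rm_def mult.commute)
  also have "\<dots> = HL \<epsilon> rm + Nlim (-1) m l * (1 / (2 * (\<epsilon> - \<i> * complex_of_real (- \<delta>))))"
    unfolding HL_add[OF Ir(2) Ie] HL_cmult HL_exp[OF \<epsilon>] ..
  finally have H2: "HL \<epsilon> (\<lambda>x. F (- x)) = HL \<epsilon> rm + Nlim (-1) m l * (1 / (2 * (\<epsilon> + \<i> * \<delta>)))" by simp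
  define p where "p = complex_of_real (PK \<epsilon> m l)"
  have nz: "\<epsilon> - \<i> * \<delta> \<noteq> 0" "\<epsilon> + \<i> * \<delta> \<noteq> 0" using \<epsilon> by (auto simp: complex_eq_iff)
  have prod: "(\<epsilon> - \<i> * \<delta>) * (\<epsilon> + \<i> * \<delta>) = complex_of_real (\<epsilon>\<^sup>2 + \<delta>\<^sup>2)"
  proof -
    have i2: "\<i> * (\<i> * c) = - c" for c by (simp flip: mult.assoc)
    show ?thesis by (simp add: power2_eq_square algebra_simps i2)
  qed
  have pe: "p = \<epsilon> / ((\<epsilon> - \<i> * \<delta>) * (\<epsilon> + \<i> * \<delta>))"
    unfolding prod p_def PK_def \<delta>_def[symmetric] by (simp only: of_real_divide)
  have r1: "\<epsilon> * (1 / (\<epsilon> - \<i> * \<delta>)) = p * (\<epsilon> + \<i> * \<delta>)" and r2: "\<epsilon> * (1 / (\<epsilon> + \<i> * \<delta>)) = p * (\<epsilon> - \<i> * \<delta>)"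
    unfolding pe using nz by simp_all
  have "2 * \<i> * complex_of_real \<delta> * (Wk \<epsilon> m l - p * (Nlim 1 m l + Nlim (-1) m l) / 2)
     = 2 * \<epsilon> * (HL \<epsilon> rp - HL \<epsilon> rm) + p * \<epsilon> * (Nlim 1 m l - Nlim (-1) m l)"
  proof -
    have "2 * \<epsilon> * (HL \<epsilon> F - HL \<epsilon> (\<lambda>x. F (- x))) = 2 * \<epsilon> * (HL \<epsilon> rp - HL \<epsilon> rm)
       + Nlim 1 m l * (\<epsilon> * (1 / (\<epsilon> - \<i> * \<delta>))) - Nlim (-1) m l * (\<epsilon> * (1 / (\<epsilon> + \<i> * \<delta>)))"
    proof -
      have half: "1 / (2 * z) = (1 / z) / 2" for z :: complex by simp
      have "2 * \<epsilon> * (p + c * (u / 2) - (q + d * (v / 2))) = 2 * \<epsilon> * (p - q) + c * (\<epsilon> * u) - d * (\<epsilon> * v)"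
        for p q c d u v :: complex by (simp add: algebra_simps)
      thus ?thesis unfolding H1 H2 half .
    qed
    also have "\<dots> = 2 * \<epsilon> * (HL \<epsilon> rp - HL \<epsilon> rm) + Nlim 1 m l * (p * (\<epsilon> + \<i> * \<delta>)) - Nlim (-1) m l * (p * (\<epsilon> - \<i> * \<delta>))"
      unfolding r1 r2 ..
    finally have *: "2 * \<i> * complex_of_real \<delta> * Wk \<epsilon> m l = \<dots>" unfolding W2 .
    show ?thesis unfolding right_diff_distrib * by (simp add: algebra_simps)
  qed
  also have "cmod \<dots> \<le> 2 * \<epsilon> * (\<bar>\<delta>\<bar> * CD N / (2 * \<rho> 1) + \<bar>\<delta>\<bar> * CD N / (2 * \<rho> 1)) + PK \<epsilon> m l * \<epsilon> * (\<bar>\<delta>\<bar> * CD N + \<bar>\<delta>\<bar> * CD N)"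
  proof (rule order_trans[OF norm_triangle_ineq], rule add_mono)
    have "cmod (HL \<epsilon> rp - HL \<epsilon> rm) \<le> \<bar>\<delta>\<bar> * CD N / (2 * \<rho> 1) + \<bar>\<delta>\<bar> * CD N / (2 * \<rho> 1)"
      using norm_triangle_ineq4[of "HL \<epsilon> rp" "HL \<epsilon> rm"] Hr by linarith
    moreover have n: "cmod (2 * \<epsilon> * z) = 2 * \<epsilon> * cmod z" for z :: complex
      using \<epsilon> by (simp add: norm_mult)
    ultimately show "cmod (2 * \<epsilon> * (HL \<epsilon> rp - HL \<epsilon> rm)) \<le> 2 * \<epsilon> * (\<bar>\<delta>\<bar> * CD N / (2 * \<rho> 1) + \<bar>\<delta>\<bar> * CD N / (2 * \<rho> 1))"
      unfolding n using \<epsilon> by (intro mult_left_mono) auto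
    have "cmod (Nlim 1 m l - Nlim (-1) m l) \<le> cmod (Nlim 1 m l - P l) + cmod (Nlim (-1) m l - P l)"
      using norm_triangle_ineq4[of "Nlim 1 m l - P l" "Nlim (-1) m l - P l"] by simp
    also have "\<dots> \<le> \<bar>\<delta>\<bar> * CD N + \<bar>\<delta>\<bar> * CD N"
      unfolding \<delta>_def by (intro add_mono Nlim_Lipschitz m l) auto
    finally have "cmod (Nlim 1 m l - Nlim (-1) m l) \<le> \<bar>\<delta>\<bar> * CD N + \<bar>\<delta>\<bar> * CD N" .
    moreover have "0 \<le> PK \<epsilon> m l" using \<epsilon> by (simp add: PK_def)
    ultimately show "cmod (p * \<epsilon> * (Nlim 1 m l - Nlim (-1) m l)) \<le> PK \<epsilon> m l * \<epsilon> * (\<bar>\<delta>\<bar> * CD N + \<bar>\<delta>\<bar> * CD N)"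
      unfolding norm_mult p_def norm_of_real using \<epsilon> by (intro mult_mono) auto
  qed
  \<comment> \<open>Each term contains |\<delta>|, which cancels against 2i\<delta> on the left.
    This is the purpose of the Lipschitz estimates in m - l.\<close>
  also have "\<dots> = (2 * \<bar>\<delta>\<bar>) * (CD N * \<epsilon> * (1 / \<rho> 1 + PK \<epsilon> m l))"
    using \<rho>_pos by (simp add: field_simps)
  finally have "cmod (Wk \<epsilon> m l - p * (Nlim 1 m l + Nlim (-1) m l) / 2) \<le> CD N * \<epsilon> * (1 / \<rho> 1 + PK \<epsilon> m l)"
    using \<delta>0 unfolding norm_mult by simp
  also have "\<dots> \<le> CD N * \<epsilon> * ((1 + 1 / \<rho> 1) * (1 + PK \<epsilon> m l))"
  proof (rule mult_left_mono)
    have "0 \<le> PK \<epsilon> m l" using \<epsilon> by (simp add: PK_def)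
    thus "1 / \<rho> 1 + PK \<epsilon> m l \<le> (1 + 1 / \<rho> 1) * (1 + PK \<epsilon> m l)"
      using \<rho>_pos by (simp add: algebra_simps)
  qed (use CD0 \<epsilon> in simp)
  finally show ?thesis unfolding p_def by (simp add: mult_ac)
qed

end

lemma compact_support_integral_bound:
  fixes f :: "real \<Rightarrow> complex"
  assumes f: "integrable lborel f" and b: "\<And>x. \<bar>x\<bar> \<le> N \<Longrightarrow> cmod (f x) \<le> c" "\<And>x. \<bar>x\<bar> > N \<Longrightarrow> f x = 0" and N: "0 \<le> N"
  shows "cmod (LINT x|lborel. f x) \<le> 2 * N * c"
proof -
  have I: "integrable lborel (indicator {-N..N} :: real \<Rightarrow> real)"
    using emeasure_compact_finite[of "{-N..N}"] by (intro integrable_real_indicator) auto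
  have "cmod (LINT x|lborel. f x) \<le> (LINT x|lborel. cmod (f x))" by (rule integral_norm_bound)
  also have "\<dots> \<le> (LINT x|lborel. c * indicator {-N..N} x)"
  proof (rule integral_mono)
    show "cmod (f x) \<le> c * indicator {-N..N} x" for x
      using b(1)[of x] b(2)[of x] by (cases "\<bar>x\<bar> \<le> N") (auto simp: indicator_def)
  qed (use f I in auto)
  also have "\<dots> = 2 * N * c" using N by simp
  finally show ?thesis .
qed

section \<open>Isometry on continuous amplitudes and its extension\<close>

context soliton
begin

definition Ua :: "(real \<Rightarrow> complex) \<Rightarrow> real \<Rightarrow> complex" where
  "Ua h x = (LINT l|lborel. h l * soliton_a \<rho> \<theta> x (complex_of_real l))"

text \<open>The cut in l makes the kernel bounded, as \<open>Fubini_bounded_kernel\<close> demands,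
  whereas the available bound sqrt (P l) for \<open>soliton_a\<close> grows quadratically.\<close>

definition kk :: "real \<Rightarrow> real \<Rightarrow> real \<Rightarrow> complex" where
  "kk N x l = indicator {-N..N} l * soliton_a \<rho> \<theta> x (complex_of_real l)"

lemma kk_measurable: "(\<lambda>(x, l). kk N x l) \<in> borel_measurable (lborel \<Otimes>\<^sub>M lborel)"
proof -
  have "(\<lambda>(x, l). kk N x l) \<in> borel_measurable (borel \<Otimes>\<^sub>M borel)"
    unfolding kk_def[abs_def] by measurable
  thus ?thesis by (simp cong: measurable_cong_sets sets_pair_measure_cong)
qed

lemma kk_bound: "cmod (kk N x l) \<le> sqrt (P N)"
  using order_trans[OF soliton_a_real_bound[of x l] real_sqrt_le_mono[OF P_mono[of l N]]] P_pos[of N]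
  by (auto simp: kk_def norm_mult split: split_indicator)

lemma Wk_measurable [measurable]: "(\<lambda>(m, l). Wk \<epsilon> m l) \<in> borel_measurable (borel \<Otimes>\<^sub>M borel)"
  unfolding Wk_def[abs_def] by measurable

lemma Wk_measurable_section [measurable]: "(\<lambda>l. Wk \<epsilon> m l) \<in> borel_measurable borel"
  by measurable

context
  fixes h :: "real \<Rightarrow> complex" and B N :: real
  assumes h_meas [measurable]: "h \<in> borel_measurable borel" and h_bound: "\<And>l. cmod (h l) \<le> B"
    and h_supp: "\<And>l. \<bar>l\<bar> > N \<Longrightarrow> h l = 0" and N_nonneg: "0 \<le> N"
begin

lemma h_integrable: "integrable lborel h"
  by (rule integrable_compact_support[OF _ h_bound h_supp]) auto

lemma B_nonneg: "0 \<le> B"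
  using h_bound[of 0] norm_ge_zero order_trans by blast

lemma Ua_kk: "Ua h x = (LINT l|lborel. h l * kk N x l)"
  unfolding Ua_def using h_supp
  by (intro Bochner_Integration.integral_cong) (auto simp: kk_def split: split_indicator)

lemma Ua_measurable [measurable]: "Ua h \<in> borel_measurable borel"
  unfolding Ua_def[abs_def] by measurable

lemma h_kk_integrable: "integrable lborel (\<lambda>l. h l * kk N x l)"
proof (rule integrable_compact_support[where N=N])
  show "(\<lambda>l. h l * kk N x l) \<in> borel_measurable borel" unfolding kk_def by measurable
  show "cmod (h l * kk N x l) \<le> B * sqrt (P N)" for l
    unfolding norm_mult using B_nonneg by (intro mult_mono h_bound kk_bound) auto
qed (simp add: h_supp)

lemma Ua_bound: "cmod (Ua h x) \<le> 2 * N * (B * sqrt (P N))"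
  unfolding Ua_kk
proof (rule compact_support_integral_bound[OF h_kk_integrable _ _ N_nonneg])
  show "cmod (h l * kk N x l) \<le> B * sqrt (P N)" for l
    unfolding norm_mult using B_nonneg by (intro mult_mono h_bound kk_bound) auto
qed (simp add: h_supp)

lemma weight_integrable:
  assumes "\<epsilon> > 0"
  shows "integrable lborel (\<lambda>x. complex_of_real (exp (- (2 * \<epsilon> * \<bar>x\<bar>))))"
  using LINT_reflect_split(2)[OF _ _ assms, of "\<lambda>_. 1" 1] by simp

text \<open>Fubini's theorem twice, with the weight kept in the x-integral so that it converges
  absolutely.\<close>

lemma weighted_norm_Ua:
  assumes \<epsilon>: "\<epsilon> > 0"
  shows "(LINT x|lborel. complex_of_real (exp (- (2 * \<epsilon> * \<bar>x\<bar>))) * (cnj (Ua h x) * Ua h x))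
    = (LINT m|lborel. cnj (h m) * (LINT l|lborel. h l * Wk \<epsilon> m l))"
proof -
  define w where "w x = complex_of_real (exp (- (2 * \<epsilon> * \<bar>x\<bar>)))" for x
  have [measurable]: "w \<in> borel_measurable borel" unfolding w_def[abs_def] by measurable
  have wI: "integrable lborel w" unfolding w_def[abs_def] by (rule weight_integrable[OF \<epsilon>])
  have wUI: "integrable lborel (\<lambda>x. w x * Ua h x)"
    unfolding w_def by (rule LINT_reflect_split(2)[OF Ua_measurable Ua_bound \<epsilon>])
  have kc: "(\<lambda>(x, l). cnj (kk N x l)) \<in> borel_measurable (lborel \<Otimes>\<^sub>M lborel)"
    using borel_measurable_cnj[OF kk_measurable] by (simp add: case_prod_beta)
  have kx: "(\<lambda>x. kk N x m) \<in> borel_measurable borel" for m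
    using measurable_Pair1[OF kk_measurable, of m] by simp
  have wkI: "integrable lborel (\<lambda>x. w x * cnj (kk N x m))" for m
    unfolding w_def using LINT_reflect_split(2)[OF borel_measurable_cnj[OF kx] _ \<epsilon>, of m "sqrt (P N)"] kk_bound by simp
  have cU: "cnj (Ua h x) = (LINT m|lborel. cnj (h m) * cnj (kk N x m))" for x
    unfolding Ua_kk by (subst Bochner_Integration.integral_cnj[symmetric]) simp
  have "(LINT x|lborel. w x * (cnj (Ua h x) * Ua h x)) = (LINT x|lborel. (w x * Ua h x) * (LINT m|lborel. cnj (h m) * cnj (kk N x m)))"
    unfolding cU[symmetric] by (simp add: mult_ac)
  also have "\<dots> = (LINT m|lborel. cnj (h m) * (LINT x|lborel. (w x * Ua h x) * cnj (kk N x m)))"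
    by (rule Fubini_bounded_kernel[OF lborel.sigma_finite_measure_axioms lborel.sigma_finite_measure_axioms wUI _ kc, where C="sqrt (P N)"])
       (use h_integrable kk_bound in auto)
  also have "\<dots> = (LINT m|lborel. cnj (h m) * (LINT l|lborel. h l * Wk \<epsilon> m l))"
  proof (rule Bochner_Integration.integral_cong[OF refl])
    fix m
    show "cnj (h m) * (LINT x|lborel. (w x * Ua h x) * cnj (kk N x m)) = cnj (h m) * (LINT l|lborel. h l * Wk \<epsilon> m l)"
    proof (cases "\<bar>m\<bar> > N")
      case True thus ?thesis by (simp add: h_supp)
    next
      case False
      have "(LINT x|lborel. (w x * Ua h x) * cnj (kk N x m)) = (LINT x|lborel. (w x * cnj (kk N x m)) * (LINT l|lborel. h l * kk N x l))"
        unfolding Ua_kk by (simp add: mult_ac)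
      also have "\<dots> = (LINT l|lborel. h l * (LINT x|lborel. (w x * cnj (kk N x m)) * kk N x l))"
        by (rule Fubini_bounded_kernel[OF lborel.sigma_finite_measure_axioms lborel.sigma_finite_measure_axioms wkI h_integrable kk_measurable kk_bound])
      also have "\<dots> = (LINT l|lborel. h l * Wk \<epsilon> m l)"
      proof (rule Bochner_Integration.integral_cong[OF refl])
        fix l
        show "h l * (LINT x|lborel. (w x * cnj (kk N x m)) * kk N x l) = h l * Wk \<epsilon> m l"
        proof (cases "\<bar>l\<bar> > N")
          case True thus ?thesis by (simp add: h_supp)
        next
          case l: False
          have "indicator {-N..N} m = (1::complex)" "indicator {-N..N} l = (1::complex)" using False l by (auto simp: indicator_def)
          thus ?thesis by (simp add: Wk_def w_def kk_def mult.assoc)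
        qed
      qed
      finally show ?thesis by simp
    qed
  qed
  finally show ?thesis by (simp add: w_def)
qed

text \<open>Crude in \<epsilon>, and meant to secure integrability; the behaviour as \<epsilon>
  tends to 0 is in \<open>Wk_estimate\<close>.\<close>

lemma Wk_bound:
  assumes \<epsilon>: "\<epsilon> > 0" and "\<bar>m\<bar> \<le> N" "\<bar>l\<bar> \<le> N"
  shows "cmod (Wk \<epsilon> m l) \<le> P N * (LINT x|lborel. exp (- (2 * \<epsilon> * \<bar>x\<bar>)))"
proof -
  have I: "integrable lborel (\<lambda>x. exp (- (2 * \<epsilon> * \<bar>x\<bar>)))"
    using integrable_norm[OF weight_integrable[OF \<epsilon>]] by simp
  have eq: "Wk \<epsilon> m l = (LINT x|lborel. complex_of_real (exp (- (2 * \<epsilon> * \<bar>x\<bar>))) * (cnj (kk N x m) * kk N x l))"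
  proof -
    have "indicator {-N..N} m = (1::complex)" "indicator {-N..N} l = (1::complex)" using assms by (auto simp: indicator_def)
    thus ?thesis by (simp add: Wk_def kk_def)
  qed
  have b: "cmod (cnj (kk N x m) * kk N x l) \<le> P N" for x
    using mult_mono[OF kk_bound[of N x m] kk_bound[of N x l]] P_pos[of N] by (simp add: norm_mult)
  have "cmod (Wk \<epsilon> m l) \<le> (LINT x|lborel. cmod (complex_of_real (exp (- (2 * \<epsilon> * \<bar>x\<bar>))) * (cnj (kk N x m) * kk N x l)))"
    unfolding eq by (rule integral_norm_bound)
  also have "\<dots> \<le> (LINT x|lborel. P N * exp (- (2 * \<epsilon> * \<bar>x\<bar>)))"
  proof (rule integral_mono)
    have "(\<lambda>x. cnj (kk N x m) * kk N x l) \<in> borel_measurable borel"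
      unfolding kk_def by measurable
    from LINT_reflect_split(2)[OF this b \<epsilon>]
    show "integrable lborel (\<lambda>x. cmod (complex_of_real (exp (- (2 * \<epsilon> * \<bar>x\<bar>))) * (cnj (kk N x m) * kk N x l)))"
      by (rule integrable_norm)
    show "cmod (complex_of_real (exp (- (2 * \<epsilon> * \<bar>x\<bar>))) * (cnj (kk N x m) * kk N x l)) \<le> P N * exp (- (2 * \<epsilon> * \<bar>x\<bar>))" for x
      unfolding norm_mult[of "complex_of_real _"] using mult_right_mono[OF b[of x], of "exp (- (2 * \<epsilon> * \<bar>x\<bar>))"]
      by (simp add: mult.commute)
  qed (use I in simp)
  finally show ?thesis by simp
qed

lemma Lq_measurable [measurable]: "Lq s \<in> borel_measurable borel"
  unfolding Lq_def[abs_def] by measurable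

lemma Lq_bound: "\<bar>l\<bar> \<le> N \<Longrightarrow> s = 1 \<or> s = -1 \<Longrightarrow> cmod (Lq s l) \<le> N\<^sup>2 + S * N + \<rho> 1 * \<rho> 2"
  by (rule limit_poly_bounds(1)[of 0]) (use N_nonneg in auto)

lemma PK_props:
  assumes "\<epsilon> > 0"
  shows "0 \<le> PK \<epsilon> m l" "PK \<epsilon> m l \<le> 1 / \<epsilon>"
    "integrable lborel (PK \<epsilon> m)" "(LINT l|lborel. PK \<epsilon> m l) = pi" "(\<lambda>(m, l). PK \<epsilon> m l) \<in> borel_measurable (borel \<Otimes>\<^sub>M borel)"
proof -
  show "0 \<le> PK \<epsilon> m l" using assms by (simp add: PK_def)
  have "\<epsilon> / (\<epsilon>\<^sup>2 + (m - l)\<^sup>2) \<le> \<epsilon> / \<epsilon>\<^sup>2" using assms by (intro divide_left_mono) (auto intro!: mult_pos_pos add_pos_nonneg)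
  thus "PK \<epsilon> m l \<le> 1 / \<epsilon>" using assms by (simp add: PK_def power2_eq_square)
  show "integrable lborel (PK \<epsilon> m)" "(LINT l|lborel. PK \<epsilon> m l) = pi"
    using Poisson_kernel_integral[OF assms, of m] by (simp_all add: has_bochner_integral_iff PK_def[abs_def])
  show "(\<lambda>(m, l). PK \<epsilon> m l) \<in> borel_measurable (borel \<Otimes>\<^sub>M borel)" unfolding PK_def by measurable
qed

lemma u_integrable: "s = 1 \<or> s = -1 \<Longrightarrow> integrable lborel (\<lambda>l. h l * Lq s l)"
proof (rule integrable_compact_support[where N=N])
  assume s: "s = 1 \<or> s = -1"
  show "cmod (h l * Lq s l) \<le> B * (N\<^sup>2 + S * N + \<rho> 1 * \<rho> 2)" for l
  proof (cases "\<bar>l\<bar> > N")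
    case True
    have "0 \<le> N\<^sup>2 + S * N + \<rho> 1 * \<rho> 2" using S_pos N_nonneg \<rho>_pos \<rho>_less by simp
    thus ?thesis using True B_nonneg by (simp add: h_supp)
  next
    case False
    thus ?thesis unfolding norm_mult using B_nonneg s by (intro mult_mono h_bound Lq_bound) auto
  qed
qed (auto simp: h_supp)

lemma PK_u_integrable:
  assumes "\<epsilon> > 0" "s = 1 \<or> s = -1"
  shows "integrable lborel (\<lambda>l. h l * Lq s l * complex_of_real (PK \<epsilon> m l))"
proof (rule Bochner_Integration.integrable_bound)
  show "integrable lborel (\<lambda>l. (h l * Lq s l) * (1 / \<epsilon>))" using u_integrable[OF assms(2)] by simp
  have [measurable]: "(\<lambda>l. PK \<epsilon> m l) \<in> borel_measurable borel" using PK_props(3)[OF assms(1), of m] by auto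
  show "(\<lambda>l. h l * Lq s l * complex_of_real (PK \<epsilon> m l)) \<in> borel_measurable lborel" by measurable
  show "AE l in lborel. norm (h l * Lq s l * complex_of_real (PK \<epsilon> m l)) \<le> norm ((h l * Lq s l) * (1 / \<epsilon>))"
  proof (rule AE_I2)
    fix l
    have "cmod (h l * Lq s l) * \<bar>PK \<epsilon> m l\<bar> \<le> cmod (h l * Lq s l) * (1 / \<epsilon>)"
      using PK_props(1,2)[OF assms(1), of m l] by (intro mult_left_mono) auto
    thus "norm (h l * Lq s l * complex_of_real (PK \<epsilon> m l)) \<le> norm ((h l * Lq s l) * (1 / \<epsilon>))"
      using assms(1) by (simp add: norm_mult norm_divide)
  qed
qed

text \<open>\<open>Nlim s m l\<close> factors as \<open>cnj (Lq s m) * Lq s l\<close>, so the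
  limiting kernel acts as a Poisson quadratic form in the single function
  \<open>h * Lq s\<close>.\<close>

definition PI :: "complex \<Rightarrow> real \<Rightarrow> complex" where
  "PI s \<epsilon> = (LINT m|lborel. cnj (h m * Lq s m) * (LINT l|lborel. h l * Lq s l * complex_of_real (PK \<epsilon> m l)))"

lemma PK_inner_bound:
  assumes "\<epsilon> > 0" "s = 1 \<or> s = -1"
  shows "cmod (LINT l|lborel. h l * Lq s l * complex_of_real (PK \<epsilon> m l)) \<le> (LINT l|lborel. cmod (h l * Lq s l) * (1 / \<epsilon>))"
proof -
  have "cmod (LINT l|lborel. h l * Lq s l * complex_of_real (PK \<epsilon> m l)) \<le> (LINT l|lborel. cmod (h l * Lq s l * complex_of_real (PK \<epsilon> m l)))"
    by (rule integral_norm_bound)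
  also have "\<dots> \<le> (LINT l|lborel. cmod (h l * Lq s l) * (1 / \<epsilon>))"
  proof (rule integral_mono)
    show "integrable lborel (\<lambda>l. cmod (h l * Lq s l) * (1 / \<epsilon>))" using u_integrable[OF assms(2)] by simp
    show "cmod (h l * Lq s l * complex_of_real (PK \<epsilon> m l)) \<le> cmod (h l * Lq s l) * (1 / \<epsilon>)" for l
      unfolding norm_mult[of "h l * Lq s l"] norm_of_real using PK_props(1,2)[OF assms(1), of m l] by (intro mult_left_mono) auto
  qed (rule integrable_norm[OF PK_u_integrable[OF assms]])
  finally show ?thesis .
qed

text \<open>The error \<epsilon>(1 + PK) of \<open>Wk_estimate\<close> integrates over |l| \<le> N
  to at most \<epsilon>(2N + \<pi>), uniformly in m, because the mass of \<open>PK\<close> is \<pi>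
  for every \<epsilon>.\<close>

lemma Wk_Poisson_difference:
  assumes \<epsilon>: "\<epsilon> > 0"
  shows "cmod ((LINT m|lborel. cnj (h m) * (LINT l|lborel. h l * Wk \<epsilon> m l)) - (PI 1 \<epsilon> + PI (-1) \<epsilon>) / 2)
    \<le> 2 * N * (B * (B * ((1 + 1 / \<rho> 1) * CD N * \<epsilon>) * (2 * N + pi)))"
proof -
  note P = PK_props[OF \<epsilon>]
  note P5[measurable] = P(5)
  define C where "C = (1 + 1 / \<rho> 1) * CD N * \<epsilon>"
  have C0: "0 \<le> C"
    using N_nonneg S_pos \<rho>_pos \<rho>_less K_nonneg \<epsilon> unfolding C_def by (intro mult_nonneg_nonneg) (auto simp: CD_def)
  have IN: "integrable lborel (indicator {-N..N} :: real \<Rightarrow> real)"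
    using emeasure_compact_finite[of "{-N..N}"] by (intro integrable_real_indicator) auto
  have WI: "integrable lborel (\<lambda>l. h l * Wk \<epsilon> m l)" if "\<bar>m\<bar> \<le> N" for m
  proof (rule integrable_compact_support[where N=N])
    show "cmod (h l * Wk \<epsilon> m l) \<le> B * (P N * (LINT x|lborel. exp (- (2 * \<epsilon> * \<bar>x\<bar>))))" for l
    proof (cases "\<bar>l\<bar> > N")
      case True thus ?thesis using B_nonneg P_pos[of N] by (auto simp: h_supp)
    next
      case False
      thus ?thesis unfolding norm_mult using B_nonneg that by (intro mult_mono h_bound Wk_bound[OF \<epsilon>]) auto
    qed
  qed (auto simp: h_supp)
  define i1 where "i1 m = (LINT l|lborel. h l * Wk \<epsilon> m l)" for m
  define i2 where "i2 s m = (LINT l|lborel. h l * Lq s l * complex_of_real (PK \<epsilon> m l))" for s m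
  define i3 where "i3 m = (cnj (Lq 1 m) * i2 1 m + cnj (Lq (-1) m) * i2 (-1) m) / 2" for m
  have [measurable]: "i1 \<in> borel_measurable borel" "i2 s \<in> borel_measurable borel" for s
    unfolding i1_def[abs_def] i2_def[abs_def] by measurable
  hence [measurable]: "i3 \<in> borel_measurable borel" unfolding i3_def[abs_def] by measurable
  have inner: "cmod (i1 m - i3 m) \<le> B * C * (2 * N + pi)" if m: "\<bar>m\<bar> \<le> N" for m
  proof -
    define q where "q l = h l * Wk \<epsilon> m l - (cnj (Lq 1 m) * (h l * Lq 1 l * complex_of_real (PK \<epsilon> m l)) + cnj (Lq (-1) m) * (h l * Lq (-1) l * complex_of_real (PK \<epsilon> m l))) / 2" for l
    have qI: "integrable lborel q"
      unfolding q_def by (intro Bochner_Integration.integrable_diff WI m integrable_divide Bochner_Integration.integrable_add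
        integrable_mult_right PK_u_integrable[OF \<epsilon>]) auto
    have "i1 m - i3 m = (LINT l|lborel. q l)"
      unfolding i1_def i3_def i2_def q_def using WI[OF m] PK_u_integrable[OF \<epsilon>, of 1 m] PK_u_integrable[OF \<epsilon>, of "-1" m] by simp
    also have "cmod \<dots> \<le> (LINT l|lborel. cmod (q l))" by (rule integral_norm_bound)
    also have "\<dots> \<le> (LINT l|lborel. B * C * (indicator {-N..N} l + PK \<epsilon> m l))"
    proof (rule integral_mono_AE)
      show "integrable lborel (\<lambda>l. cmod (q l))" using qI by (rule integrable_norm)
      show "integrable lborel (\<lambda>l. B * C * (indicator {-N..N} l + PK \<epsilon> m l))" using IN P(3)[of m] by simp
      show "AE l in lborel. cmod (q l) \<le> B * C * (indicator {-N..N} l + PK \<epsilon> m l)"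
        \<comment> \<open>\<open>Wk_estimate\<close> excludes the diagonal, a null set in l.\<close>
        using AE_lborel_singleton[of m]
      proof eventually_elim
        case (elim l)
        have ql: "q l = h l * (Wk \<epsilon> m l - complex_of_real (PK \<epsilon> m l) * (Nlim 1 m l + Nlim (-1) m l) / 2)"
          by (simp add: q_def Nlim_def algebra_simps add_divide_distrib)
        show ?case
        proof (cases "\<bar>l\<bar> > N")
          case True
          thus ?thesis using B_nonneg C0 P(1)[of m l] unfolding ql by (simp add: h_supp)
        next
          case False
          have "cmod (q l) \<le> B * ((1 + 1 / \<rho> 1) * CD N * (\<epsilon> * (1 + PK \<epsilon> m l)))"
            unfolding ql norm_mult[of "h l"] using False elim m \<epsilon> B_nonneg
            by (intro mult_mono h_bound Wk_estimate) auto
          moreover have "indicator {-N..N} l = (1::real)" using False by (auto simp: indicator_def)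
          ultimately show ?thesis by (simp add: C_def mult_ac)
        qed
      qed
    qed
    also have "\<dots> = B * C * (2 * N + pi)" using IN P(3,4)[of m] N_nonneg by simp
    finally show ?thesis .
  qed
  define d where "d m = cnj (h m) * (i1 m - i3 m)" for m
  have db: "cmod (d m) \<le> B * (B * C * (2 * N + pi))" if "\<bar>m\<bar> \<le> N" for m
    unfolding d_def norm_mult complex_mod_cnj using B_nonneg by (intro mult_mono h_bound inner that) auto
  have dz: "d m = 0" if "\<bar>m\<bar> > N" for m using that by (simp add: d_def h_supp)
  have dI: "integrable lborel d"
  proof (rule integrable_compact_support[OF _ _ dz])
    show "cmod (d m) \<le> B * (B * C * (2 * N + pi))" for m
      using db[of m] dz[of m] B_nonneg C0 N_nonneg by (cases "\<bar>m\<bar> \<le> N") auto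
    show "d \<in> borel_measurable borel" unfolding d_def[abs_def] by measurable
  qed
  define c where "c s m = cnj (h m * Lq s m) * i2 s m" for s m
  have cI: "integrable lborel (c s)" if s: "s = 1 \<or> s = -1" for s
  proof (rule Bochner_Integration.integrable_bound)
    define X where "X = (LINT l|lborel. cmod (h l * Lq s l) * (1 / \<epsilon>))"
    show "integrable lborel (\<lambda>m. cmod (h m * Lq s m) * X)" using u_integrable[OF s] by simp
    show "c s \<in> borel_measurable lborel" unfolding c_def[abs_def] by measurable
    show "AE m in lborel. norm (c s m) \<le> norm (cmod (h m * Lq s m) * X)"
      using PK_inner_bound[OF \<epsilon> s] unfolding c_def i2_def X_def
      by (intro AE_I2) (simp only: norm_mult[of "cnj _"] complex_mod_cnj real_norm_def abs_mult abs_norm_cancel,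
        intro mult_left_mono order_trans[OF _ abs_ge_self], auto)
  qed
  have "(LINT m|lborel. cnj (h m) * i1 m) = (LINT m|lborel. d m + (c 1 m + c (-1) m) / 2)"
    by (intro Bochner_Integration.integral_cong) (auto simp: d_def c_def i3_def algebra_simps add_divide_distrib)
  also have "\<dots> = (LINT m|lborel. d m) + (PI 1 \<epsilon> + PI (-1) \<epsilon>) / 2"
    using dI cI[of 1] cI[of "-1"] unfolding PI_def c_def i2_def by simp
  finally have "(LINT m|lborel. cnj (h m) * i1 m) - (PI 1 \<epsilon> + PI (-1) \<epsilon>) / 2 = (LINT m|lborel. d m)" by simp
  moreover have "cmod (LINT m|lborel. d m) \<le> 2 * N * (B * (B * C * (2 * N + pi)))"
    by (rule compact_support_integral_bound[OF dI db dz N_nonneg])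
  ultimately show ?thesis unfolding i1_def C_def by simp
qed

text \<open>\<open>PI 1\<close> and \<open>PI (-1)\<close> have the same limit, since |Lq|^2 = P for
  either sign, so the weighted norms converge. Fatou's lemma gives one inequality for the unweighted
  norm; weights at most 1 give the other.\<close>

lemma Ua_isometry:
  assumes hc: "continuous_on UNIV h"
  shows "Ua h \<in> L2 lborel" and "(L2_norm lborel (Ua h))\<^sup>2 = pi * (LINT l|lborel. P l * (cmod (h l))\<^sup>2)"
proof -
  define e where "e n = 1 / real (Suc n)" for n
  have e0: "e n > 0" for n by (simp add: e_def)
  have el: "e \<longlonglongrightarrow> 0" using LIMSEQ_inverse_real_of_nat by (simp only: e_def[abs_def] inverse_eq_divide)
  define J where "J n = (LINT m|lborel. cnj (h m) * (LINT l|lborel. h l * Wk (e n) m l))" for n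
  define X where "X = (LINT l|lborel. P l * (cmod (h l))\<^sup>2)"
  have PIl: "(\<lambda>n. PI s (e n)) \<longlonglongrightarrow> pi * X" if s: "s = 1 \<or> s = -1" for s
  proof -
    have c: "continuous_on UNIV (\<lambda>l. h l * Lq s l)" unfolding Lq_def by (intro continuous_intros hc)
    have b: "cmod (h l * Lq s l) \<le> B * (N\<^sup>2 + S * N + \<rho> 1 * \<rho> 2)" for l
    proof (cases "\<bar>l\<bar> > N")
      case True
      have "0 \<le> N\<^sup>2 + S * N + \<rho> 1 * \<rho> 2" using S_pos N_nonneg \<rho>_pos \<rho>_less by simp
      thus ?thesis using True B_nonneg by (simp add: h_supp)
    next
      case False
      thus ?thesis unfolding norm_mult using B_nonneg s by (intro mult_mono h_bound Lq_bound) auto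
    qed
    have "(\<lambda>n. PI s (e n)) \<longlonglongrightarrow> pi * (LINT l|lborel. (cmod (h l * Lq s l))\<^sup>2)"
      unfolding PI_def PK_def by (rule Poisson_approximate_identity[OF c b _ e0 el, of N]) (simp add: h_supp)
    moreover have "(cmod (h l * Lq s l))\<^sup>2 = P l * (cmod (h l))\<^sup>2" for l
    proof -
      have "cmod (Lq s l) = cmod (Ap l)" using s Ap_eq[of l] by (metis complex_mod_cnj)
      thus ?thesis using Ap_norm[of l] by (simp add: norm_mult power_mult_distrib)
    qed
    ultimately show ?thesis by (simp add: X_def)
  qed
  have "(\<lambda>n. J n - (PI 1 (e n) + PI (-1) (e n)) / 2) \<longlonglongrightarrow> 0"
  proof (rule Lim_null_comparison)
    show "\<forall>\<^sub>F n in sequentially. norm (J n - (PI 1 (e n) + PI (-1) (e n)) / 2)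
      \<le> 2 * N * (B * (B * ((1 + 1 / \<rho> 1) * CD N * e n) * (2 * N + pi)))"
      unfolding J_def by (intro always_eventually allI Wk_Poisson_difference e0)
    have "(\<lambda>n. 2 * N * (B * (B * ((1 + 1 / \<rho> 1) * CD N * e n) * (2 * N + pi)))) \<longlonglongrightarrow> 2 * N * (B * (B * ((1 + 1 / \<rho> 1) * CD N * 0) * (2 * N + pi)))"
      by (intro tendsto_intros el)
    thus "(\<lambda>n. 2 * N * (B * (B * ((1 + 1 / \<rho> 1) * CD N * e n) * (2 * N + pi)))) \<longlonglongrightarrow> 0" by simp
  qed
  moreover have "(\<lambda>n. (PI 1 (e n) + PI (-1) (e n)) / 2) \<longlonglongrightarrow> (complex_of_real (pi * X) + complex_of_real (pi * X)) / 2"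
    using PIl[of 1] PIl[of "-1"] by (intro tendsto_intros) auto
  ultimately have "(\<lambda>n. (J n - (PI 1 (e n) + PI (-1) (e n)) / 2) + (PI 1 (e n) + PI (-1) (e n)) / 2) \<longlonglongrightarrow> 0 + (complex_of_real (pi * X) + complex_of_real (pi * X)) / 2"
    by (rule tendsto_add)
  hence Jl: "J \<longlonglongrightarrow> complex_of_real (pi * X)" by simp
  \<comment> \<open>Half the exponent, since the weight in \<open>weighted_norm_Ua\<close>
    multiplies |Ua|^2.\<close>
  define f where "f n x = complex_of_real (exp (- (e n * \<bar>x\<bar>))) * Ua h x" for n x
  have f_meas: "f n \<in> borel_measurable lborel" for n unfolding f_def[abs_def] by measurable
  have fsq: "complex_of_real ((cmod (f n x))\<^sup>2) = complex_of_real (exp (- (2 * e n * \<bar>x\<bar>))) * (cnj (Ua h x) * Ua h x)" for n x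
  proof -
    have "(exp (- (e n * \<bar>x\<bar>)))\<^sup>2 = exp (- (2 * e n * \<bar>x\<bar>))" by (simp add: power2_eq_square flip: exp_add)
    hence "(cmod (f n x))\<^sup>2 = exp (- (2 * e n * \<bar>x\<bar>)) * (cmod (Ua h x))\<^sup>2"
      by (simp add: f_def norm_mult power_mult_distrib)
    thus ?thesis by (simp only: of_real_mult complex_norm_square[of "Ua h x"] mult.commute[of "Ua h x"])
  qed
  have "(\<lambda>x. cnj (Ua h x) * Ua h x) \<in> borel_measurable borel" by measurable
  moreover have "cmod (cnj (Ua h x) * Ua h x) \<le> (2 * N * (B * sqrt (P N))) * (2 * N * (B * sqrt (P N)))" for x
    unfolding norm_mult complex_mod_cnj using N_nonneg B_nonneg P_pos[of N] by (intro mult_mono Ua_bound) auto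
  ultimately have If: "integrable lborel (\<lambda>x. complex_of_real ((cmod (f n x))\<^sup>2))" for n
    unfolding fsq by (rule LINT_reflect_split(2)[OF _ _ e0])
  have fL: "f n \<in> L2 lborel" for n
    using If[of n] f_meas by (simp add: L2_def complex_of_real_integrable_eq del: of_real_power)
  have fn: "complex_of_real ((L2_norm lborel (f n))\<^sup>2) = J n" for n
    unfolding L2_norm_sq J_def weighted_norm_Ua[OF e0, symmetric] fsq[symmetric] by (rule integral_complex_of_real[symmetric])
  have "(\<lambda>n. complex_of_real ((L2_norm lborel (f n))\<^sup>2)) \<longlonglongrightarrow> complex_of_real (pi * X)"
    unfolding fn by (rule Jl)
  hence sql: "(\<lambda>n. (L2_norm lborel (f n))\<^sup>2) \<longlonglongrightarrow> pi * X" by (simp only: tendsto_of_real_iff)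
  hence nl: "(\<lambda>n. L2_norm lborel (f n)) \<longlonglongrightarrow> sqrt (pi * X)"
    using tendsto_real_sqrt[OF sql] by simp
  have pw: "AE x in lborel. (\<lambda>n. f n x) \<longlonglongrightarrow> Ua h x"
  proof (rule AE_I2)
    fix x
    have "(\<lambda>n. complex_of_real (exp (- (e n * \<bar>x\<bar>))) * Ua h x) \<longlonglongrightarrow> complex_of_real (exp (- (0 * \<bar>x\<bar>))) * Ua h x"
      by (intro tendsto_intros el)
    thus "(\<lambda>n. f n x) \<longlonglongrightarrow> Ua h x" by (simp add: f_def)
  qed
  have Um: "Ua h \<in> borel_measurable lborel" by simp
  have ev: "\<forall>\<^sub>F n in sequentially. L2_norm lborel (f n) \<le> sqrt (pi * X) + d" if "d > 0" for d
    using order_tendstoD(2)[OF nl, of "sqrt (pi * X) + d"] that by (auto elim!: eventually_mono)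
  show UL: "Ua h \<in> L2 lborel" by (rule L2_Fatou(1)[OF fL Um pw ev[of 1]]) simp
  have "L2_norm lborel (Ua h) \<le> sqrt (pi * X) + d" if "d > 0" for d
    by (rule L2_Fatou(2)[OF fL Um pw ev[OF that]])
  hence le: "L2_norm lborel (Ua h) \<le> sqrt (pi * X)" by (rule field_le_epsilon)
  have "L2_norm lborel (f n) \<le> L2_norm lborel (Ua h)" for n
    by (rule L2_norm_mono[OF f_meas UL]) (auto simp: f_def norm_mult e0 less_imp_le intro!: mult_left_le_one_le)
  hence "sqrt (pi * X) \<le> L2_norm lborel (Ua h)" by (intro LIMSEQ_le_const2[OF nl]) auto
  with le have "L2_norm lborel (Ua h) = sqrt (pi * X)" by simp
  moreover have "0 \<le> X" unfolding X_def by (intro Bochner_Integration.integral_nonneg mult_nonneg_nonneg less_imp_le[OF P_pos]) auto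
  ultimately show "(L2_norm lborel (Ua h))\<^sup>2 = pi * (LINT l|lborel. P l * (cmod (h l))\<^sup>2)"
    by (simp add: X_def)
qed

end

text \<open>Division by sqrt (\<pi> P) absorbs the weight \<pi> P that appears in
  \<open>Ua_isometry\<close>.\<close>

definition kf :: "real \<Rightarrow> real \<Rightarrow> complex" where
  "kf x l = soliton_a \<rho> \<theta> x (complex_of_real l) / complex_of_real (sqrt (pi * P l))"

lemma P_continuous: "continuous_on A P"
  unfolding P_def[abs_def] by (intro continuous_intros)

lemma P_measurable [measurable]: "P \<in> borel_measurable borel"
  by (rule borel_measurable_continuous_onI[OF P_continuous])

lemma kf_measurable: "(\<lambda>(x, l). kf x l) \<in> borel_measurable (borel \<Otimes>\<^sub>M borel)"
  unfolding kf_def by measurable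

lemma kf_measurable_lborel: "(\<lambda>(x, l). kf x l) \<in> borel_measurable (lborel \<Otimes>\<^sub>M lborel)"
  using kf_measurable by (simp cong: measurable_cong_sets sets_pair_measure_cong)

lemma kf_bound: "cmod (kf x l) \<le> 1 / sqrt pi"
  using soliton_a_real_bound[of x l] P_pos[of l] by (simp add: kf_def norm_divide norm_mult real_sqrt_mult field_simps)

lemma full_bounded_kernel: "bounded_kernel lborel kf (1 / sqrt pi)"
proof
  show "emeasure lborel ({-R..R} \<inter> space lborel) < \<infinity>" for R :: real
    using emeasure_compact_finite[of "{-R..R}"] by simp
qed (auto simp: kf_measurable_lborel kf_bound lborel.sigma_finite_measure_axioms)

interpretation fb: bounded_kernel lborel kf "1 / sqrt pi"
  by (rule full_bounded_kernel)

lemma full_isometry_continuous: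
  assumes c: "continuous_on UNIV h" and b: "\<And>l. cmod (h l) \<le> B" and z: "\<And>l. \<bar>l\<bar> > N \<Longrightarrow> h l = 0" and N: "0 \<le> N"
  shows "fb.T h \<in> L2 lborel" and "L2_norm lborel (fb.T h) = L2_norm lborel h"
proof -
  define h' where "h' l = h l / complex_of_real (sqrt (pi * P l))" for l
  have T: "fb.T h = Ua h'" by (simp add: fb.T_def Ua_def h'_def kf_def fun_eq_iff)
  have P0: "P 0 > 0" "P l \<ge> P 0" for l
    by (simp_all add: P_pos) (unfold P_def, intro mult_mono, auto)
  have c': "continuous_on UNIV h'"
    unfolding h'_def using P_pos by (intro continuous_intros c P_continuous) (auto simp: less_imp_neq[symmetric])
  have b': "cmod (h' l) \<le> B / sqrt (pi * P 0)" for l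
    unfolding h'_def norm_divide using b[of l] P0 order_trans[OF norm_ge_zero b[of l]]
    by (intro frac_le) (auto intro!: order_trans[OF _ abs_ge_self] real_sqrt_le_mono mult_left_mono)
  have z': "h' l = 0" if "\<bar>l\<bar> > N" for l using z[OF that] by (simp add: h'_def)
  have m': "h' \<in> borel_measurable borel" by (rule borel_measurable_continuous_onI[OF c'])
  note iso = Ua_isometry[OF m' b' z' N c']
  show "fb.T h \<in> L2 lborel" unfolding T by (rule iso(1))
  have e: "pi * (P l * (cmod (h' l))\<^sup>2) = (cmod (h l))\<^sup>2" for l
    using P_pos[of l] by (simp add: h'_def norm_divide power_divide)
  have "(L2_norm lborel (fb.T h))\<^sup>2 = pi * (LINT l|lborel. P l * (cmod (h' l))\<^sup>2)"
    unfolding T by (rule iso(2))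
  also have "\<dots> = (L2_norm lborel h)\<^sup>2"
    unfolding L2_norm_sq e[symmetric] by simp
  finally have "(L2_norm lborel (fb.T h))\<^sup>2 = (L2_norm lborel h)\<^sup>2" .
  thus "L2_norm lborel (fb.T h) = L2_norm lborel h" by simp
qed

text \<open>Lebesgue measurable functions are almost everywhere limits of continuous ones. Composing
  with \<open>cl\<close>, a retraction onto the disc of radius B, and multiplying by the trapezoid
  \<open>ch\<close>, equal to 1 on [-N, N], restores the bound and the support without changing the
  limit.\<close>

lemma continuous_approximation:
  fixes h :: "real \<Rightarrow> complex"
  assumes h: "h \<in> borel_measurable borel" and b: "\<And>l. cmod (h l) \<le> B" and z: "\<And>l. \<bar>l\<bar> > N \<Longrightarrow> h l = 0"
    and B: "B > 0"
  shows "\<exists>f. (\<forall>n. continuous_on UNIV (f n)) \<and> (\<forall>n l. cmod (f n l) \<le> B) \<and> (\<forall>n l. \<bar>l\<bar> > N + 1 \<longrightarrow> f n l = 0) \<and>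
    (AE l in lborel. (\<lambda>n. f n l) \<longlonglongrightarrow> h l)"
proof -
  have "h \<in> borel_measurable lebesgue" using h by (intro measurable_completion) simp
  hence "h measurable_on UNIV" by (rule lebesgue_measurable_imp_measurable_on) simp
  then obtain Z g where Z: "negligible Z" and g: "\<And>n::nat. continuous_on UNIV (g n)"
    and gl: "\<And>l. l \<notin> Z \<Longrightarrow> (\<lambda>n. g n l) \<longlonglongrightarrow> h l"
    unfolding measurable_on_def by auto
  define cl where "cl z = complex_of_real (B / max B (cmod z)) * z" for z
  define ch where "ch l = max 0 (min 1 (N + 1 - \<bar>l\<bar>))" for l
  define f where "f n l = complex_of_real (ch l) * cl (g n l)" for n l
  have ccl: "continuous_on UNIV cl" unfolding cl_def using B by (intro continuous_intros) (auto simp: max_def)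
  have clb: "cmod (cl z) \<le> B" for z
  proof -
    have "cmod (cl z) = B * (cmod z / max B (cmod z))" using B by (simp add: cl_def norm_mult norm_divide)
    also have "\<dots> \<le> B * 1" using B by (intro mult_left_mono) (auto simp: divide_le_eq)
    finally show ?thesis by simp
  qed
  have clh: "cl (h l) = h l" for l using b[of l] B by (simp add: cl_def max_absorb1)
  have chb: "0 \<le> ch l" "ch l \<le> 1" for l by (auto simp: ch_def)
  have 1: "continuous_on UNIV (f n)" for n
    unfolding f_def ch_def by (intro continuous_intros continuous_on_compose2[OF ccl g]) auto
  have 2: "cmod (f n l) \<le> B" for n l
    using mult_mono[OF chb(2)[of l] clb[of "g n l"]] chb[of l] by (simp add: f_def norm_mult)
  have 3: "f n l = 0" if "\<bar>l\<bar> > N + 1" for n l using that by (simp add: f_def ch_def)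
  have "Z \<in> null_sets lebesgue" using Z by (simp add: negligible_iff_null_sets)
  hence "AE l in lebesgue. l \<notin> Z" by (rule AE_not_in)
  hence "AE l in lborel. l \<notin> Z" by (simp add: AE_completion_iff)
  hence 4: "AE l in lborel. (\<lambda>n. f n l) \<longlonglongrightarrow> h l"
  proof eventually_elim
    case (elim l)
    have "(\<lambda>n. f n l) \<longlonglongrightarrow> complex_of_real (ch l) * cl (h l)"
      unfolding f_def using ccl by (intro tendsto_intros isCont_tendsto_compose[OF _ gl[OF elim]]) (auto simp: continuous_on_eq_continuous_at)
    moreover have "complex_of_real (ch l) * cl (h l) = h l"
      using z[of l] unfolding clh by (cases "\<bar>l\<bar> \<le> N") (auto simp: ch_def)
    ultimately show ?case by simp
  qed
  show ?thesis using 1 2 3 4 by blast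
qed

text \<open>\<open>fb.T (f n)\<close> tends to \<open>fb.T h\<close> pointwise by domination. The
  continuous case, applied to differences, controls \<open>fb.T (f m) - fb.T (f n)\<close>, and
  Fatou's lemma in m turns this into norm convergence.\<close>

lemma full_isometry:
  assumes h: "h \<in> borel_measurable borel" and b0: "\<And>l. cmod (h l) \<le> B0" and z0: "\<And>l. \<bar>l\<bar> > N0 \<Longrightarrow> h l = 0"
  shows "fb.T h \<in> L2 lborel \<and> L2_norm lborel (fb.T h) = L2_norm lborel h"
proof -
  define B where "B = \<bar>B0\<bar> + 1"
  define N where "N = \<bar>N0\<bar>"
  have B: "B > 0" and N: "N \<ge> 0" by (auto simp: B_def N_def)
  have b: "cmod (h l) \<le> B" for l using b0[of l] by (simp add: B_def)
  have z: "h l = 0" if "\<bar>l\<bar> > N" for l using z0[of l] that by (simp add: N_def)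
  obtain f where f: "\<And>n. continuous_on UNIV (f n)" "\<And>n l. cmod (f n l) \<le> B" "\<And>n l. \<bar>l\<bar> > N + 1 \<Longrightarrow> f n l = 0"
    and fl: "AE l in lborel. (\<lambda>n. f n l) \<longlonglongrightarrow> h l"
    using continuous_approximation[OF h b z B] by blast
  have fm: "f n \<in> borel_measurable borel" for n using f(1) by (rule borel_measurable_continuous_onI)
  note [measurable] = h fm
  have IN: "integrable lborel (\<lambda>l. c * indicator {-(N+1)..N+1} l :: real)" for c
    using emeasure_compact_finite[of "{-(N+1)..N+1}"] by (intro integrable_mult_right integrable_real_indicator) auto
  have bi: "cmod (f n l) \<le> B * indicator {-(N+1)..N+1} l" for n l
    using f(2)[of n l] f(3)[of l n] by (cases "\<bar>l\<bar> \<le> N + 1") (auto simp: indicator_def)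
  have bh: "cmod (h l) \<le> B * indicator {-(N+1)..N+1} l" for l
    using b[of l] z[of l] by (cases "\<bar>l\<bar> \<le> N + 1") (auto simp: indicator_def)
  have sq: "(B * indicator {-(N+1)..N+1} l)\<^sup>2 = B\<^sup>2 * indicator {-(N+1)..N+1} l" for l :: real
    by (simp add: indicator_def)
  have fL: "f n \<in> L2 lborel" for n
    by (rule L2_dominated[OF _ IN[of "B\<^sup>2"]]) (use power_mono[OF bi norm_ge_zero, of n _ 2] in \<open>auto simp only: sq, simp\<close>)
  have hL: "h \<in> L2 lborel"
    by (rule L2_dominated[OF _ IN[of "B\<^sup>2"]]) (use power_mono[OF bh norm_ge_zero, of _ 2] in \<open>auto simp only: sq, simp\<close>)
  have "(\<lambda>n. LINT l|lborel. (cmod (f n l - h l))\<^sup>2) \<longlonglongrightarrow> (LINT l::real|lborel. 0)"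
  proof (rule integral_dominated_convergence[where w="\<lambda>l. 4 * B\<^sup>2 * indicator {-(N+1)..N+1} l"])
    show "integrable lborel (\<lambda>l. 4 * B\<^sup>2 * indicator {-(N+1)..N+1} l :: real)" by (rule IN)
    show "AE l in lborel. (\<lambda>n. (cmod (f n l - h l))\<^sup>2) \<longlonglongrightarrow> 0"
      using fl
    proof eventually_elim
      case (elim l)
      have "(\<lambda>n. (cmod (f n l - h l))\<^sup>2) \<longlonglongrightarrow> (cmod (h l - h l))\<^sup>2" by (intro tendsto_intros elim)
      thus ?case by simp
    qed
    show "AE l in lborel. norm ((cmod (f n l - h l))\<^sup>2) \<le> 4 * B\<^sup>2 * indicator {-(N+1)..N+1} l" for n
    proof (rule AE_I2)
      fix l
      have "cmod (f n l - h l) \<le> 2 * (B * indicator {-(N+1)..N+1} l)"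
        using norm_triangle_ineq4[of "f n l" "h l"] bi[of n l] bh[of l] by linarith
      hence "(cmod (f n l - h l))\<^sup>2 \<le> (2 * (B * indicator {-(N+1)..N+1} l))\<^sup>2" by (intro power_mono) auto
      thus "norm ((cmod (f n l - h l))\<^sup>2) \<le> 4 * B\<^sup>2 * indicator {-(N+1)..N+1} l"
        unfolding power_mult_distrib[of 2] sq by simp
    qed
  qed auto
  hence "(\<lambda>n. sqrt (LINT l|lborel. (cmod (f n l - h l))\<^sup>2)) \<longlonglongrightarrow> sqrt 0" by (intro tendsto_real_sqrt) simp
  hence conv: "(\<lambda>n. L2_norm lborel (\<lambda>l. f n l - h l)) \<longlonglongrightarrow> 0" by (simp add: L2_norm_def)
  have Tl: "AE x in lborel. (\<lambda>n. fb.T (f n) x) \<longlonglongrightarrow> fb.T h x"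
    by (rule AE_I2, rule fb.T_tendsto[OF _ _ IN[of B] _ fl]) (use bi in auto)
  have iso: "fb.T (f n) \<in> L2 lborel" "L2_norm lborel (fb.T (f n)) = L2_norm lborel (f n)" for n
    using full_isometry_continuous[where h="f n" and N="N + 1", OF f(1,2,3)] N by auto
  have fI: "integrable lborel (f n)" for n
    by (rule integrable_compact_support[OF fm f(2) f(3)])
  have isod: "L2_norm lborel (\<lambda>x. fb.T (f m) x - fb.T (f n) x) = L2_norm lborel (\<lambda>l. f m l - f n l)" for m n
  proof -
    have "(\<lambda>x. fb.T (f m) x - fb.T (f n) x) = fb.T (\<lambda>l. f m l - f n l)"
      using fb.T_diff[OF fI fI] by auto
    moreover have "L2_norm lborel (fb.T (\<lambda>l. f m l - f n l)) = L2_norm lborel (\<lambda>l. f m l - f n l)"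
    proof (rule full_isometry_continuous(2))
      show "continuous_on UNIV (\<lambda>l. f m l - f n l)" by (intro continuous_intros f)
      show "cmod (f m l - f n l) \<le> B + B" for l by (rule order_trans[OF norm_triangle_ineq4 add_mono[OF f(2) f(2)]])
      show "f m l - f n l = 0" if "\<bar>l\<bar> > N + 1" for l using f(3)[OF that] by simp
    qed (use N in simp)
    ultimately show ?thesis by simp
  qed
  have Tm: "fb.T h \<in> borel_measurable lborel" by (rule fb.T_measurable) simp
  have fe: "\<forall>\<^sub>F n in sequentially. L2_norm lborel (\<lambda>l. f n l - h l) < e" if "e > 0" for e
    by (rule order_tendstoD(2)[OF conv that])
  have TL: "fb.T h \<in> L2 lborel"
  proof (rule L2_Fatou(1)[OF iso(1) Tm Tl])
    show "\<forall>\<^sub>F n in sequentially. L2_norm lborel (fb.T (f n)) \<le> L2_norm lborel h + 1"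
      using fe[OF zero_less_one]
    proof eventually_elim
      case (elim n)
      thus ?case using L2_norm_triangle_diff[OF fL hL, of n] by (simp add: iso)
    qed
  qed
  have "\<bar>L2_norm lborel (fb.T h) - L2_norm lborel h\<bar> \<le> 3 * e" if e: "e > 0" for e
  proof -
    obtain n where n: "L2_norm lborel (\<lambda>l. f n l - h l) < e" using eventually_happens[OF fe[OF e]] by auto
    have "L2_norm lborel (\<lambda>x. fb.T h x - fb.T (f n) x) \<le> 2 * e"
    proof (rule L2_Fatou(2)[OF L2_diff[OF iso(1) iso(1)]])
      show "(\<lambda>x. fb.T h x - fb.T (f n) x) \<in> borel_measurable lborel"
        using Tm L2_measurable[OF iso(1)[of n]] by simp
      show "AE x in lborel. (\<lambda>m. fb.T (f m) x - fb.T (f n) x) \<longlonglongrightarrow> fb.T h x - fb.T (f n) x"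
        using Tl by eventually_elim (intro tendsto_intros)
      show "\<forall>\<^sub>F m in sequentially. L2_norm lborel (\<lambda>x. fb.T (f m) x - fb.T (f n) x) \<le> 2 * e"
        using fe[OF e]
      proof eventually_elim
        case (elim m)
        thus ?case unfolding isod using L2_norm_triangle3[OF fL hL fL, of m n] n
          by (simp add: L2_norm_minus_commute[of lborel h])
      qed
    qed
    moreover have "\<bar>L2_norm lborel (fb.T h) - L2_norm lborel (f n)\<bar> \<le> L2_norm lborel (\<lambda>x. fb.T h x - fb.T (f n) x)"
      using L2_norm_abs_diff[OF TL iso(1), of n] by (simp add: iso)
    moreover have "\<bar>L2_norm lborel (f n) - L2_norm lborel h\<bar> \<le> L2_norm lborel (\<lambda>l. f n l - h l)"
      by (rule L2_norm_abs_diff[OF fL hL])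
    ultimately show ?thesis using n by linarith
  qed
  from this[of "d / 3" for d] have "\<bar>L2_norm lborel (fb.T h) - L2_norm lborel h\<bar> \<le> 0 + d" if "d > 0" for d
    using that by simp
  hence "\<bar>L2_norm lborel (fb.T h) - L2_norm lborel h\<bar> \<le> 0" by (rule field_le_epsilon)
  thus ?thesis using TL by simp
qed

end

sublocale soliton \<subseteq> full: isometric_kernel lborel kf "1 / sqrt pi"
proof -
  interpret fb: bounded_kernel lborel kf "1 / sqrt pi" by (rule full_bounded_kernel)
  show "isometric_kernel lborel kf (1 / sqrt pi)"
  proof
    fix h B N
    assume "h \<in> borel_measurable lborel" "\<And>l. l \<in> space lborel \<Longrightarrow> cmod (h l) \<le> B" "fb.supp_in N h"
    thus "fb.T h \<in> L2 lborel \<and> L2_norm lborel (fb.T h) = L2_norm lborel h"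
      by (intro full_isometry[of h B N]) (auto simp: fb.supp_in_def)
  qed
qed

section \<open>Parity: from the line to the half-line\<close>

definition halfline :: "real measure" where "halfline = restrict_space lborel {0..}"

lemma space_halfline [simp]: "space halfline = {0..}"
  by (simp add: halfline_def space_restrict_space)

definition zext :: "(real \<Rightarrow> complex) \<Rightarrow> real \<Rightarrow> complex" where
  "zext h l = indicator {0..} l *\<^sub>R h l"

lemma zext_measurable: "h \<in> borel_measurable halfline \<longleftrightarrow> zext h \<in> borel_measurable borel"
  unfolding halfline_def zext_def[abs_def]
  by (subst borel_measurable_restrict_space_iff) auto

lemma LINT_halfline:
  fixes f :: "real \<Rightarrow> 'a::{banach, second_countable_topology}"
  shows "(LINT l|halfline. f l) = (LINT l|lborel. indicator {0..} l *\<^sub>R f l)"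
  unfolding halfline_def by (subst integral_restrict_space) auto

lemma integrable_halfline:
  fixes f :: "real \<Rightarrow> 'a::{banach, second_countable_topology}"
  shows "integrable halfline f \<longleftrightarrow> integrable lborel (\<lambda>l. indicator {0..} l *\<^sub>R f l)"
  unfolding halfline_def by (subst integrable_restrict_space) auto

lemma zext_sq: "(cmod (zext h l))\<^sup>2 = indicator {0..} l *\<^sub>R (cmod (h l))\<^sup>2"
  by (simp add: zext_def indicator_def)

lemma L2_halfline: "h \<in> L2 halfline \<longleftrightarrow> zext h \<in> L2 lborel"
  by (simp add: L2_def zext_measurable integrable_halfline zext_sq)

lemma L2_norm_halfline: "L2_norm halfline h = L2_norm lborel (zext h)"
  by (simp add: L2_norm_def LINT_halfline zext_sq)

text \<open>For s = 1 the even and for s = -1 the odd extension from the half-line, up to the value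
  at the null point 0.\<close>

definition pext :: "complex \<Rightarrow> (real \<Rightarrow> complex) \<Rightarrow> real \<Rightarrow> complex" where
  "pext s h l = zext h l + s * zext h (- l)"

lemma L2_reflect:
  fixes f :: "real \<Rightarrow> complex"
  shows "f \<in> L2 lborel \<Longrightarrow> (\<lambda>x. f (- x)) \<in> L2 lborel"
  using lborel_integrable_real_affine[of "\<lambda>x. (cmod (f x))\<^sup>2" "-1" 0] by (auto simp: L2_def)

lemma LINT_reflect:
  fixes f :: "real \<Rightarrow> 'a::{banach, second_countable_topology}"
  shows "(LINT x|lborel. f (- x)) = (LINT x|lborel. f x)"
  using lborel_integral_real_affine[of "-1" f 0] by simp

lemma pext_L2: "h \<in> L2 halfline \<Longrightarrow> pext s h \<in> L2 lborel"
  unfolding pext_def[abs_def] L2_halfline by (intro L2_add L2_cmult L2_reflect)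

text \<open>The two halves overlap only at 0. The factor sqrt 2 is compensated by the 1/sqrt 2 in
  \<open>Psi_eq\<close>.\<close>

lemma pext_norm:
  assumes "h \<in> L2 halfline" "cmod s = 1"
  shows "L2_norm lborel (pext s h) = sqrt 2 * L2_norm halfline h"
proof -
  have z: "zext h \<in> L2 lborel" using assms L2_halfline by blast
  have "AE l in lborel. (cmod (pext s h l))\<^sup>2 = (cmod (zext h l))\<^sup>2 + (cmod (zext h (- l)))\<^sup>2"
    using AE_lborel_singleton[of 0]
    by eventually_elim (auto simp: pext_def zext_def indicator_def norm_mult assms)
  hence "(LINT l|lborel. (cmod (pext s h l))\<^sup>2) = (LINT l|lborel. (cmod (zext h l))\<^sup>2 + (cmod (zext h (- l)))\<^sup>2)"
    using L2_measurable[OF pext_L2[OF assms(1)]] L2_measurable[OF z] L2_measurable[OF L2_reflect[OF z]]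
    by (intro integral_cong_AE) auto
  also have "\<dots> = 2 * (LINT l|lborel. (cmod (zext h l))\<^sup>2)"
    using L2_integrable_sq[OF z] L2_integrable_sq[OF L2_reflect[OF z]] LINT_reflect[of "\<lambda>l. (cmod (zext h l))\<^sup>2"] by simp
  finally show ?thesis unfolding L2_norm_halfline by (simp add: L2_norm_def real_sqrt_mult)
qed

lemma pext_orthogonal:
  "(LINT l|lborel. cnj (pext 1 h l) * pext (-1) h' l) = 0"
proof -
  have "(LINT l|lborel. cnj (pext 1 h (- l)) * pext (-1) h' (- l)) = (LINT l|lborel. cnj (pext 1 h l) * pext (-1) h' l)"
    by (rule LINT_reflect)
  moreover have "cnj (pext 1 h (- l)) * pext (-1) h' (- l) = - (cnj (pext 1 h l) * pext (-1) h' l)" for l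
    by (simp add: pext_def algebra_simps)
  ultimately show ?thesis by simp
qed

lemma parity_sign_cases: "parity_sign \<alpha> = 1 \<or> parity_sign \<alpha> = -1" "cmod (parity_sign \<alpha>) = 1"
  by (cases \<alpha>; simp)+

context soliton
begin

lemma Psi_eq: "Psi \<rho> \<theta> \<alpha> x l = (kf x l + parity_sign \<alpha> * kf x (- l)) / sqrt 2"
proof -
  have "sqrt (2 * pi * (l\<^sup>2 + (\<rho> 1)\<^sup>2) * (l\<^sup>2 + (\<rho> 2)\<^sup>2)) = sqrt 2 * sqrt (pi * P l)"
    by (simp add: P_def real_sqrt_mult mult.assoc)
  moreover have "P (- l) = P l" by (simp add: P_def)
  ultimately show ?thesis
    by (simp add: Psi_def kf_def add_divide_distrib mult.commute)
qed

lemma Psi_bound: "cmod (Psi \<rho> \<theta> \<alpha> x l) \<le> 2"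
proof -
  have "1 / sqrt pi \<le> 1" using pi_gt3 by simp
  hence p: "cmod (kf x l) \<le> 1" for l using kf_bound[of x l] by linarith
  have "cmod (kf x l + parity_sign \<alpha> * kf x (- l)) \<le> 1 + 1"
    by (rule order_trans[OF norm_triangle_ineq add_mono]) (use p in \<open>auto simp: norm_mult parity_sign_cases\<close>)
  moreover have "2 \<le> 2 * sqrt (2::real)" by simp
  ultimately have "cmod (kf x l + parity_sign \<alpha> * kf x (- l)) \<le> 2 * sqrt 2" by linarith
  thus ?thesis unfolding Psi_eq norm_divide by (simp add: divide_le_eq)
qed

lemma Psi_measurable: "(\<lambda>(x, l). Psi \<rho> \<theta> \<alpha> x l) \<in> borel_measurable (borel \<Otimes>\<^sub>M borel)"
proof -
  note [measurable] = kf_measurable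
  have "(\<lambda>(x, l). kf x (- l)) \<in> borel_measurable (borel \<Otimes>\<^sub>M borel)" by measurable
  thus ?thesis unfolding Psi_eq by measurable
qed

lemma Psi_bounded_kernel: "bounded_kernel halfline (Psi \<rho> \<theta> \<alpha>) 2"
proof (rule bounded_kernel.intro)
  show "sigma_finite_measure halfline"
    unfolding halfline_def by (rule sigma_finite_measure_restrict_space[OF lborel.sigma_finite_measure_axioms]) simp
  have id: "(\<lambda>l. l) \<in> measurable halfline borel"
    unfolding halfline_def by (rule measurable_restrict_space1) simp
  thus "(\<lambda>l. l) \<in> borel_measurable halfline" .
  show "emeasure halfline ({-R..R} \<inter> space halfline) < \<infinity>" for R
  proof -
    have "emeasure halfline ({-R..R} \<inter> space halfline) = emeasure lborel ({-R..R} \<inter> {0..})"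
      unfolding space_halfline unfolding halfline_def by (rule emeasure_restrict_space) auto
    also have "\<dots> \<le> emeasure lborel {-R..R}" by (rule emeasure_mono) auto
    also have "\<dots> < \<infinity>" by (rule emeasure_compact_finite) simp
    finally show ?thesis .
  qed
  have "(\<lambda>p. (fst p, snd p)) \<in> measurable (lborel \<Otimes>\<^sub>M halfline) (borel \<Otimes>\<^sub>M borel)"
    by (intro measurable_Pair measurable_compose[OF measurable_snd id]) (auto intro: measurable_compose[OF measurable_fst])
  from measurable_compose[OF this Psi_measurable]
  show "(\<lambda>(x, l). Psi \<rho> \<theta> \<alpha> x l) \<in> borel_measurable (lborel \<Otimes>\<^sub>M halfline)" by (simp add: case_prod_beta)
qed (rule Psi_bound)

definition Th :: "parity \<Rightarrow> (real \<Rightarrow> complex) \<Rightarrow> real \<Rightarrow> complex" where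
  "Th \<alpha> = bounded_kernel.T halfline (Psi \<rho> \<theta> \<alpha>)"

lemma supp_pext:
  assumes "bounded_kernel.supp_in halfline N h"
  shows "full.supp_in N (pext s h)"
proof -
  interpret b: bounded_kernel halfline "Psi \<rho> \<theta> Even" 2 by (rule Psi_bounded_kernel)
  show ?thesis using assms
    by (auto simp: full.supp_in_def b.supp_in_def pext_def zext_def indicator_def)
qed

text \<open>Reflecting l moves the extension from \<open>h\<close> to the kernel, where it becomes
  the combination defining \<Psi>. Isometry and orthogonality of the parities are thereby inherited
  from the whole line.\<close>

lemma full_T_pext:
  assumes h: "h \<in> L2 halfline" and N: "bounded_kernel.supp_in halfline N h"
  shows "full.T (pext (parity_sign \<alpha>) h) x = sqrt 2 * Th \<alpha> h x"
proof -
  interpret b: bounded_kernel halfline "Psi \<rho> \<theta> \<alpha>" 2 by (rule Psi_bounded_kernel)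
  have hi: "integrable lborel (zext h)"
    using b.integrable_supp[OF h N] by (simp add: integrable_halfline zext_def[abs_def])
  have hr: "integrable lborel (\<lambda>l. zext h (- l))" using lborel_integrable_real_affine[OF hi, of "-1" 0] by simp
  have i1: "integrable lborel (\<lambda>l. zext h l * kf x l)" by (rule full.T_integrand_integrable[OF hi])
  have i2: "integrable lborel (\<lambda>l. zext h (- l) * kf x l)" by (rule full.T_integrand_integrable[OF hr])
  have i2': "integrable lborel (\<lambda>l. zext h l * kf x (- l))" using lborel_integrable_real_affine[OF i2, of "-1" 0] by simp
  have "full.T (pext (parity_sign \<alpha>) h) x = (LINT l|lborel. zext h l * kf x l + parity_sign \<alpha> * (zext h (- l) * kf x l))"
    unfolding full.T_def pext_def by (simp add: algebra_simps)
  also have "\<dots> = (LINT l|lborel. zext h l * kf x l) + parity_sign \<alpha> * (LINT l|lborel. zext h (- l) * kf x l)"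
    using i1 i2 by simp
  also have "(LINT l|lborel. zext h (- l) * kf x l) = (LINT l|lborel. zext h l * kf x (- l))"
    using LINT_reflect[of "\<lambda>l. zext h l * kf x (- l)"] by simp
  also have "(LINT l|lborel. zext h l * kf x l) + parity_sign \<alpha> * (LINT l|lborel. zext h l * kf x (- l))
     = (LINT l|lborel. zext h l * kf x l + parity_sign \<alpha> * (zext h l * kf x (- l)))"
    using i1 i2' by simp
  also have "\<dots> = (LINT l|lborel. sqrt 2 * (indicator {0..} l *\<^sub>R (h l * Psi \<rho> \<theta> \<alpha> x l)))"
  proof (rule Bochner_Integration.integral_cong[OF refl])
    fix l
    have "sqrt 2 * Psi \<rho> \<theta> \<alpha> x l = kf x l + parity_sign \<alpha> * kf x (- l)" by (simp add: Psi_eq)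
    thus "zext h l * kf x l + parity_sign \<alpha> * (zext h l * kf x (- l)) = sqrt 2 * (indicator {0..} l *\<^sub>R (h l * Psi \<rho> \<theta> \<alpha> x l))"
      by (cases "0 \<le> l") (auto simp: zext_def algebra_simps)
  qed
  also have "\<dots> = sqrt 2 * Th \<alpha> h x"
    unfolding Th_def b.T_def LINT_halfline by (rule integral_mult_right_zero)
  finally show ?thesis .
qed

lemma Psi_isometric_kernel: "isometric_kernel halfline (Psi \<rho> \<theta> \<alpha>) 2"
proof -
  interpret b: bounded_kernel halfline "Psi \<rho> \<theta> \<alpha>" 2 by (rule Psi_bounded_kernel)
  show ?thesis
  proof
    fix h B N
    assume h: "h \<in> borel_measurable halfline" and bd: "\<And>l. l \<in> space halfline \<Longrightarrow> cmod (h l) \<le> B" and N: "b.supp_in N h"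
    have hL: "h \<in> L2 halfline"
    proof (rule L2_dominated[OF h])
      show "integrable halfline (\<lambda>l. B\<^sup>2 * indicator ({-N..N} \<inter> space halfline) l)"
        using b.finite_bounded[of N] b.interval_sets by (intro integrable_mult_right integrable_real_indicator) auto
      show "(cmod (h l))\<^sup>2 \<le> B\<^sup>2 * indicator ({-N..N} \<inter> space halfline) l" if "l \<in> space halfline" for l
        using bd[OF that] N that by (cases "\<bar>l\<bar> \<le> N") (auto simp: indicator_def b.supp_in_def intro!: power_mono)
    qed
    have T: "b.T h x = (1 / sqrt 2) * full.T (pext (parity_sign \<alpha>) h) x" for x
      unfolding full_T_pext[OF hL N] Th_def by simp
    have TL: "full.T (pext (parity_sign \<alpha>) h) \<in> L2 lborel"
      by (rule full.T_L2[OF pext_L2[OF hL] supp_pext[OF N]])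
    have "L2_norm lborel (b.T h) = (1 / sqrt 2) * L2_norm lborel (full.T (pext (parity_sign \<alpha>) h))"
      unfolding T[abs_def] L2_norm_cmult by (simp add: norm_divide)
    also have "\<dots> = L2_norm halfline h"
      unfolding full.T_norm[OF pext_L2[OF hL] supp_pext[OF N]] pext_norm[OF hL parity_sign_cases(2)] by simp
    finally show "b.T h \<in> L2 lborel \<and> L2_norm lborel (b.T h) = L2_norm halfline h"
      using L2_cmult[OF TL] unfolding T[abs_def] by blast
  qed
qed

lemma parity_orthogonal:
  assumes h: "h \<in> L2 halfline" "bounded_kernel.supp_in halfline N h"
    and h': "h' \<in> L2 halfline" "bounded_kernel.supp_in halfline N' h'" and ne: "\<alpha> \<noteq> \<alpha>'"
  shows "(LINT x|lborel. cnj (Th \<alpha> h x) * Th \<alpha>' h' x) = 0"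
proof -
  have Te: "Th \<beta> g x = (1 / sqrt 2) * full.T (pext (parity_sign \<beta>) g) x" if "g \<in> L2 halfline" "bounded_kernel.supp_in halfline M g" for \<beta> g M x
    unfolding full_T_pext[OF that] by simp
  have orth: "(LINT l|lborel. cnj (pext (parity_sign \<alpha>) h l) * pext (parity_sign \<alpha>') h' l) = 0"
  proof (cases \<alpha>)
    case Even
    thus ?thesis using ne pext_orthogonal[of h h'] by (cases \<alpha>') auto
  next
    case Odd
    hence "\<alpha>' = Even" using ne by (cases \<alpha>') auto
    have "(LINT l|lborel. cnj (pext (-1) h l) * pext 1 h' l) = (LINT l|lborel. cnj (cnj (pext 1 h' l) * pext (-1) h l))"
      by (intro Bochner_Integration.integral_cong) auto
    also have "\<dots> = cnj (LINT l|lborel. cnj (pext 1 h' l) * pext (-1) h l)" by (rule Bochner_Integration.integral_cnj)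
    finally show ?thesis using Odd \<open>\<alpha>' = Even\<close> pext_orthogonal[of h' h] by simp
  qed
  have "(LINT x|lborel. cnj (Th \<alpha> h x) * Th \<alpha>' h' x)
     = (LINT x|lborel. (1 / 2) * (cnj (full.T (pext (parity_sign \<alpha>) h) x) * full.T (pext (parity_sign \<alpha>') h') x))"
    by (intro Bochner_Integration.integral_cong) (auto simp: Te[OF h] Te[OF h'] simp flip: of_real_mult)
  also have "\<dots> = (1 / 2) * (LINT l|lborel. cnj (pext (parity_sign \<alpha>) h l) * pext (parity_sign \<alpha>') h' l)"
    unfolding integral_mult_right_zero
    by (subst full.T_inner[OF pext_L2[OF h(1)] full.supp_in_mono[OF supp_pext[OF h(2)]] pext_L2[OF h'(1)] full.supp_in_mono[OF supp_pext[OF h'(2)]], of "max N N'"]) auto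
  finally show ?thesis unfolding orth by simp
qed

end

section \<open>Oscillatory integrals\<close>

text \<open>The multiplier of the evolution is \<open>ph t 0\<close>; the linear term b s is there
  to absorb the plane waves of \<Psi>.\<close>

definition ph :: "real \<Rightarrow> real \<Rightarrow> real \<Rightarrow> complex" where
  "ph t b s = exp (- \<i> * complex_of_real (2 * t * s\<^sup>2 + b * s))"

lemma ph_norm [simp]: "cmod (ph t b s) = 1"
  using norm_exp_i_times[of "- (2 * t * s\<^sup>2 + b * s)"] by (simp add: ph_def)

lemma ph_derivative: "(ph t b has_vector_derivative - \<i> * complex_of_real (4 * t * s + b) * ph t b s) (at s within A)"
proof -
  have eq: "ph t b = (\<lambda>s. exp (- \<i> * (2 * complex_of_real t * (complex_of_real s)\<^sup>2 + complex_of_real b * complex_of_real s)))"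
    by (simp add: ph_def fun_eq_iff)
  show ?thesis unfolding eq
    by (rule has_vector_derivative_at_within,
        rule has_vector_derivative_real_field[of "\<lambda>z. exp (- \<i> * (2 * complex_of_real t * z\<^sup>2 + complex_of_real b * z))"])
       (auto intro!: derivative_eq_intros simp: algebra_simps)
qed

lemma ph_continuous [continuous_intros]: "continuous_on A (ph t b)"
  unfolding ph_def[abs_def] by (intro continuous_intros)

lemma continuous_on_of_derivative:
  assumes "\<And>s. s \<in> {c..d::real} \<Longrightarrow> (f has_vector_derivative f' s) (at s within {c..d})"
  shows "continuous_on {c..d} f"
  unfolding continuous_on_eq_continuous_within using has_vector_derivative_continuous[OF assms] by blast

text \<open>Integration by parts against 1/s. Up to the factor 1/(4|t|), the boundary terms
  contribute 1/d + 1/c and the correction 1/c - 1/d.\<close>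

lemma Fresnel_tail:
  assumes c: "0 < c" "c \<le> d" and t: "t \<noteq> 0"
  shows "cmod (integral {c..d} (ph t 0)) \<le> 1 / (2 * \<bar>t\<bar> * c)"
proof -
  define F where "F s = (\<i> / (4 * complex_of_real t * complex_of_real s)) * ph t 0 s" for s
  define G where "G s = (\<i> / (4 * complex_of_real t * (complex_of_real s)\<^sup>2)) * ph t 0 s" for s
  have dF: "(F has_vector_derivative ph t 0 s - G s) (at s within {c..d})" if "s \<in> {c..d}" for s
  proof -
    have s: "s > 0" using that c by auto
    have "((\<lambda>s. \<i> / (4 * complex_of_real t * complex_of_real s)) has_vector_derivative - \<i> / (4 * complex_of_real t * (complex_of_real s)\<^sup>2)) (at s within {c..d})"
      by (rule has_vector_derivative_at_within, rule has_vector_derivative_real_field[of "\<lambda>z. \<i> / (4 * complex_of_real t * z)"])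
         (use s t in \<open>auto intro!: derivative_eq_intros simp: power2_eq_square field_simps\<close>)
    from has_vector_derivative_mult[OF this ph_derivative[of t 0 s]]
    have "(F has_vector_derivative (\<i> / (4 * complex_of_real t * complex_of_real s)) * (- \<i> * complex_of_real (4 * t * s + 0) * ph t 0 s)
       + (- \<i> / (4 * complex_of_real t * (complex_of_real s)\<^sup>2)) * ph t 0 s) (at s within {c..d})"
      unfolding F_def[abs_def] by simp
    moreover have "(\<i> / (4 * complex_of_real t * complex_of_real s)) * (- \<i> * complex_of_real (4 * t * s + 0) * ph t 0 s) = ph t 0 s"
      using s t by (simp add: field_simps)
    ultimately show ?thesis by (simp add: G_def)
  qed
  have cG: "continuous_on {c..d} G"
    unfolding G_def using c t by (intro continuous_intros) auto
  have I: "((\<lambda>s. ph t 0 s - G s) has_integral F d - F c) {c..d}"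
    using c dF by (intro fundamental_theorem_of_calculus) auto
  have GI: "G integrable_on {c..d}" by (rule integrable_continuous_real[OF cG])
  have "integral {c..d} (ph t 0) = F d - F c + integral {c..d} G"
    using integral_unique[OF I] GI integrable_continuous_real[OF ph_continuous[of "{c..d}" t 0]]
    by (simp add: Henstock_Kurzweil_Integration.integral_diff diff_eq_eq)
  also have "cmod \<dots> \<le> cmod (F d) + cmod (F c) + cmod (integral {c..d} G)"
    by (intro norm_triangle_le add_right_mono norm_triangle_ineq4)
  also have "cmod (F d) = 1 / (4 * \<bar>t\<bar> * d)" using c by (simp add: F_def norm_mult norm_divide)
  also have "cmod (F c) = 1 / (4 * \<bar>t\<bar> * c)" using c by (simp add: F_def norm_mult norm_divide)
  also have "cmod (integral {c..d} G) \<le> 1 / (4 * \<bar>t\<bar> * c) - 1 / (4 * \<bar>t\<bar> * d)"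
  proof -
    have I2: "((\<lambda>s. 1 / (4 * \<bar>t\<bar> * s\<^sup>2)) has_integral (- 1 / (4 * \<bar>t\<bar> * d)) - (- 1 / (4 * \<bar>t\<bar> * c))) {c..d}"
    proof (rule fundamental_theorem_of_calculus[OF c(2)])
      fix s assume "s \<in> {c..d}"
      hence s: "s > 0" using c by auto
      have "((\<lambda>s. - 1 / (4 * \<bar>t\<bar> * s)) has_real_derivative 1 / (4 * \<bar>t\<bar> * s\<^sup>2)) (at s within {c..d})"
        using s t by (auto intro!: derivative_eq_intros simp: power2_eq_square field_simps)
      thus "((\<lambda>s. - 1 / (4 * \<bar>t\<bar> * s)) has_vector_derivative 1 / (4 * \<bar>t\<bar> * s\<^sup>2)) (at s within {c..d})"
        by (simp add: has_real_derivative_iff_has_vector_derivative)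
    qed
    have "cmod (integral {c..d} G) \<le> integral {c..d} (\<lambda>s. 1 / (4 * \<bar>t\<bar> * s\<^sup>2))"
      by (rule integral_norm_bound_integral[OF GI]) (use I2 in \<open>auto simp: G_def norm_mult norm_divide norm_power\<close>)
    thus ?thesis using integral_unique[OF I2] by simp
  qed
  finally show ?thesis using c t by (simp add: field_simps)
qed

lemma Fresnel_from_zero:
  assumes t: "t \<noteq> 0" and x: "0 \<le> x"
  shows "cmod (integral {0..x} (ph t 0)) \<le> 3 / 2 / sqrt \<bar>t\<bar>"
proof -
  \<comment> \<open>The scale at which the trivial bound and the tail bound have the same
    order.\<close>
  define r where "r = 1 / sqrt \<bar>t\<bar>"
  have r: "r > 0" using t by (simp add: r_def)
  have I: "ph t 0 integrable_on {a..b}" for a b by (intro integrable_continuous_real ph_continuous)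
  have triv: "cmod (integral {0..y} (ph t 0)) \<le> y" if "0 \<le> y" for y
    using integral_norm_bound_integral[OF I[of 0 y], of "\<lambda>_. 1"] integrable_const_ivl[of "1::real" 0 y] that by simp
  have "cmod (integral {0..x} (ph t 0)) \<le> r + r / 2"
  proof (cases "x \<le> r")
    case True thus ?thesis using triv[OF x] r by simp
  next
    case False
    have "integral {0..x} (ph t 0) = integral {0..r} (ph t 0) + integral {r..x} (ph t 0)"
      using False r I by (intro Henstock_Kurzweil_Integration.integral_combine[symmetric]) auto
    also have "cmod \<dots> \<le> r + 1 / (2 * \<bar>t\<bar> * r)"
      using False r by (intro norm_triangle_le add_mono triv Fresnel_tail t) auto
    also have "1 / (2 * \<bar>t\<bar> * r) = r / 2"
    proof -
      have "\<bar>t\<bar> * r = sqrt \<bar>t\<bar>" using t by (simp add: r_def field_simps)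
      thus ?thesis unfolding mult.assoc by (simp only:) (simp add: r_def)
    qed
    finally show ?thesis .
  qed
  thus ?thesis by (simp add: r_def)
qed

lemma Fresnel_interval:
  assumes t: "t \<noteq> 0" and cd: "c \<le> d"
  shows "cmod (integral {c..d} (ph t 0)) \<le> 3 / sqrt \<bar>t\<bar>"
proof -
  have I: "ph t 0 integrable_on {a..b}" for a b by (intro integrable_continuous_real ph_continuous)
  have ev: "(\<lambda>s. ph t 0 (- s)) = ph t 0" by (simp add: ph_def fun_eq_iff)
  have refl: "integral {- b..- a} (ph t 0) = integral {a..b} (ph t 0)" for a b
    using Henstock_Kurzweil_Integration.integral_reflect_real[of b a "ph t 0"] unfolding ev .
  note z = Fresnel_from_zero[OF t]
  have pos: "cmod (integral {a..b} (ph t 0)) \<le> 3 / sqrt \<bar>t\<bar>" if "0 \<le> a" "a \<le> b" for a b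
  proof -
    have "integral {0..b} (ph t 0) = integral {0..a} (ph t 0) + integral {a..b} (ph t 0)"
      using that I by (intro Henstock_Kurzweil_Integration.integral_combine[symmetric]) auto
    hence "integral {a..b} (ph t 0) = integral {0..b} (ph t 0) - integral {0..a} (ph t 0)" by simp
    also have "cmod \<dots> \<le> 3 / 2 / sqrt \<bar>t\<bar> + 3 / 2 / sqrt \<bar>t\<bar>"
      using that by (intro order_trans[OF norm_triangle_ineq4] add_mono z) auto
    finally show ?thesis by simp
  qed
  consider "0 \<le> c" | "d \<le> 0" | "c \<le> 0" "0 \<le> d" by linarith
  thus ?thesis
  proof cases
    case 1 thus ?thesis using pos cd by simp
  next
    case 2 thus ?thesis using pos[of "- d" "- c"] refl[where a=c and b=d] cd by simp
  next
    case 3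
    have "integral {c..d} (ph t 0) = integral {c..0} (ph t 0) + integral {0..d} (ph t 0)"
      using 3 I by (intro Henstock_Kurzweil_Integration.integral_combine[symmetric]) auto
    also have "integral {c..0} (ph t 0) = integral {0..- c} (ph t 0)" using refl[where a=0 and b="- c"] by simp
    also have "cmod (integral {0..- c} (ph t 0) + integral {0..d} (ph t 0)) \<le> 3 / 2 / sqrt \<bar>t\<bar> + 3 / 2 / sqrt \<bar>t\<bar>"
      using 3 by (intro norm_triangle_le add_mono z) auto
    finally show ?thesis by simp
  qed
qed

text \<open>Completing the square shifts the interval and contributes a unimodular constant.
  Uniformity in b is what keeps x and y out of the even kernel bound.\<close>

lemma Fresnel_linear_phase:
  assumes t: "t \<noteq> 0" and cd: "c \<le> d"
  shows "cmod (integral {c..d} (ph t b)) \<le> 3 / sqrt \<bar>t\<bar>"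
proof -
  define \<beta> where "\<beta> = b / (4 * t)"
  define k where "k = exp (\<i> * complex_of_real (b\<^sup>2 / (8 * t)))"
  have pk: "ph t b s = k * ph t 0 (\<beta> + s)" for s
  proof -
    have e: "2 * t * s\<^sup>2 + b * s = 2 * t * (\<beta> + s)\<^sup>2 - b\<^sup>2 / (8 * t)"
      using t by (simp add: \<beta>_def power2_eq_square field_simps)
    show ?thesis unfolding k_def ph_def e exp_add[symmetric] by (simp add: algebra_simps)
  qed
  have "ph t b = (\<lambda>s. k * (ph t 0 \<circ> (+) \<beta>) s)" unfolding o_def by (rule ext) (rule pk)
  hence "integral {c..d} (ph t b) = integral {c..d} (\<lambda>s. k * (ph t 0 \<circ> (+) \<beta>) s)" by simp
  also have "\<dots> = k * integral {c..d} (ph t 0 \<circ> (+) \<beta>)" by (rule Henstock_Kurzweil_Integration.integral_mult_right)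
  also have "integral {c..d} (ph t 0 \<circ> (+) \<beta>) = integral {c + \<beta>..d + \<beta>} (ph t 0)"
    by (rule integral_shift_Icc_real)
  finally have "cmod (integral {c..d} (ph t b)) = cmod (integral {c + \<beta>..d + \<beta>} (ph t 0))"
    using norm_exp_i_times[of "b\<^sup>2 / (8 * t)"] by (simp add: norm_mult k_def)
  thus ?thesis using Fresnel_interval[OF t, of "c + \<beta>" "d + \<beta>"] cd by simp
qed

text \<open>Integration by parts against the primitive \<open>J\<close> of the phase, which is
  bounded by 3/sqrt |t|. As 1/(1 + s^2) has integral at most \<pi> < 4, the constant is 3(1 + 4) =
  15.\<close>

lemma van_der_Corput:
  assumes t: "t \<noteq> 0" and cd: "c \<le> d"
    and d: "\<And>s. s \<in> {c..d} \<Longrightarrow> (\<psi> has_vector_derivative \<psi>' s) (at s within {c..d})"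
    and M: "\<And>s. s \<in> {c..d} \<Longrightarrow> cmod (\<psi> s) \<le> M" "\<And>s. s \<in> {c..d} \<Longrightarrow> cmod (\<psi>' s) \<le> M / (1 + s\<^sup>2)"
  shows "cmod (integral {c..d} (\<lambda>s. ph t b s * \<psi> s)) \<le> 15 * M / sqrt \<bar>t\<bar>"
proof -
  define J where "J s = integral {c..s} (ph t b)" for s
  have M0: "0 \<le> M" using order_trans[OF norm_ge_zero M(1)[of c]] cd by simp
  have dJ: "(J has_vector_derivative ph t b s) (at s within {c..d})" if "s \<in> {c..d}" for s
    unfolding J_def using that by (intro integral_has_vector_derivative ph_continuous) auto
  have Jb: "cmod (J s) \<le> 3 / sqrt \<bar>t\<bar>" if "s \<in> {c..d}" for s
    unfolding J_def using that by (intro Fresnel_linear_phase t) auto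
  have I: "((\<lambda>s. J s * \<psi>' s + ph t b s * \<psi> s) has_integral J d * \<psi> d - J c * \<psi> c) {c..d}"
    by (rule fundamental_theorem_of_calculus[OF cd]) (rule has_vector_derivative_mult[OF dJ d])
  have c\<psi>: "continuous_on {c..d} \<psi>" by (rule continuous_on_of_derivative[OF d])
  have P: "(\<lambda>s. ph t b s * \<psi> s) integrable_on {c..d}"
    by (intro integrable_continuous_real continuous_intros c\<psi>)
  \<comment> \<open>\<psi>' may be discontinuous, so integrability of \<open>J s * \<psi>' s\<close>
    is obtained by subtracting the continuous part from an integrable derivative.\<close>
  have Q: "(\<lambda>s. J s * \<psi>' s) integrable_on {c..d}"
    using integrable_diff[OF has_integral_integrable[OF I] P] by simp
  have "integral {c..d} (\<lambda>s. J s * \<psi>' s + ph t b s * \<psi> s) = integral {c..d} (\<lambda>s. J s * \<psi>' s) + integral {c..d} (\<lambda>s. ph t b s * \<psi> s)"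
    by (rule Henstock_Kurzweil_Integration.integral_add[OF Q P])
  moreover have "J c = 0" by (simp add: J_def)
  ultimately have "integral {c..d} (\<lambda>s. ph t b s * \<psi> s) = J d * \<psi> d - integral {c..d} (\<lambda>s. J s * \<psi>' s)"
    using integral_unique[OF I] by (simp add: algebra_simps)
  also have "cmod \<dots> \<le> cmod (J d * \<psi> d) + cmod (integral {c..d} (\<lambda>s. J s * \<psi>' s))" by (rule norm_triangle_ineq4)
  also have "cmod (J d * \<psi> d) \<le> 3 / sqrt \<bar>t\<bar> * M"
    unfolding norm_mult using cd by (intro mult_mono Jb M) auto
  also have "cmod (integral {c..d} (\<lambda>s. J s * \<psi>' s)) \<le> 3 / sqrt \<bar>t\<bar> * M * pi"
  proof -
    have I2: "((\<lambda>s. 3 / sqrt \<bar>t\<bar> * (M / (1 + s\<^sup>2))) has_integral 3 / sqrt \<bar>t\<bar> * (M * arctan d) - 3 / sqrt \<bar>t\<bar> * (M * arctan c)) {c..d}"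
    proof (rule fundamental_theorem_of_calculus[OF cd])
      fix s assume "s \<in> {c..d}"
      have "((\<lambda>s. 3 / sqrt \<bar>t\<bar> * (M * arctan s)) has_real_derivative 3 / sqrt \<bar>t\<bar> * (M / (1 + s\<^sup>2))) (at s within {c..d})"
        by (auto intro!: derivative_eq_intros simp: divide_inverse)
      thus "((\<lambda>s. 3 / sqrt \<bar>t\<bar> * (M * arctan s)) has_vector_derivative 3 / sqrt \<bar>t\<bar> * (M / (1 + s\<^sup>2))) (at s within {c..d})"
        by (simp add: has_real_derivative_iff_has_vector_derivative)
    qed
    have "cmod (integral {c..d} (\<lambda>s. J s * \<psi>' s)) \<le> integral {c..d} (\<lambda>s. 3 / sqrt \<bar>t\<bar> * (M / (1 + s\<^sup>2)))"
    proof (rule integral_norm_bound_integral[OF Q])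
      fix s assume "s \<in> {c..d}"
      thus "cmod (J s * \<psi>' s) \<le> 3 / sqrt \<bar>t\<bar> * (M / (1 + s\<^sup>2))"
        unfolding norm_mult by (intro mult_mono Jb M) auto
    qed (use I2 in auto)
    also have "\<dots> = 3 / sqrt \<bar>t\<bar> * M * (arctan d - arctan c)" unfolding integral_unique[OF I2] by (simp add: algebra_simps diff_divide_distrib)
    also have "\<dots> \<le> 3 / sqrt \<bar>t\<bar> * M * pi"
      using arctan_ubound[of d] arctan_lbound[of c] M0 by (intro mult_left_mono) auto
    finally show ?thesis .
  qed
  also have "3 / sqrt \<bar>t\<bar> * M + 3 / sqrt \<bar>t\<bar> * M * pi \<le> 3 / sqrt \<bar>t\<bar> * M + 3 / sqrt \<bar>t\<bar> * M * 4"
    using pi_less_4 M0 by (intro add_left_mono mult_left_mono) auto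
  finally show ?thesis by simp
qed

text \<open>The conditions on the amplitudes are those of \<open>van_der_Corput\<close>, while the
  plane waves are kept apart so that they can be absorbed into the linear phase of
  \<open>ph\<close>.\<close>

definition wave :: "real \<Rightarrow> real \<Rightarrow> (real \<Rightarrow> complex) \<Rightarrow> bool" where
  "wave x U f \<longleftrightarrow> (\<exists>u u' v v'. \<forall>s. (u has_vector_derivative u' s) (at s) \<and> (v has_vector_derivative v' s) (at s) \<and>
     cmod (u s) \<le> U \<and> cmod (v s) \<le> U \<and> cmod (u' s) \<le> U / (1 + s\<^sup>2) \<and> cmod (v' s) \<le> U / (1 + s\<^sup>2) \<and>
     f s = u s * exp (- 2 * \<i> * complex_of_real (x * s)) + v s * exp (2 * \<i> * complex_of_real (x * s)))"

text \<open>The product rule has three terms, hence 45 = 3 * 15. The extra factor \<open>r\<close>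
  makes room for 1/s and 1/s^2 in the odd case.\<close>

lemma amplitude_product_bound:
  assumes t: "t \<noteq> 0" and cd: "c \<le> d"
    and u: "\<And>s. (u has_vector_derivative u' s) (at s)" "\<And>s. cmod (u s) \<le> U" "\<And>s. cmod (u' s) \<le> U / (1 + s\<^sup>2)"
    and v: "\<And>s. (v has_vector_derivative v' s) (at s)" "\<And>s. cmod (v s) \<le> V" "\<And>s. cmod (v' s) \<le> V / (1 + s\<^sup>2)"
    and r: "\<And>s. s \<in> {c..d} \<Longrightarrow> (r has_vector_derivative r' s) (at s)"
      "\<And>s. s \<in> {c..d} \<Longrightarrow> cmod (r s) \<le> R" "\<And>s. s \<in> {c..d} \<Longrightarrow> cmod (r' s) \<le> R / (1 + s\<^sup>2)"
  shows "cmod (integral {c..d} (\<lambda>s. ph t b s * (u s * cnj (v s) * r s))) \<le> 45 * (U * V * R) / sqrt \<bar>t\<bar>"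
proof -
  have U0: "0 \<le> U" and V0: "0 \<le> V" using order_trans[OF norm_ge_zero u(2)[of 0]] order_trans[OF norm_ge_zero v(2)[of 0]] by simp_all
  have R0: "0 \<le> R" using order_trans[OF norm_ge_zero r(2)[of c]] cd by simp
  have "cmod (integral {c..d} (\<lambda>s. ph t b s * (u s * cnj (v s) * r s))) \<le> 15 * (3 * (U * V * R)) / sqrt \<bar>t\<bar>"
  proof (rule van_der_Corput[OF t cd])
    fix s assume s: "s \<in> {c..d}"
    have k: "1 / (1 + s\<^sup>2) \<ge> 0" by simp
    show "((\<lambda>s. u s * cnj (v s) * r s) has_vector_derivative (u s * cnj (v s)) * r' s + (u s * cnj (v' s) + u' s * cnj (v s)) * r s) (at s within {c..d})"
      by (rule has_vector_derivative_at_within)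
         (intro has_vector_derivative_mult has_vector_derivative_cnj u v r s)
    have uv: "cmod (u s * cnj (v s)) \<le> U * V" unfolding norm_mult complex_mod_cnj using U0 by (intro mult_mono u v) auto
    have "cmod (u s * cnj (v s) * r s) \<le> (U * V) * R"
      unfolding norm_mult[of _ "r s"] using U0 V0 by (intro mult_mono uv r s) auto
    also have "\<dots> \<le> 3 * (U * V * R)" using U0 V0 R0 by simp
    finally show "cmod (u s * cnj (v s) * r s) \<le> 3 * (U * V * R)" .
    have 1: "cmod ((u s * cnj (v s)) * r' s) \<le> (U * V) * (R / (1 + s\<^sup>2))"
      unfolding norm_mult[of _ "r' s"] using U0 V0 by (intro mult_mono uv r s) auto
    have 2: "cmod (u s * cnj (v' s) * r s) \<le> (U * (V / (1 + s\<^sup>2))) * R"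
      unfolding norm_mult complex_mod_cnj using U0 V0 R0 k by (intro mult_mono u v r s) auto
    have 3: "cmod (u' s * cnj (v s) * r s) \<le> ((U / (1 + s\<^sup>2)) * V) * R"
      unfolding norm_mult complex_mod_cnj using U0 V0 R0 k by (intro mult_mono u v r s) auto
    have "cmod ((u s * cnj (v s)) * r' s + (u s * cnj (v' s) + u' s * cnj (v s)) * r s)
       \<le> cmod ((u s * cnj (v s)) * r' s) + (cmod (u s * cnj (v' s) * r s) + cmod (u' s * cnj (v s) * r s))"
      unfolding distrib_right by (intro norm_triangle_le add_left_mono norm_triangle_ineq)
    also have "\<dots> \<le> (U * V) * (R / (1 + s\<^sup>2)) + ((U * (V / (1 + s\<^sup>2))) * R + ((U / (1 + s\<^sup>2)) * V) * R)"
      by (intro add_mono 1 2 3)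
    also have "\<dots> = 3 * (U * V * R) / (1 + s\<^sup>2)" by (simp add: field_simps)
    finally show "cmod ((u s * cnj (v s)) * r' s + (u s * cnj (v' s) + u' s * cnj (v s)) * r s) \<le> 3 * (U * V * R) / (1 + s\<^sup>2)" .
  qed
  thus ?thesis by simp
qed

text \<open>Multiplying out two waves gives four products with linear phases 2(+-x +- y), hence 180
  = 4 * 45.\<close>

lemma two_wave_bound:
  assumes t: "t \<noteq> 0" and cd: "c \<le> d" and f: "wave x U f" and g: "wave y V g"
    and r: "\<And>s. s \<in> {c..d} \<Longrightarrow> (r has_vector_derivative r' s) (at s)"
      "\<And>s. s \<in> {c..d} \<Longrightarrow> cmod (r s) \<le> R" "\<And>s. s \<in> {c..d} \<Longrightarrow> cmod (r' s) \<le> R / (1 + s\<^sup>2)"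
  shows "cmod (integral {c..d} (\<lambda>s. ph t 0 s * (f s * cnj (g s) * r s))) \<le> 180 * (U * V * R) / sqrt \<bar>t\<bar>"
proof -
  obtain u1 u1' u2 u2' where u: "\<And>s. (u1 has_vector_derivative u1' s) (at s)" "\<And>s. (u2 has_vector_derivative u2' s) (at s)"
    "\<And>s. cmod (u1 s) \<le> U" "\<And>s. cmod (u2 s) \<le> U" "\<And>s. cmod (u1' s) \<le> U / (1 + s\<^sup>2)" "\<And>s. cmod (u2' s) \<le> U / (1 + s\<^sup>2)"
    and fe: "\<And>s. f s = u1 s * exp (- 2 * \<i> * complex_of_real (x * s)) + u2 s * exp (2 * \<i> * complex_of_real (x * s))"
    using f unfolding wave_def by blast
  obtain v1 v1' v2 v2' where v: "\<And>s. (v1 has_vector_derivative v1' s) (at s)" "\<And>s. (v2 has_vector_derivative v2' s) (at s)"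
    "\<And>s. cmod (v1 s) \<le> V" "\<And>s. cmod (v2 s) \<le> V" "\<And>s. cmod (v1' s) \<le> V / (1 + s\<^sup>2)" "\<And>s. cmod (v2' s) \<le> V / (1 + s\<^sup>2)"
    and ge: "\<And>s. g s = v1 s * exp (- 2 * \<i> * complex_of_real (y * s)) + v2 s * exp (2 * \<i> * complex_of_real (y * s))"
    using g unfolding wave_def by blast
  define \<Phi> where "\<Phi> b p q s = ph t b s * (p s * cnj (q s) * r s)" for b p q s
  have cr: "continuous_on {c..d} r"
    by (intro continuous_at_imp_continuous_on ballI has_vector_derivative_continuous[OF r(1)])
  have cu: "continuous_on {c..d} u1" "continuous_on {c..d} u2" "continuous_on {c..d} v1" "continuous_on {c..d} v2"
    by (intro continuous_at_imp_continuous_on ballI has_vector_derivative_continuous[OF u(1)]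
      has_vector_derivative_continuous[OF u(2)] has_vector_derivative_continuous[OF v(1)] has_vector_derivative_continuous[OF v(2)])+
  have I: "\<Phi> b p q integrable_on {c..d}" if "continuous_on {c..d} p" "continuous_on {c..d} q" for b p q
    unfolding \<Phi>_def by (intro integrable_continuous_real continuous_intros that cr)
  have eq: "ph t 0 s * (f s * cnj (g s) * r s) = \<Phi> (2 * x - 2 * y) u1 v1 s + \<Phi> (2 * x + 2 * y) u1 v2 s
      + \<Phi> (- 2 * x - 2 * y) u2 v1 s + \<Phi> (- 2 * x + 2 * y) u2 v2 s" for s
  proof -
    have e: "ph t b s = ph t 0 s * exp (- \<i> * complex_of_real (b * s))" for b
      unfolding ph_def exp_add[symmetric] by (simp add: algebra_simps)
    have m: "exp (- \<i> * complex_of_real ((2 * a + 2 * b) * s)) = exp (- 2 * \<i> * complex_of_real (a * s)) * exp (- 2 * \<i> * complex_of_real (b * s))" for a b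
      unfolding exp_add[symmetric] by (simp add: algebra_simps)
    have cn: "cnj (exp (- 2 * \<i> * complex_of_real (y * s))) = exp (- 2 * \<i> * complex_of_real (- y * s))"
      "cnj (exp (2 * \<i> * complex_of_real (y * s))) = exp (- 2 * \<i> * complex_of_real (y * s))"
      by (simp_all add: exp_cnj)
    have px: "exp (2 * \<i> * complex_of_real (x * s)) = exp (- 2 * \<i> * complex_of_real (- x * s))" by simp
    have b: "2 * x - 2 * y = 2 * x + 2 * (- y)" "- 2 * x - 2 * y = 2 * (- x) + 2 * (- y)" "- 2 * x + 2 * y = 2 * (- x) + 2 * y" by simp_all
    show ?thesis
      unfolding \<Phi>_def fe ge complex_cnj_add complex_cnj_mult cn px b e[of "2 * x + 2 * (- y)"] e[of "2 * x + 2 * y"]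
        e[of "2 * (- x) + 2 * (- y)"] e[of "2 * (- x) + 2 * y"] m by (simp only: ring_distribs mult_ac add_ac)
  qed
  have B: "cmod (integral {c..d} (\<Phi> b u1 v1)) \<le> 45 * (U * V * R) / sqrt \<bar>t\<bar>"
    "cmod (integral {c..d} (\<Phi> b u1 v2)) \<le> 45 * (U * V * R) / sqrt \<bar>t\<bar>"
    "cmod (integral {c..d} (\<Phi> b u2 v1)) \<le> 45 * (U * V * R) / sqrt \<bar>t\<bar>"
    "cmod (integral {c..d} (\<Phi> b u2 v2)) \<le> 45 * (U * V * R) / sqrt \<bar>t\<bar>" for b
    unfolding \<Phi>_def
    by (rule amplitude_product_bound[OF t cd u(1,3,5) v(1,3,5) r] amplitude_product_bound[OF t cd u(1,3,5) v(2,4,6) r]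
      amplitude_product_bound[OF t cd u(2,4,6) v(1,3,5) r] amplitude_product_bound[OF t cd u(2,4,6) v(2,4,6) r]; assumption)+
  have "integral {c..d} (\<lambda>s. ph t 0 s * (f s * cnj (g s) * r s)) = integral {c..d} (\<Phi> (2 * x - 2 * y) u1 v1) + integral {c..d} (\<Phi> (2 * x + 2 * y) u1 v2)
      + integral {c..d} (\<Phi> (- 2 * x - 2 * y) u2 v1) + integral {c..d} (\<Phi> (- 2 * x + 2 * y) u2 v2)"
    unfolding eq
    by (simp add: Henstock_Kurzweil_Integration.integral_add integrable_add I cu)
  also have "cmod \<dots> \<le> 45 * (U * V * R) / sqrt \<bar>t\<bar> + 45 * (U * V * R) / sqrt \<bar>t\<bar> + 45 * (U * V * R) / sqrt \<bar>t\<bar> + 45 * (U * V * R) / sqrt \<bar>t\<bar>"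
    by (intro norm_triangle_le add_mono order_trans[OF norm_triangle_ineq add_mono] B)
  finally show ?thesis by (simp add: mult_ac)
qed

section \<open>Amplitudes with two decaying derivatives\<close>

definition symbol :: "real \<Rightarrow> (real \<Rightarrow> complex) \<Rightarrow> bool" where
  "symbol C f \<longleftrightarrow> (\<exists>f' f''. \<forall>s. (f has_vector_derivative f' s) (at s) \<and> (f' has_vector_derivative f'' s) (at s) \<and>
     cmod (f s) \<le> C \<and> cmod (f' s) \<le> C / (1 + s\<^sup>2) \<and> cmod (f'' s) \<le> C / (1 + s\<^sup>2))"

lemma symbolI:
  assumes "\<And>s. (f has_vector_derivative f' s) (at s)" "\<And>s. (f' has_vector_derivative f'' s) (at s)"
    "\<And>s. cmod (f s) \<le> C" "\<And>s. cmod (f' s) \<le> C / (1 + s\<^sup>2)" "\<And>s. cmod (f'' s) \<le> C / (1 + s\<^sup>2)"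
  shows "symbol C f"
  unfolding symbol_def using assms by blast

lemma one_plus_sq_pos: "0 < 1 + (s::real)\<^sup>2"
  by (simp add: add_pos_nonneg)

lemma divide_one_plus_sq_le: "0 \<le> C \<Longrightarrow> C / (1 + (s::real)\<^sup>2) \<le> C"
  using mult_left_mono[of 1 "1 + s\<^sup>2" C] one_plus_sq_pos[of s] by (simp add: divide_le_eq)

lemma symbol_nonneg: "symbol C f \<Longrightarrow> 0 \<le> C"
  unfolding symbol_def using order_trans[OF norm_ge_zero] by blast

lemma symbol_mono: "symbol C f \<Longrightarrow> C \<le> D \<Longrightarrow> symbol D f"
  unfolding symbol_def by (meson divide_right_mono less_imp_le one_plus_sq_pos order_trans)

lemma symbol_const: "symbol (cmod c) (\<lambda>_. c)"
  by (rule symbolI[of _ "\<lambda>_. 0" "\<lambda>_. 0"]) (auto intro: divide_nonneg_pos one_plus_sq_pos)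

lemma symbol_add:
  assumes "symbol C f" "symbol D g"
  shows "symbol (C + D) (\<lambda>s. f s + g s)"
proof -
  obtain f' f'' where f: "\<And>s. (f has_vector_derivative f' s) (at s)" "\<And>s. (f' has_vector_derivative f'' s) (at s)"
    "\<And>s. cmod (f s) \<le> C" "\<And>s. cmod (f' s) \<le> C / (1 + s\<^sup>2)" "\<And>s. cmod (f'' s) \<le> C / (1 + s\<^sup>2)" using assms(1) unfolding symbol_def by blast
  obtain g' g'' where g: "\<And>s. (g has_vector_derivative g' s) (at s)" "\<And>s. (g' has_vector_derivative g'' s) (at s)"
    "\<And>s. cmod (g s) \<le> D" "\<And>s. cmod (g' s) \<le> D / (1 + s\<^sup>2)" "\<And>s. cmod (g'' s) \<le> D / (1 + s\<^sup>2)" using assms(2) unfolding symbol_def by blast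
  show ?thesis
    by (rule symbolI[of _ "\<lambda>s. f' s + g' s" "\<lambda>s. f'' s + g'' s"])
       (auto simp: add_divide_distrib intro!: has_vector_derivative_add f g order_trans[OF norm_triangle_ineq add_mono])
qed

text \<open>The second derivative of a product has four terms, each at most C D / (1 + s^2); hence
  the factor 4.\<close>

lemma symbol_mult:
  assumes "symbol C f" "symbol D g"
  shows "symbol (4 * C * D) (\<lambda>s. f s * g s)"
proof -
  obtain f' f'' where f: "\<And>s. (f has_vector_derivative f' s) (at s)" "\<And>s. (f' has_vector_derivative f'' s) (at s)"
    "\<And>s. cmod (f s) \<le> C" "\<And>s. cmod (f' s) \<le> C / (1 + s\<^sup>2)" "\<And>s. cmod (f'' s) \<le> C / (1 + s\<^sup>2)" using assms(1) unfolding symbol_def by blast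
  obtain g' g'' where g: "\<And>s. (g has_vector_derivative g' s) (at s)" "\<And>s. (g' has_vector_derivative g'' s) (at s)"
    "\<And>s. cmod (g s) \<le> D" "\<And>s. cmod (g' s) \<le> D / (1 + s\<^sup>2)" "\<And>s. cmod (g'' s) \<le> D / (1 + s\<^sup>2)" using assms(2) unfolding symbol_def by blast
  have C: "0 \<le> C" and D: "0 \<le> D" using assms symbol_nonneg by auto
  define k where "k s = 1 / (1 + s\<^sup>2)" for s :: real
  have k: "0 \<le> k s" "k s \<le> 1" for s using one_plus_sq_pos[of s] by (auto simp: k_def)
  have fk: "cmod (f' s) \<le> C * k s" "cmod (f'' s) \<le> C * k s" and gk: "cmod (g' s) \<le> D * k s" "cmod (g'' s) \<le> D * k s" for s
    using f(4,5)[of s] g(4,5)[of s] by (simp_all add: k_def)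
  have CDk: "0 \<le> C * D * k s" for s using C D k by simp
  show ?thesis
  proof (rule symbolI[of _ "\<lambda>s. f s * g' s + f' s * g s" "\<lambda>s. (f s * g'' s + f' s * g' s) + (f' s * g' s + f'' s * g s)"])
    fix s
    have C0: "0 \<le> C * k s" and D0: "0 \<le> D * k s" using C D k by auto
    show "((\<lambda>s. f s * g s) has_vector_derivative f s * g' s + f' s * g s) (at s)"
      by (intro has_vector_derivative_mult f g)
    show "((\<lambda>s. f s * g' s + f' s * g s) has_vector_derivative (f s * g'' s + f' s * g' s) + (f' s * g' s + f'' s * g s)) (at s)"
      by (intro has_vector_derivative_add has_vector_derivative_mult f g)
    have "cmod (f s * g s) \<le> C * D" unfolding norm_mult using C by (intro mult_mono f g) auto
    also have "\<dots> \<le> 4 * C * D" using C D by simp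
    finally show "cmod (f s * g s) \<le> 4 * C * D" .
    have a: "cmod (f s * g' s) \<le> C * D * k s" "cmod (f' s * g s) \<le> C * D * k s"
       "cmod (f s * g'' s) \<le> C * D * k s" "cmod (f'' s * g s) \<le> C * D * k s"
      using mult_mono[OF f(3)[of s] gk(1)[of s] C] mult_mono[OF fk(1)[of s] g(3)[of s] C0]
        mult_mono[OF f(3)[of s] gk(2)[of s] C] mult_mono[OF fk(2)[of s] g(3)[of s] C0]
      by (simp_all add: norm_mult mult_ac)
    have "cmod (f' s) \<le> C" using fk(1)[of s] mult_left_mono[OF k(2)[of s] C] by simp
    from mult_mono[OF this gk(1)[of s] C] have b: "cmod (f' s * g' s) \<le> C * D * k s" by (simp add: norm_mult mult_ac)
    have "cmod (f s * g' s + f' s * g s) \<le> C * D * k s + C * D * k s"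
      by (rule order_trans[OF norm_triangle_ineq add_mono[OF a(1,2)]])
    also have "\<dots> \<le> 4 * (C * D * k s)" using CDk[of s] by simp
    finally show "cmod (f s * g' s + f' s * g s) \<le> 4 * C * D / (1 + s\<^sup>2)" by (simp add: k_def)
    have "cmod ((f s * g'' s + f' s * g' s) + (f' s * g' s + f'' s * g s)) \<le> (C * D * k s + C * D * k s) + (C * D * k s + C * D * k s)"
      by (rule order_trans[OF norm_triangle_ineq add_mono[OF order_trans[OF norm_triangle_ineq add_mono[OF a(3) b]] order_trans[OF norm_triangle_ineq add_mono[OF b a(4)]]]])
    thus "cmod ((f s * g'' s + f' s * g' s) + (f' s * g' s + f'' s * g s)) \<le> 4 * C * D / (1 + s\<^sup>2)" by (simp add: k_def)
  qed
qed

lemma symbol_cmult: "symbol C f \<Longrightarrow> symbol (4 * cmod c * C) (\<lambda>s. c * f s)"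
  by (rule symbol_mult[OF symbol_const])

lemma vector_derivative_reflect:
  assumes "\<And>s. (f has_vector_derivative f' s) (at s)"
  shows "((\<lambda>s. f (- s)) has_vector_derivative - f' (- s)) (at (s::real))"
proof -
  have "(uminus has_vector_derivative (-1::real)) (at s)"
    by (auto intro!: derivative_eq_intros simp: has_real_derivative_iff_has_vector_derivative[symmetric])
  from vector_diff_chain_at[OF this assms] show ?thesis by (simp add: o_def)
qed

lemma symbol_reflect:
  assumes "symbol C f" shows "symbol C (\<lambda>s. f (- s))"
proof -
  obtain f' f'' where f: "\<And>s. (f has_vector_derivative f' s) (at s)" "\<And>s. (f' has_vector_derivative f'' s) (at s)"
    "\<And>s. cmod (f s) \<le> C" "\<And>s. cmod (f' s) \<le> C / (1 + s\<^sup>2)" "\<And>s. cmod (f'' s) \<le> C / (1 + s\<^sup>2)" using assms unfolding symbol_def by blast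
  have "((\<lambda>s. - f' (- s)) has_vector_derivative - (- f'' (- s))) (at s)" for s
    by (intro has_vector_derivative_minus vector_derivative_reflect f)
  moreover have "cmod (- f' (- s)) \<le> C / (1 + s\<^sup>2)" "cmod (- (- f'' (- s))) \<le> C / (1 + s\<^sup>2)" for s
    using f(4,5)[of "- s"] by simp_all
  ultimately show ?thesis
    by (intro symbolI[of _ "\<lambda>s. - f' (- s)" "\<lambda>s. - (- f'' (- s))"]) (auto intro: vector_derivative_reflect f)
qed

text \<open>z = 1/(l - ir) satisfies z' = -z^2 and z'' = 2 z^3, and |z|^2 \<le> c^2/(1 + l^2). The
  maximum in \<open>c\<close> secures both c \<ge> 1 and c |r| \<ge> 1, which this bound
  uses.\<close>

lemma simple_pole_symbol:
  fixes r :: real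
  assumes "r \<noteq> 0"
  defines "c \<equiv> max 1 (1 / \<bar>r\<bar>)"
  shows "symbol (2 * c ^ 3) (\<lambda>l. 1 / (complex_of_real l - \<i> * r))"
proof -
  define z where "z l = 1 / (complex_of_real l - \<i> * r)" for l :: real
  have nz: "complex_of_real l - \<i> * r \<noteq> 0" for l using assms by (simp add: complex_eq_iff)
  have dz: "(z has_vector_derivative - (z l)\<^sup>2) (at l)" for l
    unfolding z_def[abs_def]
    by (rule has_vector_derivative_real_field[of "\<lambda>w. 1 / (w - \<i> * r)"])
       (use nz[of l] in \<open>auto intro!: derivative_eq_intros simp: power2_eq_square field_simps\<close>)
  have dz2: "((\<lambda>l. - (z l)\<^sup>2) has_vector_derivative 2 * (z l) ^ 3) (at l)" for l
  proof -
    have "((\<lambda>l. - (z l * z l)) has_vector_derivative - (z l * (- (z l)\<^sup>2) + (- (z l)\<^sup>2) * z l)) (at l)"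
      by (intro has_vector_derivative_minus has_vector_derivative_mult dz)
    thus ?thesis by (simp add: power2_eq_square power3_eq_cube mult.assoc)
  qed
  have c1: "1 \<le> c" by (simp add: c_def)
  have zb: "(cmod (z l))\<^sup>2 \<le> c\<^sup>2 / (1 + l\<^sup>2)" for l
  proof -
    have n: "(cmod (complex_of_real l - \<i> * r))\<^sup>2 = l\<^sup>2 + r\<^sup>2" by (simp add: cmod_power2)
    have "1 / \<bar>r\<bar> \<le> c" by (simp add: c_def)
    hence "1 \<le> c * \<bar>r\<bar>" using assms(1) by (simp add: divide_le_eq)
    hence "1\<^sup>2 \<le> (c * \<bar>r\<bar>)\<^sup>2" by (intro power_mono) auto
    hence "1 \<le> c\<^sup>2 * r\<^sup>2" by (simp add: power_mult_distrib)
    moreover have "1 * l\<^sup>2 \<le> c\<^sup>2 * l\<^sup>2" using c1 by (intro mult_right_mono) (auto simp: one_le_power)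
    ultimately have "1 + l\<^sup>2 \<le> c\<^sup>2 * (l\<^sup>2 + r\<^sup>2)" by (simp add: algebra_simps)
    moreover have "l\<^sup>2 + r\<^sup>2 > 0" using assms by (simp add: add_nonneg_pos)
    ultimately show ?thesis
      unfolding z_def norm_divide power_divide n using one_plus_sq_pos[of l] by (simp add: field_simps)
  qed
  have zc: "cmod (z l) \<le> c" for l
  proof (rule power2_le_imp_le)
    have "c\<^sup>2 / (1 + l\<^sup>2) \<le> c\<^sup>2" by (rule divide_one_plus_sq_le) simp
    thus "(cmod (z l))\<^sup>2 \<le> c\<^sup>2" using zb[of l] by simp
  qed (use c1 in simp)
  have c23: "c \<le> 2 * c ^ 3" "c\<^sup>2 \<le> 2 * c ^ 3"
    using c1 power_increasing[of 1 3 c] power_increasing[of 2 3 c] by auto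
  show ?thesis unfolding z_def[symmetric]
  proof (rule symbolI[OF dz dz2])
    fix l
    show "cmod (z l) \<le> 2 * c ^ 3" using zc[of l] c23 by linarith
    have "cmod (- (z l)\<^sup>2) \<le> c\<^sup>2 / (1 + l\<^sup>2)" using zb[of l] by (simp add: norm_power)
    also have "\<dots> \<le> 2 * c ^ 3 / (1 + l\<^sup>2)" using c23 one_plus_sq_pos[of l] by (intro divide_right_mono) auto
    finally show "cmod (- (z l)\<^sup>2) \<le> 2 * c ^ 3 / (1 + l\<^sup>2)" .
    have "cmod (2 * (z l) ^ 3) = 2 * (cmod (z l) * (cmod (z l))\<^sup>2)" by (simp add: norm_mult norm_power power3_eq_cube power2_eq_square)
    also have "\<dots> \<le> 2 * (c * (c\<^sup>2 / (1 + l\<^sup>2)))" using c1 by (intro mult_left_mono mult_mono zc zb) auto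
    finally show "cmod (2 * (z l) ^ 3) \<le> 2 * c ^ 3 / (1 + l\<^sup>2)" by (simp add: power3_eq_cube power2_eq_square mult.assoc)
  qed
qed

text \<open>From p' = w p follows p'' = (w^2 + w') p, so the decay of w and w' passes to the
  derivatives of p. Being a symbol does not make w itself decay, whence the separate hypothesis on
  w.\<close>

lemma bounded_multiple_derivative_symbol:
  assumes d: "\<And>l. (p has_vector_derivative w l * p l) (at l)" and p: "\<And>l. cmod (p l) \<le> 1"
    and w: "symbol C w" and wd: "\<And>l. cmod (w l) \<le> C / (1 + l\<^sup>2)"
  shows "symbol (1 + C + C * C) p"
proof -
  obtain w' w'' where w': "\<And>s. (w has_vector_derivative w' s) (at s)" "\<And>s. cmod (w s) \<le> C" "\<And>s. cmod (w' s) \<le> C / (1 + s\<^sup>2)"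
    using w unfolding symbol_def by blast
  have C: "0 \<le> C" by (rule symbol_nonneg[OF w])
  show ?thesis
  proof (rule symbolI[OF d])
    fix l
    have q: "0 \<le> C / (1 + l\<^sup>2)" "0 \<le> 1 / (1 + l\<^sup>2)" using C one_plus_sq_pos[of l] by auto
    show "((\<lambda>l. w l * p l) has_vector_derivative w l * (w l * p l) + w' l * p l) (at l)"
      by (intro has_vector_derivative_mult w' d)
    show "cmod (p l) \<le> 1 + C + C * C" using p[of l] C by (simp add: add_increasing2)
    have 1: "cmod (w l * p l) \<le> C / (1 + l\<^sup>2) * 1" unfolding norm_mult using q by (intro mult_mono wd p) auto
    have m: "C / (1 + l\<^sup>2) \<le> (1 + C + C * C) / (1 + l\<^sup>2)" "(C * C + C) / (1 + l\<^sup>2) \<le> (1 + C + C * C) / (1 + l\<^sup>2)"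
      using C one_plus_sq_pos[of l] by (auto intro!: divide_right_mono)
    show "cmod (w l * p l) \<le> (1 + C + C * C) / (1 + l\<^sup>2)" using 1 m by simp
    have 2: "cmod (w l * (w l * p l)) \<le> C * (C / (1 + l\<^sup>2) * 1)"
      unfolding norm_mult[of "w l" "w l * p l"] using C by (intro mult_mono w' 1) auto
    have 3: "cmod (w' l * p l) \<le> C / (1 + l\<^sup>2) * 1" unfolding norm_mult using q by (intro mult_mono w' p) auto
    have "cmod (w l * (w l * p l) + w' l * p l) \<le> C * (C / (1 + l\<^sup>2) * 1) + C / (1 + l\<^sup>2) * 1"
      by (rule order_trans[OF norm_triangle_ineq add_mono[OF 2 3]])
    also have "\<dots> = (C * C + C) / (1 + l\<^sup>2)" by (simp add: add_divide_distrib)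
    finally show "cmod (w l * (w l * p l) + w' l * p l) \<le> (1 + C + C * C) / (1 + l\<^sup>2)" using m(2) by linarith
  qed
qed

lemma symbol_wave:
  assumes "symbol C u" "symbol C v"
    and f: "\<And>s. f s = u s * exp (- 2 * \<i> * complex_of_real (x * s)) + v s * exp (2 * \<i> * complex_of_real (x * s))"
  shows "wave x C f"
proof -
  obtain u' u'' where u: "\<And>s. (u has_vector_derivative u' s) (at s)" "\<And>s. (u' has_vector_derivative u'' s) (at s)"
    "\<And>s. cmod (u s) \<le> C" "\<And>s. cmod (u' s) \<le> C / (1 + s\<^sup>2)" "\<And>s. cmod (u'' s) \<le> C / (1 + s\<^sup>2)" using assms(1) unfolding symbol_def by blast
  obtain v' v'' where v: "\<And>s. (v has_vector_derivative v' s) (at s)" "\<And>s. (v' has_vector_derivative v'' s) (at s)"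
    "\<And>s. cmod (v s) \<le> C" "\<And>s. cmod (v' s) \<le> C / (1 + s\<^sup>2)" "\<And>s. cmod (v'' s) \<le> C / (1 + s\<^sup>2)" using assms(2) unfolding symbol_def by blast
  show ?thesis unfolding wave_def using u v f by blast
qed

lemma wave_mono:
  assumes "wave x U f" "U \<le> V"
  shows "wave x V f"
proof -
  have "U / (1 + s\<^sup>2) \<le> V / (1 + s\<^sup>2)" for s :: real
    using assms(2) one_plus_sq_pos[of s] by (intro divide_right_mono) auto
  hence le: "a \<le> V / (1 + s\<^sup>2)" if "a \<le> U / (1 + s\<^sup>2)" for a s :: real using that order_trans by blast
  from assms(1) obtain u u' v v' where h: "\<forall>s. (u has_vector_derivative u' s) (at s) \<and> (v has_vector_derivative v' s) (at s) \<and>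
     cmod (u s) \<le> U \<and> cmod (v s) \<le> U \<and> cmod (u' s) \<le> U / (1 + s\<^sup>2) \<and> cmod (v' s) \<le> U / (1 + s\<^sup>2) \<and>
     f s = u s * exp (- 2 * \<i> * complex_of_real (x * s)) + v s * exp (2 * \<i> * complex_of_real (x * s))"
    unfolding wave_def by blast
  show ?thesis unfolding wave_def
    by (rule exI[of _ u], rule exI[of _ u'], rule exI[of _ v], rule exI[of _ v'])
      (use h le order_trans[OF _ assms(2)] in blast)
qed

lemma wave_bound: "wave x U f \<Longrightarrow> cmod (f s) \<le> 2 * U"
proof -
  assume "wave x U f"
  then obtain u v where "cmod (u s) \<le> U" "cmod (v s) \<le> U"
    "f s = u s * exp (- 2 * \<i> * complex_of_real (x * s)) + v s * exp (2 * \<i> * complex_of_real (x * s))" 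
    unfolding wave_def by blast
  moreover have "cmod (exp (- 2 * \<i> * complex_of_real (x * s))) = 1" "cmod (exp (2 * \<i> * complex_of_real (x * s))) = 1" by simp_all
  ultimately show ?thesis
    using norm_triangle_ineq[of "u s * exp (- 2 * \<i> * complex_of_real (x * s))" "v s * exp (2 * \<i> * complex_of_real (x * s))"]
    by (simp only: norm_mult mult_1_right)
qed

lemma exp_linear_derivative:
  "((\<lambda>s. exp (c * \<i> * complex_of_real (x * s))) has_vector_derivative c * \<i> * complex_of_real x * exp (c * \<i> * complex_of_real (x * s))) (at s)"
proof -
  have eq: "c * \<i> * complex_of_real (x * s) = c * \<i> * complex_of_real x * complex_of_real s" for s by simp
  show ?thesis unfolding eq
    by (rule has_vector_derivative_real_field[of "\<lambda>z. exp (c * \<i> * complex_of_real x * z)"]) (auto intro!: derivative_eq_intros)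
qed

text \<open>Each derivative of a plane wave costs a factor |x|. The first derivative is again a
  wave, thanks to the decay of two derivatives of the amplitudes; of the second only the size is
  kept. These powers of 1 + |x| are what the spatial weights have to pay for.\<close>

lemma symbol_wave_derivatives:
  assumes "symbol C u" "symbol C v"
    and f: "\<And>s. f s = u s * exp (- 2 * \<i> * complex_of_real (x * s)) + v s * exp (2 * \<i> * complex_of_real (x * s))"
  shows "\<exists>f1 f2. (\<forall>s. (f has_vector_derivative f1 s) (at s)) \<and> (\<forall>s. (f1 has_vector_derivative f2 s) (at s)) \<and>
    wave x (2 * C * (1 + \<bar>x\<bar>)) f1 \<and> (\<forall>s. cmod (f2 s) \<le> 8 * C * (1 + \<bar>x\<bar>)\<^sup>2)"
proof -
  obtain u' u'' where u: "\<And>s. (u has_vector_derivative u' s) (at s)" "\<And>s. (u' has_vector_derivative u'' s) (at s)"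
    "\<And>s. cmod (u s) \<le> C" "\<And>s. cmod (u' s) \<le> C / (1 + s\<^sup>2)" "\<And>s. cmod (u'' s) \<le> C / (1 + s\<^sup>2)" using assms(1) unfolding symbol_def by blast
  obtain v' v'' where v: "\<And>s. (v has_vector_derivative v' s) (at s)" "\<And>s. (v' has_vector_derivative v'' s) (at s)"
    "\<And>s. cmod (v s) \<le> C" "\<And>s. cmod (v' s) \<le> C / (1 + s\<^sup>2)" "\<And>s. cmod (v'' s) \<le> C / (1 + s\<^sup>2)" using assms(2) unfolding symbol_def by blast
  have C: "0 \<le> C" by (rule symbol_nonneg[OF assms(1)])
  define em where "em s = exp (- 2 * \<i> * complex_of_real (x * s))" for s
  define ep where "ep s = exp (2 * \<i> * complex_of_real (x * s))" for s
  define k where "k = 2 * \<i> * complex_of_real x"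
  have kn: "cmod k = 2 * \<bar>x\<bar>" by (simp add: k_def norm_mult)
  have de: "(em has_vector_derivative - k * em s) (at s)" "(ep has_vector_derivative k * ep s) (at s)" for s
    using exp_linear_derivative[of "-2" x s] exp_linear_derivative[of 2 x s] by (simp_all add: em_def[abs_def] ep_def[abs_def] k_def)
  have en: "cmod (em s) = 1" "cmod (ep s) = 1" for s by (simp_all add: em_def ep_def)
  have fe: "f = (\<lambda>s. u s * em s + v s * ep s)" using f by (auto simp: em_def ep_def)
  define U where "U s = u' s - k * u s" for s
  define V where "V s = v' s + k * v s" for s
  define U' where "U' s = u'' s - k * u' s" for s
  define V' where "V' s = v'' s + k * v' s" for s
  define f1 where "f1 s = U s * em s + V s * ep s" for s
  define f2 where "f2 s = (U' s - k * U s) * em s + (V' s + k * V s) * ep s" for s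
  have dUV: "(U has_vector_derivative U' s) (at s)" "(V has_vector_derivative V' s) (at s)" for s
    unfolding U_def[abs_def] V_def[abs_def] U'_def V'_def
    by (intro has_vector_derivative_add has_vector_derivative_diff has_vector_derivative_mult_right u v)+
  have "(f has_vector_derivative (u s * (- k * em s) + u' s * em s) + (v s * (k * ep s) + v' s * ep s)) (at s)" for s
    unfolding fe by (intro has_vector_derivative_add has_vector_derivative_mult u v de)
  hence d1: "(f has_vector_derivative f1 s) (at s)" for s
    by (rule has_vector_derivative_eq_rhs) (simp add: f1_def U_def V_def algebra_simps)
  have "(f1 has_vector_derivative (U s * (- k * em s) + U' s * em s) + (V s * (k * ep s) + V' s * ep s)) (at s)" for s
    unfolding f1_def[abs_def] by (intro has_vector_derivative_add has_vector_derivative_mult dUV de)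
  hence d2: "(f1 has_vector_derivative f2 s) (at s)" for s
    by (rule has_vector_derivative_eq_rhs) (simp add: f2_def algebra_simps)
  define X where "X = 1 + \<bar>x\<bar>"
  have X: "1 \<le> X" by (simp add: X_def)
  have s1: "C / (1 + s\<^sup>2) \<le> C" for s using C by (rule divide_one_plus_sq_le)
  have CX: "C + 2 * \<bar>x\<bar> * C \<le> 2 * C * X" using C by (simp add: X_def algebra_simps)
  have kb: "cmod (p - k * q) \<le> a + 2 * \<bar>x\<bar> * b" "cmod (p + k * q) \<le> a + 2 * \<bar>x\<bar> * b" if "cmod p \<le> a" "cmod q \<le> b" for p q a b
    using norm_triangle_ineq4[of p "k * q"] norm_triangle_ineq[of p "k * q"] that mult_left_mono[OF that(2), of "2 * \<bar>x\<bar>"]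
    by (auto simp: norm_mult kn)
  have bU: "cmod (U s) \<le> 2 * C * X" "cmod (V s) \<le> 2 * C * X" for s
    using kb(1)[OF order_trans[OF u(4) s1] u(3), of s s] kb(2)[OF order_trans[OF v(4) s1] v(3), of s s] CX
    by (auto simp: U_def V_def)
  have q: "C / (1 + s\<^sup>2) + 2 * \<bar>x\<bar> * (C / (1 + s\<^sup>2)) \<le> 2 * C * X / (1 + s\<^sup>2)" for s
    using divide_right_mono[OF CX less_imp_le[OF one_plus_sq_pos[of s]]] by (simp add: add_divide_distrib)
  have bU': "cmod (U' s) \<le> 2 * C * X / (1 + s\<^sup>2)" "cmod (V' s) \<le> 2 * C * X / (1 + s\<^sup>2)" for s
    using order_trans[OF kb(1)[OF u(5) u(4)] q, of s] order_trans[OF kb(2)[OF v(5) v(4)] q, of s] by (auto simp: U'_def V'_def)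
  have w: "wave x (2 * C * X) f1"
    unfolding wave_def f1_def em_def ep_def
    by (rule exI[of _ U], rule exI[of _ U'], rule exI[of _ V], rule exI[of _ V']) (use dUV bU bU' in auto)
  have bU'': "cmod (U' s) \<le> 2 * C * X" "cmod (V' s) \<le> 2 * C * X" for s
  proof -
    have "2 * C * X / (1 + s\<^sup>2) \<le> 2 * C * X" using C X by (intro divide_one_plus_sq_le) auto
    thus "cmod (U' s) \<le> 2 * C * X" "cmod (V' s) \<le> 2 * C * X" using bU'[of s] by auto
  qed
  have "cmod (f2 s) \<le> 8 * C * X\<^sup>2" for s
  proof -
    have "cmod (f2 s) \<le> cmod (U' s - k * U s) + cmod (V' s + k * V s)"
      unfolding f2_def by (rule order_trans[OF norm_triangle_ineq]) (simp add: norm_mult en)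
    also have "\<dots> \<le> (2 * C * X + 2 * \<bar>x\<bar> * (2 * C * X)) + (2 * C * X + 2 * \<bar>x\<bar> * (2 * C * X))"
      by (intro add_mono kb bU bU'')
    also have "\<dots> = 4 * C * X * (1 + 2 * \<bar>x\<bar>)" by (simp add: algebra_simps)
    also have "\<dots> \<le> 4 * C * X * (2 * X)" using C X by (intro mult_left_mono) (auto simp: X_def)
    finally show ?thesis by (simp add: power2_eq_square)
  qed
  thus ?thesis using d1 d2 w unfolding X_def by blast
qed

section \<open>Division by the spectral variable and the kernel integrals\<close>

lemma mean_value_bound:
  fixes F :: "real \<Rightarrow> complex"
  assumes d: "\<And>s. (F has_vector_derivative F' s) (at s)" and F0: "F 0 = 0" and x: "0 \<le> x"
    and B: "\<And>s. 0 \<le> s \<Longrightarrow> s \<le> x \<Longrightarrow> cmod (F' s) \<le> B"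
  shows "cmod (F x) \<le> B * x"
proof -
  have I: "(F' has_integral F x - F 0) {0..x}"
    by (rule fundamental_theorem_of_calculus[OF x]) (rule has_vector_derivative_at_within[OF d])
  have "cmod (integral {0..x} F') \<le> integral {0..x} (\<lambda>_. B)"
    by (rule integral_norm_bound_integral[OF has_integral_integrable[OF I]]) (use B in auto)
  thus ?thesis using integral_unique[OF I] F0 x by (simp add: mult.commute)
qed

text \<open>As f(0) = 0, the mean value bound controls f/s. Its derivative is h/s^2 with h = s f1 -
  f, where h(0) = 0 and h' = s f2 give |h| \<le> B s^2.\<close>

lemma quotient_bounds:
  fixes f f1 f2 :: "real \<Rightarrow> complex"
  assumes f: "\<And>s. (f has_vector_derivative f1 s) (at s)" "\<And>s. (f1 has_vector_derivative f2 s) (at s)" "f 0 = 0"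
    and b: "\<And>s. cmod (f1 s) \<le> A" "\<And>s. cmod (f2 s) \<le> B" and s: "0 < s"
  shows "cmod (f s / s) \<le> A" "cmod (f1 s / s - f s / s\<^sup>2) \<le> B"
    "((\<lambda>s. f s / complex_of_real s) has_vector_derivative f1 s / s - f s / s\<^sup>2) (at s)"
proof -
  have "cmod (f s) \<le> A * s" by (rule mean_value_bound[OF f(1,3)]) (use b s in auto)
  thus "cmod (f s / s) \<le> A" using s by (simp add: norm_divide divide_le_eq)
  define h where "h s = complex_of_real s * f1 s - f s" for s
  have dr: "(complex_of_real has_vector_derivative 1) (at s)" for s
    by (rule has_vector_derivative_eq_rhs[OF has_vector_derivative_of_real[OF DERIV_ident]]) simp
  have dh: "(h has_vector_derivative complex_of_real s * f2 s) (at s)" for s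
  proof -
    have "(h has_vector_derivative (complex_of_real s * f2 s + 1 * f1 s) - f1 s) (at s)"
      unfolding h_def[abs_def] by (intro has_vector_derivative_diff has_vector_derivative_mult dr f)
    thus ?thesis by simp
  qed
  have "cmod (h s) \<le> (s * B) * s"
  proof (rule mean_value_bound[OF dh])
    fix u assume u: "0 \<le> u" "u \<le> s"
    have "0 \<le> B" using b(2)[of 0] norm_ge_zero order_trans by blast
    show "cmod (complex_of_real u * f2 u) \<le> s * B" unfolding norm_mult using u b(2)[of u] \<open>0 \<le> B\<close> by (intro mult_mono) auto
  qed (use s f in \<open>auto simp: h_def\<close>)
  hence "cmod (h s) / s\<^sup>2 \<le> B" using s by (simp add: divide_le_eq power2_eq_square mult_ac)
  moreover have eq: "f1 s / s - f s / s\<^sup>2 = h s / s\<^sup>2" using s by (simp add: h_def power2_eq_square field_simps)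
  ultimately show "cmod (f1 s / s - f s / s\<^sup>2) \<le> B" by (simp add: norm_divide norm_power)
  have "((\<lambda>s. 1 / complex_of_real s) has_vector_derivative - 1 / (complex_of_real s)\<^sup>2) (at s)"
    by (rule has_vector_derivative_real_field[of "\<lambda>w. 1 / w"]) (use s in \<open>auto intro!: derivative_eq_intros simp: power2_eq_square\<close>)
  from has_vector_derivative_mult[OF f(1) this]
  show "((\<lambda>s. f s / complex_of_real s) has_vector_derivative f1 s / s - f s / s\<^sup>2) (at s)"
    by simp
qed

lemma even_kernel_bound:
  assumes t: "t \<noteq> 0" and R: "0 \<le> R" and f: "wave x C f" and g: "wave y C g"
  shows "cmod (integral {0..R} (\<lambda>s. ph t 0 s * (f s * cnj (g s)))) \<le> 180 * C\<^sup>2 / sqrt \<bar>t\<bar>"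
  using two_wave_bound[OF t R f g, of "\<lambda>_. 1" "\<lambda>_. 0" 1]
  by (simp add: power2_eq_square one_plus_sq_pos less_imp_le)

text \<open>As \<open>f\<close> and \<open>g\<close> vanish at $0$, the amplitude is $s\,\Phi(s)$ with $\Phi = f\bar g/s$, so it can be
  integrated by parts against $s\,e^{-2its^2}$. This gains $1/|t|$ and leaves the integral of
  $e^{-2its^2}\Phi'$.\<close>

lemma odd_kernel_bound:
  fixes f f1 f2 g g1 g2 :: "real \<Rightarrow> complex"
  assumes t: "t \<noteq> 0" and R: "1 \<le> R" and X: "1 \<le> X" and Y: "1 \<le> Y"
    and f: "\<And>s. (f has_vector_derivative f1 s) (at s)" "\<And>s. (f1 has_vector_derivative f2 s) (at s)" "f 0 = 0"
      "wave x C f" "wave x (C * X) f1" "\<And>s. cmod (f2 s) \<le> C * X\<^sup>2"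
    and g: "\<And>s. (g has_vector_derivative g1 s) (at s)" "\<And>s. (g1 has_vector_derivative g2 s) (at s)" "g 0 = 0"
      "wave y C g" "wave y (C * Y) g1" "\<And>s. cmod (g2 s) \<le> C * Y\<^sup>2"
  shows "cmod (integral {0..R} (\<lambda>s. ph t 0 s * (f s * cnj (g s))))
    \<le> (C * X * Y)\<^sup>2 * (630 / (\<bar>t\<bar> * sqrt \<bar>t\<bar>) + 1 / (\<bar>t\<bar> * R))"
proof -
  \<comment> \<open>Since X, Y \<ge> 1, every product that occurs, such as C^2 X^2 Y, is at most
    \<open>Q\<close>.\<close>
  define Q where "Q = (C * X * Y)\<^sup>2"
  define T where "T = sqrt \<bar>t\<bar>"
  have T: "0 < T" using t by (simp add: T_def)
  have C: "0 \<le> C" using order_trans[OF norm_ge_zero wave_bound[OF f(4), of 0]] by simp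
  have XY: "0 \<le> X" "0 \<le> Y" "X \<le> X\<^sup>2" "Y \<le> Y\<^sup>2" "1 \<le> X\<^sup>2" "1 \<le> Y\<^sup>2" using X Y mult_mono[of 1 X 1 X] mult_mono[of 1 Y 1 Y] by (auto simp: power2_eq_square)
  have mXY: "a * b \<le> X\<^sup>2 * Y\<^sup>2" if "0 \<le> a" "0 \<le> b" "a \<le> X\<^sup>2" "b \<le> Y\<^sup>2" for a b
    using that XY by (intro mult_mono) auto
  have Qle: "C\<^sup>2 * (a * b) \<le> Q" if "0 \<le> a" "0 \<le> b" "a \<le> X\<^sup>2" "b \<le> Y\<^sup>2" for a b
    using mult_left_mono[OF mXY[OF that], of "C\<^sup>2"] by (simp add: Q_def power_mult_distrib mult.assoc)
  have Q0: "0 \<le> Q" by (simp add: Q_def)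
  note QX = Qle[of X Y] Qle[of "X\<^sup>2" Y] Qle[of X "Y\<^sup>2"] Qle[of 1 1] Qle[of X 1] Qle[of 1 Y]
  have fb: "cmod (f s) \<le> 2 * C" "cmod (f1 s) \<le> 2 * (C * X)" "cmod (g s) \<le> 2 * C" "cmod (g1 s) \<le> 2 * (C * Y)" for s
    using wave_bound[OF f(4)] wave_bound[OF f(5)] wave_bound[OF g(4)] wave_bound[OF g(5)] by auto
  define wf where "wf s = f s / complex_of_real s" for s
  define wg where "wg s = g s / complex_of_real s" for s
  define wf1 where "wf1 s = f1 s / s - f s / s\<^sup>2" for s :: real
  define wg1 where "wg1 s = g1 s / s - g s / s\<^sup>2" for s :: real
  have wfb: "cmod (wf s) \<le> 2 * (C * X)" "cmod (wf1 s) \<le> C * X\<^sup>2" "(wf has_vector_derivative wf1 s) (at s)" if "0 < s" for s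
    using quotient_bounds[OF f(1,2,3) fb(2) f(6) that] unfolding wf_def[abs_def] wf1_def by auto
  have wgb: "cmod (wg s) \<le> 2 * (C * Y)" "cmod (wg1 s) \<le> C * Y\<^sup>2" "(wg has_vector_derivative wg1 s) (at s)" if "0 < s" for s
    using quotient_bounds[OF g(1,2,3) fb(4) g(6) that] unfolding wg_def[abs_def] wg1_def by auto
  define \<Phi> where "\<Phi> s = f s * cnj (wg s)" for s
  \<comment> \<open>The derivative of \<open>\<Phi>\<close> for s > 0, written through the quotients
    \<open>wf\<close> and \<open>wg\<close> so that every factor stays bounded near 0.\<close>
  define \<xi> where "\<xi> s = (f1 s * cnj (wg s) + wf s * cnj (g1 s)) - wf s * cnj (wg s)" for s
  define \<xi>1 where "\<xi>1 s = ((f1 s * cnj (wg1 s) + f2 s * cnj (wg s)) + (wf s * cnj (g2 s) + wf1 s * cnj (g1 s))) - (wf s * cnj (wg1 s) + wf1 s * cnj (wg s))" for s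
  have d\<Phi>: "(\<Phi> has_vector_derivative \<xi> s) (at s)" if "0 < s" for s
  proof -
    have "(\<Phi> has_vector_derivative f s * cnj (wg1 s) + f1 s * cnj (wg s)) (at s)"
      unfolding \<Phi>_def[abs_def] by (intro has_vector_derivative_mult has_vector_derivative_cnj f wgb that)
    moreover have "f s * cnj (wg1 s) = wf s * cnj (g1 s) - wf s * cnj (wg s)"
      using that by (simp add: wf_def wg_def wg1_def algebra_simps power2_eq_square)
    ultimately show ?thesis by (simp add: \<xi>_def algebra_simps)
  qed
  have d\<xi>: "(\<xi> has_vector_derivative \<xi>1 s) (at s)" if "0 < s" for s
    unfolding \<xi>_def[abs_def] \<xi>1_def
    by (intro has_vector_derivative_diff has_vector_derivative_add has_vector_derivative_mult has_vector_derivative_cnj f g wfb wgb that)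
  have prod: "cmod (p * cnj q) \<le> a * b" if "cmod p \<le> a" "cmod q \<le> b" for p q a b
    unfolding norm_mult complex_mod_cnj using that order_trans[OF norm_ge_zero that(1)] by (intro mult_mono) auto
  \<comment> \<open>For s \<le> 1 the factor 1/(1 + s^2) is at least 1/2, so plain bounds on \<xi>
    and \<xi>1 suffice.\<close>
  have near: "cmod (integral {\<eta>..1} (\<lambda>s. ph t 0 s * \<xi> s)) \<le> 15 * (24 * Q) / T" if \<eta>: "0 < \<eta>" "\<eta> < 1" for \<eta>
    unfolding T_def
  proof (rule van_der_Corput[OF t])
    fix s assume "s \<in> {\<eta>..1}"
    hence s: "0 < s" "s \<le> 1" using \<eta> by auto
    show "(\<xi> has_vector_derivative \<xi>1 s) (at s within {\<eta>..1})"
      by (rule has_vector_derivative_at_within[OF d\<xi>[OF s(1)]])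
    note w = wfb(1,2)[OF s(1)] wgb(1,2)[OF s(1)]
    have "cmod (\<xi> s) \<le> (2 * (C * X) * (2 * (C * Y)) + 2 * (C * X) * (2 * (C * Y))) + 2 * (C * X) * (2 * (C * Y))"
      unfolding \<xi>_def
      by (intro order_trans[OF norm_triangle_ineq4 add_mono] order_trans[OF norm_triangle_ineq add_mono] prod w fb)
    also have "\<dots> = 12 * (C\<^sup>2 * (X * Y))" by (simp add: power2_eq_square)
    also have "\<dots> \<le> 24 * Q" using QX(1) XY Q0 by linarith
    finally show "cmod (\<xi> s) \<le> 24 * Q" .
    have "cmod (\<xi>1 s) \<le> ((2 * (C * X) * (C * Y\<^sup>2) + C * X\<^sup>2 * (2 * (C * Y))) + (2 * (C * X) * (C * Y\<^sup>2) + C * X\<^sup>2 * (2 * (C * Y))))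
       + (2 * (C * X) * (C * Y\<^sup>2) + C * X\<^sup>2 * (2 * (C * Y)))"
      unfolding \<xi>1_def
      by (intro order_trans[OF norm_triangle_ineq4 add_mono] order_trans[OF norm_triangle_ineq add_mono] prod w fb f g)
    also have "\<dots> = 6 * (C\<^sup>2 * (X * Y\<^sup>2)) + 6 * (C\<^sup>2 * (X\<^sup>2 * Y))" by (simp add: power2_eq_square)
    also have "\<dots> \<le> 12 * Q" using QX(2,3) XY by linarith
    also have "\<dots> \<le> 24 * Q / (1 + s\<^sup>2)"
    proof -
      have "s\<^sup>2 \<le> 1" using s by (simp add: power_le_one)
      hence "12 * Q * (1 + s\<^sup>2) \<le> 12 * Q * 2" using Q0 by (intro mult_left_mono) auto
      thus ?thesis using one_plus_sq_pos[of s] by (simp add: le_divide_eq)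
    qed
    finally show "cmod (\<xi>1 s) \<le> 24 * Q / (1 + s\<^sup>2)" .
  qed (use \<eta> in auto)
  \<comment> \<open>The available bound for \<xi>1 is not integrable here, because f2 and g2 are
    merely bounded. Instead \<xi> is expanded into products of waves with the decaying factors 1/s
    and 1/s^2, which leaves the plane waves to the phase.\<close>
  have far: "cmod (integral {1..R} (\<lambda>s. ph t 0 s * \<xi> s)) \<le> 2160 * Q / T"
  proof -
    define r1 where "r1 s = 1 / complex_of_real s" for s
    define r2 where "r2 s = 1 / (complex_of_real s)\<^sup>2" for s
    have sb: "1 / s\<^sup>2 \<le> 2 / (1 + s\<^sup>2)" "1 / s ^ 3 \<le> 1 / s\<^sup>2" "1 / s\<^sup>2 \<le> 1" "1 / s \<le> 1" if "1 \<le> s" for s :: real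
    proof -
      have "1 \<le> s\<^sup>2" using that by (simp add: one_le_power)
      thus "1 / s\<^sup>2 \<le> 2 / (1 + s\<^sup>2)" using that one_plus_sq_pos[of s] by (simp add: field_simps)
      have "s\<^sup>2 \<le> s ^ 3" using that by (intro power_increasing) auto
      thus "1 / s ^ 3 \<le> 1 / s\<^sup>2" using that by (intro frac_le) auto
      show "1 / s\<^sup>2 \<le> 1" "1 / s \<le> 1" using \<open>1 \<le> s\<^sup>2\<close> that by auto
    qed
    have r1: "(r1 has_vector_derivative - 1 / (complex_of_real s)\<^sup>2) (at s)" "cmod (r1 s) \<le> 4" "cmod (- 1 / (complex_of_real s)\<^sup>2) \<le> 4 / (1 + s\<^sup>2)"
      if "s \<in> {1..R}" for s
    proof -
      have s: "1 \<le> s" using that by simp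
      show "(r1 has_vector_derivative - 1 / (complex_of_real s)\<^sup>2) (at s)" unfolding r1_def[abs_def]
        by (rule has_vector_derivative_real_field[of "\<lambda>w. 1 / w"]) (use s in \<open>auto intro!: derivative_eq_intros simp: power2_eq_square\<close>)
      have "cmod (r1 s) = 1 / s" using s by (simp add: r1_def norm_divide)
      thus "cmod (r1 s) \<le> 4" using sb(4)[OF s] by linarith
      have "2 / (1 + s\<^sup>2) \<le> 4 / (1 + s\<^sup>2)" using one_plus_sq_pos[of s] by (intro divide_right_mono) auto
      thus "cmod (- 1 / (complex_of_real s)\<^sup>2) \<le> 4 / (1 + s\<^sup>2)" using sb(1)[OF s] by (simp add: norm_divide norm_power)
    qed
    have r2: "(r2 has_vector_derivative - 2 / (complex_of_real s) ^ 3) (at s)" "cmod (r2 s) \<le> 4" "cmod (- 2 / (complex_of_real s) ^ 3) \<le> 4 / (1 + s\<^sup>2)"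
      if "s \<in> {1..R}" for s
    proof -
      have s: "1 \<le> s" using that by simp
      show "(r2 has_vector_derivative - 2 / (complex_of_real s) ^ 3) (at s)" unfolding r2_def[abs_def]
        by (rule has_vector_derivative_real_field[of "\<lambda>w. 1 / w\<^sup>2"]) (use s in \<open>auto intro!: derivative_eq_intros simp: power2_eq_square power3_eq_cube field_simps\<close>)
      have "cmod (r2 s) = 1 / s\<^sup>2" using s by (simp add: r2_def norm_divide norm_power)
      thus "cmod (r2 s) \<le> 4" using sb(3)[OF s] by linarith
      have "2 * (1 / s ^ 3) \<le> 2 * (2 / (1 + s\<^sup>2))" using sb(1,2)[OF s] by linarith
      thus "cmod (- 2 / (complex_of_real s) ^ 3) \<le> 4 / (1 + s\<^sup>2)" using s by (simp add: norm_divide norm_power)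
    qed
    have cont: "continuous_on {1..R} f" "continuous_on {1..R} g" "continuous_on {1..R} f1" "continuous_on {1..R} g1" "continuous_on {1..R} r1" "continuous_on {1..R} r2"
      by (intro continuous_at_imp_continuous_on ballI has_vector_derivative_continuous[OF f(1)] has_vector_derivative_continuous[OF f(2)]
        has_vector_derivative_continuous[OF g(1)] has_vector_derivative_continuous[OF g(2)] has_vector_derivative_continuous[OF r1(1)] has_vector_derivative_continuous[OF r2(1)]; assumption?)+
    have I: "(\<lambda>s. ph t 0 s * (f1 s * cnj (g s) * r1 s)) integrable_on {1..R}" "(\<lambda>s. ph t 0 s * (f s * cnj (g1 s) * r1 s)) integrable_on {1..R}"
      "(\<lambda>s. ph t 0 s * (f s * cnj (g s) * r2 s)) integrable_on {1..R}"
      by (intro integrable_continuous_real continuous_intros cont)+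
    have "integral {1..R} (\<lambda>s. ph t 0 s * \<xi> s) = integral {1..R} (\<lambda>s. (ph t 0 s * (f1 s * cnj (g s) * r1 s) + ph t 0 s * (f s * cnj (g1 s) * r1 s)) - ph t 0 s * (f s * cnj (g s) * r2 s))"
      by (simp add: \<xi>_def wf_def wg_def r1_def r2_def algebra_simps power2_eq_square)
    also have "\<dots> = (integral {1..R} (\<lambda>s. ph t 0 s * (f1 s * cnj (g s) * r1 s)) + integral {1..R} (\<lambda>s. ph t 0 s * (f s * cnj (g1 s) * r1 s)))
       - integral {1..R} (\<lambda>s. ph t 0 s * (f s * cnj (g s) * r2 s))"
      using I by (simp add: Henstock_Kurzweil_Integration.integral_diff Henstock_Kurzweil_Integration.integral_add integrable_add)
    also have "cmod \<dots> \<le> (180 * (C * X * C * 4) / T + 180 * (C * (C * Y) * 4) / T) + 180 * (C * C * 4) / T"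
      unfolding T_def
      by (intro order_trans[OF norm_triangle_ineq4 add_mono] order_trans[OF norm_triangle_ineq add_mono]
        two_wave_bound[OF t R f(5) g(4) r1] two_wave_bound[OF t R f(4) g(5) r1] two_wave_bound[OF t R f(4) g(4) r2])
    also have "\<dots> = 720 * (C\<^sup>2 * (X * 1) + C\<^sup>2 * (1 * Y) + C\<^sup>2 * (1 * 1)) / T" by (simp add: power2_eq_square algebra_simps add_divide_distrib)
    also have "\<dots> \<le> 720 * (Q + Q + Q) / T"
      using QX(4,5,6) XY T by (intro divide_right_mono mult_left_mono add_mono) auto
    finally show ?thesis by simp
  qed
  \<comment> \<open>The quotients are controlled only for s > 0, so the integration by parts starts
    at \<eta> and the piece [0, \<eta>] is estimated by its length.\<close>
  have main: "cmod (integral {0..R} (\<lambda>s. ph t 0 s * (f s * cnj (g s)))) \<le> Q * (630 / (\<bar>t\<bar> * T) + 1 / (\<bar>t\<bar> * R)) + (Q / \<bar>t\<bar> + 4 * Q) * \<eta>"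
    if \<eta>: "0 < \<eta>" "\<eta> < 1" for \<eta>
  proof -
    define k where "k = \<i> / (4 * complex_of_real t)"
    have kn: "cmod k = 1 / (4 * \<bar>t\<bar>)" by (simp add: k_def norm_divide norm_mult)
    define H where "H s = k * (ph t 0 s * \<Phi> s)" for s
    have cf: "continuous_on A f" "continuous_on A g" for A
      by (intro continuous_at_imp_continuous_on ballI has_vector_derivative_continuous[OF f(1)] has_vector_derivative_continuous[OF g(1)])+
    have c\<xi>: "continuous_on {\<eta>..b} \<xi>" for b
      using \<eta> by (intro continuous_at_imp_continuous_on ballI has_vector_derivative_continuous[OF d\<xi>]) auto
    have If: "(\<lambda>s. ph t 0 s * (f s * cnj (g s))) integrable_on {a..b}" for a b
      by (intro integrable_continuous_real continuous_intros cf)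
    have I\<xi>: "(\<lambda>s. ph t 0 s * \<xi> s) integrable_on {\<eta>..b}" for b
      by (intro integrable_continuous_real continuous_intros c\<xi>)
    have dH: "(H has_vector_derivative ph t 0 s * (f s * cnj (g s)) + k * (ph t 0 s * \<xi> s)) (at s within {\<eta>..R})" if "s \<in> {\<eta>..R}" for s
    proof -
      have s: "0 < s" using that \<eta> by auto
      have "(H has_vector_derivative k * (ph t 0 s * \<xi> s + (- \<i> * complex_of_real (4 * t * s + 0) * ph t 0 s) * \<Phi> s)) (at s)"
        unfolding H_def[abs_def] by (intro has_vector_derivative_mult_right has_vector_derivative_mult ph_derivative d\<Phi> s)
      moreover have "k * (- \<i> * complex_of_real (4 * t * s + 0)) = s" using t by (simp add: k_def)
      hence "k * ((- \<i> * complex_of_real (4 * t * s + 0) * ph t 0 s) * \<Phi> s) = s * (ph t 0 s * \<Phi> s)" by (simp only: mult.assoc[symmetric])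
      moreover have "s * (ph t 0 s * \<Phi> s) = ph t 0 s * (f s * cnj (g s))" using s by (simp add: \<Phi>_def wg_def)
      ultimately have "(H has_vector_derivative ph t 0 s * (f s * cnj (g s)) + k * (ph t 0 s * \<xi> s)) (at s)"
        by (simp only: distrib_left add.commute)
      thus ?thesis by (rule has_vector_derivative_at_within)
    qed
    have "((\<lambda>s. ph t 0 s * (f s * cnj (g s)) + k * (ph t 0 s * \<xi> s)) has_integral H R - H \<eta>) {\<eta>..R}"
      using \<eta> R by (intro fundamental_theorem_of_calculus dH) auto
    from integral_unique[OF this]
    have "integral {\<eta>..R} (\<lambda>s. ph t 0 s * (f s * cnj (g s))) + k * integral {\<eta>..R} (\<lambda>s. ph t 0 s * \<xi> s) = H R - H \<eta>"
      using Henstock_Kurzweil_Integration.integral_add[OF If[of \<eta> R] integrable_on_mult_right[OF I\<xi>[of R], of k]]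
      by (simp add: Henstock_Kurzweil_Integration.integral_mult_right)
    hence "integral {\<eta>..R} (\<lambda>s. ph t 0 s * (f s * cnj (g s))) = (H R - H \<eta>) - k * integral {\<eta>..R} (\<lambda>s. ph t 0 s * \<xi> s)"
      by (simp add: eq_diff_eq)
    also have "integral {\<eta>..R} (\<lambda>s. ph t 0 s * \<xi> s) = integral {\<eta>..1} (\<lambda>s. ph t 0 s * \<xi> s) + integral {1..R} (\<lambda>s. ph t 0 s * \<xi> s)"
      using \<eta> R I\<xi> by (intro Henstock_Kurzweil_Integration.integral_combine[symmetric]) auto
    finally have e1: "integral {\<eta>..R} (\<lambda>s. ph t 0 s * (f s * cnj (g s))) = (H R - H \<eta>) - k * (integral {\<eta>..1} (\<lambda>s. ph t 0 s * \<xi> s) + integral {1..R} (\<lambda>s. ph t 0 s * \<xi> s))" .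
    have Hn: "cmod (H s) = 1 / (4 * \<bar>t\<bar>) * cmod (\<Phi> s)" for s by (simp add: H_def norm_mult kn)
    have HR: "cmod (H R) \<le> 1 / (4 * \<bar>t\<bar>) * (4 * Q / R)"
    proof -
      have "cmod (\<Phi> R) = cmod (f R * cnj (g R)) / R" using R by (simp add: \<Phi>_def wg_def norm_mult norm_divide)
      also have "\<dots> \<le> (2 * C * (2 * C)) / R" using R by (intro divide_right_mono prod fb) auto
      also have "\<dots> \<le> 4 * Q / R" using QX(4) XY R by (intro divide_right_mono) (auto simp: power2_eq_square)
      finally show ?thesis unfolding Hn by (rule mult_left_mono) simp
    qed
    have H\<eta>: "cmod (H \<eta>) \<le> 1 / (4 * \<bar>t\<bar>) * (4 * Q * \<eta>)"
    proof -
      have "cmod (f \<eta>) \<le> 2 * (C * X) * \<eta>" using wfb(1)[OF \<eta>(1)] \<eta> by (simp add: wf_def norm_divide divide_le_eq)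
      hence "cmod (\<Phi> \<eta>) \<le> (2 * (C * X) * \<eta>) * (2 * (C * Y))" unfolding \<Phi>_def by (intro prod wgb \<eta>)
      also have "\<dots> = 4 * (C\<^sup>2 * (X * Y)) * \<eta>" by (simp add: power2_eq_square)
      also have "\<dots> \<le> 4 * Q * \<eta>" using QX(1) XY \<eta> by (intro mult_right_mono) auto
      finally show ?thesis unfolding Hn by (rule mult_left_mono) simp
    qed
    have K: "cmod (k * (integral {\<eta>..1} (\<lambda>s. ph t 0 s * \<xi> s) + integral {1..R} (\<lambda>s. ph t 0 s * \<xi> s))) \<le> 1 / (4 * \<bar>t\<bar>) * (15 * (24 * Q) / T + 2160 * Q / T)"
      unfolding norm_mult kn by (intro mult_left_mono order_trans[OF norm_triangle_ineq add_mono] near far \<eta>) auto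
    have "cmod (integral {\<eta>..R} (\<lambda>s. ph t 0 s * (f s * cnj (g s)))) \<le>
       (1 / (4 * \<bar>t\<bar>) * (4 * Q / R) + 1 / (4 * \<bar>t\<bar>) * (4 * Q * \<eta>)) + 1 / (4 * \<bar>t\<bar>) * (15 * (24 * Q) / T + 2160 * Q / T)"
      unfolding e1 by (intro order_trans[OF norm_triangle_ineq4 add_mono] HR H\<eta> K)
    \<comment> \<open>630 = (15 * 24 + 2160) / 4, where the quarter comes from the factor 4t in the
      derivative of the phase.\<close>
    also have "\<dots> = Q * (630 / (\<bar>t\<bar> * T) + 1 / (\<bar>t\<bar> * R)) + Q / \<bar>t\<bar> * \<eta>"
      using t T R by (simp add: field_simps)
    finally have E1: "cmod (integral {\<eta>..R} (\<lambda>s. ph t 0 s * (f s * cnj (g s)))) \<le> Q * (630 / (\<bar>t\<bar> * T) + 1 / (\<bar>t\<bar> * R)) + Q / \<bar>t\<bar> * \<eta>" .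
    have "cmod (integral {0..\<eta>} (\<lambda>s. ph t 0 s * (f s * cnj (g s)))) \<le> integral {0..\<eta>} (\<lambda>_. 4 * Q)"
    proof (rule integral_norm_bound_integral[OF If])
      show "(\<lambda>_. 4 * Q) integrable_on {0..\<eta>}" by (rule integrable_const_ivl)
      fix s
      have "cmod (f s * cnj (g s)) \<le> 2 * C * (2 * C)" by (intro prod fb)
      also have "\<dots> \<le> 4 * Q" using QX(4) XY by (simp add: power2_eq_square)
      finally show "cmod (ph t 0 s * (f s * cnj (g s))) \<le> 4 * Q" by (simp add: norm_mult)
    qed
    hence E2: "cmod (integral {0..\<eta>} (\<lambda>s. ph t 0 s * (f s * cnj (g s)))) \<le> 4 * Q * \<eta>" using \<eta> by (simp add: mult_ac)
    have "integral {0..R} (\<lambda>s. ph t 0 s * (f s * cnj (g s))) = integral {0..\<eta>} (\<lambda>s. ph t 0 s * (f s * cnj (g s))) + integral {\<eta>..R} (\<lambda>s. ph t 0 s * (f s * cnj (g s)))"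
      using \<eta> R If by (intro Henstock_Kurzweil_Integration.integral_combine[symmetric]) auto
    hence "cmod (integral {0..R} (\<lambda>s. ph t 0 s * (f s * cnj (g s)))) \<le> 4 * Q * \<eta> + (Q * (630 / (\<bar>t\<bar> * T) + 1 / (\<bar>t\<bar> * R)) + Q / \<bar>t\<bar> * \<eta>)"
      using order_trans[OF norm_triangle_ineq add_mono[OF E2 E1]] by simp
    thus ?thesis by (simp add: algebra_simps)
  qed
  have "cmod (integral {0..R} (\<lambda>s. ph t 0 s * (f s * cnj (g s)))) \<le> Q * (630 / (\<bar>t\<bar> * T) + 1 / (\<bar>t\<bar> * R)) + d" if d: "d > 0" for d
  proof -
    define M where "M = Q / \<bar>t\<bar> + 4 * Q + 1"
    have M: "1 \<le> M" using Q0 by (simp add: M_def)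
    define \<eta> where "\<eta> = min (1/2) (d / M)"
    have \<eta>: "0 < \<eta>" "\<eta> < 1" "\<eta> \<le> d / M" using d M by (auto simp: \<eta>_def)
    have "(Q / \<bar>t\<bar> + 4 * Q) * \<eta> \<le> M * (d / M)" using \<eta> M Q0 by (intro mult_mono) (auto simp: M_def)
    thus ?thesis using main[OF \<eta>(1,2)] M by simp
  qed
  hence "cmod (integral {0..R} (\<lambda>s. ph t 0 s * (f s * cnj (g s)))) \<le> Q * (630 / (\<bar>t\<bar> * T) + 1 / (\<bar>t\<bar> * R))" by (rule field_le_epsilon)
  thus ?thesis by (simp add: Q_def T_def)
qed

section \<open>Decay of the truncated kernels\<close>

text \<open>The factor $(\lambda - ir)/\sqrt{\lambda^2+r^2}$ is not handled by the product rule for symbols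
  (the inverse square root is not of this form); instead its logarithmic derivative is a symbol.\<close>

lemma unimodular_symbol:
  assumes r: "0 < r"
  shows "\<exists>C. symbol C (\<lambda>l. (complex_of_real l - \<i> * r) / complex_of_real (sqrt (l\<^sup>2 + r\<^sup>2)))"
proof -
  define p where "p l = (complex_of_real l - \<i> * r) / complex_of_real (sqrt (l\<^sup>2 + r\<^sup>2))" for l :: real
  define c where "c = max 1 (1 / \<bar>r\<bar>)"
  \<comment> \<open>The logarithmic derivative ir/(l^2 + r^2) of \<open>p\<close>, split into two
    simple poles so that \<open>symbol_mult\<close> applies.\<close>
  define w where "w l = \<i> * r * (1 / (complex_of_real l - \<i> * r) * (1 / (complex_of_real l - \<i> * complex_of_real (- r))))" for l :: real
  define C where "C = 4 * cmod (\<i> * r) * (4 * (2 * c ^ 3) * (2 * c ^ 3))"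
  have c1: "1 \<le> c" by (simp add: c_def)
  have s1: "symbol (2 * c ^ 3) (\<lambda>l. 1 / (complex_of_real l - \<i> * r))"
    using simple_pole_symbol[of r] r by (simp add: c_def)
  have s2: "symbol (2 * c ^ 3) (\<lambda>l. 1 / (complex_of_real l - \<i> * complex_of_real (- r)))"
    using simple_pole_symbol[of "- r"] r by (simp add: c_def)
  have w: "symbol C w" unfolding w_def C_def by (rule symbol_cmult[OF symbol_mult[OF s1 s2]])
  have pos: "l\<^sup>2 + r\<^sup>2 > 0" for l using r by (simp add: add_nonneg_pos)
  have i2: "\<i> * (\<i> * c) = - c" for c by (simp flip: mult.assoc)
  have fac: "(complex_of_real l - \<i> * r) * (complex_of_real l - \<i> * complex_of_real (- r)) = complex_of_real (l\<^sup>2 + r\<^sup>2)" for l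
    by (simp add: power2_eq_square algebra_simps i2)
  have we: "w l = \<i> * r / complex_of_real (l\<^sup>2 + r\<^sup>2)" for l
    unfolding w_def fac[symmetric] by simp
  have wd: "cmod (w l) \<le> C / (1 + l\<^sup>2)" for l
  proof -
    have "1 / r \<le> c" using r by (simp add: c_def)
    hence "1 \<le> c * r" using r by (simp add: divide_le_eq)
    hence "1 * 1 \<le> (c * r) * (c * r)" by (intro mult_mono) auto
    hence "1 \<le> c\<^sup>2 * r\<^sup>2" by (simp add: power2_eq_square mult_ac)
    moreover have "1 * l\<^sup>2 \<le> c\<^sup>2 * l\<^sup>2" using c1 by (intro mult_right_mono) (auto simp: one_le_power)
    ultimately have "1 + l\<^sup>2 \<le> c\<^sup>2 * (l\<^sup>2 + r\<^sup>2)" by (simp add: algebra_simps)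
    hence "r * (1 + l\<^sup>2) \<le> (r * c\<^sup>2) * (l\<^sup>2 + r\<^sup>2)" using r by (simp add: mult.assoc)
    hence "r / (l\<^sup>2 + r\<^sup>2) \<le> r * c\<^sup>2 / (1 + l\<^sup>2)"
      using pos[of l] one_plus_sq_pos[of l] by (simp add: field_simps)
    also have "\<dots> \<le> C / (1 + l\<^sup>2)"
    proof (rule divide_right_mono)
      have "c\<^sup>2 \<le> c ^ 3 * c ^ 3" using power_increasing[of 2 6 c] c1 by (simp flip: power_add)
      hence "r * c\<^sup>2 \<le> r * (c ^ 3 * c ^ 3)" using r by simp
      also have "\<dots> \<le> 64 * (r * (c ^ 3 * c ^ 3))" using r c1 by simp
      finally show "r * c\<^sup>2 \<le> C" using r by (simp add: C_def norm_mult)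
    qed (use one_plus_sq_pos[of l] in simp)
    finally show ?thesis unfolding we norm_divide norm_of_real using r pos[of l] by (simp add: norm_mult)
  qed
  have dp: "(p has_vector_derivative w l * p l) (at l)" for l
  proof -
    define q where "q l = 1 / sqrt (l\<^sup>2 + r\<^sup>2)" for l
    have "(q has_real_derivative - l / (l\<^sup>2 + r\<^sup>2) * q l) (at l)"
      unfolding q_def[abs_def] using pos[of l]
      by (auto intro!: derivative_eq_intros simp: field_simps power2_eq_square)
    from has_vector_derivative_of_real[OF this]
    have dq: "((\<lambda>l. complex_of_real (q l)) has_vector_derivative of_real (- l / (l\<^sup>2 + r\<^sup>2) * q l)) (at l)" .
    have dl: "((\<lambda>l. complex_of_real l - \<i> * r) has_vector_derivative 1) (at l)"
      by (rule has_vector_derivative_real_field[of "\<lambda>z. z - \<i> * r"], auto intro!: derivative_eq_intros)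
    have pq: "p = (\<lambda>l. (complex_of_real l - \<i> * r) * complex_of_real (q l))" by (simp add: p_def q_def fun_eq_iff)
    have "(p has_vector_derivative (complex_of_real l - \<i> * r) * of_real (- l / (l\<^sup>2 + r\<^sup>2) * q l) + 1 * complex_of_real (q l)) (at l)"
      unfolding pq by (rule has_vector_derivative_mult[OF dl dq])
    moreover have "(complex_of_real l - \<i> * r) * of_real (- l / (l\<^sup>2 + r\<^sup>2) * q l) + 1 * complex_of_real (q l) = w l * p l"
    proof -
      define D where "D = complex_of_real (l\<^sup>2 + r\<^sup>2)"
      have D0: "D \<noteq> 0" using pos[of l] by (simp only: D_def of_real_eq_0_iff)
      have De: "D = of_real l * of_real l + of_real r * of_real r" by (simp add: D_def power2_eq_square)
      have "(complex_of_real l - \<i> * r) * (- of_real l) + D = \<i> * r * (complex_of_real l - \<i> * r)"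
        by (simp add: De algebra_simps i2)
      moreover have "(complex_of_real l - \<i> * r) * (- of_real l / D) + 1 = ((complex_of_real l - \<i> * r) * (- of_real l) + D) / D"
        using D0 by (simp add: add_divide_distrib diff_divide_distrib)
      ultimately have "(complex_of_real l - \<i> * r) * (- of_real l / D) + 1 = \<i> * r / D * (complex_of_real l - \<i> * r)" by simp
      hence "((complex_of_real l - \<i> * r) * (- of_real l / D) + 1) * of_real (q l) = \<i> * r / D * (complex_of_real l - \<i> * r) * of_real (q l)" by simp
      thus ?thesis unfolding we pq D_def[symmetric] of_real_mult of_real_divide of_real_minus
        by (simp only: distrib_right mult.assoc mult_1_left)
    qed
    ultimately show ?thesis by simp
  qed
  have pn: "cmod (p l) \<le> 1" for l
  proof -
    have "cmod (complex_of_real l - \<i> * r) = sqrt (l\<^sup>2 + r\<^sup>2)" by (simp add: cmod_def)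
    thus ?thesis using pos[of l] by (simp add: p_def norm_divide)
  qed
  show ?thesis using bounded_multiple_derivative_symbol[OF dp pn w wd] unfolding p_def by blast
qed

context soliton
begin

definition al :: "real \<Rightarrow> real \<Rightarrow> complex" where
  "al x l = ((complex_of_real l)\<^sup>2 + a1 x * complex_of_real l + a0 x) / complex_of_real (sqrt (pi * P l))"

lemma kf_al: "kf x l = al x l * exp (- 2 * \<i> * complex_of_real (x * l))"
  by (simp add: kf_def al_def soliton_a_eq mult_ac)

text \<open>With m_k = l - i\<rho>_k the numerator is m_1 m_2 + d1 m_1 + d2, so \<open>al x\<close>
  equals p_1 p_2 (1 + d1/m_2 + d2/(m_1 m_2)) / sqrt \<pi> with unimodular p_k. Only d1 and d2 depend
  on x, and \<open>coeff_bounds\<close> bounds them by the constant \<open>A\<close>.\<close>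

lemma amplitude_symbol: "\<exists>C. \<forall>x. symbol C (al x)"
proof -
  have \<rho>2: "0 < \<rho> 2" using \<rho>_pos \<rho>_less by simp
  obtain C1 where C1: "symbol C1 (\<lambda>l. (complex_of_real l - \<i> * \<rho> 1) / complex_of_real (sqrt (l\<^sup>2 + (\<rho> 1)\<^sup>2)))"
    using unimodular_symbol[OF \<rho>_pos] by blast
  obtain C2 where C2: "symbol C2 (\<lambda>l. (complex_of_real l - \<i> * \<rho> 2) / complex_of_real (sqrt (l\<^sup>2 + (\<rho> 2)\<^sup>2)))"
    using unimodular_symbol[OF \<rho>2] by blast
  obtain Z1 where Z1: "symbol Z1 (\<lambda>l. 1 / (complex_of_real l - \<i> * \<rho> 1))" using simple_pole_symbol[of "\<rho> 1"] \<rho>_pos by auto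
  obtain Z2 where Z2: "symbol Z2 (\<lambda>l. 1 / (complex_of_real l - \<i> * \<rho> 2))" using simple_pole_symbol[of "\<rho> 2"] \<rho>2 by auto
  define A where "A = CB + S + \<rho> 1 * \<rho> 2 + (CB + S) * \<rho> 1"
  have pp: "0 \<le> \<rho> 1 * \<rho> 2" "0 \<le> CB + S" using \<rho>_pos \<rho>2 CB_ge S_pos by auto
  have A0: "0 \<le> A" using pp CB_ge S_pos \<rho>_pos by (simp add: A_def)
  define CC where "CC = 4 * cmod (complex_of_real (1 / sqrt pi)) * (4 * (4 * C1 * C2) * ((cmod (1::complex) + 4 * A * Z2) + 4 * A * (4 * Z1 * Z2)))"
  have "symbol CC (al x)" for x
  proof -
    define d1 where "d1 = a1 x + \<i> * S"
    define d0 where "d0 = a0 x + \<rho> 1 * \<rho> 2"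
    \<comment> \<open>The value of the numerator at l = i\<rho>_1, that is, its remainder on
      division by m_1.\<close>
    define d2 where "d2 = d1 * (\<i> * \<rho> 1) + d0"
    have d1: "cmod d1 \<le> CB + S"
      unfolding d1_def using coeff_bounds(2)[of x] S_pos by (intro order_trans[OF norm_triangle_ineq]) (simp add: norm_mult)
    have d0: "cmod d0 \<le> CB + \<rho> 1 * \<rho> 2"
      unfolding d0_def using coeff_bounds(1)[of x] \<rho>_pos \<rho>2 by (intro order_trans[OF norm_triangle_ineq]) (simp add: norm_mult)
    have d1A: "cmod d1 \<le> A" using d1 pp \<rho>_pos by (simp add: A_def add_increasing2)
    have "cmod d2 \<le> cmod d1 * \<rho> 1 + cmod d0"
      unfolding d2_def using \<rho>_pos by (intro order_trans[OF norm_triangle_ineq]) (simp add: norm_mult)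
    also have "\<dots> \<le> (CB + S) * \<rho> 1 + (CB + \<rho> 1 * \<rho> 2)" using d1 d0 \<rho>_pos by (intro add_mono mult_right_mono) auto
    finally have d2A: "cmod d2 \<le> A" using S_pos by (simp add: A_def)
    define p1 where "p1 l = (complex_of_real l - \<i> * \<rho> 1) / complex_of_real (sqrt (l\<^sup>2 + (\<rho> 1)\<^sup>2))" for l :: real
    define p2 where "p2 l = (complex_of_real l - \<i> * \<rho> 2) / complex_of_real (sqrt (l\<^sup>2 + (\<rho> 2)\<^sup>2))" for l :: real
    define z1 where "z1 l = 1 / (complex_of_real l - \<i> * \<rho> 1)" for l :: real
    define z2 where "z2 l = 1 / (complex_of_real l - \<i> * \<rho> 2)" for l :: real
    note sy = C1[folded p1_def] C2[folded p2_def] Z1[folded z1_def] Z2[folded z2_def]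
    have sc: "symbol (4 * A * Z) (\<lambda>l. d * f l)" if "symbol Z f" "cmod d \<le> A" for Z f d
      using symbol_mono[OF symbol_cmult[OF that(1), of d]] that symbol_nonneg[OF that(1)]
      by (simp add: mult_right_mono)
    have "symbol CC (\<lambda>l. complex_of_real (1 / sqrt pi) * ((p1 l * p2 l) * ((1 + d1 * z2 l) + d2 * (z1 l * z2 l))))"
      unfolding CC_def
      by (intro symbol_cmult symbol_mult symbol_add symbol_const sc d1A d2A sy)
    moreover have "al x = (\<lambda>l. complex_of_real (1 / sqrt pi) * ((p1 l * p2 l) * ((1 + d1 * z2 l) + d2 * (z1 l * z2 l))))"
    proof
      fix l
      define m1 where "m1 = complex_of_real l - \<i> * \<rho> 1"
      define m2 where "m2 = complex_of_real l - \<i> * \<rho> 2"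
      have nz: "m1 \<noteq> 0" "m2 \<noteq> 0" using \<rho>_pos \<rho>2 by (auto simp: m1_def m2_def complex_eq_iff)
      have num: "(complex_of_real l)\<^sup>2 + a1 x * complex_of_real l + a0 x = m1 * m2 + d1 * m1 + d2"
      proof -
        have i2: "\<i> * (\<i> * c) = - c" for c by (simp flip: mult.assoc)
        show ?thesis by (simp add: m1_def m2_def d1_def d2_def d0_def S_def power2_eq_square algebra_simps i2)
      qed
      have den: "complex_of_real (sqrt (pi * P l)) = complex_of_real (sqrt pi) * (complex_of_real (sqrt (l\<^sup>2 + (\<rho> 1)\<^sup>2)) * complex_of_real (sqrt (l\<^sup>2 + (\<rho> 2)\<^sup>2)))"
        by (simp add: P_def real_sqrt_mult)
      have "m1 * m2 * ((1 + d1 * (1 / m2)) + d2 * (1 / m1 * (1 / m2))) = m1 * m2 + d1 * m1 + d2" using nz by (simp add: field_simps)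
      thus "al x l = complex_of_real (1 / sqrt pi) * ((p1 l * p2 l) * ((1 + d1 * z2 l) + d2 * (z1 l * z2 l)))"
        unfolding al_def num den p1_def p2_def z1_def z2_def m1_def[symmetric] m2_def[symmetric]
        by (simp add: divide_inverse mult_ac)
    qed
    ultimately show ?thesis by simp
  qed
  thus ?thesis by blast
qed

definition ua :: "parity \<Rightarrow> real \<Rightarrow> real \<Rightarrow> complex" where "ua \<alpha> x s = (1 / sqrt 2) * al x s"
definition va :: "parity \<Rightarrow> real \<Rightarrow> real \<Rightarrow> complex" where "va \<alpha> x s = (parity_sign \<alpha> / sqrt 2) * al x (- s)"

lemma Psi_wave_form:
  "Psi \<rho> \<theta> \<alpha> x s = ua \<alpha> x s * exp (- 2 * \<i> * complex_of_real (x * s)) + va \<alpha> x s * exp (2 * \<i> * complex_of_real (x * s))"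
  unfolding Psi_eq kf_al ua_def va_def by (simp add: add_divide_distrib)

lemma Psi_amplitudes: "\<exists>C. \<forall>\<alpha> x. symbol C (ua \<alpha> x) \<and> symbol C (va \<alpha> x)"
proof -
  obtain C where C: "\<And>x. symbol C (al x)" using amplitude_symbol by blast
  define D where "D = 4 * cmod (1 / complex_of_real (sqrt 2)) * C"
  have "symbol D (ua \<alpha> x)" for \<alpha> x
    unfolding ua_def[abs_def] D_def using symbol_cmult[OF C, of "1 / complex_of_real (sqrt 2)"] by simp
  moreover have "symbol D (va \<alpha> x)" for \<alpha> x
  proof -
    have "cmod (parity_sign \<alpha> / complex_of_real (sqrt 2)) = cmod (1 / complex_of_real (sqrt 2))"
      by (simp add: norm_divide parity_sign_cases)
    thus ?thesis unfolding va_def[abs_def] D_def using symbol_cmult[OF symbol_reflect[OF C], of "parity_sign \<alpha> / complex_of_real (sqrt 2)"] by simp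
  qed
  ultimately show ?thesis by blast
qed

lemma Psi_odd_zero: "Psi \<rho> \<theta> Odd x 0 = 0"
  by (simp add: Psi_eq)

lemma even_kernel_decay:
  "\<exists>D\<ge>0. \<forall>t R x y. t \<noteq> 0 \<longrightarrow> 1 \<le> R \<longrightarrow>
    cmod (integral {0..R} (\<lambda>s. ph t 0 s * (Psi \<rho> \<theta> Even x s * cnj (Psi \<rho> \<theta> Even y s)))) \<le> D / sqrt \<bar>t\<bar>"
proof -
  obtain C where C: "\<And>\<alpha> x. symbol C (ua \<alpha> x)" "\<And>\<alpha> x. symbol C (va \<alpha> x)" using Psi_amplitudes by blast
  have w: "wave x C (Psi \<rho> \<theta> \<alpha> x)" for \<alpha> x by (rule symbol_wave[OF C(1) C(2) Psi_wave_form])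
  show ?thesis
    by (rule exI[of _ "180 * C\<^sup>2"]) (auto intro!: even_kernel_bound w)
qed

text \<open>\<open>odd_kernel_bound\<close> expects one common constant; 8 C dominates the constants
  C, 2 C and 8 C of \<Psi> and its two derivatives.\<close>

lemma odd_kernel_decay:
  "\<exists>D\<ge>0. \<forall>t R x y. t \<noteq> 0 \<longrightarrow> 1 \<le> R \<longrightarrow>
    cmod (integral {0..R} (\<lambda>s. ph t 0 s * (Psi \<rho> \<theta> Odd x s * cnj (Psi \<rho> \<theta> Odd y s))))
      \<le> D * ((1 + \<bar>x\<bar>) * (1 + \<bar>y\<bar>))\<^sup>2 * (1 / (\<bar>t\<bar> * sqrt \<bar>t\<bar>) + 1 / (\<bar>t\<bar> * R))"
proof -
  obtain C where C: "\<And>\<alpha> x. symbol C (ua \<alpha> x)" "\<And>\<alpha> x. symbol C (va \<alpha> x)" using Psi_amplitudes by blast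
  have C0: "0 \<le> C" by (rule symbol_nonneg[OF C(1)])
  have w: "wave x (8 * C) (Psi \<rho> \<theta> \<alpha> x)" for \<alpha> x
    by (rule wave_mono[OF symbol_wave[OF C(1) C(2) Psi_wave_form]]) (use C0 in simp)
  show ?thesis
  proof (rule exI[of _ "(8 * C)\<^sup>2 * 630"], intro conjI allI impI)
    fix t R x y :: real assume t: "t \<noteq> 0" and R: "1 \<le> R"
    obtain f1 f2 where f: "\<And>s. (Psi \<rho> \<theta> Odd x has_vector_derivative f1 s) (at s)" "\<And>s. (f1 has_vector_derivative f2 s) (at s)"
      "wave x (2 * C * (1 + \<bar>x\<bar>)) f1" "\<And>s. cmod (f2 s) \<le> 8 * C * (1 + \<bar>x\<bar>)\<^sup>2"
      using symbol_wave_derivatives[OF C(1) C(2) Psi_wave_form, of Odd x] by blast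
    obtain g1 g2 where g: "\<And>s. (Psi \<rho> \<theta> Odd y has_vector_derivative g1 s) (at s)" "\<And>s. (g1 has_vector_derivative g2 s) (at s)"
      "wave y (2 * C * (1 + \<bar>y\<bar>)) g1" "\<And>s. cmod (g2 s) \<le> 8 * C * (1 + \<bar>y\<bar>)\<^sup>2"
      using symbol_wave_derivatives[OF C(1) C(2) Psi_wave_form, of Odd y] by blast
    have m: "wave z (8 * C * (1 + \<bar>z\<bar>)) h" if "wave z (2 * C * (1 + \<bar>z\<bar>)) h" for z h
      by (rule wave_mono[OF that]) (use C0 in \<open>auto intro!: mult_right_mono\<close>)
    have X: "1 \<le> 1 + \<bar>x\<bar>" "1 \<le> 1 + \<bar>y\<bar>" by simp_all
    have "cmod (integral {0..R} (\<lambda>s. ph t 0 s * (Psi \<rho> \<theta> Odd x s * cnj (Psi \<rho> \<theta> Odd y s))))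
       \<le> (8 * C * (1 + \<bar>x\<bar>) * (1 + \<bar>y\<bar>))\<^sup>2 * (630 / (\<bar>t\<bar> * sqrt \<bar>t\<bar>) + 1 / (\<bar>t\<bar> * R))"
      by (rule odd_kernel_bound[OF t R X f(1,2) Psi_odd_zero w m[OF f(3)] f(4) g(1,2) Psi_odd_zero w m[OF g(3)] g(4)])
    also have "\<dots> \<le> (8 * C * (1 + \<bar>x\<bar>) * (1 + \<bar>y\<bar>))\<^sup>2 * (630 * (1 / (\<bar>t\<bar> * sqrt \<bar>t\<bar>) + 1 / (\<bar>t\<bar> * R)))"
      using R by (intro mult_left_mono) (auto simp: divide_right_mono)
    also have "\<dots> = (8 * C)\<^sup>2 * 630 * ((1 + \<bar>x\<bar>) * (1 + \<bar>y\<bar>))\<^sup>2 * (1 / (\<bar>t\<bar> * sqrt \<bar>t\<bar>) + 1 / (\<bar>t\<bar> * R))"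
      by (simp only: power_mult_distrib mult_ac)
    finally show "cmod (integral {0..R} (\<lambda>s. ph t 0 s * (Psi \<rho> \<theta> Odd x s * cnj (Psi \<rho> \<theta> Odd y s))))
      \<le> (8 * C)\<^sup>2 * 630 * ((1 + \<bar>x\<bar>) * (1 + \<bar>y\<bar>))\<^sup>2 * (1 / (\<bar>t\<bar> * sqrt \<bar>t\<bar>) + 1 / (\<bar>t\<bar> * R))" .
  qed simp
qed

end

section \<open>Bound states\<close>

text \<open>\<open>bound_proj\<close> is a \<open>THE\<close> over functions, so equality almost
  everywhere has to be raised to equality; the bound states are continuous.\<close>

lemma continuous_AE_zero:
  fixes h :: "real \<Rightarrow> complex"
  assumes c: "continuous_on UNIV h" and z: "AE x in lborel. h x = 0"
  shows "h x = 0"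
proof -
  have "closed (h -` {0})" using c by (simp add: continuous_closed_vimage continuous_on_eq_continuous_at)
  moreover have "AE x in lebesgue. x \<in> h -` {0}" using z by (intro AE_completion) simp
  ultimately have "x \<in> h -` {0}" by (rule mem_closed_if_AE_lebesgue)
  thus ?thesis by simp
qed

lemma integral_derivative_zero:
  fixes F :: "real \<Rightarrow> complex"
  assumes F: "\<And>x. (F has_vector_derivative f x) (at x)" and c: "continuous_on UNIV f" and i: "integrable lborel f"
    and lim: "(F \<longlongrightarrow> 0) at_top" "(F \<longlongrightarrow> 0) at_bot"
  shows "(LINT x|lborel. f x) = 0"
proof -
  have "(LBINT x=-\<infinity>..\<infinity>. f x) = 0 - 0"
  proof (rule interval_integral_FTC_integrable)
    show "((F \<circ> real_of_ereal) \<longlongrightarrow> 0) (at_right (- \<infinity>))" "((F \<circ> real_of_ereal) \<longlongrightarrow> 0) (at_left \<infinity>)"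
      using lim by (simp_all only: ereal_tendsto_simps1)
  qed (use F c i in \<open>auto simp: continuous_on_eq_continuous_at set_integrable_def\<close>)
  thus ?thesis by (simp add: interval_lebesgue_integral_def set_lebesgue_integral_def)
qed

context soliton
begin

lemma e_integrable: "integrable lborel e"
proof -
  have "integrable lborel (\<lambda>x. complex_of_real (exp (- (2 * \<rho> 1 * \<bar>x\<bar>))) * 1)"
    by (rule LINT_reflect_split(2)[where B=1]) (use \<rho>_pos in auto)
  from integrable_norm[OF this] show ?thesis by (simp add: e_def[abs_def])
qed

lemma e_tendsto: "(e \<longlongrightarrow> 0) at_top" "(e \<longlongrightarrow> 0) at_bot"
proof -
  have "filterlim (\<lambda>x. 2 * \<rho> 1 * x) at_top at_top"
    using \<rho>_pos by (intro filterlim_tendsto_pos_mult_at_top[OF tendsto_const _ filterlim_ident]) auto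
  hence 1: "((\<lambda>x. exp (- (2 * \<rho> 1 * x))) \<longlongrightarrow> 0) at_top"
    by (intro filterlim_compose[OF exp_at_bot]) (simp add: filterlim_uminus_at_top)
  show "(e \<longlongrightarrow> 0) at_top"
    by (rule Lim_transform_eventually[OF 1]) (use eventually_ge_at_top[of 0] in \<open>eventually_elim, simp add: e_def\<close>)
  have 2: "((\<lambda>x. exp (- (2 * \<rho> 1 * - x))) \<longlongrightarrow> 0) at_bot"
    using filterlim_compose[OF 1 filterlim_uminus_at_top_at_bot] .
  show "(e \<longlongrightarrow> 0) at_bot"
    by (rule Lim_transform_eventually[OF 2]) (use eventually_le_at_bot[of 0] in \<open>eventually_elim, simp add: e_def\<close>)
qed

lemma coeff_b_decay: "cmod (b0 x) \<le> K * e x" "cmod (b1 x) \<le> K * e x"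
  using asymptotics(3,4)[of x 1] asymptotics(3,4)[of x "-1"] by (cases "x \<ge> 0"; auto)+

lemma B_decay: "cmod (b1 x * z + b0 x) \<le> K * (cmod z + 1) * e x"
    "cmod (cnj (b1 x) * z + cnj (b0 x)) \<le> K * (cmod z + 1) * e x"
proof -
  have "cmod (u * z + v) \<le> K * (cmod z + 1) * e x" if "cmod u \<le> K * e x" "cmod v \<le> K * e x" for u v
  proof -
    have "cmod (u * z + v) \<le> cmod u * cmod z + cmod v" using norm_triangle_ineq[of "u * z" v] by (simp add: norm_mult)
    also have "\<dots> \<le> K * e x * cmod z + K * e x" using that by (intro add_mono mult_right_mono) auto
    finally show ?thesis by (simp add: algebra_simps)
  qed
  from this[OF coeff_b_decay(2,1)] this[of "cnj (b1 x)" "cnj (b0 x)"] coeff_b_decay[of x]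
  show "cmod (b1 x * z + b0 x) \<le> K * (cmod z + 1) * e x" "cmod (cnj (b1 x) * z + cnj (b0 x)) \<le> K * (cmod z + 1) * e x"
    by simp_all
qed

text \<open>The factor 1 / \<open>E k x\<close> in the bound state grows as x tends to -infinity.
  Through the relation at -i\<rho>_k it is traded for B(-i\<rho>_k), which decays at both
  ends.\<close>

lemma bound_state_eq:
  assumes "k \<in> {1, 2}"
  shows "bound_state \<rho> \<theta> k x = - cnj (g k) * (b1 x * (- \<i> * \<rho> k) + b0 x)"
proof -
  have "exp (- 2 * \<i> * (- \<i> * complex_of_real (\<rho> k)) * complex_of_real x) = complex_of_real (1 / E k x)"
  proof -
    have "- 2 * \<i> * (- \<i> * complex_of_real (\<rho> k)) * complex_of_real x = complex_of_real (- (2 * \<rho> k * x))" by simp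
    thus ?thesis by (simp only: exp_of_real) (simp add: E_def exp_minus inverse_eq_divide)
  qed
  hence "bound_state \<rho> \<theta> k x = ((- \<i> * \<rho> k)\<^sup>2 + a1 x * (- \<i> * \<rho> k) + a0 x) / E k x"
    unfolding bound_state_def soliton_a_eq by simp
  also have "\<dots> = (cnj (g k) * g k) * (((- \<i> * \<rho> k)\<^sup>2 + a1 x * (- \<i> * \<rho> k) + a0 x) / E k x)"
    by (simp only: g_unit mult_1_left)
  also have "\<dots> = - cnj (g k) * (- g k * ((- \<i> * \<rho> k)\<^sup>2 + a1 x * (- \<i> * \<rho> k) + a0 x) / E k x)" by simp
  finally show ?thesis by (simp only: relation2[OF assms])
qed

lemma bound_state_decay:
  assumes "k \<in> {1, 2}"
  shows "cmod (bound_state \<rho> \<theta> k x) \<le> K * (\<rho> 2 + 1) * e x"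
proof -
  have "cmod (bound_state \<rho> \<theta> k x) = cmod (b1 x * (- \<i> * \<rho> k) + b0 x)"
    unfolding bound_state_eq[OF assms] by (simp only: norm_mult norm_minus_cancel complex_mod_cnj g_unit mult_1_left)
  also have "\<dots> \<le> K * (cmod (- \<i> * \<rho> k) + 1) * e x" by (rule B_decay)
  also have "\<dots> \<le> K * (\<rho> 2 + 1) * e x"
    using \<rho>_cases[OF assms] K_nonneg e_bounds[of x] by (intro mult_right_mono mult_left_mono) (auto simp: norm_mult)
  finally show ?thesis .
qed

lemma bound_state_continuous: "continuous_on UNIV (bound_state \<rho> \<theta> k)"
  unfolding bound_state_def[abs_def] by (rule soliton_a_continuous)

lemma bound_state_measurable [measurable]: "bound_state \<rho> \<theta> k \<in> borel_measurable borel"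
  by (rule borel_measurable_continuous_onI[OF bound_state_continuous])

lemma bound_state_L2:
  assumes "k \<in> {1, 2}"
  shows "bound_state \<rho> \<theta> k \<in> L2 lborel"
proof (rule L2_dominated)
  define C where "C = K * (\<rho> 2 + 1)"
  show "integrable lborel (\<lambda>x. C\<^sup>2 * e x)" using e_integrable by simp
  fix x
  have "(cmod (bound_state \<rho> \<theta> k x))\<^sup>2 \<le> (C * e x)\<^sup>2"
    using bound_state_decay[OF assms, of x] by (intro power_mono) (auto simp: C_def)
  also have "\<dots> = C\<^sup>2 * (e x * e x)" by (simp add: power2_eq_square)
  also have "\<dots> \<le> C\<^sup>2 * (e x * 1)" using e_bounds[of x] by (intro mult_left_mono) auto
  finally show "(cmod (bound_state \<rho> \<theta> k x))\<^sup>2 \<le> C\<^sup>2 * e x" by simp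
qed simp

lemma bound_state_integrable:
  assumes "k \<in> {1, 2}"
  shows "integrable lborel (bound_state \<rho> \<theta> k)"
proof (rule Bochner_Integration.integrable_bound)
  show "integrable lborel (\<lambda>x. K * (\<rho> 2 + 1) * e x)" using e_integrable by simp
  have "cmod (bound_state \<rho> \<theta> k x) \<le> \<bar>K * (\<rho> 2 + 1) * e x\<bar>" for x using bound_state_decay[OF assms, of x] by linarith
  thus "AE x in lborel. norm (bound_state \<rho> \<theta> k x) \<le> norm (K * (\<rho> 2 + 1) * e x)" by simp
qed simp

lemma bound_state_soliton_integrable:
  assumes k: "k \<in> {1, 2}"
  shows "integrable lborel (\<lambda>x. cnj (bound_state \<rho> \<theta> k x) * soliton_a \<rho> \<theta> x (complex_of_real l))"
proof (rule Bochner_Integration.integrable_bound)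
  show "integrable lborel (\<lambda>x. bound_state \<rho> \<theta> k x * complex_of_real (sqrt (P l)))" using bound_state_integrable[OF k] by simp
  have "continuous_on UNIV (\<lambda>x. cnj (bound_state \<rho> \<theta> k x) * soliton_a \<rho> \<theta> x (complex_of_real l))"
    by (intro continuous_intros bound_state_continuous soliton_a_continuous)
  thus "(\<lambda>x. cnj (bound_state \<rho> \<theta> k x) * soliton_a \<rho> \<theta> x (complex_of_real l)) \<in> borel_measurable lborel"
    using borel_measurable_continuous_onI by simp
  have "cmod (cnj (bound_state \<rho> \<theta> k x) * soliton_a \<rho> \<theta> x (complex_of_real l)) \<le> cmod (bound_state \<rho> \<theta> k x) * sqrt (P l)" for x
    unfolding norm_mult complex_mod_cnj by (intro mult_left_mono soliton_a_real_bound norm_ge_zero)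
  thus "AE x in lborel. norm (cnj (bound_state \<rho> \<theta> k x) * soliton_a \<rho> \<theta> x (complex_of_real l))
      \<le> norm (bound_state \<rho> \<theta> k x * complex_of_real (sqrt (P l)))"
    using P_pos[of l] by (simp add: norm_mult less_imp_le)
qed

text \<open>On both half-lines the defining relations at $\pm i\rho_k$ absorb the factor $e^{-2\rho_k x}$
  of \<open>G\<close>; what remains is linear in the decaying coefficients of $B$.\<close>

lemma G_bound_point:
  assumes k: "k \<in> {1, 2}"
  shows "cmod (G (\<i> * \<rho> k) (complex_of_real l) x) \<le> (K * (\<rho> 2 + 1) * sqrt (P l) + KA * (K * (\<bar>l\<bar> + 1))) * e x"
proof -
  define Al where "Al = (complex_of_real l)\<^sup>2 + a1 x * complex_of_real l + a0 x"
  define Bl where "Bl = cnj (b1 x) * complex_of_real l + cnj (b0 x)"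
  define Aw where "Aw = (\<i> * \<rho> k)\<^sup>2 + a1 x * (\<i> * \<rho> k) + a0 x"
  define Bw where "Bw = b1 x * (\<i> * \<rho> k) + b0 x"
  define As where "As = (\<i> * \<rho> k)\<^sup>2 + cnj (a1 x) * (\<i> * \<rho> k) + cnj (a0 x)"
  define Bs where "Bs = cnj (b1 x) * (\<i> * \<rho> k) + cnj (b0 x)"
  have r1: "Aw * E k x = cnj (g k) * Bw" unfolding Aw_def Bw_def by (rule relation1[OF k])
  have r2: "Bs = - cnj (g k) * As / E k x" unfolding As_def Bs_def by (rule relation2_cnj[OF k])
  have E0: "complex_of_real (E k x) \<noteq> 0" using E_pos[of k x] by simp
  have "Bw = g k * (cnj (g k) * Bw)" by (simp add: g_unit flip: mult.assoc)
  hence f1: "Bw / E k x = g k * Aw" using E0 by (simp flip: r1)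
  have "As = g k * (cnj (g k) * As)" by (simp add: g_unit flip: mult.assoc)
  moreover have "cnj (g k) * As / E k x = - Bs" using r2 by simp
  ultimately have f2: "As / E k x = - (g k * Bs)" by (metis times_divide_eq_right mult_minus_right)
  have "2 * \<i> * (\<i> * complex_of_real (\<rho> k) - complex_of_real l) * complex_of_real x = complex_of_real (- (2 * \<rho> k * x)) + \<i> * complex_of_real (- (2 * l * x))"
    by (simp add: algebra_simps)
  hence ex: "exp (2 * \<i> * (\<i> * complex_of_real (\<rho> k) - complex_of_real l) * complex_of_real x) = exp (\<i> * complex_of_real (- (2 * l * x))) / E k x"
    by (simp only: exp_add exp_of_real) (simp add: E_def exp_minus divide_inverse mult.commute)
  have "G (\<i> * \<rho> k) (complex_of_real l) x = exp (\<i> * complex_of_real (- (2 * l * x))) / E k x * (As * Al + Bw * Bl)"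
    unfolding G_def ex As_def Al_def Bw_def Bl_def ..
  also have "\<dots> = exp (\<i> * complex_of_real (- (2 * l * x))) * (As / E k x * Al + Bw / E k x * Bl)"
    by (simp add: field_simps add_divide_distrib)
  also have "\<dots> = exp (\<i> * complex_of_real (- (2 * l * x))) * (g k * (- Bs * Al + Aw * Bl))"
    unfolding f1 f2 by (simp add: algebra_simps)
  finally have "cmod (G (\<i> * \<rho> k) (complex_of_real l) x) = cmod (- Bs * Al + Aw * Bl)"
    by (simp only: norm_mult norm_exp_i_times g_unit mult_1_left)
  also have "\<dots> \<le> cmod Bs * cmod Al + cmod Aw * cmod Bl"
    using norm_triangle_ineq[of "- Bs * Al" "Aw * Bl"] by (simp add: norm_mult)
  also have "\<dots> \<le> (K * (\<rho> 2 + 1) * e x) * sqrt (P l) + KA * (K * (\<bar>l\<bar> + 1) * e x)"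
  proof (intro add_mono mult_mono)
    have "cmod Bs \<le> K * (cmod (\<i> * \<rho> k) + 1) * e x" unfolding Bs_def by (rule B_decay)
    also have "\<dots> \<le> K * (\<rho> 2 + 1) * e x"
      using \<rho>_cases[OF k] K_nonneg e_bounds[of x] by (intro mult_right_mono mult_left_mono) (auto simp: norm_mult)
    finally show Bs: "cmod Bs \<le> K * (\<rho> 2 + 1) * e x" .
    show "0 \<le> K * (\<rho> 2 + 1) * e x" using order_trans[OF norm_ge_zero Bs] .
    show "cmod Al \<le> sqrt (P l)" unfolding Al_def using soliton_a_norm(1)[of l x] by simp
    show "cmod Aw \<le> KA" unfolding Aw_def using A_bound_bound_points(1)[OF k, of 1 x] by simp
    show "cmod Bl \<le> K * (\<bar>l\<bar> + 1) * e x" unfolding Bl_def using B_decay(2)[of x "complex_of_real l"] by simp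
  qed (use KA_nonneg in auto)
  finally show ?thesis by (simp add: algebra_simps)
qed

lemma bound_state_orthogonal:
  assumes k: "k \<in> {1, 2}"
  shows "(LINT x|lborel. cnj (bound_state \<rho> \<theta> k x) * soliton_a \<rho> \<theta> x (complex_of_real l)) = 0"
proof -
  define f where "f x = cnj (bound_state \<rho> \<theta> k x) * soliton_a \<rho> \<theta> x (complex_of_real l)" for x
  define c where "c = 2 * \<i> * (\<i> * complex_of_real (\<rho> k) - complex_of_real l)"
  have c0: "c \<noteq> 0" using \<rho>_cases[OF k] by (auto simp: c_def complex_eq_iff)
  have fc: "continuous_on UNIV f" unfolding f_def[abs_def] by (intro continuous_intros bound_state_continuous soliton_a_continuous)
  have fi: "integrable lborel f" unfolding f_def[abs_def] by (rule bound_state_soliton_integrable[OF k])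
  define D where "D = K * (\<rho> 2 + 1) * sqrt (P l) + KA * (K * (\<bar>l\<bar> + 1))"
  have Gb: "cmod (G (\<i> * \<rho> k) (complex_of_real l) x) \<le> D * e x" for x unfolding D_def by (rule G_bound_point[OF k])
  have lim: "(G (\<i> * \<rho> k) (complex_of_real l) \<longlongrightarrow> 0) F" if "(e \<longlongrightarrow> 0) F" for F
    by (rule Lim_null_comparison[OF _ tendsto_mult_right_zero[OF that, of D]]) (use Gb in \<open>auto intro: always_eventually\<close>)
  have "(LINT x|lborel. c * f x) = 0"
  proof (rule integral_derivative_zero)
    fix x
    \<comment> \<open>The bound state belongs to the spectral point -i\<rho>_k, the conjugate of m =
      i\<rho>_k. As m - l is never 0 for real l, the integral is a multiple of the difference of the
      limits of \<open>G\<close>, which are 0.\<close>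
    have "cnj (\<i> * complex_of_real (\<rho> k)) = - \<i> * complex_of_real (\<rho> k)" by simp
    thus "(G (\<i> * \<rho> k) (complex_of_real l) has_vector_derivative c * f x) (at x)"
      using G_derivative[of "\<i> * \<rho> k" "complex_of_real l" x] by (simp only: c_def f_def bound_state_def)
    show "continuous_on UNIV (\<lambda>x. c * f x)" by (intro continuous_intros fc)
    show "integrable lborel (\<lambda>x. c * f x)" using fi by simp
  qed (rule lim e_tendsto)+
  thus ?thesis using c0 by (simp add: f_def)
qed

lemma bound_state_Psi_orthogonal:
  assumes k: "k \<in> {1, 2}"
  shows "(LINT x|lborel. cnj (bound_state \<rho> \<theta> k x) * Psi \<rho> \<theta> \<alpha> x l) = 0"
proof -
  define q where "q = complex_of_real (sqrt (2 * pi * (l\<^sup>2 + (\<rho> 1)\<^sup>2) * (l\<^sup>2 + (\<rho> 2)\<^sup>2)))"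
  define F where "F l x = cnj (bound_state \<rho> \<theta> k x) * soliton_a \<rho> \<theta> x (complex_of_real l)" for l x
  have i: "integrable lborel (F l)" for l unfolding F_def[abs_def] by (rule bound_state_soliton_integrable[OF k])
  have z: "(LINT x|lborel. F l x) = 0" for l unfolding F_def by (rule bound_state_orthogonal[OF k])
  have "(LINT x|lborel. cnj (bound_state \<rho> \<theta> k x) * Psi \<rho> \<theta> \<alpha> x l) = (LINT x|lborel. (F l x + parity_sign \<alpha> * F (- l) x) / q)"
    by (simp add: F_def Psi_def q_def algebra_simps)
  also have "\<dots> = ((LINT x|lborel. F l x) + parity_sign \<alpha> * (LINT x|lborel. F (- l) x)) / q" using i by simp
  finally show ?thesis by (simp add: z)
qed

text \<open>The zero function lies in the span and qualifies by orthogonality; any other candidate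
  is orthogonal to itself.\<close>

lemma bound_proj_zero:
  assumes f: "f \<in> L2 lborel" and orth: "\<And>k. k \<in> {1, 2} \<Longrightarrow> (LINT x|lborel. cnj (bound_state \<rho> \<theta> k x) * f x) = 0"
  shows "bound_proj \<rho> \<theta> f = (\<lambda>_. 0)"
proof -
  have b: "bound_state \<rho> \<theta> 1 \<in> L2 lborel" "bound_state \<rho> \<theta> 2 \<in> L2 lborel" by (intro bound_state_L2; simp)+
  have v: "v \<in> L2 lborel \<and> continuous_on UNIV v \<and> (LINT x|lborel. cnj (v x) * f x) = 0" if vb: "v \<in> bound_space \<rho> \<theta>" for v
  proof -
    obtain c1 c2 where ve: "v = (\<lambda>x. c1 * bound_state \<rho> \<theta> 1 x + c2 * bound_state \<rho> \<theta> 2 x)"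
      using vb unfolding bound_space_def by blast
    have "(LINT x|lborel. cnj (v x) * f x) =
      (LINT x|lborel. cnj c1 * (cnj (bound_state \<rho> \<theta> 1 x) * f x) + cnj c2 * (cnj (bound_state \<rho> \<theta> 2 x) * f x))"
      by (simp add: ve algebra_simps)
    also have "\<dots> = 0" using L2_cnj_mult_integrable[OF b(1) f] L2_cnj_mult_integrable[OF b(2) f] orth[of 1] orth[of 2] by simp
    finally show ?thesis unfolding ve by (intro conjI L2_add L2_cmult b continuous_intros bound_state_continuous)
  qed
  show ?thesis unfolding bound_proj_def
  proof (rule the_equality)
    show "(\<lambda>_. 0) \<in> bound_space \<rho> \<theta> \<and> (\<forall>v\<in>bound_space \<rho> \<theta>. L2_inner v (\<lambda>x. f x - 0) = 0)"
      using v by (auto simp: bound_space_def L2_inner_def intro!: exI[of _ 0])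
    fix h assume h: "h \<in> bound_space \<rho> \<theta> \<and> (\<forall>v\<in>bound_space \<rho> \<theta>. L2_inner v (\<lambda>x. f x - h x) = 0)"
    note vh = v[OF conjunct1[OF h]]
    have "0 = (LINT x|lborel. cnj (h x) * f x - cnj (h x) * h x)" using h by (auto simp: L2_inner_def algebra_simps)
    also have "\<dots> = 0 - (LINT x|lborel. cnj (h x) * h x)"
      using vh L2_cnj_mult_integrable[of h lborel f] L2_cnj_mult_integrable[of h lborel h] f by simp
    also have "(LINT x|lborel. cnj (h x) * h x) = complex_of_real ((L2_norm lborel h)\<^sup>2)"
      unfolding L2_norm_sq integral_complex_of_real[symmetric]
      by (intro Bochner_Integration.integral_cong) (simp_all only: complex_norm_square mult.commute)
    finally have "L2_norm lborel h = 0" by simp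
    with vh have "AE x in lborel. h x = 0" by (intro L2_norm_zero_AE) auto
    with vh show "h = (\<lambda>_. 0)" by (auto intro: continuous_AE_zero)
  qed
qed

end

section \<open>Weighted decay of the evolution\<close>

lemma japanese_ge_1: "1 \<le> japanese x"
  by (simp add: japanese_def)

lemma japanese_pos: "0 < japanese x"
  using japanese_ge_1[of x] by linarith

lemma japanese_sq: "(japanese x)\<^sup>2 = 1 + x\<^sup>2"
  by (simp add: japanese_def add_nonneg_nonneg)

lemma japanese_measurable [measurable]: "japanese \<in> borel_measurable borel"
  unfolding japanese_def[abs_def] by measurable

lemma one_plus_abs_sq_le: "(1 + \<bar>x\<bar>)\<^sup>2 \<le> 2 * (japanese x)\<^sup>2"
  unfolding japanese_sq using zero_le_power2[of "1 - \<bar>x\<bar>"] by (simp add: power2_eq_square algebra_simps)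

lemma japanese_le_max: "japanese t \<le> 2 * max 1 \<bar>t\<bar>"
proof -
  have "1 + t\<^sup>2 \<le> (1 + \<bar>t\<bar>)\<^sup>2" by (simp add: power2_eq_square algebra_simps)
  hence "japanese t \<le> 1 + \<bar>t\<bar>" unfolding japanese_def by (intro real_le_lsqrt) auto
  thus ?thesis by linarith
qed

text \<open>Small and large times are merged through max 1 |t|. The factor 2^\<gamma> is at most 4
  for \<gamma> \<le> 2, which covers both rates 1/2 and 3/2.\<close>

lemma time_weight:
  assumes "0 \<le> \<gamma>" "\<gamma> \<le> 2"
  shows "max 1 \<bar>t\<bar> powr (- \<gamma>) \<le> 4 * japanese t powr (- \<gamma>)"
proof -
  have "max 1 \<bar>t\<bar> powr (- \<gamma>) \<le> (japanese t / 2) powr (- \<gamma>)"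
    using japanese_le_max[of t] japanese_pos[of t] assms by (intro powr_mono2') auto
  also have "\<dots> = japanese t powr (- \<gamma>) * 2 powr \<gamma>"
    using japanese_pos[of t] by (simp add: powr_divide powr_minus_divide)
  also have "\<dots> \<le> japanese t powr (- \<gamma>) * 2 powr 2"
    using assms by (intro mult_left_mono powr_mono) auto
  finally show ?thesis by simp
qed

lemma powr_tail_integrable:
  assumes p: "1 < p"
  shows "integrable lborel (\<lambda>x::real. indicator {0..} x * (1 + x) powr (- p))"
proof -
  have "filterlim (\<lambda>x::real. 1 + x) at_top at_top"
    by (intro filterlim_tendsto_add_at_top[OF tendsto_const] filterlim_ident)
  hence "((\<lambda>x::real. (1 + x) powr (1 - p)) \<longlongrightarrow> 0) at_top" using p by (intro tendsto_neg_powr) auto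
  hence lim: "((\<lambda>x::real. (1 + x) powr (1 - p) / (1 - p)) \<longlongrightarrow> 0 / (1 - p)) at_top"
    using p by (intro tendsto_intros) auto
  have "(\<integral>\<^sup>+x. ennreal ((1 + x) powr (- p)) * indicator {0..} x \<partial>lborel)
      = ennreal (0 / (1 - p) - (1 + 0) powr (1 - p) / (1 - p))"
  proof (rule nn_integral_FTC_atLeast[OF _ _ _ lim])
    fix x :: real assume x: "0 \<le> x"
    have "((\<lambda>x. (1 + x) powr (1 - p) / (1 - p)) has_real_derivative (1 - p) * (1 + x) powr (1 - p - 1) / (1 - p)) (at x)"
      using x p by (auto intro!: derivative_eq_intros)
    thus "((\<lambda>x. (1 + x) powr (1 - p) / (1 - p)) has_real_derivative (1 + x) powr (- p)) (at x)" using p by simp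
  qed auto
  hence "(\<integral>\<^sup>+x. ennreal (indicator {0..} x * (1 + x) powr (- p)) \<partial>lborel) < \<infinity>"
    by (simp add: ennreal_mult ennreal_indicator mult.commute)
  thus ?thesis by (intro integrableI_nonneg) auto
qed

text \<open>The bound 1 + |x| \<le> 2 \<open>japanese x\<close> reduces the claim to integrability
  of (1 + |x|)^(2q), whose exponent is below -1.\<close>

lemma japanese_powr_L2:
  assumes q: "q < - 1 / 2"
  shows "(\<lambda>x. complex_of_real (japanese x powr q)) \<in> L2 lborel"
proof (rule L2_dominated)
  define p where "p = - 2 * q"
  have p: "1 < p" using q by (simp add: p_def)
  define w where "w x = indicator {0..} x * (1 + x) powr (- p)" for x :: real
  have wi: "integrable lborel w" unfolding w_def[abs_def] by (rule powr_tail_integrable[OF p])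
  have "integrable lborel (\<lambda>x. w (- x))"
    using lborel_integrable_real_affine[OF wi, of "-1" 0] by simp
  thus "integrable lborel (\<lambda>x. 2 powr p * (w x + w (- x)))" using wi by simp
  fix x
  have "(1 + \<bar>x\<bar>) \<le> 2 * japanese x"
  proof (rule power2_le_imp_le)
    show "(1 + \<bar>x\<bar>)\<^sup>2 \<le> (2 * japanese x)\<^sup>2"
    proof -
      have "(2 * japanese x)\<^sup>2 = 4 * (japanese x)\<^sup>2" by (simp add: power_mult_distrib)
      thus ?thesis using one_plus_abs_sq_le[of x] zero_le_power2[of "japanese x"] by linarith
    qed
  qed (use japanese_pos[of x] in simp)
  hence "japanese x powr (- p) \<le> ((1 + \<bar>x\<bar>) / 2) powr (- p)" using p by (intro powr_mono2') auto
  also have "\<dots> = 2 powr p * (1 + \<bar>x\<bar>) powr (- p)" by (simp add: powr_divide powr_minus_divide)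
  also have "(1 + \<bar>x\<bar>) powr (- p) \<le> w x + w (- x)" by (auto simp: w_def split: split_indicator)
  finally have "japanese x powr (- p) \<le> 2 powr p * (w x + w (- x))" by simp
  moreover have "(japanese x powr q)\<^sup>2 = japanese x powr (- p)"
    by (simp add: p_def power2_eq_square flip: powr_add)
  ultimately show "(cmod (complex_of_real (japanese x powr q)))\<^sup>2 \<le> 2 powr p * (w x + w (- x))" by simp
qed measurable

lemma (in bounded_kernel) T_cong_AE:
  assumes "h \<in> borel_measurable M" "h' \<in> borel_measurable M" "AE l in M. h l = h' l"
  shows "T h = T h'"
proof
  fix x
  have [measurable]: "(\<lambda>l. K x l) \<in> borel_measurable M" by (rule kernel_section)
  show "T h x = T h' x" unfolding T_def
    by (rule integral_cong_AE) (use assms in \<open>auto elim!: eventually_mono\<close>)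
qed

lemma (in isometric_kernel) V_cong_AE:
  assumes "h \<in> borel_measurable M" "h' \<in> borel_measurable M" "AE l in M. h l = h' l"
  shows "V h = V h'"
proof -
  have "T (cut R h) = T (cut R h')" for R
    by (rule T_cong_AE) (use assms in \<open>auto simp: cut_def cut_measurable elim!: eventually_mono\<close>)
  thus ?thesis by (simp add: V_def)
qed

section \<open>The evolution on the ranges of the projections\<close>

context soliton
begin

abbreviation Vh :: "parity \<Rightarrow> (real \<Rightarrow> complex) \<Rightarrow> real \<Rightarrow> complex" where
  "Vh \<alpha> \<equiv> isometric_kernel.V halfline (Psi \<rho> \<theta> \<alpha>)"

lemma eigen_coeff_eq: "eigen_coeff \<rho> \<theta> \<alpha> f = isometric_kernel.W halfline (Psi \<rho> \<theta> \<alpha>) f"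
proof -
  interpret H: isometric_kernel halfline "Psi \<rho> \<theta> \<alpha>" 2 by (rule Psi_isometric_kernel)
  have "(LINT x:{-R..R}|lborel. cnj (Psi \<rho> \<theta> \<alpha> x l) * f x) = H.TS (H.trunc R f) l" for R l
    unfolding set_lebesgue_integral_def H.TS_def H.trunc_def
    by (intro Bochner_Integration.integral_cong) (auto split: split_indicator)
  thus ?thesis by (simp add: eigen_coeff_def H.W_def halfline_def[symmetric])
qed

text \<open>Matches the limit in the definition with that of \<open>V\<close>: on the half-line,
  cutting to [0, R] and to [-R, R] is the same.\<close>

lemma eigen_expansion_eq: "eigen_expansion \<rho> \<theta> \<alpha> m f = Vh \<alpha> (\<lambda>l. m l * eigen_coeff \<rho> \<theta> \<alpha> f l)"
proof -
  interpret H: isometric_kernel halfline "Psi \<rho> \<theta> \<alpha>" 2 by (rule Psi_isometric_kernel)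
  have "(LINT l:{0..R}|lborel. m l * eigen_coeff \<rho> \<theta> \<alpha> f l * Psi \<rho> \<theta> \<alpha> x l)
      = H.T (H.cut R (\<lambda>l. m l * eigen_coeff \<rho> \<theta> \<alpha> f l)) x" for R x
    unfolding set_lebesgue_integral_def H.T_def H.cut_def LINT_halfline
    by (intro Bochner_Integration.integral_cong) (auto split: split_indicator)
  thus ?thesis by (simp add: eigen_expansion_def H.V_def)
qed

lemma eigen_coeff_L2: "f \<in> L2 lborel \<Longrightarrow> eigen_coeff \<rho> \<theta> \<alpha> f \<in> L2 halfline"
  unfolding eigen_coeff_eq by (rule isometric_kernel.W_L2[OF Psi_isometric_kernel])

lemma cont_proj_eq: "cont_proj \<rho> \<theta> \<alpha> f = Vh \<alpha> (eigen_coeff \<rho> \<theta> \<alpha> f)"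
  by (simp add: cont_proj_def eigen_expansion_eq)

text \<open>Fubini's theorem applies to the cut expansions, and the limit in the mean preserves
  orthogonality.\<close>

lemma Vh_bound_state_orthogonal:
  assumes c: "c \<in> L2 halfline" and k: "k \<in> {1, 2}"
  shows "(LINT x|lborel. cnj (bound_state \<rho> \<theta> k x) * Vh \<alpha> c x) = 0"
proof -
  interpret H: isometric_kernel halfline "Psi \<rho> \<theta> \<alpha>" 2 by (rule Psi_isometric_kernel)
  have z: "(LINT x|lborel. cnj (bound_state \<rho> \<theta> k x) * H.T (H.cut R c) x) = 0" for R
  proof -
    have i: "integrable halfline (H.cut R c)" by (rule H.integrable_supp[OF H.cut_L2[OF c] H.cut_supp])
    have "(LINT x|lborel. cnj (bound_state \<rho> \<theta> k x) * (LINT l|halfline. H.cut R c l * Psi \<rho> \<theta> \<alpha> x l))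
        = (LINT l|halfline. H.cut R c l * (LINT x|lborel. cnj (bound_state \<rho> \<theta> k x) * Psi \<rho> \<theta> \<alpha> x l))"
      by (rule Fubini_bounded_kernel[OF lborel.sigma_finite_measure_axioms H.sigma_finite _ i H.kernel_measurable H.kernel_bound])
         (use bound_state_integrable[OF k] in auto)
    thus ?thesis by (simp add: H.T_def bound_state_Psi_orthogonal[OF k])
  qed
  have "((\<lambda>R::real. 0) \<longlongrightarrow> (LINT x|lborel. cnj (bound_state \<rho> \<theta> k x) * Vh \<alpha> c x)) at_top"
    using is_L2_limit_inner[OF H.V_limit[OF c] bound_state_L2[OF k]] by (simp only: z)
  from LIM_unique_at_top[OF this tendsto_const] show ?thesis .
qed

text \<open>Of the three parts of the functional calculus applied to Q = V c, the bound-state part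
  vanishes, the part of the same parity recovers c by \<open>W_V\<close>, and the part of the other
  parity has null coefficients. A null coefficient function yields a representative that is 0 only
  almost everywhere, whence the form of the statement.\<close>

lemma evolution_AE:
  assumes f: "f \<in> L2 lborel"
  shows "AE x in lborel. exp_itB \<rho> \<theta> \<beta> t (cont_proj \<rho> \<theta> \<alpha> f) x = Vh \<alpha> (\<lambda>l. ph t 0 l * eigen_coeff \<rho> \<theta> \<alpha> f l) x"
    and "exp_itB \<rho> \<theta> \<beta> t (cont_proj \<rho> \<theta> \<alpha> f) \<in> borel_measurable lborel"
proof -
  define c where "c = eigen_coeff \<rho> \<theta> \<alpha> f"
  have c: "c \<in> L2 halfline" unfolding c_def by (rule eigen_coeff_L2[OF f])
  define Q where "Q = cont_proj \<rho> \<theta> \<alpha> f"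
  have Q: "Q = Vh \<alpha> c" unfolding Q_def c_def by (rule cont_proj_eq)
  interpret H: isometric_kernel halfline "Psi \<rho> \<theta> \<alpha>" 2 by (rule Psi_isometric_kernel)
  have QL: "Q \<in> L2 lborel" unfolding Q by (rule H.V_L2[OF c])
  have phm [measurable]: "ph t 0 \<in> borel_measurable halfline"
    unfolding halfline_def by (intro borel_measurable_continuous_on_restrict measurable_restrict_space1) (simp add: borel_measurable_continuous_onI ph_continuous)
  define u where "u \<alpha>' l = ph t 0 l * eigen_coeff \<rho> \<theta> \<alpha>' Q l" for \<alpha>' l
  have uL: "u \<alpha>' \<in> L2 halfline" for \<alpha>'
    unfolding u_def[abs_def] by (intro L2_mult_bounded eigen_coeff_L2 QL phm) simp
  have ex: "exp_itB \<rho> \<theta> \<beta> t Q = (\<lambda>x. Vh Even (u Even) x + Vh Odd (u Odd) x)"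
  proof -
    have "bound_proj \<rho> \<theta> Q = (\<lambda>_. 0)"
      by (rule bound_proj_zero[OF QL]) (simp only: Q, rule Vh_bound_state_orthogonal[OF c])
    moreover have "exp (- \<i> * complex_of_real t * complex_of_real (2 * l\<^sup>2)) = ph t 0 l" for l
      by (simp add: ph_def mult_ac)
    ultimately show ?thesis
      unfolding exp_itB_def B_calculus_def eigen_expansion_eq u_def[abs_def] by simp
  qed
  have same: "Vh \<alpha> (u \<alpha>) = Vh \<alpha> (\<lambda>l. ph t 0 l * c l)"
  proof (rule H.V_cong_AE)
    show "AE l in halfline. u \<alpha> l = ph t 0 l * c l"
      using H.W_V[OF c] unfolding u_def eigen_coeff_eq Q by eventually_elim simp
    have "(\<lambda>l. ph t 0 l * c l) \<in> L2 halfline" by (intro L2_mult_bounded c phm) simp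
    thus "(\<lambda>l. ph t 0 l * c l) \<in> borel_measurable halfline" by (rule L2_measurable)
    show "u \<alpha> \<in> borel_measurable halfline" by (rule L2_measurable[OF uL])
  qed
  have other: "AE x in lborel. Vh \<alpha>' (u \<alpha>') x = 0" if ne: "\<alpha>' \<noteq> \<alpha>" for \<alpha>'
  proof -
    interpret H': isometric_kernel halfline "Psi \<rho> \<theta> \<alpha>'" 2 by (rule Psi_isometric_kernel)
    have "AE l in halfline. H'.W Q l = 0"
    proof (rule H'.W_orthogonal[OF QL])
      show "is_L2_limit lborel (\<lambda>R. H.T (H.cut R c)) Q" unfolding Q by (rule H.V_limit[OF c])
      fix N \<phi> R assume "\<phi> \<in> L2 halfline" "H'.supp_in N \<phi>"
      from parity_orthogonal[OF this H.cut_L2[OF c] H.cut_supp ne, of R]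
      show "(LINT x|lborel. cnj (H'.T \<phi> x) * H.T (H.cut R c) x) = 0" by (simp only: Th_def)
    qed
    hence "AE l in halfline. u \<alpha>' l = 0" unfolding u_def eigen_coeff_eq by eventually_elim simp
    from H'.V_null[OF uL this] show ?thesis .
  qed
  have cases: "\<alpha> = Even \<and> Odd \<noteq> \<alpha> \<or> \<alpha> = Odd \<and> Even \<noteq> \<alpha>" by (cases \<alpha>) auto
  show "AE x in lborel. exp_itB \<rho> \<theta> \<beta> t (cont_proj \<rho> \<theta> \<alpha> f) x = Vh \<alpha> (\<lambda>l. ph t 0 l * eigen_coeff \<rho> \<theta> \<alpha> f l) x"
    unfolding Q_def[symmetric] ex c_def[symmetric] same[symmetric] using cases other[of Even] other[of Odd]
    by (elim disjE conjE) (auto elim!: eventually_mono)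
  show "exp_itB \<rho> \<theta> \<beta> t (cont_proj \<rho> \<theta> \<alpha> f) \<in> borel_measurable lborel"
    unfolding Q_def[symmetric] ex
    by (intro borel_measurable_add L2_measurable isometric_kernel.V_L2[OF Psi_isometric_kernel] uL)
qed

abbreviation japanese_weight :: "real \<Rightarrow> real \<Rightarrow> complex" where
  "japanese_weight q x \<equiv> complex_of_real (japanese x powr q)"

lemma japanese_weight_measurable: "japanese_weight q \<in> borel_measurable lborel"
  by measurable

lemma japanese_weight_le_1: "0 \<le> \<sigma> \<Longrightarrow> cmod (japanese_weight (- \<sigma>) x) \<le> 1"
  using powr_mono[of "- \<sigma>" 0 "japanese x"] japanese_ge_1[of x] by simp

text \<open>\<sigma> > 5/2 says exactly that \<open>japanese_weight (2 - \<sigma>)\<close> is square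
  integrable; the two powers are spent on the growth of the odd kernel.\<close>

lemma weighted_L1:
  assumes \<sigma>: "5 / 2 < \<sigma>" and f: "f \<in> L2 lborel" and wf: "(\<lambda>x. japanese_weight \<sigma> x * f x) \<in> L2 lborel"
  shows "integrable lborel (\<lambda>y. (japanese y)\<^sup>2 * cmod (f y))"
    and "(LINT y|lborel. (japanese y)\<^sup>2 * cmod (f y))
      \<le> L2_norm lborel (japanese_weight (2 - \<sigma>)) * L2_norm lborel (\<lambda>x. japanese_weight \<sigma> x * f x)"
    and "integrable lborel f"
proof -
  have w: "japanese_weight (2 - \<sigma>) \<in> L2 lborel" using \<sigma> by (intro japanese_powr_L2) simp
  have eq: "cmod (japanese_weight (2 - \<sigma>) y) * cmod (japanese_weight \<sigma> y * f y) = (japanese y)\<^sup>2 * cmod (f y)" for y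
  proof -
    have "japanese y powr (2 - \<sigma>) * japanese y powr \<sigma> = japanese y powr 2" by (simp flip: powr_add)
    also have "\<dots> = (japanese y)\<^sup>2" using japanese_pos[of y] by simp
    finally show ?thesis by (simp add: norm_mult flip: mult.assoc)
  qed
  show i: "integrable lborel (\<lambda>y. (japanese y)\<^sup>2 * cmod (f y))"
    using L2_norm_mult_integrable[OF w wf] by (simp only: eq)
  show "(LINT y|lborel. (japanese y)\<^sup>2 * cmod (f y))
      \<le> L2_norm lborel (japanese_weight (2 - \<sigma>)) * L2_norm lborel (\<lambda>x. japanese_weight \<sigma> x * f x)"
    using L2_Cauchy_Schwarz_norm[OF w wf] by (simp only: eq)
  show "integrable lborel f"
  proof (rule Bochner_Integration.integrable_bound[OF i L2_measurable[OF f]])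
    have "1 * cmod (f y) \<le> (japanese y)\<^sup>2 * cmod (f y)" for y
      using japanese_ge_1[of y] by (intro mult_right_mono) (auto simp: one_le_power)
    thus "AE y in lborel. norm (f y) \<le> norm ((japanese y)\<^sup>2 * cmod (f y))" by simp
  qed
qed

text \<open>Passes from Lebesgue integrals over the half-line to the gauge integral in which the
  oscillatory estimates are stated.\<close>

lemma evolution_kernel_form:
  assumes f: "integrable lborel f" and R: "0 \<le> R"
  shows "bounded_kernel.T halfline (Psi \<rho> \<theta> \<alpha>) (bounded_kernel.cut R (\<lambda>l. ph t 0 l * bounded_kernel.TS (Psi \<rho> \<theta> \<alpha>) f l)) x
    = (LINT y|lborel. f y * integral {0..R} (\<lambda>s. ph t 0 s * (Psi \<rho> \<theta> \<alpha> x s * cnj (Psi \<rho> \<theta> \<alpha> y s))))"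
proof -
  interpret H: isometric_kernel halfline "Psi \<rho> \<theta> \<alpha>" 2 by (rule Psi_isometric_kernel)
  have phm [measurable]: "ph t 0 \<in> borel_measurable borel" by (simp add: borel_measurable_continuous_onI ph_continuous)
  have Pm [measurable]: "(\<lambda>s. Psi \<rho> \<theta> \<alpha> y s) \<in> borel_measurable borel" for y
    using measurable_compose[OF measurable_Pair1'[of y borel borel] Psi_measurable[of \<alpha>]] by simp
  have si: "set_integrable lborel {0..R} (\<lambda>s. ph t 0 s * (Psi \<rho> \<theta> \<alpha> x s * k s))" if [measurable]: "k \<in> borel_measurable borel" and k: "\<And>s. cmod (k s) \<le> 2" for k
    unfolding set_integrable_def
  proof (rule integrable_compact_support[where B=4 and N=R])
    show "cmod (indicator {0..R} s *\<^sub>R (ph t 0 s * (Psi \<rho> \<theta> \<alpha> x s * k s))) \<le> 4" for s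
      using mult_mono[OF Psi_bound[of \<alpha> x s] k[of s]] by (auto simp: norm_mult split: split_indicator)
  qed (auto split: split_indicator)
  \<comment> \<open>The indicator from \<open>cut\<close> is attached to the phase and the
    eigenfunction at x, which makes \<open>v\<close> integrable and lets the bounded kernel carry
    only y.\<close>
  define v where "v s = ph t 0 s * indicator {- R..R} s * Psi \<rho> \<theta> \<alpha> x s" for s
  have z: "indicator {0..} s *\<^sub>R (v s * z) = indicator {0..R} s *\<^sub>R (ph t 0 s * (Psi \<rho> \<theta> \<alpha> x s * z))" for s z
    by (auto simp: v_def split: split_indicator)
  have vi: "integrable halfline v"
    using si[of "\<lambda>_. 1"] z[of _ 1] unfolding integrable_halfline set_integrable_def by simp
  have k: "(\<lambda>(l, y). cnj (Psi \<rho> \<theta> \<alpha> y l)) \<in> borel_measurable (halfline \<Otimes>\<^sub>M lborel)"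
    using borel_measurable_cnj[OF measurable_compose[OF measurable_pair_swap' H.kernel_measurable]] by (simp add: case_prod_beta)
  have "H.T (H.cut R (\<lambda>l. ph t 0 l * H.TS f l)) x = (LINT l|halfline. v l * (LINT y|lborel. f y * cnj (Psi \<rho> \<theta> \<alpha> y l)))"
    unfolding H.T_def H.cut_def H.TS_def v_def by (simp add: mult_ac)
  also have "\<dots> = (LINT y|lborel. f y * (LINT l|halfline. v l * cnj (Psi \<rho> \<theta> \<alpha> y l)))"
    by (rule Fubini_bounded_kernel[OF H.sigma_finite lborel.sigma_finite_measure_axioms vi f k, where C=2])
       (simp add: Psi_bound)
  also have "(\<lambda>y. LINT l|halfline. v l * cnj (Psi \<rho> \<theta> \<alpha> y l)) = (\<lambda>y. integral {0..R} (\<lambda>s. ph t 0 s * (Psi \<rho> \<theta> \<alpha> x s * cnj (Psi \<rho> \<theta> \<alpha> y s))))"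
  proof
    fix y
    show "(LINT l|halfline. v l * cnj (Psi \<rho> \<theta> \<alpha> y l)) = integral {0..R} (\<lambda>s. ph t 0 s * (Psi \<rho> \<theta> \<alpha> x s * cnj (Psi \<rho> \<theta> \<alpha> y s)))"
      unfolding LINT_halfline z
      using set_borel_integral_eq_integral(2)[OF si[of "\<lambda>s. cnj (Psi \<rho> \<theta> \<alpha> y s)"]] Psi_bound by (simp add: set_lebesgue_integral_def)
  qed
  finally show ?thesis .
qed

text \<open>The kernel bound and \<open>weighted_L1\<close> make |T f(x)| at most a multiple of
  \<open>japanese x\<close> squared, and the outer weight turns this into
  \<open>japanese_weight (2 - \<sigma>)\<close>. The 4 comes from \<open>one_plus_abs_sq_le\<close>,
  used once in x and once in y.\<close>

lemma evolution_truncated_bound: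
  assumes \<sigma>: "5 / 2 < \<sigma>" and f: "f \<in> L2 lborel" and wf: "(\<lambda>x. japanese_weight \<sigma> x * f x) \<in> L2 lborel"
    and R: "0 \<le> R" and \<kappa>: "0 \<le> \<kappa>"
    and kb: "\<And>x y. cmod (integral {0..R} (\<lambda>s. ph t 0 s * (Psi \<rho> \<theta> \<alpha> x s * cnj (Psi \<rho> \<theta> \<alpha> y s)))) \<le> \<kappa> * ((1 + \<bar>x\<bar>) * (1 + \<bar>y\<bar>))\<^sup>2"
  shows "L2_norm lborel (\<lambda>x. japanese_weight (- \<sigma>) x *
      bounded_kernel.T halfline (Psi \<rho> \<theta> \<alpha>) (bounded_kernel.cut R (\<lambda>l. ph t 0 l * bounded_kernel.TS (Psi \<rho> \<theta> \<alpha>) f l)) x)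
    \<le> 4 * \<kappa> * (L2_norm lborel (japanese_weight (2 - \<sigma>)))\<^sup>2 * L2_norm lborel (\<lambda>x. japanese_weight \<sigma> x * f x)"
proof -
  interpret H: isometric_kernel halfline "Psi \<rho> \<theta> \<alpha>" 2 by (rule Psi_isometric_kernel)
  define T where "T = H.T (H.cut R (\<lambda>l. ph t 0 l * H.TS f l))"
  define N where "N = L2_norm lborel (japanese_weight (2 - \<sigma>))"
  define F where "F = L2_norm lborel (\<lambda>x. japanese_weight \<sigma> x * f x)"
  have N0: "0 \<le> N" "0 \<le> F" by (simp_all add: N_def F_def)
  note L1 = weighted_L1[OF \<sigma> f wf, folded N_def F_def]
  define k where "k x y = integral {0..R} (\<lambda>s. ph t 0 s * (Psi \<rho> \<theta> \<alpha> x s * cnj (Psi \<rho> \<theta> \<alpha> y s)))" for x y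
  have Te: "T x = (LINT y|lborel. f y * k x y)" for x
    unfolding T_def k_def by (rule evolution_kernel_form[OF L1(3) R])
  have kk: "cmod (k x y) \<le> 4 * \<kappa> * (japanese x)\<^sup>2 * (japanese y)\<^sup>2" for x y
  proof -
    have "((1 + \<bar>x\<bar>) * (1 + \<bar>y\<bar>))\<^sup>2 \<le> (2 * (japanese x)\<^sup>2) * (2 * (japanese y)\<^sup>2)"
      unfolding power_mult_distrib by (intro mult_mono one_plus_abs_sq_le) auto
    from mult_left_mono[OF this \<kappa>] kb[of x y] show ?thesis by (simp add: k_def mult_ac)
  qed
  have Tb: "cmod (T x) \<le> 4 * \<kappa> * N * F * (japanese x)\<^sup>2" for x
  proof -
    have "cmod (T x) \<le> (LINT y|lborel. (4 * \<kappa> * (japanese x)\<^sup>2) * ((japanese y)\<^sup>2 * cmod (f y)))"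
      unfolding Te
    proof (rule order_trans[OF integral_norm_bound integral_mono'])
      show "integrable lborel (\<lambda>y. (4 * \<kappa> * (japanese x)\<^sup>2) * ((japanese y)\<^sup>2 * cmod (f y)))" using L1(1) by simp
      show "cmod (f y * k x y) \<le> (4 * \<kappa> * (japanese x)\<^sup>2) * ((japanese y)\<^sup>2 * cmod (f y))" for y
        using mult_left_mono[OF kk[of x y], of "cmod (f y)"] by (simp add: norm_mult mult_ac)
      show "0 \<le> (4 * \<kappa> * (japanese x)\<^sup>2) * ((japanese y)\<^sup>2 * cmod (f y))" for y using \<kappa> by simp
    qed
    also have "\<dots> = (4 * \<kappa> * (japanese x)\<^sup>2) * (LINT y|lborel. (japanese y)\<^sup>2 * cmod (f y))" by simp
    also have "\<dots> \<le> (4 * \<kappa> * (japanese x)\<^sup>2) * (N * F)" using L1(2) \<kappa> by (intro mult_left_mono) auto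
    finally show ?thesis by (simp add: mult_ac)
  qed
  have hm: "T \<in> borel_measurable lborel"
  proof -
    have "H.TS f \<in> L2 halfline" by (rule H.TS_contraction[OF f L1(3)])
    moreover have "ph t 0 \<in> borel_measurable halfline"
      unfolding halfline_def by (intro measurable_restrict_space1) (simp add: borel_measurable_continuous_onI ph_continuous)
    ultimately have "(\<lambda>l. ph t 0 l * H.TS f l) \<in> L2 halfline" by (intro L2_mult_bounded) simp_all
    thus ?thesis unfolding T_def by (intro H.T_measurable H.cut_measurable L2_measurable)
  qed
  have w: "japanese_weight (2 - \<sigma>) \<in> L2 lborel" using \<sigma> by (intro japanese_powr_L2) simp
  have "L2_norm lborel (\<lambda>x. japanese_weight (- \<sigma>) x * T x)
      \<le> L2_norm lborel (\<lambda>x. complex_of_real (4 * \<kappa> * N * F) * japanese_weight (2 - \<sigma>) x)"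
  proof (rule L2_norm_mono)
    show "(\<lambda>x. japanese_weight (- \<sigma>) x * T x) \<in> borel_measurable lborel"
      by (intro borel_measurable_times japanese_weight_measurable hm)
    show "(\<lambda>x. complex_of_real (4 * \<kappa> * N * F) * japanese_weight (2 - \<sigma>) x) \<in> L2 lborel" by (rule L2_cmult[OF w])
    fix x
    have p: "japanese x powr (- \<sigma>) * (japanese x)\<^sup>2 = japanese x powr (2 - \<sigma>)"
    proof -
      have "(japanese x)\<^sup>2 = japanese x powr 2" using japanese_pos[of x] by simp
      thus ?thesis by (simp flip: powr_add)
    qed
    have "cmod (japanese_weight (- \<sigma>) x * T x) \<le> japanese x powr (- \<sigma>) * (4 * \<kappa> * N * F * (japanese x)\<^sup>2)"
      unfolding norm_mult by (intro mult_mono Tb) auto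
    also have "\<dots> = 4 * \<kappa> * N * F * (japanese x powr (- \<sigma>) * (japanese x)\<^sup>2)" by (simp only: mult_ac)
    also have "\<dots> = cmod (complex_of_real (4 * \<kappa> * N * F) * japanese_weight (2 - \<sigma>) x)"
      unfolding p norm_mult norm_of_real using \<kappa> N0 by simp
    finally show "cmod (japanese_weight (- \<sigma>) x * T x) \<le> cmod (complex_of_real (4 * \<kappa> * N * F) * japanese_weight (2 - \<sigma>) x)" .
  qed
  also have "\<dots> = 4 * \<kappa> * N\<^sup>2 * F"
    unfolding L2_norm_cmult N_def[symmetric] norm_of_real using \<kappa> N0 by (simp add: power2_eq_square)
  finally show ?thesis by (simp only: T_def N_def F_def)
qed

text \<open>The first bound is isometry alone and serves small times. The second is proved at finite
  R, where the operator has a kernel; since the outer weight is at most 1, the error of the cut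
  vanishes with the limit in the mean.\<close>

lemma weighted_evolution_bound:
  assumes \<sigma>: "5 / 2 < \<sigma>" and f: "f \<in> L2 lborel" and wf: "(\<lambda>x. japanese_weight \<sigma> x * f x) \<in> L2 lborel"
  shows "L2_norm lborel (\<lambda>x. japanese_weight (- \<sigma>) x * exp_itB \<rho> \<theta> \<beta> t (cont_proj \<rho> \<theta> \<alpha> f) x)
      \<le> L2_norm lborel (\<lambda>x. japanese_weight \<sigma> x * f x)"
    and "(\<And>R x y. 1 \<le> R \<Longrightarrow> cmod (integral {0..R} (\<lambda>s. ph t 0 s * (Psi \<rho> \<theta> \<alpha> x s * cnj (Psi \<rho> \<theta> \<alpha> y s)))) \<le> \<kappa> R * ((1 + \<bar>x\<bar>) * (1 + \<bar>y\<bar>))\<^sup>2) \<Longrightarrow>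
      (\<And>R. 1 \<le> R \<Longrightarrow> 0 \<le> \<kappa> R) \<Longrightarrow> (\<kappa> \<longlongrightarrow> \<kappa>') at_top \<Longrightarrow>
      L2_norm lborel (\<lambda>x. japanese_weight (- \<sigma>) x * exp_itB \<rho> \<theta> \<beta> t (cont_proj \<rho> \<theta> \<alpha> f) x)
      \<le> 4 * \<kappa>' * (L2_norm lborel (japanese_weight (2 - \<sigma>)))\<^sup>2 * L2_norm lborel (\<lambda>x. japanese_weight \<sigma> x * f x)"
proof -
  interpret H: isometric_kernel halfline "Psi \<rho> \<theta> \<alpha>" 2 by (rule Psi_isometric_kernel)
  have fi: "integrable lborel f" by (rule weighted_L1(3)[OF \<sigma> f wf])
  have phm: "ph t 0 \<in> borel_measurable halfline"
    unfolding halfline_def by (intro measurable_restrict_space1) (simp add: borel_measurable_continuous_onI ph_continuous)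
  define h where "h l = ph t 0 l * H.TS f l" for l
  have TSL: "H.TS f \<in> L2 halfline" by (rule H.TS_contraction[OF f fi])
  have hL: "h \<in> L2 halfline" unfolding h_def[abs_def] by (intro L2_mult_bounded TSL phm) simp
  define u where "u = Vh \<alpha> h"
  have uL: "u \<in> L2 lborel" unfolding u_def by (rule H.V_L2[OF hL])
  have Vu: "Vh \<alpha> (\<lambda>l. ph t 0 l * eigen_coeff \<rho> \<theta> \<alpha> f l) = u"
    unfolding u_def
  proof (rule H.V_cong_AE)
    show "AE l in halfline. ph t 0 l * eigen_coeff \<rho> \<theta> \<alpha> f l = h l"
      using H.W_integrable[OF f fi] unfolding eigen_coeff_eq h_def by eventually_elim simp
    show "(\<lambda>l. ph t 0 l * eigen_coeff \<rho> \<theta> \<alpha> f l) \<in> borel_measurable halfline"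
      by (intro borel_measurable_times phm L2_measurable eigen_coeff_L2 f)
    show "h \<in> borel_measurable halfline" by (rule L2_measurable[OF hL])
  qed
  have \<sigma>0: "0 \<le> \<sigma>" using \<sigma> by simp
  have eq: "L2_norm lborel (\<lambda>x. japanese_weight (- \<sigma>) x * exp_itB \<rho> \<theta> \<beta> t (cont_proj \<rho> \<theta> \<alpha> f) x)
    = L2_norm lborel (\<lambda>x. japanese_weight (- \<sigma>) x * u x)"
  proof (rule L2_norm_cong_AE)
    show "AE x in lborel. japanese_weight (- \<sigma>) x * exp_itB \<rho> \<theta> \<beta> t (cont_proj \<rho> \<theta> \<alpha> f) x = japanese_weight (- \<sigma>) x * u x"
      using evolution_AE(1)[OF f, of \<beta> t \<alpha>] unfolding Vu by eventually_elim simp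
  qed (intro borel_measurable_times japanese_weight_measurable evolution_AE(2) f L2_measurable uL)+
  have "L2_norm lborel (\<lambda>x. japanese_weight (- \<sigma>) x * u x) \<le> L2_norm lborel u"
    by (intro L2_norm_mult_bounded uL japanese_weight_measurable japanese_weight_le_1 \<sigma>0)
  also have "\<dots> = L2_norm halfline h" unfolding u_def by (rule H.V_norm[OF hL])
  also have "\<dots> \<le> L2_norm halfline (H.TS f)" unfolding h_def[abs_def] by (intro L2_norm_mult_bounded TSL phm) simp
  also have "\<dots> \<le> L2_norm lborel f" by (rule H.TS_contraction[OF f fi])
  also have "\<dots> \<le> L2_norm lborel (\<lambda>x. japanese_weight \<sigma> x * f x)"
  proof (rule L2_norm_mono[OF L2_measurable[OF f] wf])
    fix x
    have "1 * cmod (f x) \<le> japanese x powr \<sigma> * cmod (f x)"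
      using powr_mono[of 0 \<sigma> "japanese x"] japanese_ge_1[of x] \<sigma>0 japanese_pos[of x] by (intro mult_right_mono) auto
    thus "cmod (f x) \<le> cmod (japanese_weight \<sigma> x * f x)" by (simp add: norm_mult)
  qed
  finally show "L2_norm lborel (\<lambda>x. japanese_weight (- \<sigma>) x * exp_itB \<rho> \<theta> \<beta> t (cont_proj \<rho> \<theta> \<alpha> f) x)
      \<le> L2_norm lborel (\<lambda>x. japanese_weight \<sigma> x * f x)" unfolding eq .
  assume kb: "\<And>R x y. 1 \<le> R \<Longrightarrow> cmod (integral {0..R} (\<lambda>s. ph t 0 s * (Psi \<rho> \<theta> \<alpha> x s * cnj (Psi \<rho> \<theta> \<alpha> y s)))) \<le> \<kappa> R * ((1 + \<bar>x\<bar>) * (1 + \<bar>y\<bar>))\<^sup>2"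
    and k0: "\<And>R. 1 \<le> R \<Longrightarrow> 0 \<le> \<kappa> R" and klim: "(\<kappa> \<longlongrightarrow> \<kappa>') at_top"
  define N where "N = L2_norm lborel (japanese_weight (2 - \<sigma>))"
  define F where "F = L2_norm lborel (\<lambda>x. japanese_weight \<sigma> x * f x)"
  define TR where "TR R = H.T (H.cut R h)" for R
  have TRL: "TR R \<in> L2 lborel" for R unfolding TR_def by (rule H.T_L2[OF H.cut_L2[OF hL] H.cut_supp])
  have le: "L2_norm lborel (\<lambda>x. japanese_weight (- \<sigma>) x * u x) \<le> 4 * \<kappa> R * N\<^sup>2 * F + L2_norm lborel (\<lambda>x. TR R x - u x)" if R: "1 \<le> R" for R
  proof -
    have "L2_norm lborel (\<lambda>x. japanese_weight (- \<sigma>) x * u x) \<le> L2_norm lborel (\<lambda>x. japanese_weight (- \<sigma>) x * TR R x)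
        + L2_norm lborel (\<lambda>x. japanese_weight (- \<sigma>) x * u x - japanese_weight (- \<sigma>) x * TR R x)"
      by (intro L2_norm_triangle_diff L2_mult_bounded uL TRL japanese_weight_measurable japanese_weight_le_1 \<sigma>0)
    also have "(\<lambda>x. japanese_weight (- \<sigma>) x * u x - japanese_weight (- \<sigma>) x * TR R x) = (\<lambda>x. japanese_weight (- \<sigma>) x * (u x - TR R x))"
      by (simp only: right_diff_distrib)
    also have "L2_norm lborel (\<lambda>x. japanese_weight (- \<sigma>) x * (u x - TR R x)) \<le> L2_norm lborel (\<lambda>x. u x - TR R x)"
      by (intro L2_norm_mult_bounded L2_diff uL TRL japanese_weight_measurable japanese_weight_le_1 \<sigma>0)
    also have "\<dots> = L2_norm lborel (\<lambda>x. TR R x - u x)" by (rule L2_norm_minus_commute)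
    also have "L2_norm lborel (\<lambda>x. japanese_weight (- \<sigma>) x * TR R x) \<le> 4 * \<kappa> R * N\<^sup>2 * F"
      unfolding TR_def h_def[abs_def] N_def F_def
      by (rule evolution_truncated_bound[OF \<sigma> f wf _ k0[OF R] kb[OF R]]) (use R in simp)
    finally show ?thesis by simp
  qed
  have "((\<lambda>R. 4 * \<kappa> R * N\<^sup>2 * F + L2_norm lborel (\<lambda>x. TR R x - u x)) \<longlongrightarrow> 4 * \<kappa>' * N\<^sup>2 * F + 0) at_top"
    using H.V_limit[OF hL] unfolding is_L2_limit_def u_def[symmetric] TR_def[symmetric]
    by (intro tendsto_intros klim) auto
  hence "L2_norm lborel (\<lambda>x. japanese_weight (- \<sigma>) x * u x) \<le> 4 * \<kappa>' * N\<^sup>2 * F + 0"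
    by (rule tendsto_lowerbound[OF _ eventually_mono[OF eventually_ge_at_top le] trivial_limit_at_top_linorder])
  thus "L2_norm lborel (\<lambda>x. japanese_weight (- \<sigma>) x * exp_itB \<rho> \<theta> \<beta> t (cont_proj \<rho> \<theta> \<alpha> f) x)
      \<le> 4 * \<kappa>' * N\<^sup>2 * F" unfolding eq by simp
qed

text \<open>The summand 1 in \<open>C\<close> covers |t| \<le> 1; for larger |t| the term 1/(|t| R)
  disappears as R tends to infinity.\<close>

lemma decay_from_kernel:
  assumes \<sigma>: "5 / 2 < \<sigma>" and D: "0 \<le> D" and \<gamma>: "0 \<le> \<gamma>" "\<gamma> \<le> 2"
    and kb: "\<And>t R x y. 1 < \<bar>t\<bar> \<Longrightarrow> 1 \<le> R \<Longrightarrow>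
      cmod (integral {0..R} (\<lambda>s. ph t 0 s * (Psi \<rho> \<theta> \<alpha> x s * cnj (Psi \<rho> \<theta> \<alpha> y s))))
        \<le> (D * (\<bar>t\<bar> powr (- \<gamma>) + 1 / (\<bar>t\<bar> * R))) * ((1 + \<bar>x\<bar>) * (1 + \<bar>y\<bar>))\<^sup>2"
  shows "\<exists>L>0. \<forall>t f. f \<in> L2 lborel \<longrightarrow> (\<lambda>x. japanese_weight \<sigma> x * f x) \<in> L2 lborel \<longrightarrow>
    L2_norm lborel (\<lambda>x. japanese_weight (- \<sigma>) x * exp_itB \<rho> \<theta> \<beta> t (cont_proj \<rho> \<theta> \<alpha> f) x)
      \<le> L * japanese t powr (- \<gamma>) * L2_norm lborel (\<lambda>x. japanese_weight \<sigma> x * f x)"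
proof -
  define C where "C = 4 * D * (L2_norm lborel (japanese_weight (2 - \<sigma>)))\<^sup>2 + 1"
  have C: "1 \<le> C" using D by (simp add: C_def)
  show ?thesis
  proof (intro exI[of _ "4 * C"] conjI allI impI)
    show "0 < 4 * C" using C by simp
    fix t f assume f: "f \<in> L2 lborel" "(\<lambda>x. japanese_weight \<sigma> x * f x) \<in> L2 lborel"
    define F where "F = L2_norm lborel (\<lambda>x. japanese_weight \<sigma> x * f x)"
    have F0: "0 \<le> F" by (simp add: F_def)
    have "L2_norm lborel (\<lambda>x. japanese_weight (- \<sigma>) x * exp_itB \<rho> \<theta> \<beta> t (cont_proj \<rho> \<theta> \<alpha> f) x) \<le> C * max 1 \<bar>t\<bar> powr (- \<gamma>) * F"
    proof (cases "\<bar>t\<bar> \<le> 1")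
      case True
      have "1 * F \<le> C * F" using C F0 by (intro mult_right_mono)
      thus ?thesis using weighted_evolution_bound(1)[OF \<sigma> f, of \<beta> t \<alpha>] True by (simp add: F_def max_def)
    next
      case False
      hence t: "1 < \<bar>t\<bar>" by simp
      have "((\<lambda>R. 1 / (\<bar>t\<bar> * R)) \<longlongrightarrow> 0) at_top"
        using t by (intro real_tendsto_divide_at_top[OF tendsto_const] filterlim_tendsto_pos_mult_at_top[OF tendsto_const _ filterlim_ident]) auto
      hence lim: "((\<lambda>R. D * (\<bar>t\<bar> powr (- \<gamma>) + 1 / (\<bar>t\<bar> * R))) \<longlongrightarrow> D * (\<bar>t\<bar> powr (- \<gamma>) + 0)) at_top"
        by (intro tendsto_intros)
      have "L2_norm lborel (\<lambda>x. japanese_weight (- \<sigma>) x * exp_itB \<rho> \<theta> \<beta> t (cont_proj \<rho> \<theta> \<alpha> f) x)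
        \<le> 4 * (D * (\<bar>t\<bar> powr (- \<gamma>) + 0)) * (L2_norm lborel (japanese_weight (2 - \<sigma>)))\<^sup>2 * F"
        unfolding F_def by (rule weighted_evolution_bound(2)[OF \<sigma> f kb[OF t] _ lim]) (use t D in auto)
      also have "\<dots> = (C - 1) * (\<bar>t\<bar> powr (- \<gamma>) * F)" by (simp add: C_def)
      also have "\<dots> \<le> C * (\<bar>t\<bar> powr (- \<gamma>) * F)" using F0 by (intro mult_right_mono) auto
      finally show ?thesis using t by (simp add: max_def)
    qed
    also have "\<dots> \<le> C * (4 * japanese t powr (- \<gamma>)) * F"
      using C F0 by (intro mult_right_mono mult_left_mono time_weight \<gamma>) auto
    finally show "L2_norm lborel (\<lambda>x. japanese_weight (- \<sigma>) x * exp_itB \<rho> \<theta> \<beta> t (cont_proj \<rho> \<theta> \<alpha> f) x)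
      \<le> 4 * C * japanese t powr (- \<gamma>) * L2_norm lborel (\<lambda>x. japanese_weight \<sigma> x * f x)"
      by (simp add: F_def mult_ac)
  qed
qed

lemma even_decay:
  assumes "5 / 2 < \<sigma>"
  shows "\<exists>L>0. \<forall>t f. f \<in> L2 lborel \<longrightarrow> (\<lambda>x. japanese_weight \<sigma> x * f x) \<in> L2 lborel \<longrightarrow>
    L2_norm lborel (\<lambda>x. japanese_weight (- \<sigma>) x * exp_itB \<rho> \<theta> \<beta> t (cont_proj \<rho> \<theta> Even f) x)
      \<le> L * japanese t powr (- (1 / 2)) * L2_norm lborel (\<lambda>x. japanese_weight \<sigma> x * f x)"
proof -
  obtain D where D: "0 \<le> D" and b: "\<And>t R x y. t \<noteq> 0 \<Longrightarrow> 1 \<le> R \<Longrightarrow>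
    cmod (integral {0..R} (\<lambda>s. ph t 0 s * (Psi \<rho> \<theta> Even x s * cnj (Psi \<rho> \<theta> Even y s)))) \<le> D / sqrt \<bar>t\<bar>"
    using even_kernel_decay by blast
  show ?thesis
  proof (rule decay_from_kernel[OF assms D])
    fix t R x y :: real assume t: "1 < \<bar>t\<bar>" and R: "1 \<le> R"
    have p: "1 / sqrt \<bar>t\<bar> = \<bar>t\<bar> powr (- (1 / 2))" using t by (simp add: powr_minus_divide powr_half_sqrt)
    \<comment> \<open>The even bound is free of growth in x and y; it is brought to the common form
      by inserting a factor that is at least 1.\<close>
    have X: "1 \<le> ((1 + \<bar>x\<bar>) * (1 + \<bar>y\<bar>))\<^sup>2"
      using mult_mono[of 1 "1 + \<bar>x\<bar>" 1 "1 + \<bar>y\<bar>"] by (intro one_le_power) simp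
    have "D / sqrt \<bar>t\<bar> = D * \<bar>t\<bar> powr (- (1 / 2)) * 1" unfolding p[symmetric] by simp
    also have "\<dots> \<le> (D * (\<bar>t\<bar> powr (- (1 / 2)) + 1 / (\<bar>t\<bar> * R))) * ((1 + \<bar>x\<bar>) * (1 + \<bar>y\<bar>))\<^sup>2"
      using D t R by (intro mult_mono mult_left_mono X) (auto intro!: mult_nonneg_nonneg add_nonneg_nonneg)
    finally show "cmod (integral {0..R} (\<lambda>s. ph t 0 s * (Psi \<rho> \<theta> Even x s * cnj (Psi \<rho> \<theta> Even y s))))
        \<le> (D * (\<bar>t\<bar> powr (- (1 / 2)) + 1 / (\<bar>t\<bar> * R))) * ((1 + \<bar>x\<bar>) * (1 + \<bar>y\<bar>))\<^sup>2"
      using b[of t R x y] t R by linarith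
  qed auto
qed

lemma odd_decay:
  assumes "5 / 2 < \<sigma>"
  shows "\<exists>L>0. \<forall>t f. f \<in> L2 lborel \<longrightarrow> (\<lambda>x. japanese_weight \<sigma> x * f x) \<in> L2 lborel \<longrightarrow>
    L2_norm lborel (\<lambda>x. japanese_weight (- \<sigma>) x * exp_itB \<rho> \<theta> \<beta> t (cont_proj \<rho> \<theta> Odd f) x)
      \<le> L * japanese t powr (- (3 / 2)) * L2_norm lborel (\<lambda>x. japanese_weight \<sigma> x * f x)"
proof -
  obtain D where D: "0 \<le> D" and b: "\<And>t R x y. t \<noteq> 0 \<Longrightarrow> 1 \<le> R \<Longrightarrow>
    cmod (integral {0..R} (\<lambda>s. ph t 0 s * (Psi \<rho> \<theta> Odd x s * cnj (Psi \<rho> \<theta> Odd y s))))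
      \<le> D * ((1 + \<bar>x\<bar>) * (1 + \<bar>y\<bar>))\<^sup>2 * (1 / (\<bar>t\<bar> * sqrt \<bar>t\<bar>) + 1 / (\<bar>t\<bar> * R))"
    using odd_kernel_decay by blast
  show ?thesis
  proof (rule decay_from_kernel[OF assms D])
    fix t R x y :: real assume t: "1 < \<bar>t\<bar>" and R: "1 \<le> R"
    have "\<bar>t\<bar> powr (3 / 2) = \<bar>t\<bar> powr (1 + 1 / 2)" by simp
    also have "\<dots> = \<bar>t\<bar> powr 1 * \<bar>t\<bar> powr (1 / 2)" by (rule powr_add)
    finally have "\<bar>t\<bar> powr (3 / 2) = \<bar>t\<bar> powr 1 * \<bar>t\<bar> powr (1 / 2)" .
    hence p: "1 / (\<bar>t\<bar> * sqrt \<bar>t\<bar>) = \<bar>t\<bar> powr (- (3 / 2))" using t by (simp add: powr_minus_divide powr_half_sqrt)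
    show "cmod (integral {0..R} (\<lambda>s. ph t 0 s * (Psi \<rho> \<theta> Odd x s * cnj (Psi \<rho> \<theta> Odd y s))))
        \<le> (D * (\<bar>t\<bar> powr (- (3 / 2)) + 1 / (\<bar>t\<bar> * R))) * ((1 + \<bar>x\<bar>) * (1 + \<bar>y\<bar>))\<^sup>2"
      using b[of t R x y] t R unfolding p by (simp add: mult_ac)
  qed auto
qed

end

theorem propositionB1:
  fixes \<rho> \<theta> :: "nat \<Rightarrow> real" and L \<beta> \<sigma> :: real
  assumes "0 < \<rho> 1" and "\<rho> 1 < \<rho> 2"
    and "L = pi / ((\<rho> 2)\<^sup>2 - (\<rho> 1)\<^sup>2)"
    and "\<beta> > 0"
    and "exp (2 * \<i> * complex_of_real (\<beta> * L)) = exp (2 * \<i> * complex_of_real ((\<rho> 1)\<^sup>2 * L))"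
    and "exp (2 * \<i> * complex_of_real (\<beta> * L)) = exp (2 * \<i> * complex_of_real ((\<rho> 2)\<^sup>2 * L))"
    and "\<sigma> > 5 / 2"
  shows "\<exists>L_e L_o :: real. L_e > 0 \<and> L_o > 0 \<and>
    (\<forall>(t::real) (f :: real \<Rightarrow> complex).
       f \<in> L2 lborel \<longrightarrow>
       (\<lambda>x. complex_of_real (japanese x powr \<sigma>) * f x) \<in> L2 lborel \<longrightarrow>
         L2_norm lborel
             (\<lambda>x. complex_of_real (japanese x powr (- \<sigma>)) *
                  exp_itB \<rho> \<theta> \<beta> t (cont_proj \<rho> \<theta> Even f) x)
           \<le> L_e * japanese t powr (- 1 / 2) *
             L2_norm lborel (\<lambda>x. complex_of_real (japanese x powr \<sigma>) * f x) \<and>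
         L2_norm lborel
             (\<lambda>x. complex_of_real (japanese x powr (- \<sigma>)) *
                  exp_itB \<rho> \<theta> \<beta> t (cont_proj \<rho> \<theta> Odd f) x)
           \<le> L_o * japanese t powr (- 3 / 2) *
             L2_norm lborel (\<lambda>x. complex_of_real (japanese x powr \<sigma>) * f x))"
proof -
  interpret soliton \<rho> \<theta> using assms(1,2) by unfold_locales
  have e: "- 1 / 2 = - (1 / 2 :: real)" "- 3 / 2 = - (3 / 2 :: real)" by simp_all
  show ?thesis unfolding e using even_decay[OF assms(7), of \<beta>] odd_decay[OF assms(7), of \<beta>] by blast
qed

end
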